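(* Let $u$ be the solution of the nonlinear Schrödinger equation $$\mathrm{i}u_t=-\frac1\varepsilon\Delta u+\lambda|u|^2u,\quad(t,x)\in[0,T]\times[-\pi,\pi]^d,\qquad u(0,x)=u^0(x),$$ with periodic boundary conditions and $u^0\in H^\alpha$, where $\varepsilon=1$ or $0<\varepsilon\ll1$. Let $\Phi^h$ be the one-step map of EP1, EP2 or EP3 (defined in the context) with a time step size $h\lesssim\varepsilon$, and let $t_n=nh$. Then for all $n$ with $nh\le T$: $$\begin{aligned}&\text{EP1: }\ \|(\Phi^h)^n(u^0)-u(t_n)\|_{H^{\alpha-4}}\lesssim\frac{h^2}{\varepsilon^2},&&\alpha>\max(d/2+2,4),\\ &\text{EP2: }\ \|(\Phi^h)^n(u^0)-u(t_n)\|_{H^{\alpha-6}}\lesssim\frac{h^2}{\varepsilon}+\frac{h^3}{\varepsilon^3},&&\alpha>\max(d/2+2,6),\\ &\text{EP3: }\ \|(\Phi^h)^n(u^0)-u(t_n)\|_{H^{\alpha-8}}\lesssim\frac{h^3}{\varepsilon^2}+\frac{h^4}{\varepsilon^4},&&\alpha>\max(d/2+2,8).\end{aligned}$$ When $\varepsilon=1$, the bounds for EP2 and EP3 also hold in the $H^{\alpha-4}$-norm and the $H^{\alpha-6}$-norm, respectively.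
   Context: $H^\beta$ denotes the Sobolev space of periodic functions on $[-\pi,\pi]^d$ (only $\beta\ge0$ is considered); $\lambda\in\mathbb{R}$ is a fixed parameter. The constant $T>0$ is such that for every $\varepsilon$ considered the solution exists uniquely on $[0,T]$, with $u\in C^0([0,T];H^\alpha)\cap C^1([0,T];H^{\alpha-2})$ and $\|u(t)\|_{H^\alpha}\le K\|u^0\|_{H^\alpha}$ for some $K>1$ independent of $\varepsilon$. $A\lesssim B$ means $A\le CB$ with a generic constant $C>0$ independent of $n$, $h$ and $\varepsilon$ (it may depend on $T$, on $K$, on $\|u^0\|_{H^\alpha}$, and on the bounds and Lipschitz constants of $f$ and of the coefficient operators on the relevant Sobolev spaces). Methods. Let $f(u)=-\mathrm{i}\lambda|u|^2u$, $\mathcal{V}=\mathrm{i}\frac h\varepsilon\Delta$, $\varphi_1(z)=\int_0^1e^{(1-\xi)z}d\xi$. Given coefficient functions $C_\tau$, $A_{\tau,\sigma}$, the integrator is the (implicit) scheme $$u^{n+\tau}=\Phi^{\tau h}(u^n):=C_\tau(\mathcal{V})u^n+h\int_0^1A_{\tau,\sigma}(\mathcal{V})f(u^{n+\sigma})\,d\sigma,\quad0\le\tau\le1,$$ and $u^{n+1}=\Phi^h(u^n)$ is the case $\tau=1$. EP1: $C_\tau(\mathcal{V})=(1-\tau)I+\tau e^{\mathcal{V}}$, $A_{\tau,\sigma}(\mathcal{V})=\tau\varphi_1(\mathcal{V})$. EP2: with $m=1/2$, $C_\tau(\mathcal{V})=\frac{(\tau-1)(\tau-m)}{m}I+\frac{\tau(\tau-1)}{m(m-1)}e^{m\mathcal{V}}+\frac{\tau(m-\tau)}{m-1}e^{\mathcal{V}}$,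 $A_{\tau,\sigma}(\mathcal{V})=\sum_{l=1}^2\sum_{n=1}^2a_{ln}(\mathcal{V})\tau^l\sigma^{n-1}$, where $a_{11}=\frac{1+m}{m(1-m)}\varphi_1(m\mathcal{V})+\frac{m+1}{m-1}\varphi_1(\mathcal{V})+\frac1{1-m}\varphi_1((1-m)\mathcal{V})$, $a_{22}=\frac2{m(1-m)}\big(\varphi_1(m\mathcal{V})-\varphi_1(\mathcal{V})+\varphi_1((1-m)\mathcal{V})\big)$, $a_{21}=(1+\frac1m)\varphi_1(\mathcal{V})-\frac1m\varphi_1((1-m)\mathcal{V})-a_{11}$, $a_{12}=-\frac2m(\varphi_1(\mathcal{V})-\varphi_1((1-m)\mathcal{V}))-a_{22}$. EP3: with nodes $c_0=0$, $c_1=\frac13$, $c_2=\frac1{18}\big(14+(71-9\sqrt{58})^{1/3}+(71+9\sqrt{58})^{1/3}\big)$, $c_3=1$, and $l_j(\tau)=\prod_{k\ne j}\frac{\tau-c_k}{c_j-c_k}$ ($j=0,\dots,3$), $C_\tau(\mathcal{V})=\sum_{k=0}^3l_k(\tau)e^{c_k\mathcal{V}}$ and $A_{\tau,\sigma}(\mathcal{V})=\sum_{l=1}^3\sum_{n=1}^3a_{ln}(\mathcal{V})\tau^l\sigma^{n-1}$, where $a_{ln}(\mathcal{V})=-\frac1l\sum_{0\le k<i\le3}(c_i-c_k)\,C_{l-1,i}\,C_{n-1,k}\,\varphi_1((c_i-c_k)\mathcal{V})$ and $C_{jk}$ is the coefficient of $\tau^j$ in the polynomial $l_k'(\tau)$.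 *)

theory Defs
  imports "HOL-Analysis.Analysis" "HOL-Computational_Algebra.Polynomial"
begin

section \<open>Periodic Sobolev spaces\<close>

text \<open>
  Functions on the torus are functions on \<open>\<real>\<^sup>d\<close> of period \<open>2\<pi>\<close> in every coordinate, where
  \<open>d = CARD('d)\<close>; frequencies are integer vectors. Elements of a Sobolev space are only
  determined almost everywhere, so equations between them are stated with \<open>AE\<close>.
\<close>

type_synonym 'd torus_fun = "real ^ 'd \<Rightarrow> complex"

definition periodic_fun :: "'d::finite torus_fun \<Rightarrow> bool" where
  "periodic_fun u \<longleftrightarrow> (\<forall>x i. u (x + axis i (2 * pi)) = u x)"

definition period_cell :: "(real ^ 'd::finite) set" where
  "period_cell = cbox (\<chi> i. - pi) (\<chi> i. pi)"

definition freq_norm_sq :: "int ^ 'd::finite \<Rightarrow> real" where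
  "freq_norm_sq k = (\<Sum>i\<in>UNIV. (real_of_int (k $ i))\<^sup>2)"

definition wave :: "int ^ 'd::finite \<Rightarrow> 'd torus_fun" where
  "wave k x = cis (\<Sum>i\<in>UNIV. real_of_int (k $ i) * x $ i)"

definition fourier_coeff :: "'d::finite torus_fun \<Rightarrow> int ^ 'd \<Rightarrow> complex" where
  "fourier_coeff u k =
     (LINT x|lebesgue_on period_cell. u x * cnj (wave k x)) / of_real ((2 * pi) ^ CARD('d))"

definition L2_torus :: "'d::finite torus_fun set" where
  "L2_torus = {u. periodic_fun u \<and> u \<in> borel_measurable lebesgue \<and>
                  integrable (lebesgue_on period_cell) (\<lambda>x. (cmod (u x))\<^sup>2)}"

definition sobolev :: "real \<Rightarrow> 'd::finite torus_fun set" where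
  "sobolev s = {u \<in> L2_torus.
     (\<lambda>k. (1 + freq_norm_sq k) powr s * (cmod (fourier_coeff u k))\<^sup>2) summable_on UNIV}"

definition sobolev_norm :: "real \<Rightarrow> 'd::finite torus_fun \<Rightarrow> real" where
  "sobolev_norm s u =
     sqrt (\<Sum>\<^sub>\<infinity>k. (1 + freq_norm_sq k) powr s * (cmod (fourier_coeff u k))\<^sup>2)"

text \<open>
  The operator with symbol \<open>m\<close>, written as a pointwise Fourier series. This is meaningful when
  \<open>m k * fourier_coeff u k\<close> is absolutely summable over \<open>k\<close>, which by Cauchy-Schwarz is the case
  for \<open>u \<in> H\<^sup>s\<close>, \<open>s > d/2\<close> and bounded \<open>m\<close>, and for the Laplacian when \<open>s > d/2 + 2\<close>.
\<close>

definition fourier_multiplier ::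
  "(int ^ 'd \<Rightarrow> complex) \<Rightarrow> 'd::finite torus_fun \<Rightarrow> 'd torus_fun" where
  "fourier_multiplier m u = (\<lambda>x. \<Sum>\<^sub>\<infinity>k. m k * fourier_coeff u k * wave k x)"

definition laplacian :: "'d::finite torus_fun \<Rightarrow> 'd torus_fun" where
  "laplacian = fourier_multiplier (\<lambda>k. - of_real (freq_norm_sq k))"

text \<open>\<open>F \<in> C\<^sup>0(J; H\<^sup>s)\<close>, and \<open>F'\<close> is the derivative of \<open>F\<close> on \<open>J\<close> in the norm of \<open>H\<^sup>s\<close>.\<close>

definition sobolev_continuous_on ::
  "real \<Rightarrow> real set \<Rightarrow> (real \<Rightarrow> 'd::finite torus_fun) \<Rightarrow> bool" where
  "sobolev_continuous_on s J F \<longleftrightarrow>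
     (\<forall>t\<in>J. F t \<in> sobolev s) \<and>
     (\<forall>t\<in>J. ((\<lambda>r. sobolev_norm s (F r - F t)) \<longlongrightarrow> 0) (at t within J))"

definition sobolev_derivative_on ::
  "real \<Rightarrow> real set \<Rightarrow> (real \<Rightarrow> 'd::finite torus_fun) \<Rightarrow> (real \<Rightarrow> 'd torus_fun) \<Rightarrow> bool" where
  "sobolev_derivative_on s J F F' \<longleftrightarrow>
     (\<forall>t\<in>J. ((\<lambda>r. sobolev_norm s (\<lambda>x. (F r x - F t x) / of_real (r - t) - F' t x)) \<longlongrightarrow> 0)
              (at t within J))"


section \<open>The nonlinear Schroedinger equation\<close>

definition nls_nonlinearity :: "real \<Rightarrow> 'd torus_fun \<Rightarrow> 'd torus_fun" where
  "nls_nonlinearity lam u = (\<lambda>x. - \<i> * of_real lam * of_real ((cmod (u x))\<^sup>2) * u x)"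

definition nls_solution ::
  "real \<Rightarrow> real \<Rightarrow> real \<Rightarrow> real \<Rightarrow> 'd::finite torus_fun \<Rightarrow> (real \<Rightarrow> 'd torus_fun) \<Rightarrow> bool" where
  "nls_solution lam eps T \<alpha> u0 u \<longleftrightarrow>
     sobolev_continuous_on \<alpha> {0..T} u \<and>
     (\<exists>u'. sobolev_continuous_on (\<alpha> - 2) {0..T} u' \<and>
           sobolev_derivative_on (\<alpha> - 2) {0..T} u u' \<and>
           (\<forall>t\<in>{0..T}. AE x in lebesgue.
              \<i> * u' t x = - of_real (1 / eps) * laplacian (u t) x
                           + of_real lam * of_real ((cmod (u t x))\<^sup>2) * u t x)) \<and>
     (AE x in lebesgue. u 0 x = u0 x)"

definition unique_nls_solution ::
  "real \<Rightarrow> real \<Rightarrow> real \<Rightarrow> real \<Rightarrow> 'd::finite torus_fun \<Rightarrow> (real \<Rightarrow> 'd torus_fun) \<Rightarrow> bool" where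
  "unique_nls_solution lam eps T \<alpha> u0 u \<longleftrightarrow>
     nls_solution lam eps T \<alpha> u0 u \<and>
     (\<forall>w. nls_solution lam eps T \<alpha> u0 w \<longrightarrow> (\<forall>t\<in>{0..T}. AE x in lebesgue. w t x = u t x))"


section \<open>Continuous-stage exponential integrators\<close>

text \<open>\<open>g(\<V>)\<close> for \<open>\<V> = \<i> (h/\<epsilon>) \<Delta>\<close>, which acts on \<open>wave k\<close> as multiplication by
  \<open>- \<i> (h/\<epsilon>) |k|\<^sup>2\<close>.\<close>

definition fun_of_V ::
  "real \<Rightarrow> real \<Rightarrow> (complex \<Rightarrow> complex) \<Rightarrow> 'd::finite torus_fun \<Rightarrow> 'd torus_fun" where
  "fun_of_V eps h g =
     fourier_multiplier (\<lambda>k. g (\<i> * of_real (h / eps) * (- of_real (freq_norm_sq k))))"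

text \<open>
  A method is a pair of coefficient functions \<open>C \<tau> z\<close> and \<open>A \<tau> \<sigma> z\<close>. The scheme is implicit and
  its equation may have spurious large solutions, so the stages are confined to a ball of
  radius \<open>\<rho>\<close> in \<open>H\<^sup>\<alpha>\<close>; \<open>ep_step\<close> is a genuine one-step map as soon as the stages exist and are
  unique in that ball.
\<close>

definition ep_stages ::
  "(real \<Rightarrow> complex \<Rightarrow> complex) \<Rightarrow> (real \<Rightarrow> real \<Rightarrow> complex \<Rightarrow> complex) \<Rightarrow> real \<Rightarrow> real \<Rightarrow> real \<Rightarrow>
   real \<Rightarrow> real \<Rightarrow> 'd::finite torus_fun \<Rightarrow> (real \<Rightarrow> 'd torus_fun) \<Rightarrow> bool" where
  "ep_stages C A lam \<alpha> \<rho> eps h v U \<longleftrightarrow>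
     sobolev_continuous_on \<alpha> {0..1} U \<and>
     (\<forall>\<tau>\<in>{0..1}. sobolev_norm \<alpha> (U \<tau>) \<le> \<rho>) \<and>
     (\<forall>\<tau>\<in>{0..1}. AE x in lebesgue.
        U \<tau> x = fun_of_V eps h (C \<tau>) v x
                + of_real h * integral {0..1}
                    (\<lambda>\<sigma>. fun_of_V eps h (A \<tau> \<sigma>) (nls_nonlinearity lam (U \<sigma>)) x))"

definition ep_step ::
  "(real \<Rightarrow> complex \<Rightarrow> complex) \<Rightarrow> (real \<Rightarrow> real \<Rightarrow> complex \<Rightarrow> complex) \<Rightarrow> real \<Rightarrow> real \<Rightarrow> real \<Rightarrow>
   real \<Rightarrow> real \<Rightarrow> 'd::finite torus_fun \<Rightarrow> 'd torus_fun" where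
  "ep_step C A lam \<alpha> \<rho> eps h v = (SOME U. ep_stages C A lam \<alpha> \<rho> eps h v U) 1"

definition ep_uniquely_solvable ::
  "(real \<Rightarrow> complex \<Rightarrow> complex) \<Rightarrow> (real \<Rightarrow> real \<Rightarrow> complex \<Rightarrow> complex) \<Rightarrow> real \<Rightarrow> real \<Rightarrow> real \<Rightarrow>
   real \<Rightarrow> real \<Rightarrow> 'd::finite torus_fun \<Rightarrow> bool" where
  "ep_uniquely_solvable C A lam \<alpha> \<rho> eps h v \<longleftrightarrow>
     (\<exists>U. ep_stages C A lam \<alpha> \<rho> eps h v U \<and>
          (\<forall>W. ep_stages C A lam \<alpha> \<rho> eps h v W \<longrightarrow>
               (\<forall>\<tau>\<in>{0..1}. AE x in lebesgue. W \<tau> x = U \<tau> x)))"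

definition phi1 :: "complex \<Rightarrow> complex" where
  "phi1 z = integral {0..1} (\<lambda>\<xi>::real. exp (of_real (1 - \<xi>) * z))"

definition EP1_C :: "real \<Rightarrow> complex \<Rightarrow> complex" where
  "EP1_C \<tau> z = of_real (1 - \<tau>) + of_real \<tau> * exp z"

definition EP1_A :: "real \<Rightarrow> real \<Rightarrow> complex \<Rightarrow> complex" where
  "EP1_A \<tau> \<sigma> z = of_real \<tau> * phi1 z"

definition EP2_m :: real where
  "EP2_m = 1 / 2"

definition EP2_C :: "real \<Rightarrow> complex \<Rightarrow> complex" where
  "EP2_C \<tau> z = (let m = EP2_m in
     of_real ((\<tau> - 1) * (\<tau> - m) / m)
     + of_real (\<tau> * (\<tau> - 1) / (m * (m - 1))) * exp (of_real m * z)
     + of_real (\<tau> * (m - \<tau>) / (m - 1)) * exp z)"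

definition EP2_a11 :: "complex \<Rightarrow> complex" where
  "EP2_a11 z = (let m = EP2_m in
     of_real ((1 + m) / (m * (1 - m))) * phi1 (of_real m * z)
     + of_real ((m + 1) / (m - 1)) * phi1 z
     + of_real (1 / (1 - m)) * phi1 (of_real (1 - m) * z))"

definition EP2_a22 :: "complex \<Rightarrow> complex" where
  "EP2_a22 z = (let m = EP2_m in
     of_real (2 / (m * (1 - m)))
     * (phi1 (of_real m * z) - phi1 z + phi1 (of_real (1 - m) * z)))"

definition EP2_a21 :: "complex \<Rightarrow> complex" where
  "EP2_a21 z = (let m = EP2_m in
     of_real (1 + 1 / m) * phi1 z - of_real (1 / m) * phi1 (of_real (1 - m) * z) - EP2_a11 z)"

definition EP2_a12 :: "complex \<Rightarrow> complex" where
  "EP2_a12 z = (let m = EP2_m in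
     - of_real (2 / m) * (phi1 z - phi1 (of_real (1 - m) * z)) - EP2_a22 z)"

definition EP2_A :: "real \<Rightarrow> real \<Rightarrow> complex \<Rightarrow> complex" where
  "EP2_A \<tau> \<sigma> z = EP2_a11 z * of_real \<tau> + EP2_a12 z * of_real (\<tau> * \<sigma>)
                 + EP2_a21 z * of_real (\<tau>\<^sup>2) + EP2_a22 z * of_real (\<tau>\<^sup>2 * \<sigma>)"

definition EP3_node :: "nat \<Rightarrow> real" where
  "EP3_node k =
     (if k = 0 then 0
      else if k = 1 then 1 / 3
      else if k = 2 then (14 + root 3 (71 - 9 * sqrt 58) + root 3 (71 + 9 * sqrt 58)) / 18
      else 1)"

definition EP3_lagrange :: "nat \<Rightarrow> real poly" where
  "EP3_lagrange j =
     (\<Prod>k\<in>{0..3} - {j}. smult (1 / (EP3_node j - EP3_node k)) [:- EP3_node k, 1:])"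

definition EP3_Cjk :: "nat \<Rightarrow> nat \<Rightarrow> real" where
  "EP3_Cjk j k = coeff (pderiv (EP3_lagrange k)) j"

definition EP3_C :: "real \<Rightarrow> complex \<Rightarrow> complex" where
  "EP3_C \<tau> z = (\<Sum>k=0..3. of_real (poly (EP3_lagrange k) \<tau>) * exp (of_real (EP3_node k) * z))"

definition EP3_a :: "nat \<Rightarrow> nat \<Rightarrow> complex \<Rightarrow> complex" where
  "EP3_a l n z =
     - of_real (1 / real l) *
     (\<Sum>(k, i)\<in>{(k, i). k < i \<and> i \<le> 3}.
        of_real ((EP3_node i - EP3_node k) * EP3_Cjk (l - 1) i * EP3_Cjk (n - 1) k)
        * phi1 (of_real (EP3_node i - EP3_node k) * z))"

definition EP3_A :: "real \<Rightarrow> real \<Rightarrow> complex \<Rightarrow> complex" where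
  "EP3_A \<tau> \<sigma> z = (\<Sum>l=1..3. \<Sum>n=1..3. EP3_a l n z * of_real (\<tau> ^ l * \<sigma> ^ (n - 1)))"


section \<open>Global error bounds\<close>

text \<open>
  Given the data \<open>\<lambda>\<close>, \<open>T\<close>, \<open>K\<close>, \<open>\<alpha>\<close>, the dimension and an upper bound \<open>R\<close> for the \<open>H\<^sup>\<alpha>\<close>-norm of
  the initial value, the constants \<open>c\<close> (of the step size restriction \<open>h \<le> c \<epsilon>\<close>), \<open>\<rho>\<close> and \<open>B\<close> are
  uniform in \<open>\<epsilon> \<in> E\<close>, the initial value, the step size and the number of steps. The first
  conclusion says that all iterates of the implicit one-step map are well defined, the second
  is the error bound of size \<open>B * bnd h \<epsilon>\<close> in \<open>H\<^sup>\<beta>\<close>.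
\<close>

definition ep_error_bound ::
  "'d::finite itself \<Rightarrow> (real \<Rightarrow> complex \<Rightarrow> complex) \<Rightarrow> (real \<Rightarrow> real \<Rightarrow> complex \<Rightarrow> complex) \<Rightarrow>
   real \<Rightarrow> real \<Rightarrow> real \<Rightarrow> real \<Rightarrow> real \<Rightarrow> real \<Rightarrow> real set \<Rightarrow> (real \<Rightarrow> real \<Rightarrow> real) \<Rightarrow> bool" where
  "ep_error_bound _ C A lam T K R \<alpha> \<beta> E bnd \<longleftrightarrow>
     (\<exists>c>0. \<exists>\<rho>>0. \<exists>B>0. \<forall>eps\<in>E. \<forall>(u0 :: 'd torus_fun) u h.
        u0 \<in> sobolev \<alpha> \<and> sobolev_norm \<alpha> u0 \<le> R \<and>
        unique_nls_solution lam eps T \<alpha> u0 u \<and>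
        (\<forall>t\<in>{0..T}. sobolev_norm \<alpha> (u t) \<le> K * sobolev_norm \<alpha> u0) \<and>
        0 < h \<and> h \<le> c * eps \<longrightarrow>
        (\<forall>n. real (Suc n) * h \<le> T \<longrightarrow>
           ep_uniquely_solvable C A lam \<alpha> \<rho> eps h ((ep_step C A lam \<alpha> \<rho> eps h ^^ n) u0)) \<and>
        (\<forall>n. real n * h \<le> T \<longrightarrow>
           (ep_step C A lam \<alpha> \<rho> eps h ^^ n) u0 - u (real n * h) \<in> sobolev \<beta> \<and>
           sobolev_norm \<beta> ((ep_step C A lam \<alpha> \<rho> eps h ^^ n) u0 - u (real n * h))
             \<le> B * bnd h eps))"

end

theory Submission
  imports Defs
begin

text \<open>
  In Fourier coefficients the equation becomes an infinite system of ordinary differential equations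
  in weighted \<open>\<ell>\<^sup>2\<close>-spaces, and the nonlinearity is a triple convolution. Since \<open>\<alpha> - 2 > d/2\<close>, the cubic map
  is locally Lipschitz on \<open>H\<^sup>\<beta>\<close> for \<open>0 \<le> \<beta> \<le> \<alpha> - 2\<close>, with constants governed by the \<open>H\<close>-norm of
  order \<open>\<alpha> - 2\<close>, and a step of the method expands \<open>H\<^sup>\<beta>\<close>-distances by a factor at most \<open>1 + O(h)\<close>. The
  local error is \<open>O(h\<^sup>2/\<epsilon>)\<close> in \<open>H\<close> of order \<open>\<alpha> - 2\<close>; for \<open>h \<le> c\<epsilon>\<close> this keeps the iterates bounded in that
  space, and a tame estimate then bounds them in \<open>H\<^sup>\<alpha>\<close>. The convergence orders follow from the sharper
  local errors in weaker norms, each power of \<open>h/\<epsilon>\<close> gained in a Taylor expansion costing two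
  derivatives. For EP3 the stages are only accurate up to a drift \<open>h g(\<tau>)\<close> times a smooth factor, but
  the choice of \<open>c\<^sub>2\<close> gives \<open>\<integral> g = 0\<close>, so that this contribution averages out over the step.
\<close>

section \<open>Fourier series on the torus\<close>

text \<open>The constants have to be fixed without a circle. The stage radius \<open>\<rho>\<close>
  must dominate the H^\<alpha> norms of all iterates, and the Lipschitz constants depend on
  \<open>\<rho>\<close>; a growth rate computed from \<open>\<rho>\<close> would make
  \<open>\<rho>\<close> depend on itself. The tame estimate breaks this: the rate in H^\<alpha>
  depends only on the norm of order \<alpha> - 2, which the error bound there keeps below
  \<open>M + 1\<close>. So the rate comes before \<open>\<rho>\<close>, and the bound on the step
  size comes last.

  The target norm may have order below d/2, where the space is not closed under products. The
  estimates for differences therefore admit one factor of low regularity and keep the others in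
  order \<alpha> - 2.

  With \<kappa> = h / eps the local errors are h times \<kappa>^(p + 1) + h \<kappa>, or h times
  \<kappa>^(p + 1) + h \<kappa>^2 with averaging, in order \<alpha> - 2 - 2p. The integer p is free
  up to the order of the method. For eps = 1 the second term is of size h^2 or h^3 anyway, so p
  smaller by one suffices, which saves two derivatives.\<close>

abbreviation cell :: "(real ^ 'd::finite) measure" where
  "cell \<equiv> lebesgue_on period_cell"

lemma period_cell_lmeasurable [simp]: "period_cell \<in> lmeasurable"
  by (simp add: period_cell_def)

lemma period_cell_sets [simp]: "period_cell \<in> sets lebesgue"
  using period_cell_lmeasurable by blast

lemma finite_measure_cell: "finite_measure (cell :: (real ^ 'd::finite) measure)"
  by (rule finite_measure_lebesgue_on) simp

section \<open>Orthogonality of the waves\<close>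

lemma wave_prod: "wave k x = (\<Prod>i\<in>UNIV. cis (real_of_int (k $ i) * x $ i))"
proof -
  have "cis (sum f A) = (\<Prod>i\<in>A. cis (f i))" if "finite A" for f :: "'a \<Rightarrow> real" and A
    using that by induction (auto simp: cis_mult [symmetric])
  then show ?thesis by (simp add: wave_def)
qed

lemma norm_wave [simp]: "norm (wave k x) = 1"
  by (simp add: wave_def)

lemma wave_mult: "wave k x * wave l x = wave (k + l) x"
  by (simp add: wave_def cis_mult ring_distribs sum.distrib)

lemma cnj_wave: "cnj (wave k x) = wave (- k) x"
  by (simp add: wave_def cis_cnj sum_negf)

lemma wave_0 [simp]: "wave 0 x = 1"
  by (simp add: wave_def)

lemma continuous_on_wave [continuous_intros]: "continuous_on A (wave k)"
  unfolding wave_def [abs_def] by (intro continuous_intros)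

lemma wave_periodic: "wave k (x + axis i (2 * pi)) = wave k x"
proof -
  have "(\<Sum>j\<in>UNIV. real_of_int (k $ j) * (x + axis i (2 * pi)) $ j) =
        (\<Sum>j\<in>UNIV. real_of_int (k $ j) * x $ j) + 2 * pi * real_of_int (k $ i)"
    by (simp add: ring_distribs sum.distrib axis_def if_distrib [of "\<lambda>y. _ * y"] cong: if_cong)
  moreover have "cis (2 * pi * real_of_int (k $ i)) = 1"
    by (rule cis_multiple_2pi) simp
  ultimately show ?thesis
    by (simp add: wave_def cis_mult [symmetric])
qed

lemma continuous_measurable_cell:
  "continuous_on UNIV f \<Longrightarrow> f \<in> borel_measurable cell"
  for f :: "real ^ 'd::finite \<Rightarrow> 'b::euclidean_space"
  by (rule continuous_imp_measurable_on_sets_lebesgue)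
    (auto intro: continuous_on_subset)

text \<open>Lebesgue measure on \<open>real ^ 'd\<close> is the image of a product measure over the
  basis vectors. Cutting each factor off outside [-pi, pi] turns the cell integral into one over the
  whole product space, where the integral of a product splits.\<close>

lemma cell_integral_prod:
  fixes f :: "'d::finite \<Rightarrow> real \<Rightarrow> complex"
  assumes f: "\<And>i. continuous_on UNIV (f i)"
  shows "(LINT x|cell. (\<Prod>i\<in>UNIV. f i (x $ i))) = (\<Prod>i\<in>UNIV. integral {-pi..pi} (f i))"
proof -
  define g where "g = (\<lambda>i t. indicator {-pi..pi} t *\<^sub>R f i t)"
  have fm [measurable]: "f i \<in> borel_measurable borel" for i
    by (rule borel_measurable_continuous_onI [OF f])
  have gm [measurable]: "g i \<in> borel_measurable borel" for i
    unfolding g_def by measurable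
  have int: "integrable lborel (g i)" for i
    unfolding g_def
    by (rule borel_integrable_compact [unfolded scaleR_conv_of_real])
      (auto intro!: continuous_on_subset [OF f] simp: scaleR_conv_of_real)
  have intg: "integral\<^sup>L lborel (g i) = integral {-pi..pi} (f i)" for i
  proof -
    have "integral\<^sup>L lborel (g i) = set_lebesgue_integral lborel {-pi..pi} (f i)"
      by (simp add: set_lebesgue_integral_def g_def)
    also have "\<dots> = integral {-pi..pi} (f i)"
      by (rule set_borel_integral_eq_integral)
        (use int in \<open>simp add: set_integrable_def g_def\<close>)
    finally show ?thesis .
  qed
  \<comment> \<open>The product measure is indexed by basis vectors, the factors by
    \<open>'d\<close>; \<open>e\<close> translates between the two index sets.\<close>
  define e :: "'d \<Rightarrow> real ^ 'd" where "e = (\<lambda>i. axis i 1)"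
  have e_inj: "inj e" by (auto simp: e_def inj_on_def axis_eq_axis)
  have e_Basis: "Basis = range e" by (auto simp: e_def Basis_vec_def)
  have nth: "(\<Sum>b\<in>Basis. p b *\<^sub>R b) $ i = p (e i)" for p :: "real ^ 'd \<Rightarrow> real" and i
  proof -
    have "(\<Sum>b\<in>Basis. p b *\<^sub>R b) $ i = (\<Sum>j\<in>UNIV. p (e j) * (e j $ i))"
      unfolding e_Basis by (subst sum.reindex [OF e_inj]) simp
    also have "\<dots> = p (e i)"
      by (simp add: e_def axis_def if_distrib [of "\<lambda>y. _ * y"] cong: if_cong)
    finally show ?thesis .
  qed
  have "(LINT x|cell. (\<Prod>i\<in>UNIV. f i (x $ i))) =
        (LINT x|lebesgue. indicator period_cell x *\<^sub>R (\<Prod>i\<in>UNIV. f i (x $ i)))"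
    by (rule integral_restrict_space) simp
  also have "(\<lambda>x. indicator period_cell x *\<^sub>R (\<Prod>i\<in>UNIV. f i (x $ i))) =
             (\<lambda>x. \<Prod>i\<in>UNIV. g i (x $ i))"
  proof
    fix x :: "real ^ 'd"
    show "indicator period_cell x *\<^sub>R (\<Prod>i\<in>UNIV. f i (x $ i)) = (\<Prod>i\<in>UNIV. g i (x $ i))"
    proof (cases "x \<in> period_cell")
      case True
      then show ?thesis
        by (auto simp: g_def period_cell_def mem_box_cart intro!: prod.cong)
    next
      case False
      then obtain i where "x $ i \<notin> {-pi..pi}"
        by (auto simp: period_cell_def mem_box_cart)
      then have "g i (x $ i) = 0" by (simp add: g_def)
      then have "(\<Prod>i\<in>UNIV. g i (x $ i)) = 0" by (intro prod_zero) auto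
      then show ?thesis using False by simp
    qed
  qed
  also have "(LINT x|lebesgue. (\<Prod>i\<in>UNIV. g i (x $ i))) = (LINT x|lborel. (\<Prod>i\<in>UNIV. g i (x $ i)))"
    by (rule integral_completion) measurable
  also have "\<dots> = (LINT p|(\<Pi>\<^sub>M b\<in>(Basis :: (real^'d) set). (lborel :: real measure)). (\<Prod>i\<in>UNIV. g i ((\<Sum>b\<in>Basis. p b *\<^sub>R b) $ i)))"
    by (subst lborel_eq, subst integral_distr) auto
  also have "\<dots> = (LINT p|(\<Pi>\<^sub>M b\<in>(Basis :: (real^'d) set). (lborel :: real measure)). (\<Prod>b\<in>Basis. g (inv e b) (p b)))"
    unfolding nth unfolding e_Basis by (subst prod.reindex [OF e_inj]) (simp add: e_inj)
  also have "\<dots> = (\<Prod>b\<in>(Basis :: (real^'d) set). integral\<^sup>L lborel (g (inv e b)))"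
  proof -
    interpret product_sigma_finite "\<lambda>_ :: real ^ 'd. lborel :: real measure"
      by standard
    show ?thesis
      by (rule product_integral_prod) (auto intro: int)
  qed
  also have "\<dots> = (\<Prod>i\<in>UNIV. integral {-pi..pi} (f i))"
    unfolding e_Basis by (subst prod.reindex [OF e_inj]) (simp add: e_inj intg)
  finally show ?thesis .
qed

lemma integral_cis_multiple:
  "integral {-pi..pi} (\<lambda>t. cis (real_of_int m * t)) = (if m = 0 then of_real (2 * pi) else 0)"
proof (cases "m = 0")
  case True
  then show ?thesis by (simp add: scaleR_conv_of_real)
next
  case False
  define F where "F = (\<lambda>t. cis (real_of_int m * t) / (\<i> * of_int m))"
  have "((\<lambda>t. cis (real_of_int m * t)) has_integral F pi - F (-pi)) {-pi..pi}"
  proof (rule fundamental_theorem_of_calculus)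
    fix t
    have "((\<lambda>z. exp (\<i> * (of_int m * z)) / (\<i> * of_int m)) has_field_derivative
           exp (\<i> * (of_int m * of_real t))) (at (of_real t))"
      using False by (auto intro!: derivative_eq_intros simp: mult.commute [of _ \<i>])
    from has_vector_derivative_real_field [OF this]
    show "(F has_vector_derivative cis (real_of_int m * t)) (at t within {-pi..pi})"
      by (simp add: F_def [abs_def] cis_conv_exp)
  qed simp
  moreover have "cis (real_of_int m * pi) = cis (real_of_int m * (- pi))"
  proof -
    have "cis (real_of_int m * pi) = cis (real_of_int m * (- pi)) * cis (2 * pi * real_of_int m)"
      unfolding cis_mult by (rule arg_cong [of _ _ cis]) (simp add: algebra_simps)
    also have "cis (2 * pi * real_of_int m) = 1" by (rule cis_multiple_2pi) simp
    finally show ?thesis by simp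
  qed
  ultimately show ?thesis using False
    by (simp add: F_def integral_unique)
qed

lemma wave_integral:
  "(LINT x|cell. wave k x) = (if k = 0 then of_real ((2 * pi) ^ CARD('d)) else 0)"
  for k :: "int ^ 'd::finite"
proof -
  have "(LINT x|cell. wave k x) = (\<Prod>i\<in>UNIV. if k $ i = 0 then of_real (2 * pi) else 0)"
    unfolding wave_prod
    by (subst cell_integral_prod) (auto intro!: continuous_intros prod.cong simp: integral_cis_multiple)
  also have "\<dots> = (if k = 0 then of_real ((2 * pi) ^ CARD('d)) else 0)"
    by (auto simp: vec_eq_iff)
  finally show ?thesis .
qed

section \<open>Integrability on the cell and linearity of the coefficients\<close>

lemma integrable_cell_bounded_mult:
  fixes v :: "real ^ 'd::finite \<Rightarrow> complex"
  assumes v: "integrable cell v" and g: "continuous_on UNIV g" and b: "\<And>x. norm (g x) \<le> B"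
  shows "integrable cell (\<lambda>x. v x * g x)"
proof (rule Bochner_Integration.integrable_bound)
  show "integrable cell (\<lambda>x. B * norm (v x))" using v by simp
  show "(\<lambda>x. v x * g x) \<in> borel_measurable cell"
    using v continuous_measurable_cell [OF g] by measurable
  have "norm (v x) * norm (g x) \<le> B * norm (v x)" for x
    using mult_left_mono [OF b, of "norm (v x)" x] by (simp add: mult.commute)
  moreover have "B \<ge> 0" using b [of 0] norm_ge_zero order_trans by blast
  ultimately show "AE x in cell. norm (v x * g x) \<le> norm (B * norm (v x))"
    by (auto simp: norm_mult)
qed

lemma integrable_wave_mult: "integrable cell v \<Longrightarrow> integrable cell (\<lambda>x. v x * wave k x)"
  by (rule integrable_cell_bounded_mult [where B = 1]) (auto intro: continuous_on_wave)

lemma integrable_cnj_wave_mult: "integrable cell v \<Longrightarrow> integrable cell (\<lambda>x. v x * cnj (wave k x))"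
  unfolding cnj_wave by (rule integrable_wave_mult)

text \<open>The cell has finite measure, so t \<le> 1 + t^2 gives an integrable majorant.\<close>

lemma L2_torus_integrable:
  assumes "u \<in> L2_torus" shows "integrable cell u"
proof (rule Bochner_Integration.integrable_bound)
  interpret finite_measure cell by (rule finite_measure_cell)
  show "integrable cell (\<lambda>x. 1 + (cmod (u x))\<^sup>2)"
    using assms by (auto simp: L2_torus_def)
  show "u \<in> borel_measurable cell"
    using assms by (auto simp: L2_torus_def intro: measurable_restrict_space1)
  have "t \<le> 1 + t\<^sup>2" for t :: real
    using zero_le_power2 [of "t - 1/2"] by (simp add: power2_eq_square algebra_simps)
  then show "AE x in cell. norm (u x) \<le> norm (1 + (cmod (u x))\<^sup>2)"
    by (auto simp: abs_of_nonneg)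
qed

lemma fourier_coeff_diff:
  assumes "integrable cell u" "integrable cell v"
  shows "fourier_coeff (\<lambda>x. u x - v x) k = fourier_coeff u k - fourier_coeff v k"
  using integrable_cnj_wave_mult [OF assms(1), of k] integrable_cnj_wave_mult [OF assms(2), of k]
  by (simp add: fourier_coeff_def ring_distribs diff_divide_distrib)

lemma fourier_coeff_cmult: "fourier_coeff (\<lambda>x. c * u x) k = c * fourier_coeff u k"
  by (simp add: fourier_coeff_def mult.assoc)

lemma AE_lebesgue_cell: "AE x in lebesgue. P x \<Longrightarrow> AE x in cell. P x"
  by (subst AE_restrict_space_iff) (auto elim: eventually_mono)

lemma fourier_coeff_cong_AE:
  assumes "u \<in> borel_measurable cell" "v \<in> borel_measurable cell" "AE x in lebesgue. u x = v x"
  shows "fourier_coeff u k = fourier_coeff v k"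
proof -
  note assms(1,2) [measurable]
  have [measurable]: "(\<lambda>x. cnj (wave k x)) \<in> borel_measurable cell"
    unfolding cnj_wave by (intro continuous_measurable_cell continuous_intros)
  have "(LINT x|cell. u x * cnj (wave k x)) = (LINT x|cell. v x * cnj (wave k x))"
    using AE_lebesgue_cell [OF assms(3)] by (intro integral_cong_AE) auto
  then show ?thesis by (simp add: fourier_coeff_def)
qed


section \<open>Fourier series with absolutely summable coefficients\<close>

definition fourier_series :: "(int ^ 'd \<Rightarrow> complex) \<Rightarrow> 'd::finite torus_fun" where
  "fourier_series a x = (\<Sum>\<^sub>\<infinity>k. a k * wave k x)"

lemma fourier_multiplier_series: "fourier_multiplier m u = fourier_series (\<lambda>k. m k * fourier_coeff u k)"
  by (simp add: fourier_multiplier_def fourier_series_def fun_eq_iff)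

text \<open>Absolute summability comes with an explicit bound on the finite partial sums, so that
  the resulting sup bounds are quantitative and no summability has to be tracked separately.\<close>

definition l1_bound :: "('k \<Rightarrow> complex) \<Rightarrow> real \<Rightarrow> bool" where
  "l1_bound a B \<longleftrightarrow> (\<forall>F. finite F \<longrightarrow> (\<Sum>k\<in>F. norm (a k)) \<le> B)"

lemma l1_bound_summable: "l1_bound a B \<Longrightarrow> (\<lambda>k. norm (a k)) summable_on UNIV"
  by (rule nonneg_bdd_above_summable_on) (auto simp: l1_bound_def bdd_above_def)

lemma fourier_series_summable:
  assumes "l1_bound a B" shows "(\<lambda>k. a k * wave k x) summable_on A"
proof -
  have "(\<lambda>k. a k * wave k x) summable_on UNIV"
    by (rule abs_summable_summable) (simp add: norm_mult l1_bound_summable [OF assms])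
  then show ?thesis by (rule summable_on_subset_banach) simp
qed

lemma fourier_series_uniform_limit:
  assumes "l1_bound a B"
  shows "uniform_limit UNIV (\<lambda>F x. \<Sum>k\<in>F. a k * wave k x) (fourier_series a) (finite_subsets_at_top UNIV)"
  unfolding fourier_series_def [abs_def]
  by (rule Weierstrass_m_test_general [OF _ l1_bound_summable [OF assms]]) (simp add: norm_mult)

lemma continuous_on_fourier_series:
  assumes "l1_bound a B" shows "continuous_on UNIV (fourier_series a)"
  by (rule uniform_limit_theorem [OF _ fourier_series_uniform_limit [OF assms]])
    (auto intro!: always_eventually continuous_intros)

lemma fourier_series_periodic: "periodic_fun (fourier_series a)"
  by (simp add: periodic_fun_def fourier_series_def wave_periodic)

lemma norm_fourier_series_le:
  assumes "l1_bound a B" shows "norm (fourier_series a x) \<le> B"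
proof -
  have "norm (fourier_series a x) \<le> (\<Sum>\<^sub>\<infinity>k. norm (a k))"
    unfolding fourier_series_def
    using norm_infsum_bound [of "\<lambda>k. a k * wave k x" UNIV] l1_bound_summable [OF assms]
    by (simp add: norm_mult)
  also have "\<dots> \<le> B"
    by (rule infsum_le_finite_sums [OF l1_bound_summable [OF assms]])
      (use assms in \<open>auto simp: l1_bound_def\<close>)
  finally show ?thesis .
qed

lemma fourier_series_integrable:
  assumes "l1_bound a B" shows "integrable cell (fourier_series a)"
proof -
  interpret finite_measure cell by (rule finite_measure_cell)
  show ?thesis
    by (rule integrable_const_bound [where B = B])
      (auto simp: norm_fourier_series_le [OF assms]
        intro: continuous_measurable_cell continuous_on_fourier_series [OF assms])
qed

lemma fourier_series_L2:
  assumes "l1_bound a B" shows "fourier_series a \<in> L2_torus"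
proof -
  interpret finite_measure cell by (rule finite_measure_cell)
  have m: "fourier_series a \<in> borel_measurable lebesgue"
    using borel_measurable_continuous_onI [OF continuous_on_fourier_series [OF assms]]
    by (simp add: measurable_completion)
  have "(cmod (fourier_series a x))\<^sup>2 \<le> B\<^sup>2" for x
    by (rule power_mono [OF norm_fourier_series_le [OF assms]]) simp
  then have "integrable cell (\<lambda>x. (cmod (fourier_series a x))\<^sup>2)"
    using measurable_restrict_space1 [OF m]
    by (intro integrable_const_bound [where B = "B\<^sup>2"]) auto
  then show ?thesis by (simp add: L2_torus_def fourier_series_periodic m)
qed

text \<open>The series converges uniformly on a set of finite measure, so the coefficients of the
  partial sums converge to that of the limit. By orthogonality they are constant as soon as the
  finite index set contains \<open>l\<close>.\<close>

lemma fourier_coeff_fourier_series: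
  fixes a :: "int ^ 'd::finite \<Rightarrow> complex"
  assumes "l1_bound a B" shows "fourier_coeff (fourier_series a) l = a l"
proof -
  interpret finite_measure "cell :: (real ^ 'd) measure" by (rule finite_measure_cell)
  define V :: complex where "V = of_real ((2 * pi) ^ CARD('d))"
  have V0: "V \<noteq> 0" by (simp add: V_def)
  define P where "P = (\<lambda>F x. \<Sum>k\<in>F. a k * wave k x)"
  let ?I = "\<lambda>g :: real ^ 'd \<Rightarrow> complex. LINT x|cell. g x * cnj (wave l x)"
  have wi: "integrable cell (wave k :: real ^ 'd \<Rightarrow> complex)" for k
    by (rule integrable_const_bound [where B = 1]) (auto intro: continuous_measurable_cell continuous_intros)
  have Pi: "integrable cell (P F)" for F
    unfolding P_def by (intro Bochner_Integration.integrable_sum integrable_mult_right wi)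
  have IP: "?I (P F) = a l * V" if "l \<in> F" "finite F" for F
  proof -
    have "?I (P F) = (LINT x|cell. (\<Sum>k\<in>F. a k * wave (k - l) x))"
      unfolding P_def
      by (rule Bochner_Integration.integral_cong)
        (auto simp: sum_distrib_right cnj_wave mult.assoc wave_mult)
    also have "\<dots> = (\<Sum>k\<in>F. a k * (LINT x|cell. wave (k - l) x))"
      by (subst Bochner_Integration.integral_sum) (auto intro!: wi)
    also have "\<dots> = (\<Sum>k\<in>F. if k = l then a k * V else 0)"
      by (rule sum.cong) (auto simp: wave_integral V_def)
    also have "\<dots> = a l * V" using that by simp
    finally show ?thesis .
  qed
  have si: "integrable cell (fourier_series a)" by (rule fourier_series_integrable [OF assms])
  have "((\<lambda>F. ?I (P F)) \<longlongrightarrow> ?I (fourier_series a)) (finite_subsets_at_top UNIV)"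
  proof (rule tendstoI)
    fix e :: real assume e: "e > 0"
    \<comment> \<open>Adding 1 makes the denominator positive without computing the measure of the
      cell.\<close>
    define e' where "e' = e / (measure (cell :: (real ^ 'd) measure) (space cell) + 1)"
    have e': "e' > 0" unfolding e'_def using e by (intro divide_pos_pos) (auto intro: add_nonneg_pos)
    have "\<forall>\<^sub>F F in finite_subsets_at_top UNIV. \<forall>x\<in>UNIV. dist (P F x) (fourier_series a x) < e'"
      using fourier_series_uniform_limit [OF assms] e' unfolding uniform_limit_iff P_def by blast
    then show "\<forall>\<^sub>F F in finite_subsets_at_top UNIV. dist (?I (P F)) (?I (fourier_series a)) < e"
    proof eventually_elim
      case (elim F)
      have "dist (?I (P F)) (?I (fourier_series a)) =
            norm (LINT x|cell. (P F x - fourier_series a x) * cnj (wave l x))"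
        using integrable_cnj_wave_mult [OF Pi, of F l] integrable_cnj_wave_mult [OF si, of l]
        by (simp add: dist_norm left_diff_distrib)
      also have "\<dots> \<le> (LINT x|(cell :: (real ^ 'd) measure). e')"
        by (rule Bochner_Integration.integral_norm_bound_integral)
          (use elim integrable_cnj_wave_mult [OF Bochner_Integration.integrable_diff [OF Pi si], of F l]
            in \<open>auto simp: norm_mult dist_norm less_imp_le\<close>)
      also have "\<dots> < e"
      proof -
        have "measure (cell :: (real ^ 'd) measure) (space cell) * e <
              (measure (cell :: (real ^ 'd) measure) (space cell) + 1) * e"
          using e by simp
        then show ?thesis
          using measure_nonneg [of "cell :: (real ^ 'd) measure" "space cell"]
          by (simp add: e'_def pos_divide_less_eq add_nonneg_pos ring_distribs mult.commute)
      qed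
      finally show ?case .
    qed
  qed
  moreover have "((\<lambda>F. ?I (P F)) \<longlongrightarrow> a l * V) (finite_subsets_at_top UNIV)"
  proof (rule tendsto_eventually)
    show "\<forall>\<^sub>F F in finite_subsets_at_top UNIV. ?I (P F) = a l * V"
      unfolding eventually_finite_subsets_at_top
      by (rule exI [of _ "{l}"]) (auto intro: IP)
  qed
  ultimately have "?I (fourier_series a) = a l * V"
    by (rule tendsto_unique [OF finite_subsets_at_top_neq_bot])
  then show ?thesis using V0 by (simp add: fourier_coeff_def V_def)
qed

section \<open>Uniqueness of Fourier coefficients\<close>

definition fourier_null :: "'d::finite torus_fun \<Rightarrow> bool" where
  "fourier_null v \<longleftrightarrow> integrable cell v \<and> (\<forall>k. (LINT x|cell. v x * wave k x) = 0)"

lemma fourier_nullI: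
  assumes "integrable cell v" "\<And>k. fourier_coeff v k = 0"
  shows "fourier_null v"
  unfolding fourier_null_def
proof (intro conjI allI assms)
  fix k
  show "(LINT x|cell. v x * wave k x) = 0"
    using assms(2) [of "- k"] by (simp add: fourier_coeff_def cnj_wave)
qed

text \<open>Embeds the torus into \<open>complex ^ 'd\<close> as the compact set of vectors with all
  entries of modulus 1. Real polynomials in the coordinates pull back to trigonometric polynomials,
  and \<open>G (torus_point x)\<close> is periodic for every \<open>G\<close>.\<close>

definition torus_point :: "real ^ 'd \<Rightarrow> complex ^ 'd" where
  "torus_point x = (\<chi> i. cis (x $ i))"

lemma continuous_on_torus_point [continuous_intros]: "continuous_on A torus_point"
  unfolding torus_point_def [abs_def] by (intro continuous_intros)

lemma compact_torus: "compact {z :: complex ^ 'd::finite. \<forall>i. norm (z $ i) = 1}"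
proof -
  have "closed {z :: complex ^ 'd. \<forall>i. norm (z $ i) = 1}"
    by (intro closed_Collect_all closed_Collect_eq continuous_intros)
  moreover have "bounded {z :: complex ^ 'd. \<forall>i. norm (z $ i) = 1}"
  proof (rule boundedI)
    fix z :: "complex ^ 'd" assume "z \<in> {z. \<forall>i. norm (z $ i) = 1}"
    then show "norm z \<le> real CARD('d)"
      unfolding norm_vec_def by (intro order_trans [OF L2_set_le_sum]) auto
  qed
  ultimately show ?thesis by (simp add: compact_eq_bounded_closed)
qed

lemma torus_point_in [simp]: "norm (torus_point x $ i) = 1"
  by (simp add: torus_point_def)

lemma fourier_null_wave:
  assumes "fourier_null v" shows "fourier_null (\<lambda>x. v x * wave k x)"
  using assms by (simp add: fourier_null_def integrable_wave_mult mult.assoc wave_mult)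

lemma fourier_null_cmult:
  assumes "fourier_null v" shows "fourier_null (\<lambda>x. v x * c)"
proof -
  have "(LINT x|cell. v x * c * wave k x) = (LINT x|cell. v x * wave k x * c)" for k
    by (rule Bochner_Integration.integral_cong) auto
  then show ?thesis using assms by (simp add: fourier_null_def)
qed

lemma fourier_null_add:
  assumes "fourier_null v" "fourier_null w" shows "fourier_null (\<lambda>x. v x + w x)"
  using assms by (simp add: fourier_null_def ring_distribs integrable_wave_mult)

lemma fourier_null_sum:
  assumes "\<And>i. i \<in> I \<Longrightarrow> fourier_null (f i)" shows "fourier_null (\<lambda>x. \<Sum>i\<in>I. f i x)"
  using assms
  by (induction I rule: infinite_finite_induct) (auto intro: fourier_null_add simp: fourier_null_def [of "\<lambda>_. 0"])

text \<open>Cosine and sine of a coordinate are combinations of two waves, and multiplication by a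
  wave only shifts the Fourier coefficients.\<close>

lemma fourier_null_coordinate:
  assumes v: "fourier_null v"
  shows "fourier_null (\<lambda>x. v x * of_real (Re (cis (x $ i))))"
    and "fourier_null (\<lambda>x. v x * of_real (Im (cis (x $ i))))"
proof -
  have w: "wave (axis i 1) x = cis (x $ i)" "wave (- axis i 1) x = cnj (cis (x $ i))" for x
  proof -
    show *: "wave (axis i 1) x = cis (x $ i)"
      by (simp add: wave_def axis_def if_distrib [of "\<lambda>y. y * _"] if_distrib [of real_of_int] cong: if_cong)
    show "wave (- axis i 1) x = cnj (cis (x $ i))"
      unfolding cnj_wave [symmetric] * ..
  qed
  have p: "fourier_null (\<lambda>x. v x * wave (axis i 1) x)" "fourier_null (\<lambda>x. v x * wave (- axis i 1) x)"
    by (rule fourier_null_wave [OF v])+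
  have "fourier_null (\<lambda>x. (v x * wave (axis i 1) x + v x * wave (- axis i 1) x) * (1 / 2))"
    by (intro fourier_null_cmult fourier_null_add p)
  then show "fourier_null (\<lambda>x. v x * of_real (Re (cis (x $ i))))"
    unfolding w by (simp add: distrib_left [symmetric] complex_add_cnj)
  have "fourier_null (\<lambda>x. (v x * wave (axis i 1) x + v x * wave (- axis i 1) x * (- 1)) * (1 / (2 * \<i>)))"
    by (intro fourier_null_cmult fourier_null_add p)
  moreover have "(v x * c + v x * cnj c * (- 1)) * (1 / (2 * \<i>)) = v x * of_real (Im c)" for x c
  proof -
    have "v x * c + v x * cnj c * (- 1) = v x * (c - cnj c)"
      by (simp add: algebra_simps)
    then show ?thesis by (simp add: complex_diff_cnj)
  qed
  ultimately show "fourier_null (\<lambda>x. v x * of_real (Im (cis (x $ i))))"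
    unfolding w by simp
qed

text \<open>Induction over the polynomial with \<open>v\<close> arbitrary: in the product case one
  hypothesis is applied to \<open>v\<close> already multiplied by the other factor. A real linear
  functional on \<open>complex ^ 'd\<close> is a combination of the real and imaginary parts of the
  coordinates.\<close>

lemma fourier_null_real_polynomial:
  assumes "real_polynomial_function g" and "fourier_null v"
  shows "fourier_null (\<lambda>x. v x * of_real (g (torus_point x)))"
  using assms
proof (induction arbitrary: v rule: real_polynomial_function.induct)
  case (linear f v)
  then interpret bounded_linear f by simp
  have lin: "f (torus_point x) = (\<Sum>i\<in>UNIV. Re (cis (x $ i)) * f (axis i 1) + Im (cis (x $ i)) * f (axis i \<i>))" for x
  proof -
    have "torus_point x = (\<Sum>i\<in>UNIV. Re (cis (x $ i)) *\<^sub>R axis i 1 + Im (cis (x $ i)) *\<^sub>R axis i \<i>)"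
      by (simp add: vec_eq_iff torus_point_def axis_def if_distrib [of "\<lambda>y. _ *\<^sub>R y"]
          complex_eq_iff sum.distrib cong: if_cong)
    then show ?thesis by (simp add: sum add scale)
  qed
  have "fourier_null (\<lambda>x. \<Sum>i\<in>UNIV. v x * of_real (Re (cis (x $ i))) * of_real (f (axis i 1)) +
                            v x * of_real (Im (cis (x $ i))) * of_real (f (axis i \<i>)))"
    by (intro fourier_null_sum fourier_null_add fourier_null_cmult
        fourier_null_coordinate [OF \<open>fourier_null v\<close>])
  then show ?case unfolding lin
    by (simp add: sum_distrib_left ring_distribs mult.assoc)
next
  case (const c)
  then show ?case by (intro fourier_null_cmult)
next
  case (add f g)
  then show ?case by (simp add: ring_distribs fourier_null_add)
next
  case (mult f g)
  then have "fourier_null (\<lambda>x. v x * of_real (f (torus_point x)) * of_real (g (torus_point x)))"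
    by (intro mult.IH(2) mult.IH(1))
  then show ?case by (simp add: mult.assoc)
qed

text \<open>Stone-Weierstrass on the compact torus gives a polynomial within \<open>e\<close> of
  \<open>G\<close>. The polynomial integrates to 0 against \<open>v\<close>, and the error is at
  most \<open>e\<close> times the L1 norm of \<open>v\<close>.\<close>

lemma fourier_null_continuous:
  fixes G :: "complex ^ 'd::finite \<Rightarrow> real"
  assumes G: "continuous_on UNIV G" and v: "fourier_null v"
  shows "(LINT x|cell. v x * of_real (G (torus_point x))) = 0"
proof -
  let ?S = "{z :: complex ^ 'd. \<forall>i. norm (z $ i) = 1}"
  have vi: "integrable cell v" using v by (simp add: fourier_null_def)
  have ii: "integrable cell (\<lambda>x. v x * of_real (H (torus_point x)))" if H: "continuous_on UNIV H" for H
  proof -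
    have "compact (H ` ?S)"
      by (rule compact_continuous_image [OF continuous_on_subset [OF H] compact_torus]) simp
    then obtain B where B: "\<And>z. z \<in> ?S \<Longrightarrow> norm (H z) \<le> B"
      by (meson bounded_iff compact_imp_bounded imageI)
    show ?thesis
      by (rule integrable_cell_bounded_mult [OF vi, where B = B])
        (use B [of "torus_point _"] in \<open>auto intro!: continuous_intros continuous_on_compose2 [OF H]\<close>)
  qed
  define J where "J = (LINT x|cell. norm (v x))"
  have J: "J \<ge> 0" unfolding J_def by simp
  have "norm (LINT x|cell. v x * of_real (G (torus_point x))) \<le> e * J" if e: "e > 0" for e
  proof -
    obtain g where g: "real_polynomial_function g" "\<And>z. z \<in> ?S \<Longrightarrow> \<bar>G z - g z\<bar> < e"
      using Stone_Weierstrass_real_polynomial_function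
        [OF compact_torus continuous_on_subset [OF G] e] by blast
    have gc: "continuous_on UNIV g"
      using g(1) by (simp add: continuous_on_polymonial_function real_polynomial_function_eq)
    \<comment> \<open>At frequency 0 the condition of \<open>fourier_null\<close> is the vanishing
      of the integral itself.\<close>
    have "(LINT x|cell. v x * of_real (g (torus_point x)) * wave 0 x) = 0"
      using fourier_null_real_polynomial [OF g(1) v] unfolding fourier_null_def by blast
    then have "(LINT x|cell. v x * of_real (G (torus_point x))) =
          (LINT x|cell. v x * of_real (G (torus_point x)) - v x * of_real (g (torus_point x)))"
      using ii [OF G] ii [OF gc] by simp
    also have "norm \<dots> \<le> (LINT x|cell. e * norm (v x))"
    proof (rule Bochner_Integration.integral_norm_bound_integral)
      show "integrable cell (\<lambda>x. e * norm (v x))" using vi by simp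
      fix x :: "real ^ 'd"
      have "norm (v x * of_real (G (torus_point x)) - v x * of_real (g (torus_point x))) =
            norm (v x) * \<bar>G (torus_point x) - g (torus_point x)\<bar>"
        unfolding right_diff_distrib [symmetric] of_real_diff [symmetric] norm_mult norm_of_real ..
      also have "\<dots> \<le> norm (v x) * e"
        using g(2) [of "torus_point x"] by (intro mult_left_mono) (auto simp: less_imp_le)
      finally show "norm (v x * of_real (G (torus_point x)) - v x * of_real (g (torus_point x))) \<le> e * norm (v x)"
        by (simp add: mult.commute)
    qed (use ii [OF G] ii [OF gc] in auto)
    also have "\<dots> = e * J" by (simp add: J_def)
    finally show ?thesis .
  qed
  note bd = this
  have "norm (LINT x|cell. v x * of_real (G (torus_point x))) \<le> 0 + e" if "e > 0" for e
    using bd [of "e / (J + 1)"] that J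
    by (smt (verit, ccfv_SIG) divide_pos_pos mult_less_cancel_left1 pos_divide_le_eq times_divide_eq_left mult_left_mono)
  then have "norm (LINT x|cell. v x * of_real (G (torus_point x))) \<le> 0"
    by (rule field_le_epsilon)
  then show ?thesis by simp
qed

text \<open>The open box avoids the identification of opposite faces; by \<open>AE_cell_box\<close>
  it is almost all of the cell.\<close>

lemma torus_point_inj:
  assumes "x \<in> box (\<chi> i. - pi) (\<chi> i. pi)" "y \<in> box (\<chi> i. - pi) (\<chi> i. pi)"
    and "torus_point x = torus_point y"
  shows "x = y"
proof -
  have "x $ i = y $ i" for i
  proof -
    have "cis (x $ i) = cis (y $ i)" using assms(3) by (simp add: torus_point_def vec_eq_iff)
    moreover have "x $ i \<in> {-pi<..pi}" "y $ i \<in> {-pi<..pi}"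
      using assms(1,2) by (auto simp: mem_box_cart less_imp_le)
    ultimately show ?thesis by (metis Arg_cis)
  qed
  then show ?thesis by (simp add: vec_eq_iff)
qed

lemma AE_cell_box: "AE x in (cell :: (real ^ 'd::finite) measure). x \<in> box (\<chi> i. - pi) (\<chi> i. pi)"
proof -
  have "period_cell - box (\<chi> i. - pi) (\<chi> i. pi :: real ^ 'd) \<in> null_sets lebesgue"
    unfolding period_cell_def using negligible_frontier_interval
    by (simp add: negligible_iff_null_sets)
  then have "AE x in lebesgue. x \<notin> period_cell - box (\<chi> i. - pi) (\<chi> i. pi :: real ^ 'd)"
    by (rule AE_not_in)
  then show ?thesis
    by (subst AE_restrict_space_iff) (auto elim: eventually_mono)
qed

text \<open>Continuous functions on the torus decrease to the indicator of the image of
  \<open>K\<close>, so dominated convergence transfers the vanishing. Points of the open box outside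
  \<open>K\<close> are not mapped into that image, since \<open>K\<close> lies in the open box
  too.\<close>

lemma fourier_null_compact:
  fixes K :: "(real ^ 'd::finite) set"
  assumes v: "fourier_null v" and K: "compact K" "K \<subseteq> box (\<chi> i. - pi) (\<chi> i. pi)"
  shows "(LINT x|cell. indicator K x *\<^sub>R v x) = 0"
proof (cases "K = {}")
  case True then show ?thesis by simp
next
  case False
  define C where "C = torus_point ` K"
  have C: "closed C" "C \<noteq> {}"
    using compact_continuous_image [OF continuous_on_torus_point K(1)] False
    by (auto simp: C_def compact_imp_closed)
  define G where "G = (\<lambda>n z. max 0 (1 - real n * infdist z C))"
  have Gc: "continuous_on UNIV (G n)" for n
    unfolding G_def by (intro continuous_intros)
  have vi: "integrable cell v" using v by (simp add: fourier_null_def)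
  have vm [measurable]: "v \<in> borel_measurable cell" using vi by simp
  have Km: "K \<in> sets cell"
  proof -
    have "K \<subseteq> period_cell"
      unfolding period_cell_def using K(2) box_subset_cbox by (rule order_trans)
    moreover have "K \<in> sets lebesgue" using K(1) by (auto intro: lmeasurable_compact fmeasurableD)
    ultimately show ?thesis by (auto simp: sets_restrict_space)
  qed
  have Kmeas: "(\<lambda>x. indicator K x :: real) \<in> borel_measurable cell"
    using Km by measurable
  have Gm: "(\<lambda>x. of_real (G n (torus_point x)) :: complex) \<in> borel_measurable cell" for n
    by (intro continuous_measurable_cell continuous_intros continuous_on_compose2 [OF Gc]) auto
  have lim: "(\<lambda>n. LINT x|cell. v x * of_real (G n (torus_point x))) \<longlonglongrightarrow> (LINT x|cell. indicator K x *\<^sub>R v x)"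
  proof (rule integral_dominated_convergence)
    show "integrable cell (\<lambda>x. norm (v x))" using vi by simp
    show "(\<lambda>x. indicator K x *\<^sub>R v x) \<in> borel_measurable cell"
      using Kmeas by measurable
    show "(\<lambda>x. v x * of_real (G n (torus_point x))) \<in> borel_measurable cell" for n
      using Gm [of n] by measurable
    show "AE x in cell. norm (v x * of_real (G n (torus_point x))) \<le> norm (v x)" for n
    proof (rule AE_I2)
      fix x
      have "\<bar>G n (torus_point x)\<bar> \<le> 1" by (auto simp: G_def infdist_nonneg)
      then show "norm (v x * of_real (G n (torus_point x))) \<le> norm (v x)"
        by (simp add: norm_mult mult_left_le)
    qed
    show "AE x in cell. (\<lambda>n. v x * of_real (G n (torus_point x))) \<longlonglongrightarrow> indicator K x *\<^sub>R v x"
      using AE_cell_box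
    proof eventually_elim
      case (elim x)
      have "(\<lambda>n. G n (torus_point x)) \<longlonglongrightarrow> indicator K x"
      proof (cases "x \<in> K")
        case True
        then have "infdist (torus_point x) C = 0" by (simp add: C_def)
        then show ?thesis using True by (simp add: G_def)
      next
        case False
        have "torus_point x \<notin> C"
          using torus_point_inj [OF elim] False K(2) by (auto simp: C_def)
        then have d: "infdist (torus_point x) C > 0"
          using C by (metis in_closed_iff_infdist_zero infdist_nonneg less_le)
        obtain N where N: "real N * infdist (torus_point x) C > 1"
          using d reals_Archimedean3 by blast
        have "G n (torus_point x) = 0" if "n \<ge> N" for n
        proof -
          have "real N * infdist (torus_point x) C \<le> real n * infdist (torus_point x) C"
            using that d by (intro mult_right_mono) auto
          then show ?thesis using N by (simp add: G_def)
        qed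
        then have "\<forall>\<^sub>F n in sequentially. G n (torus_point x) = 0"
          by (auto simp: eventually_sequentially)
        then show ?thesis using False by (simp add: tendsto_eventually)
      qed
      then have "(\<lambda>n. v x * of_real (G n (torus_point x))) \<longlonglongrightarrow> v x * of_real (indicator K x)"
        by (intro tendsto_intros)
      then show ?case by (simp add: scaleR_conv_of_real mult.commute)
    qed
  qed
  have "(\<lambda>n. 0 :: complex) \<longlonglongrightarrow> (LINT x|cell. indicator K x *\<^sub>R v x)"
    using lim by (simp add: fourier_null_continuous [OF Gc v])
  then show ?thesis by (simp add: LIMSEQ_const_iff)
qed

text \<open>The integrals over compact sets vanish. A Lebesgue set is a countable union of compact
  sets up to a null set, so the integrals over all measurable sets vanish, which forces
  \<open>v\<close> to be 0 almost everywhere.\<close>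

lemma fourier_null_AE:
  fixes v :: "'d::finite torus_fun"
  assumes v: "fourier_null v"
  shows "AE x in cell. v x = 0"
proof -
  let ?B = "box (\<chi> i. - pi) (\<chi> i. pi) :: (real ^ 'd) set"
  have vi: "integrable cell v" using v by (simp add: fourier_null_def)
  have "set_lebesgue_integral cell A v = 0" if A: "A \<in> sets cell" for A
  proof -
    have "A \<in> sets lebesgue" using A by (auto simp: sets_restrict_space)
    then have AB: "A \<inter> ?B \<in> sets lebesgue" by (intro sets.Int) auto
    obtain C N where CN: "fsigma C" "N \<in> null_sets lebesgue" "C \<union> N = A \<inter> ?B" "disjnt C N"
      by (rule lebesgue_set_almost_fsigma [OF AB])
    obtain F :: "nat \<Rightarrow> (real ^ 'd) set" where "range F \<subseteq> Collect compact" and F2: "C = (\<Union>n. F n)"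
      using iffD1 [OF fsigma_Union_compact CN(1)] by (elim exE conjE)
    then have F: "compact (F n)" "C = (\<Union>n. F n)" for n by auto
    \<comment> \<open>Finite unions make the sequence increasing, as continuity from below
      requires.\<close>
    define K where "K = (\<lambda>n. \<Union>m\<le>n. F m)"
    have K: "compact (K n)" "K n \<subseteq> ?B" for n
    proof -
      show "compact (K n)" unfolding K_def by (intro compact_UN) (auto simp: F)
      show "K n \<subseteq> ?B" using CN(3) F(2) by (auto simp: K_def)
    qed
    have KC: "(\<Union>n. K n) = C" by (auto simp: K_def F(2))
    have Ks: "K n \<in> sets cell" for n
    proof -
      have "K n \<subseteq> period_cell"
        unfolding period_cell_def using K(2) [of n] box_subset_cbox by (rule order_trans)
      moreover have "K n \<in> sets lebesgue" using K(1) by (auto intro: lmeasurable_compact fmeasurableD)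
      ultimately show ?thesis by (auto simp: sets_restrict_space)
    qed
    have Cs: "C \<in> sets cell" using Ks unfolding KC [symmetric] by (intro sets.countable_UN) auto
    have lim: "(\<lambda>n. LINT x:K n|cell. v x) \<longlonglongrightarrow> (LINT x:(\<Union>n. K n)|cell. v x)"
    proof (rule set_integral_cont_up [OF Ks])
      show "incseq K" by (force simp: K_def incseq_def)
      show "set_integrable cell (\<Union>n. K n) v"
        unfolding set_integrable_def KC by (rule integrable_mult_indicator [OF Cs vi])
    qed
    have "(LINT x:K n|cell. v x) = 0" for n
      unfolding set_lebesgue_integral_def by (rule fourier_null_compact [OF v K])
    with lim have C0: "(LINT x:C|cell. v x) = 0" by (simp add: KC LIMSEQ_const_iff)
    have "(LINT x:A|cell. v x) = (LINT x:C|cell. v x)"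
      unfolding set_lebesgue_integral_def
    proof (rule integral_cong_AE)
      show "(\<lambda>x. indicat_real A x *\<^sub>R v x) \<in> borel_measurable cell"
        "(\<lambda>x. indicat_real C x *\<^sub>R v x) \<in> borel_measurable cell"
        using integrable_mult_indicator [OF A vi] integrable_mult_indicator [OF Cs vi] by auto
      have "AE x in cell. x \<notin> N"
        using AE_lebesgue_cell [OF AE_not_in [OF CN(2)]] .
      then show "AE x in cell. indicat_real A x *\<^sub>R v x = indicat_real C x *\<^sub>R v x"
        using AE_cell_box
      proof eventually_elim
        case (elim x)
        then have "x \<in> A \<longleftrightarrow> x \<in> C" using CN(3) by blast
        then show ?case by (simp add: indicator_def)
      qed
    qed
    with C0 show ?thesis by simp
  qed
  then have "AE x in cell. v x = (\<lambda>_. 0) x"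
    by (intro sigma_finite_measure.density_unique_banach
        [OF finite_measure.axioms(1) [OF finite_measure_cell] vi])
      (auto simp: set_lebesgue_integral_def)
  then show ?thesis by simp
qed

text \<open>The exceptional set is covered by countably many translates, by vectors of the period
  lattice, of the null set in the cell.\<close>

lemma AE_cell_translate:
  fixes P :: "real ^ 'd::finite \<Rightarrow> bool"
  assumes "AE x in cell. P x" and per: "\<And>x i. P (x + axis i (2 * pi)) \<longleftrightarrow> P x"
  shows "AE x in lebesgue. P x"
proof -
  define t :: "int ^ 'd \<Rightarrow> real ^ 'd" where "t = (\<lambda>m. \<chi> i. 2 * pi * real_of_int (m $ i))"
  have axn: "P (x + axis i (2 * pi * real n)) \<longleftrightarrow> P x" for x i n
  proof (induction n)
    case (Suc n)
    have "x + axis i (2 * pi * real (Suc n)) = (x + axis i (2 * pi * real n)) + axis i (2 * pi)"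
      by (simp add: vec_eq_iff axis_def algebra_simps)
    then show ?case using Suc per [of "x + axis i (2 * pi * real n)" i] by (simp only:)
  next
    case 0
    have "x + axis i (2 * pi * real 0) = x" by (simp add: vec_eq_iff axis_def)
    then show ?case by (simp only:)
  qed
  have axz: "P (x + axis i (2 * pi * real_of_int z)) \<longleftrightarrow> P x" for x i z
  proof (cases z rule: int_cases2)
    case (nonneg n) then show ?thesis using axn [of x i n] by simp
  next
    case (nonpos n)
    have "x = (x + axis i (2 * pi * real_of_int z)) + axis i (2 * pi * real n)"
      by (simp add: vec_eq_iff axis_def nonpos)
    from arg_cong [OF this, of P] show ?thesis
      using axn [of "x + axis i (2 * pi * real_of_int z)" i n] by blast
  qed
  have ax: "P (x + (\<Sum>i\<in>I. axis i (2 * pi * real_of_int (m $ i)))) \<longleftrightarrow> P x" if "finite I" for x I and m :: "int ^ 'd"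
    using that
  proof (induction I arbitrary: x)
    case (insert j I)
    then show ?case by (simp add: add.assoc [symmetric] axz)
  qed simp
  have tm: "P (x + t m) \<longleftrightarrow> P x" for x m
  proof -
    have "t m = (\<Sum>i\<in>UNIV. axis i (2 * pi * real_of_int (m $ i)))"
      by (simp add: vec_eq_iff t_def axis_def)
    then show ?thesis using ax [OF finite, of x m UNIV] by simp
  qed
  obtain N where N: "N \<in> null_sets lebesgue" "{x \<in> period_cell. \<not> P x} \<subseteq> N"
  proof -
    have "AE x in lebesgue. x \<in> period_cell \<longrightarrow> P x"
      using assms(1) by (subst (asm) AE_restrict_space_iff) auto
    then obtain N where "N \<in> null_sets lebesgue" "{x \<in> space lebesgue. \<not> (x \<in> period_cell \<longrightarrow> P x)} \<subseteq> N"
      unfolding eventually_ae_filter by blast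
    then show ?thesis by (intro that) auto
  qed
  have "{x. \<not> P x} \<subseteq> (\<Union>m. (+) (t m) ` N)"
  proof
    fix x assume "x \<in> {x. \<not> P x}"
    define m :: "int ^ 'd" where "m = (\<chi> i. \<lfloor>(x $ i + pi) / (2 * pi)\<rfloor>)"
    have "- pi \<le> x $ i - 2 * pi * real_of_int (m $ i) \<and> x $ i - 2 * pi * real_of_int (m $ i) \<le> pi" for i
    proof -
      have "real_of_int (m $ i) \<le> (x $ i + pi) / (2 * pi)" "(x $ i + pi) / (2 * pi) < real_of_int (m $ i) + 1"
        unfolding m_def by simp_all
      then show ?thesis by (simp add: field_simps)
    qed
    then have "x - t m \<in> period_cell" by (simp add: period_cell_def mem_box_cart t_def)
    moreover have "\<not> P (x - t m)"
      using tm [of "x - t m" m] \<open>x \<in> {x. \<not> P x}\<close> by simp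
    ultimately have "x - t m \<in> N" using N(2) by blast
    then have "x \<in> (+) (t m) ` N" by (force simp: image_iff)
    then show "x \<in> (\<Union>m. (+) (t m) ` N)" by blast
  qed
  moreover have "(\<Union>m. (+) (t m) ` N) \<in> null_sets lebesgue"
    using N(1) by (intro null_sets_UN' countableI_type)
      (auto simp: negligible_iff_null_sets [symmetric] negligible_translation)
  ultimately have "{x \<in> space lebesgue. \<not> P x} \<subseteq> (\<Union>m. (+) (t m) ` N)" by simp
  then show ?thesis using \<open>(\<Union>m. (+) (t m) ` N) \<in> null_sets lebesgue\<close>
    by (auto simp: eventually_ae_filter)
qed

text \<open>Both sides have the same coefficients, so they agree almost everywhere on the cell and,
  by periodicity, on the whole space. The series is the continuous representative that replaces
  \<open>u\<close> from here on.\<close>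

theorem fourier_series_AE:
  fixes u :: "'d::finite torus_fun"
  assumes u: "u \<in> L2_torus" and l1: "l1_bound (fourier_coeff u) B"
  shows "AE x in lebesgue. u x = fourier_series (fourier_coeff u) x"
proof -
  let ?w = "fourier_series (fourier_coeff u)"
  have ui: "integrable cell u" by (rule L2_torus_integrable [OF u])
  have wi: "integrable cell ?w" by (rule fourier_series_integrable [OF l1])
  have "fourier_null (\<lambda>x. u x - ?w x)"
    by (rule fourier_nullI)
      (use ui wi in \<open>auto simp: fourier_coeff_diff fourier_coeff_fourier_series [OF l1]\<close>)
  then have "AE x in cell. u x - ?w x = 0" by (rule fourier_null_AE)
  then have "AE x in lebesgue. u x - ?w x = 0"
    using u fourier_series_periodic [of "fourier_coeff u"]
    by (elim AE_cell_translate) (simp add: L2_torus_def periodic_fun_def)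
  then show ?thesis by simp
qed

section \<open>Weighted sequence spaces\<close>

text \<open>The exponent is \<open>s / 2\<close> because the weight multiplies the coefficients
  inside the l2 norm; its square is the weight that occurs in \<open>sobolev_norm\<close>.\<close>

definition weight :: "real \<Rightarrow> int ^ 'd::finite \<Rightarrow> real" where
  "weight s k = (1 + freq_norm_sq k) powr (s / 2)"

text \<open>\<open>hbound s a B\<close> says that the sequence \<open>a\<close> of Fourier coefficients has \<open>H\<^sup>s\<close>-norm at most \<open>B\<close>.\<close>

definition hbound :: "real \<Rightarrow> (int ^ 'd::finite \<Rightarrow> complex) \<Rightarrow> real \<Rightarrow> bool" where
  "hbound s a B \<longleftrightarrow> (\<forall>F. finite F \<longrightarrow> L2_set (\<lambda>k. weight s k * norm (a k)) F \<le> B)"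

lemma freq_norm_sq_nonneg [simp]: "freq_norm_sq k \<ge> 0"
  by (simp add: freq_norm_sq_def sum_nonneg)

lemma freq_norm_sq_pos [simp]: "1 + freq_norm_sq k > 0"
  using freq_norm_sq_nonneg [of k] by linarith

lemma freq_norm_sq_neq [simp]: "1 + freq_norm_sq k \<noteq> 0"
  using freq_norm_sq_nonneg [of k] by linarith

lemma freq_norm_sq_uminus [simp]: "freq_norm_sq (- k) = freq_norm_sq k"
  by (simp add: freq_norm_sq_def)

lemma weight_pos [simp]: "weight s k > 0"
  by (simp add: weight_def)

lemma weight_nonneg [simp]: "weight s k \<ge> 0"
  by (rule less_imp_le) simp

lemma weight_uminus [simp]: "weight s (- k) = weight s k"
  by (simp add: weight_def)

lemma weight_0 [simp]: "weight 0 k = 1"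
  by (simp add: weight_def)

lemma weight_add: "weight (s + t) k = weight s k * weight t k"
  by (simp add: weight_def add_divide_distrib powr_add)

lemma weight_mono: "s \<le> t \<Longrightarrow> weight s k \<le> weight t k"
  by (auto simp: weight_def intro!: powr_mono)

lemma weight_sq: "(weight s k)\<^sup>2 = (1 + freq_norm_sq k) powr s"
proof -
  have "(weight s k)\<^sup>2 = weight (s + s) k" by (simp only: weight_add power2_eq_square)
  then show ?thesis by (simp add: weight_def)
qed

lemma weight_shift: "weight (s - 2 * real j) k * (1 + freq_norm_sq k) ^ j = weight s k"
proof -
  have "(1 + freq_norm_sq k) ^ j = weight (2 * real j) k"
    using freq_norm_sq_pos [of k] by (simp add: weight_def powr_realpow)
  then show ?thesis by (simp add: weight_add [symmetric])
qed

section \<open>Estimates in the weighted l2 norms\<close>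

lemma L2_set_single [simp]: "L2_set f {x} = \<bar>f x\<bar>"
  by (simp add: L2_set_def)

lemma L2_set_sum_le:
  assumes "finite G" shows "L2_set (\<lambda>k. \<Sum>l\<in>G. f l k) F \<le> (\<Sum>l\<in>G. L2_set (f l) F)"
  using assms
proof induction
  case empty
  then show ?case by (simp add: L2_set_def)
next
  case (insert x G)
  then show ?case using L2_set_triangle_ineq [of "f x" "\<lambda>k. \<Sum>l\<in>G. f l k" F] by simp
qed

lemma L2_set_cmult: "L2_set (\<lambda>k. c * f k) F = \<bar>c\<bar> * L2_set f F"
  by (simp add: L2_set_def power_mult_distrib sum_distrib_left [symmetric] real_sqrt_mult)

lemma hbound_nonneg: "hbound s a B \<Longrightarrow> B \<ge> 0"
  unfolding hbound_def by (drule spec [of _ "{}"]) simp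

lemma hbound_zero [simp]: "hbound s (\<lambda>k. 0) 0"
  by (simp add: hbound_def L2_set_0')

lemma hbound_le: "hbound s a B \<Longrightarrow> B \<le> B' \<Longrightarrow> hbound s a B'"
  by (meson hbound_def order_trans)

lemma hbound_compare:
  assumes a: "hbound s a B" and c: "c \<ge> 0"
    and le: "\<And>k. weight t k * norm (b k) \<le> c * (weight s k * norm (a k))"
  shows "hbound t b (c * B)"
  unfolding hbound_def
proof (intro allI impI)
  fix F :: "(int ^ 'a) set" assume F: "finite F"
  have "L2_set (\<lambda>k. weight t k * norm (b k)) F \<le> L2_set (\<lambda>k. c * (weight s k * norm (a k))) F"
    by (rule L2_set_mono [OF le]) simp
  also have "\<dots> = c * L2_set (\<lambda>k. weight s k * norm (a k)) F"
    using c by (simp only: L2_set_cmult abs_of_nonneg)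
  also have "\<dots> \<le> c * B" using a F c by (auto simp: hbound_def intro: mult_left_mono)
  finally show "L2_set (\<lambda>k. weight t k * norm (b k)) F \<le> c * B" .
qed

lemma hbound_weaken: "hbound s a B \<Longrightarrow> t \<le> s \<Longrightarrow> hbound t a B"
  using hbound_compare [of s a B 1 t a] by (simp add: mult_right_mono weight_mono)

lemma hbound_mult:
  assumes "hbound s a B" "c \<ge> 0" "\<And>k. norm (g k) \<le> c"
  shows "hbound s (\<lambda>k. g k * a k) (c * B)"
proof (rule hbound_compare [OF assms(1,2)])
  fix k
  show "weight s k * norm (g k * a k) \<le> c * (weight s k * norm (a k))"
    using mult_right_mono [OF assms(3) [of k], of "weight s k * norm (a k)"]
    by (simp add: norm_mult algebra_simps)
qed

text \<open>A symbol that grows like the \<open>j\<close>-th power of |k|^2 costs 2j derivatives.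
  This is the place where powers of \<kappa> are paid for with regularity.\<close>

lemma hbound_multiplier:
  assumes "hbound s a B" "c \<ge> 0" "\<And>k. norm (g k) \<le> c * freq_norm_sq k ^ j"
  shows "hbound (s - 2 * real j) (\<lambda>k. g k * a k) (c * B)"
proof (rule hbound_compare [OF assms(1,2)])
  fix k
  have "norm (g k) \<le> c * (1 + freq_norm_sq k) ^ j"
    by (rule order_trans [OF assms(3)]) (auto intro!: mult_left_mono power_mono assms)
  then have "weight (s - 2 * real j) k * norm (a k) * norm (g k) \<le>
      weight (s - 2 * real j) k * norm (a k) * (c * (1 + freq_norm_sq k) ^ j)"
    by (intro mult_left_mono) auto
  also have "\<dots> = c * ((weight (s - 2 * real j) k * (1 + freq_norm_sq k) ^ j) * norm (a k))"
    by (simp only: ac_simps)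
  also have "\<dots> = c * (weight s k * norm (a k))" by (simp only: weight_shift)
  finally show "weight (s - 2 * real j) k * norm (g k * a k) \<le> c * (weight s k * norm (a k))"
    by (simp add: norm_mult ac_simps)
qed

lemma hbound_cmult: "hbound s a B \<Longrightarrow> hbound s (\<lambda>k. c * a k) (norm c * B)"
  by (rule hbound_mult) auto

lemma hbound_add:
  assumes "hbound s a A" "hbound s b B" shows "hbound s (\<lambda>k. a k + b k) (A + B)"
  unfolding hbound_def
proof (intro allI impI)
  fix F :: "(int ^ 'a) set" assume F: "finite F"
  have "L2_set (\<lambda>k. weight s k * norm (a k + b k)) F \<le>
        L2_set (\<lambda>k. weight s k * norm (a k) + weight s k * norm (b k)) F"
    by (rule L2_set_mono) (auto simp: distrib_left [symmetric] intro!: mult_left_mono norm_triangle_ineq)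
  also have "\<dots> \<le> L2_set (\<lambda>k. weight s k * norm (a k)) F + L2_set (\<lambda>k. weight s k * norm (b k)) F"
    by (rule L2_set_triangle_ineq)
  also have "\<dots> \<le> A + B" using assms F by (auto simp: hbound_def intro: add_mono)
  finally show "L2_set (\<lambda>k. weight s k * norm (a k + b k)) F \<le> A + B" .
qed

lemma hbound_norm_cong: "hbound s a A \<Longrightarrow> (\<And>k. norm (b k) = norm (a k)) \<Longrightarrow> hbound s b A"
  by (simp add: hbound_def)

lemma hbound_uminus: "hbound s a A \<Longrightarrow> hbound s (\<lambda>k. - a k) A"
  by (erule hbound_norm_cong) simp

lemma hbound_diff:
  assumes "hbound s a A" "hbound s b B" shows "hbound s (\<lambda>k. a k - b k) (A + B)"
  using hbound_add [OF assms(1) hbound_uminus [OF assms(2)]] by simp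

lemma hbound_coord_weight: "hbound s a B \<Longrightarrow> weight s k * norm (a k) \<le> B"
  unfolding hbound_def by (drule spec [of _ "{k}"]) simp

lemma hbound_coord:
  assumes "hbound s a B" "s \<ge> 0" shows "norm (a k) \<le> B"
  using hbound_coord_weight [OF hbound_weaken [OF assms], of k] by simp

text \<open>Fatou's lemma in this setting: only finite subsums are bounded, and these are continuous
  in finitely many coordinates.\<close>

lemma hbound_limit:
  fixes a :: "'n \<Rightarrow> int ^ 'd::finite \<Rightarrow> complex"
  assumes h: "\<forall>\<^sub>F n in \<F>. hbound s (a n) (B n)" and a: "\<And>k. ((\<lambda>n. a n k) \<longlongrightarrow> b k) \<F>"
    and B: "(B \<longlongrightarrow> C) \<F>" and ne: "\<F> \<noteq> bot"
  shows "hbound s b C"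
  unfolding hbound_def
proof (intro allI impI)
  fix F :: "(int ^ 'd) set" assume F: "finite F"
  have "((\<lambda>n. L2_set (\<lambda>k. weight s k * norm (a n k)) F) \<longlongrightarrow> L2_set (\<lambda>k. weight s k * norm (b k)) F) \<F>"
    unfolding L2_set_def by (intro tendsto_intros a)
  then show "L2_set (\<lambda>k. weight s k * norm (b k)) F \<le> C"
    by (rule tendsto_le [OF ne B]) (use h F in \<open>auto simp: hbound_def elim: eventually_mono\<close>)
qed

text \<open>Absorption without a supremum over \<open>t\<close>: iterating \<open>X\<close> to
  \<open>A + X / 2\<close> from any finite bound \<open>X0\<close> tends to the fixed point
  \<open>2 * A\<close>. The a priori bound has to be finite, but its size disappears.\<close>

lemma hbound_self_improve:
  assumes A: "A \<ge> 0" and X0: "\<And>t. t \<in> J \<Longrightarrow> hbound s (U t) X0"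
    and step: "\<And>X. (\<And>t. t \<in> J \<Longrightarrow> hbound s (U t) X) \<Longrightarrow> X \<ge> 0 \<Longrightarrow> (\<And>t. t \<in> J \<Longrightarrow> hbound s (U t) (A + X / 2))"
    and t: "t \<in> J"
  shows "hbound s (U t) (2 * A)"
proof -
  have X0': "X0 \<ge> 0" using hbound_nonneg [OF X0 [OF t]] .
  have *: "\<forall>t\<in>J. hbound s (U t) (2 * A + X0 / 2 ^ n)" for n
  proof (induction n)
    case 0
    have "X0 \<le> 2 * A + X0 / 2 ^ 0" using A by simp
    then show ?case using hbound_le [OF X0] by blast
  next
    case (Suc n)
    show ?case
    proof
      fix t assume "t \<in> J"
      have "hbound s (U t) (A + (2 * A + X0 / 2 ^ n) / 2)"
        by (rule step) (use Suc \<open>t \<in> J\<close> A X0' in auto)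
      then show "hbound s (U t) (2 * A + X0 / 2 ^ Suc n)"
        by (simp add: add_divide_distrib mult.commute)
    qed
  qed
  show ?thesis
  proof (rule hbound_limit)
    show "((\<lambda>n. 2 * A + X0 / 2 ^ n) \<longlongrightarrow> 2 * A) sequentially"
      using tendsto_add [OF tendsto_const [of "2 * A"] LIMSEQ_divide_realpow_zero [of 2 X0]] by simp
    show "\<forall>\<^sub>F n in sequentially. hbound s (U t) (2 * A + X0 / 2 ^ n)"
      using * t by simp
  qed auto
qed

text \<open>Minkowski's inequality for integrals, by duality: pairing the integral with itself in
  the weighted inner product writes \<open>Z\<^sup>2\<close> as an integral of inner products, each
  at most \<open>Z * B\<close> by Cauchy-Schwarz. Then one factor \<open>Z\<close> is
  cancelled.\<close>

lemma hbound_integral: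
  assumes G: "\<And>\<sigma>. \<sigma> \<in> {a..b} \<Longrightarrow> hbound s (G \<sigma>) B" and ab: "a \<le> b"
    and int: "\<And>k. (\<lambda>\<sigma>. G \<sigma> k) integrable_on {a..b}"
  shows "hbound s (\<lambda>k. integral {a..b} (\<lambda>\<sigma>. G \<sigma> k)) ((b - a) * B)"
  unfolding hbound_def
proof (intro allI impI)
  fix F :: "(int ^ 'a) set" assume F: "finite F"
  have B: "B \<ge> 0" using hbound_nonneg [OF G [of a]] ab by simp
  define I where "I = (\<lambda>k. integral {a..b} (\<lambda>\<sigma>. G \<sigma> k))"
  define Z where "Z = L2_set (\<lambda>k. weight s k * norm (I k)) F"
  have Z0: "Z \<ge> 0" by (simp add: Z_def)
  have hi: "((\<lambda>\<sigma>. \<Sum>k\<in>F. of_real ((weight s k)\<^sup>2) * cnj (I k) * G \<sigma> k) has_integral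
        (\<Sum>k\<in>F. of_real ((weight s k)\<^sup>2) * cnj (I k) * I k)) {a..b}"
    unfolding I_def
    by (intro has_integral_sum F has_integral_mult_right integrable_integral int)
  have "of_real (Z\<^sup>2) = (\<Sum>k\<in>F. of_real ((weight s k)\<^sup>2) * cnj (I k) * I k)"
    by (simp add: Z_def L2_set_def sum_nonneg power_mult_distrib complex_norm_square [symmetric] mult.assoc mult.commute [of "cnj _"])
  then have "Z\<^sup>2 = norm (\<Sum>k\<in>F. of_real ((weight s k)\<^sup>2) * cnj (I k) * I k)"
    by (metis abs_of_nonneg norm_of_real zero_le_power2)
  also have "\<dots> \<le> (Z * B) * (b - a)"
  proof -
    have "norm (\<Sum>k\<in>F. of_real ((weight s k)\<^sup>2) * cnj (I k) * G \<sigma> k) \<le> Z * B" if "\<sigma> \<in> {a..b}" for \<sigma>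
    proof -
      have "norm (\<Sum>k\<in>F. of_real ((weight s k)\<^sup>2) * cnj (I k) * G \<sigma> k) \<le>
            (\<Sum>k\<in>F. \<bar>weight s k * norm (I k)\<bar> * \<bar>weight s k * norm (G \<sigma> k)\<bar>)"
        by (rule order_trans [OF norm_sum])
          (auto intro!: sum_mono simp: norm_mult norm_power power2_eq_square algebra_simps)
      also have "\<dots> \<le> Z * L2_set (\<lambda>k. weight s k * norm (G \<sigma> k)) F"
        unfolding Z_def by (rule L2_set_mult_ineq)
      also have "\<dots> \<le> Z * B"
        using G [OF that] F by (intro mult_left_mono Z0) (auto simp: hbound_def)
      finally show ?thesis .
    qed
    then show ?thesis
      using has_integral_bound [OF _ hi [folded cbox_interval], of "Z * B"] Z0 B ab
      by simp
  qed
  finally have "Z * Z \<le> Z * (B * (b - a))" by (simp add: power2_eq_square)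
  then have "Z \<le> (b - a) * B"
    using Z0 B ab by (cases "Z = 0") (auto simp: mult.commute)
  then show "L2_set (\<lambda>k. weight s k * norm (integral {a..b} (\<lambda>\<sigma>. G \<sigma> k))) F \<le> (b - a) * B"
    by (simp add: Z_def I_def)
qed

section \<open>Bounds on finite sums and Sobolev norms of functions\<close>

lemma hbound_summable:
  assumes "hbound s a B"
  shows "(\<lambda>k. (1 + freq_norm_sq k) powr s * (norm (a k))\<^sup>2) summable_on UNIV"
    and "sqrt (\<Sum>\<^sub>\<infinity>k. (1 + freq_norm_sq k) powr s * (norm (a k))\<^sup>2) \<le> B"
proof -
  have B: "B \<ge> 0" by (rule hbound_nonneg [OF assms])
  have *: "(\<Sum>k\<in>F. (1 + freq_norm_sq k) powr s * (norm (a k))\<^sup>2) \<le> B\<^sup>2" if "finite F" for F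
  proof -
    have "sqrt (\<Sum>k\<in>F. (1 + freq_norm_sq k) powr s * (norm (a k))\<^sup>2) \<le> B"
      using assms that by (auto simp: hbound_def L2_set_def power_mult_distrib weight_sq)
    then show ?thesis using sqrt_le_D by blast
  qed
  show sm: "(\<lambda>k. (1 + freq_norm_sq k) powr s * (norm (a k))\<^sup>2) summable_on UNIV"
    by (rule nonneg_bdd_above_summable_on) (auto simp: bdd_above_def intro!: exI [of _ "B\<^sup>2"] *)
  have "(\<Sum>\<^sub>\<infinity>k. (1 + freq_norm_sq k) powr s * (norm (a k))\<^sup>2) \<le> B\<^sup>2"
    by (rule infsum_le_finite_sums [OF sm]) (rule *)
  then show "sqrt (\<Sum>\<^sub>\<infinity>k. (1 + freq_norm_sq k) powr s * (norm (a k))\<^sup>2) \<le> B"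
    using B by (simp add: real_le_lsqrt infsum_nonneg)
qed

lemma hboundI_summable:
  assumes "(\<lambda>k. (1 + freq_norm_sq k) powr s * (norm (a k))\<^sup>2) summable_on UNIV"
  shows "hbound s a (sqrt (\<Sum>\<^sub>\<infinity>k. (1 + freq_norm_sq k) powr s * (norm (a k))\<^sup>2))"
  unfolding hbound_def L2_set_def power_mult_distrib weight_sq
  by (intro allI impI real_sqrt_le_mono finite_sum_le_infsum assms) auto

lemma sobolev_hbound: "u \<in> sobolev s \<Longrightarrow> hbound s (fourier_coeff u) (sobolev_norm s u)"
  by (simp add: sobolev_def sobolev_norm_def hboundI_summable)

lemma sobolevI_hbound: "u \<in> L2_torus \<Longrightarrow> hbound s (fourier_coeff u) B \<Longrightarrow> u \<in> sobolev s"
  by (simp add: sobolev_def hbound_summable)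

lemma sobolev_norm_le: "hbound s (fourier_coeff u) B \<Longrightarrow> sobolev_norm s u \<le> B"
  by (simp add: sobolev_norm_def hbound_summable)

section \<open>Summability of the coefficients for s > d/2\<close>

lemma summable_nat_weight:
  assumes "s > 1 / 2" shows "summable (\<lambda>n. (1 + (real n)\<^sup>2) powr (- s))"
proof (rule summable_comparison_test')
  show "summable (\<lambda>n. real n powr (- 2 * s))"
    using assms by (simp add: summable_real_powr_iff)
  fix n :: nat assume n: "n \<ge> 1"
  have "(1 + (real n)\<^sup>2) powr (- s) \<le> ((real n)\<^sup>2) powr (- s)"
    using n assms by (intro powr_mono2') auto
  also have "\<dots> = real n powr (- 2 * s)"
    using n powr_powr [of "real n" 2 "- s"] by simp
  finally show "norm ((1 + (real n)\<^sup>2) powr (- s)) \<le> real n powr (- 2 * s)" by simp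
qed

lemma finite_int_weight_bound:
  assumes "s > 1 / 2"
  shows "\<exists>S. \<forall>N :: nat. (\<Sum>m\<in>{- int N..int N}. (1 + (real_of_int m)\<^sup>2) powr (- s)) \<le> S"
proof -
  let ?f = "\<lambda>n. (1 + (real n)\<^sup>2) powr (- s)"
  let ?g = "\<lambda>m. (1 + (real_of_int m)\<^sup>2) powr (- s)"
  have "(\<Sum>m\<in>{- int N..int N}. ?g m) \<le> 2 * suminf ?f" for N
  proof -
    have "{- int N..int N} = int ` {..N} \<union> (\<lambda>n. - int n) ` {1..N}"
    proof (intro set_eqI iffI)
      fix m assume m: "m \<in> {- int N..int N}"
      show "m \<in> int ` {..N} \<union> (\<lambda>n. - int n) ` {1..N}"
      proof (cases "m \<ge> 0")
        case True
        then have "m = int (nat m)" "nat m \<le> N" using m by auto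
        then show ?thesis by blast
      next
        case False
        then have "m = - int (nat (- m))" "nat (- m) \<in> {1..N}" using m by auto
        then show ?thesis by blast
      qed
    qed auto
    then have "(\<Sum>m\<in>{- int N..int N}. ?g m) \<le> (\<Sum>m\<in>int ` {..N}. ?g m) + (\<Sum>m\<in>(\<lambda>n. - int n) ` {1..N}. ?g m)"
      using sum_Un2 [of "int ` {..N}" "(\<lambda>n. - int n) ` {1..N}" ?g] 
      by (simp add: sum_Un sum_nonneg)
    also have "\<dots> = sum ?f {..N} + sum ?f {1..N}"
      by (simp add: sum.reindex inj_on_def)
    also have "\<dots> \<le> suminf ?f + suminf ?f"
      by (intro add_mono sum_le_suminf summable_nat_weight assms) auto
    finally show ?thesis by simp
  qed
  then show ?thesis by blast
qed

text \<open>The weight (1 + |k|^2)^(-s) is a product of d equal factors with exponent -s/d. Keeping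
  a single coordinate in each factor bounds the sum by a product of one-dimensional sums, which
  converge because s/d > 1/2.\<close>

lemma weight_summable:
  assumes s: "s > real CARD('d) / 2"
  shows "(\<lambda>k :: int ^ 'd::finite. (weight (- s) k)\<^sup>2) summable_on UNIV"
proof -
  define d where "d = real CARD('d)"
  have d: "d > 0" by (simp add: d_def)
  have sd: "s / d > 1 / 2" "s > 0" using s d by (auto simp: d_def field_simps)
  obtain S where S: "\<And>N :: nat. (\<Sum>m\<in>{- int N..int N}. (1 + (real_of_int m)\<^sup>2) powr (- (s / d))) \<le> S"
    using finite_int_weight_bound [OF sd(1)] by blast
  have le: "(weight (- s) k)\<^sup>2 \<le> (\<Prod>i\<in>UNIV. (1 + (real_of_int (k $ i))\<^sup>2) powr (- (s / d)))" for k :: "int ^ 'd"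
  proof -
    have "(\<Prod>i\<in>(UNIV :: 'd set). (1 + freq_norm_sq k) powr (- (s / d))) \<le>
          (\<Prod>i\<in>UNIV. (1 + (real_of_int (k $ i))\<^sup>2) powr (- (s / d)))"
    proof (rule prod_mono, intro conjI)
      fix i :: 'd
      have "(real_of_int (k $ i))\<^sup>2 \<le> freq_norm_sq k"
        unfolding freq_norm_sq_def by (rule member_le_sum) auto
      then show "(1 + freq_norm_sq k) powr (- (s / d)) \<le> (1 + (real_of_int (k $ i))\<^sup>2) powr (- (s / d))"
        using sd d by (intro powr_mono2') (auto intro: add_pos_nonneg)
    qed simp
    also have "(\<Prod>i\<in>(UNIV :: 'd set). (1 + freq_norm_sq k) powr (- (s / d))) = (weight (- s) k)\<^sup>2"
      using d freq_norm_sq_pos [of k]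
      by (simp add: weight_sq d_def powr_powr flip: powr_realpow) 
    finally show ?thesis .
  qed
  have "(\<Sum>k\<in>F. (weight (- s) k)\<^sup>2) \<le> S ^ CARD('d)" if F: "finite F" for F :: "(int ^ 'd) set"
  proof -
    \<comment> \<open>A finite set of frequencies lies in a cube, and the sum over a cube factors
      into one-dimensional sums.\<close>
    define N where "N = Max (insert 0 ((\<lambda>(k, i). nat \<bar>k $ i\<bar>) ` (F \<times> UNIV)))"
    have N: "k $ i \<in> {- int N..int N}" if "k \<in> F" for k i
    proof -
      have "nat \<bar>k $ i\<bar> \<le> N" unfolding N_def by (rule Max_ge) (use F that in force)+
      then show ?thesis by auto
    qed
    let ?h = "\<lambda>m. (1 + (real_of_int m)\<^sup>2) powr (- (s / d))"
    have "(\<Sum>k\<in>F. (weight (- s) k)\<^sup>2) \<le> (\<Sum>k\<in>F. \<Prod>i\<in>UNIV. ?h (k $ i))"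
      by (rule sum_mono [OF le])
    also have "\<dots> = (\<Sum>f\<in>vec_nth ` F. \<Prod>i\<in>UNIV. ?h (f i))"
      by (subst sum.reindex) (auto simp: inj_on_def vec_eq_iff)
    also have "\<dots> \<le> (\<Sum>f\<in>PiE (UNIV :: 'd set) (\<lambda>_. {- int N..int N}). \<Prod>i\<in>UNIV. ?h (f i))"
        by (rule sum_mono2) (use N in \<open>auto intro!: finite_PiE prod_nonneg\<close>)
    also have "\<dots> = (\<Prod>i\<in>(UNIV :: 'd set). \<Sum>m\<in>{- int N..int N}. ?h m)"
      by (rule prod_sum_PiE [symmetric]) auto
    also have "\<dots> \<le> S ^ CARD('d)"
      using S [of N] by (simp add: power_mono sum_nonneg)
    finally show ?thesis .
  qed
  then show ?thesis
    by (intro nonneg_bdd_above_summable_on) (auto simp: bdd_above_def)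
qed

text \<open>The constant of the embedding of H^s into the absolutely summable sequences, as
  Cauchy-Schwarz gives it.\<close>

definition sob_const :: "'d::finite itself \<Rightarrow> real \<Rightarrow> real" where
  "sob_const _ s = sqrt (\<Sum>\<^sub>\<infinity>k :: int ^ 'd. (weight (- s) k)\<^sup>2)"

lemma sob_const_nonneg [simp]: "sob_const TYPE('d::finite) s \<ge> 0"
  by (simp add: sob_const_def infsum_nonneg)

lemma sum_weight_le:
  fixes F :: "(int ^ 'd::finite) set"
  assumes s: "s > real CARD('d) / 2" and F: "finite F"
    and q: "L2_set q F \<le> Q" and q0: "\<And>k. q k \<ge> 0"
  shows "(\<Sum>k\<in>F. weight (- s) k * q k) \<le> sob_const TYPE('d) s * Q"
proof -
  have "(\<Sum>k\<in>F. weight (- s) k * q k) = (\<Sum>k\<in>F. \<bar>weight (- s) k\<bar> * \<bar>q k\<bar>)"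
    by (simp add: q0)
  also have "\<dots> \<le> L2_set (weight (- s)) F * L2_set q F" by (rule L2_set_mult_ineq)
  also have "\<dots> \<le> sob_const TYPE('d) s * Q"
  proof (rule mult_mono [OF _ q])
    show "L2_set (weight (- s)) F \<le> sob_const TYPE('d) s"
      unfolding L2_set_def sob_const_def
      by (intro real_sqrt_le_mono finite_sum_le_infsum weight_summable s F) auto
  qed auto
  finally show ?thesis .
qed

lemma hbound_l1:
  fixes a :: "int ^ 'd::finite \<Rightarrow> complex"
  assumes s: "s > real CARD('d) / 2" and a: "hbound s a B"
  shows "l1_bound a (sob_const TYPE('d) s * B)"
  unfolding l1_bound_def
proof (intro allI impI)
  fix F :: "(int ^ 'd) set" assume F: "finite F"
  have "(\<Sum>k\<in>F. norm (a k)) = (\<Sum>k\<in>F. weight (- s) k * (weight s k * norm (a k)))"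
    by (simp add: mult.assoc [symmetric] weight_add [symmetric])
  also have "\<dots> \<le> sob_const TYPE('d) s * B"
    using a F by (intro sum_weight_le [OF s F]) (auto simp: hbound_def)
  finally show "(\<Sum>k\<in>F. norm (a k)) \<le> sob_const TYPE('d) s * B" .
qed

section \<open>Products as convolutions\<close>

definition conv :: "(int ^ 'd \<Rightarrow> complex) \<Rightarrow> (int ^ 'd \<Rightarrow> complex) \<Rightarrow> int ^ 'd::finite \<Rightarrow> complex" where
  "conv a b k = (\<Sum>\<^sub>\<infinity>l. a l * b (k - l))"

text \<open>The Fourier coefficients of the complex conjugate of the function with coefficients
  \<open>a\<close>.\<close>

definition flat :: "(int ^ 'd \<Rightarrow> complex) \<Rightarrow> int ^ 'd::finite \<Rightarrow> complex" where
  "flat a k = cnj (a (- k))"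

lemma bij_minus: "bij (\<lambda>l :: int ^ 'd::finite. k - l)"
  by (rule bij_betw_byWitness [where f' = "\<lambda>l. k - l"]) auto

lemma infsum_reflect: "(\<Sum>\<^sub>\<infinity>l. f (k - l)) = (\<Sum>\<^sub>\<infinity>l. f l)"
  for k :: "int ^ 'd::finite"
  using infsum_reindex_bij_betw [OF bij_minus, of f k] by simp

lemma summable_reflect: "f summable_on UNIV \<Longrightarrow> (\<lambda>l. f (k - l)) summable_on UNIV"
  for k :: "int ^ 'd::finite"
  using summable_on_reindex_bij_betw [OF bij_minus, of f k] by simp

lemma conv_commute: "conv a b k = conv b a k"
  using infsum_reflect [of "\<lambda>l. a l * b (k - l)" k] by (simp add: conv_def mult.commute)

lemma young_summable:
  fixes p q :: "int ^ 'd::finite \<Rightarrow> real"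
  assumes p: "\<And>F. finite F \<Longrightarrow> sum p F \<le> P" "\<And>k. p k \<ge> 0"
    and q: "\<And>F. finite F \<Longrightarrow> L2_set q F \<le> Q" "\<And>k. q k \<ge> 0"
  shows "(\<lambda>l. p l * q (k - l)) summable_on UNIV"
proof (rule nonneg_bdd_above_summable_on)
  have qQ: "q k \<le> Q" for k using q(1) [of "{k}"] by (simp add: abs_of_nonneg q(2))
  have Q: "Q \<ge> 0" using q(1) [of "{}"] by simp
  have "(\<Sum>l\<in>F. p l * q (k - l)) \<le> P * Q" if "finite F" for F
  proof -
    have "(\<Sum>l\<in>F. p l * q (k - l)) \<le> (\<Sum>l\<in>F. p l * Q)"
      by (intro sum_mono mult_left_mono qQ p)
    also have "\<dots> \<le> P * Q" using p(1) [OF that] Q by (simp add: sum_distrib_right [symmetric] mult_right_mono)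
    finally show ?thesis .
  qed
  then show "bdd_above (sum (\<lambda>l. p l * q (k - l)) ` {F. F \<subseteq> UNIV \<and> finite F})"
    by (auto simp: bdd_above_def)
qed (simp add: p q)

text \<open>Young's inequality, via Minkowski: a convolution is a superposition of translates.\<close>

lemma young:
  fixes p q :: "int ^ 'd::finite \<Rightarrow> real"
  assumes p: "\<And>F. finite F \<Longrightarrow> sum p F \<le> P" "\<And>k. p k \<ge> 0"
    and q: "\<And>F. finite F \<Longrightarrow> L2_set q F \<le> Q" "\<And>k. q k \<ge> 0"
    and F: "finite F"
  shows "L2_set (\<lambda>k. \<Sum>\<^sub>\<infinity>l. p l * q (k - l)) F \<le> P * Q"
proof -
  have Q: "Q \<ge> 0" using q(1) [of "{}"] by simp
  have lim: "((\<lambda>G. \<Sum>l\<in>G. p l * q (k - l)) \<longlongrightarrow> (\<Sum>\<^sub>\<infinity>l. p l * q (k - l))) (finite_subsets_at_top UNIV)" for k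
    by (rule infsum_tendsto [OF young_summable [OF p q]])
  have "((\<lambda>G. L2_set (\<lambda>k. \<Sum>l\<in>G. p l * q (k - l)) F) \<longlongrightarrow> L2_set (\<lambda>k. \<Sum>\<^sub>\<infinity>l. p l * q (k - l)) F) (finite_subsets_at_top UNIV)"
    unfolding L2_set_def by (intro tendsto_intros lim)
  moreover have "\<forall>\<^sub>F G in finite_subsets_at_top UNIV. L2_set (\<lambda>k. \<Sum>l\<in>G. p l * q (k - l)) F \<le> P * Q"
  proof (rule eventually_finite_subsets_at_top_weakI)
    fix G :: "(int ^ 'd) set" assume G: "finite G"
    have tr: "L2_set (\<lambda>k. q (k - l)) F \<le> Q" for l
    proof -
      have "L2_set (\<lambda>k. q (k - l)) F = L2_set q ((\<lambda>k. k - l) ` F)"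
        unfolding L2_set_def by (subst sum.reindex) (auto simp: inj_on_def)
      then show ?thesis using q(1) F by simp
    qed
    have "L2_set (\<lambda>k. \<Sum>l\<in>G. p l * q (k - l)) F \<le> (\<Sum>l\<in>G. L2_set (\<lambda>k. p l * q (k - l)) F)"
      by (rule L2_set_sum_le [OF G])
    also have "\<dots> \<le> (\<Sum>l\<in>G. p l * Q)"
      unfolding L2_set_cmult by (intro sum_mono mult_mono tr) (auto simp: p)
    also have "\<dots> \<le> P * Q" using p(1) [OF G] Q by (simp add: sum_distrib_right [symmetric] mult_right_mono)
    finally show "L2_set (\<lambda>k. \<Sum>l\<in>G. p l * q (k - l)) F \<le> P * Q" .
  qed
  ultimately show ?thesis by (rule tendsto_upperbound) simp
qed

lemma conv_abs_summable:
  assumes "hbound 0 a A" "hbound 0 b B"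
  shows "(\<lambda>l. norm (a l) * norm (b (k - l))) summable_on UNIV"
proof (rule nonneg_bdd_above_summable_on)
  have "(\<Sum>l\<in>F. norm (a l) * norm (b (k - l))) \<le> A * B" if F: "finite F" for F
  proof -
    have "(\<Sum>l\<in>F. norm (a l) * norm (b (k - l))) \<le> L2_set (\<lambda>l. norm (a l)) F * L2_set (\<lambda>l. norm (b (k - l))) F"
      using L2_set_mult_ineq [of "\<lambda>l. norm (a l)" "\<lambda>l. norm (b (k - l))" F] by simp
    also have "L2_set (\<lambda>l. norm (b (k - l))) F = L2_set (\<lambda>l. norm (b l)) ((\<lambda>l. k - l) ` F)"
      unfolding L2_set_def by (subst sum.reindex) (auto simp: inj_on_def)
    also have "L2_set (\<lambda>l. norm (a l)) F * L2_set (\<lambda>l. norm (b l)) ((\<lambda>l. k - l) ` F) \<le> A * B"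
      using assms F hbound_nonneg [OF assms(1)] by (intro mult_mono) (auto simp: hbound_def)
    finally show ?thesis .
  qed
  then show "bdd_above (sum (\<lambda>l. norm (a l) * norm (b (k - l))) ` {F. F \<subseteq> UNIV \<and> finite F})"
    by (auto simp: bdd_above_def)
qed simp

lemma conv_summable:
  assumes "hbound 0 a A" "hbound 0 b B"
  shows "(\<lambda>l. a l * b (k - l)) summable_on UNIV"
  by (rule abs_summable_summable) (simp add: norm_mult conv_abs_summable [OF assms])

text \<open>The last hypothesis distributes the weight at frequency k over two products, each with
  one absolutely summable and one square summable factor, and Young's inequality applies to both.
  The product estimates below differ only in the choice of these factors.\<close>

lemma hbound_conv_split:
  fixes a b :: "int ^ 'd::finite \<Rightarrow> complex"
  assumes ab: "hbound 0 a A" "hbound 0 b B"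
    and p: "\<And>F. finite F \<Longrightarrow> sum p F \<le> P" "\<And>k. p k \<ge> 0"
    and q: "\<And>F. finite F \<Longrightarrow> L2_set q F \<le> Q" "\<And>k. q k \<ge> 0"
    and p': "\<And>F. finite F \<Longrightarrow> sum p' F \<le> P'" "\<And>k. p' k \<ge> 0"
    and q': "\<And>F. finite F \<Longrightarrow> L2_set q' F \<le> Q'" "\<And>k. q' k \<ge> 0"
    and c: "c \<ge> 0"
    and le: "\<And>k l. weight s k * (norm (a l) * norm (b (k - l))) \<le> c * (p l * q (k - l) + q' l * p' (k - l))"
  shows "hbound s (conv a b) (c * (P * Q + P' * Q'))"
  unfolding hbound_def
proof (intro allI impI)
  fix F :: "(int ^ 'd) set" assume F: "finite F"
  have s1: "(\<lambda>l. p l * q (k - l)) summable_on UNIV" for k by (rule young_summable [OF p q])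
  have s2: "(\<lambda>l. q' l * p' (k - l)) summable_on UNIV" for k
    using summable_reflect [OF young_summable [OF p' q', of k], of k] by (simp add: mult.commute)
  have i2: "(\<Sum>\<^sub>\<infinity>l. q' l * p' (k - l)) = (\<Sum>\<^sub>\<infinity>l. p' l * q' (k - l))" for k
    using infsum_reflect [of "\<lambda>l. q' l * p' (k - l)" k] by (simp add: mult.commute)
  have pt: "weight s k * norm (conv a b k) \<le>
      c * ((\<Sum>\<^sub>\<infinity>l. p l * q (k - l)) + (\<Sum>\<^sub>\<infinity>l. p' l * q' (k - l)))" for k
  proof -
    have "weight s k * norm (conv a b k) \<le> weight s k * (\<Sum>\<^sub>\<infinity>l. norm (a l) * norm (b (k - l)))"
      unfolding conv_def
      using norm_infsum_bound [of "\<lambda>l. a l * b (k - l)" UNIV] conv_abs_summable [OF ab]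
      by (intro mult_left_mono) (auto simp: norm_mult)
    also have "\<dots> = (\<Sum>\<^sub>\<infinity>l. weight s k * (norm (a l) * norm (b (k - l))))"
      by (rule infsum_cmult_right' [symmetric])
    also have "\<dots> \<le> (\<Sum>\<^sub>\<infinity>l. c * (p l * q (k - l) + q' l * p' (k - l)))"
      by (intro infsum_mono le summable_on_cmult_right conv_abs_summable [OF ab] summable_on_add s1 s2)
    also have "\<dots> = c * ((\<Sum>\<^sub>\<infinity>l. p l * q (k - l)) + (\<Sum>\<^sub>\<infinity>l. q' l * p' (k - l)))"
      by (simp add: infsum_cmult_right' infsum_add s1 s2)
    finally show ?thesis by (simp only: i2)
  qed
  have "L2_set (\<lambda>k. weight s k * norm (conv a b k)) F \<le>
        L2_set (\<lambda>k. c * ((\<Sum>\<^sub>\<infinity>l. p l * q (k - l)) + (\<Sum>\<^sub>\<infinity>l. p' l * q' (k - l)))) F"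
    by (rule L2_set_mono [OF pt]) simp
  also have "\<dots> = c * L2_set (\<lambda>k. (\<Sum>\<^sub>\<infinity>l. p l * q (k - l)) + (\<Sum>\<^sub>\<infinity>l. p' l * q' (k - l))) F"
    using c by (simp only: L2_set_cmult abs_of_nonneg)
  also have "\<dots> \<le> c * (L2_set (\<lambda>k. \<Sum>\<^sub>\<infinity>l. p l * q (k - l)) F + L2_set (\<lambda>k. \<Sum>\<^sub>\<infinity>l. p' l * q' (k - l)) F)"
    by (intro mult_left_mono L2_set_triangle_ineq c)
  also have "\<dots> \<le> c * (P * Q + P' * Q')"
    by (intro mult_left_mono add_mono young [OF p q F] young [OF p' q' F] c)
  finally show "L2_set (\<lambda>k. weight s k * norm (conv a b k)) F \<le> c * (P * Q + P' * Q')" .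
qed

section \<open>Product estimates in the weighted spaces\<close>

lemma freq_norm_sq_split: "1 + freq_norm_sq k \<le> 4 * max (1 + freq_norm_sq l) (1 + freq_norm_sq (k - l))"
proof -
  have "(real_of_int (k $ i))\<^sup>2 \<le> 2 * (real_of_int (l $ i))\<^sup>2 + 2 * (real_of_int ((k - l) $ i))\<^sup>2" for i
  proof -
    have "(x + y)\<^sup>2 \<le> 2 * x\<^sup>2 + 2 * y\<^sup>2" for x y :: real
      using zero_le_power2 [of "x - y"] by (simp add: power2_eq_square algebra_simps)
    from this [of "real_of_int (l $ i)" "real_of_int ((k - l) $ i)"] show ?thesis by simp
  qed
  then have "freq_norm_sq k \<le> 2 * freq_norm_sq l + 2 * freq_norm_sq (k - l)"
    unfolding freq_norm_sq_def sum_distrib_left sum.distrib [symmetric] by (intro sum_mono)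
  then show ?thesis by (auto simp: max_def)
qed

lemma weight_split:
  assumes "s \<ge> 0" shows "weight s k \<le> 2 powr s * max (weight s l) (weight s (k - l))"
proof -
  have "weight s k \<le> (4 * max (1 + freq_norm_sq l) (1 + freq_norm_sq (k - l))) powr (s / 2)"
    unfolding weight_def using assms freq_norm_sq_split
    by (intro powr_mono2) (auto intro: less_imp_le)
  also have "\<dots> = 4 powr (s / 2) * max (1 + freq_norm_sq l) (1 + freq_norm_sq (k - l)) powr (s / 2)"
    by (rule powr_mult)
  also have "4 powr (s / 2) = (2 powr 2) powr (s / 2)" by simp
  also have "\<dots> = 2 powr s" by (simp only: powr_powr) simp
  also have "max (1 + freq_norm_sq l) (1 + freq_norm_sq (k - l)) powr (s / 2) \<le> max (weight s l) (weight s (k - l))"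
    by (auto simp: weight_def max_def)
  finally show ?thesis by simp
qed

text \<open>A factor 2^\<sigma> comes from splitting the weight, one more factor 2 from the two
  summands of \<open>hbound_conv_split\<close>.\<close>

definition prod_const :: "'d::finite itself \<Rightarrow> real \<Rightarrow> real" where
  "prod_const d \<sigma> = 2 powr (\<sigma> + 1) * sob_const d \<sigma>"

lemma prod_const_nonneg [simp]: "prod_const TYPE('d::finite) s \<ge> 0"
  by (simp add: prod_const_def)

text \<open>For \<open>\<beta> < d/2\<close> the factor \<open>b\<close> need not have summable coefficients, so the excess regularity of
  \<open>a\<close> is shifted to \<open>b\<close> where the frequency of \<open>a\<close> dominates.\<close>

lemma hbound_conv:
  fixes a b :: "int ^ 'd::finite \<Rightarrow> complex"
  assumes \<sigma>: "\<sigma> > real CARD('d) / 2" and \<beta>: "0 \<le> \<beta>" "\<beta> \<le> \<sigma>"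
    and a: "hbound \<sigma> a A" and b: "hbound \<beta> b B"
  shows "hbound \<beta> (conv a b) (prod_const TYPE('d) \<sigma> * A * B)"
proof -
  define S where "S = sob_const TYPE('d) \<sigma>"
  have AB: "A \<ge> 0" "B \<ge> 0" using a b by (auto intro: hbound_nonneg)
  have w: "weight (\<beta> - \<sigma>) k = weight (- \<sigma>) k * weight \<beta> k" for k :: "int ^ 'd"
    by (simp add: weight_add [symmetric])
  have "hbound \<beta> (conv a b) (2 powr \<beta> * ((S * A) * B + (S * B) * A))"
  proof (rule hbound_conv_split)
    show "hbound 0 a A" "hbound 0 b B" using hbound_weaken [OF a] hbound_weaken [OF b] \<beta> by auto
    show "(\<Sum>k\<in>F. norm (a k)) \<le> S * A" if "finite F" for F
      using hbound_l1 [OF \<sigma> a] that by (auto simp: l1_bound_def S_def)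
    show "L2_set (\<lambda>k. weight \<beta> k * norm (b k)) F \<le> B" if "finite F" for F
      using b that by (auto simp: hbound_def)
    show "L2_set (\<lambda>k. weight \<sigma> k * norm (a k)) F \<le> A" if "finite F" for F
      using a that by (auto simp: hbound_def)
    show "(\<Sum>k\<in>F. weight (- \<sigma>) k * (weight \<beta> k * norm (b k))) \<le> S * B" if "finite F" for F
      unfolding S_def using b that by (intro sum_weight_le \<sigma>) (auto simp: hbound_def)
    fix k l :: "int ^ 'd"
    have "weight \<beta> k * (norm (a l) * norm (b (k - l))) \<le>
          2 powr \<beta> * max (weight \<beta> l) (weight \<beta> (k - l)) * (norm (a l) * norm (b (k - l)))"
      by (intro mult_right_mono weight_split \<beta>) auto
    also have "\<dots> \<le> 2 powr \<beta> * (norm (a l) * (weight \<beta> (k - l) * norm (b (k - l))) +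
               weight \<sigma> l * norm (a l) * (weight (- \<sigma>) (k - l) * (weight \<beta> (k - l) * norm (b (k - l)))))"
    proof -
      \<comment> \<open>If l is the larger frequency, then \<beta> - \<sigma> \<le> 0 allows
        \<open>weight (\<beta> - \<sigma>)\<close> to be moved from l to k - l. By \<open>w\<close>
        the factor at k - l becomes \<open>weight (- \<sigma>)\<close> times a square summable
        sequence, which is absolutely summable.\<close>
      have "max (weight \<beta> l) (weight \<beta> (k - l)) \<le> weight \<beta> (k - l) + weight \<sigma> l * weight (\<beta> - \<sigma>) (k - l)"
      proof (cases "freq_norm_sq l \<le> freq_norm_sq (k - l)")
        case True
        then have "weight \<beta> l \<le> weight \<beta> (k - l)"
          unfolding weight_def using \<beta> by (intro powr_mono2) auto
        then show ?thesis by (simp add: max_def)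
      next
        case False
        have "weight (\<beta> - \<sigma>) l \<le> weight (\<beta> - \<sigma>) (k - l)"
          unfolding weight_def using \<beta> False by (intro powr_mono2') (auto intro: add_pos_nonneg)
        then have "weight \<sigma> l * weight (\<beta> - \<sigma>) l \<le> weight \<sigma> l * weight (\<beta> - \<sigma>) (k - l)"
          by (intro mult_left_mono) auto
        moreover have "weight \<sigma> l * weight (\<beta> - \<sigma>) l = weight \<beta> l"
          by (simp add: weight_add [symmetric])
        moreover have "0 \<le> weight \<sigma> l * weight (\<beta> - \<sigma>) (k - l)" by simp
        moreover have "0 \<le> weight \<beta> (k - l)" by simp
        ultimately show ?thesis unfolding max.bounded_iff by linarith
      qed
      then have "max (weight \<beta> l) (weight \<beta> (k - l)) * (norm (a l) * norm (b (k - l))) \<le>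
          (weight \<beta> (k - l) + weight \<sigma> l * weight (\<beta> - \<sigma>) (k - l)) * (norm (a l) * norm (b (k - l)))"
        by (intro mult_right_mono) auto
      then show ?thesis
        unfolding w mult.assoc by (intro mult_left_mono) (auto simp: algebra_simps)
    qed
    finally show "weight \<beta> k * (norm (a l) * norm (b (k - l))) \<le>
        2 powr \<beta> * (norm (a l) * (weight \<beta> (k - l) * norm (b (k - l))) +
               weight \<sigma> l * norm (a l) * (weight (- \<sigma>) (k - l) * (weight \<beta> (k - l) * norm (b (k - l)))))" .
  qed auto
  moreover have "2 powr \<beta> * ((S * A) * B + (S * B) * A) \<le> prod_const TYPE('d) \<sigma> * A * B"
  proof -
    have "2 powr \<beta> * ((S * A) * B + (S * B) * A) = 2 powr (\<beta> + 1) * S * A * B"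
      by (simp add: powr_add algebra_simps)
    also have "\<dots> \<le> 2 powr (\<sigma> + 1) * S * A * B"
      using \<beta> AB by (intro mult_right_mono) (auto simp: S_def)
    finally show ?thesis by (simp add: prod_const_def S_def)
  qed
  ultimately show ?thesis by (rule hbound_le)
qed

lemma hbound_conv':
  fixes a b :: "int ^ 'd::finite \<Rightarrow> complex"
  assumes \<sigma>: "\<sigma> > real CARD('d) / 2" and \<beta>: "0 \<le> \<beta>" "\<beta> \<le> \<sigma>"
    and a: "hbound \<beta> a A" and b: "hbound \<sigma> b B"
  shows "hbound \<beta> (conv a b) (prod_const TYPE('d) \<sigma> * A * B)"
proof -
  have "conv b a = conv a b" by (rule ext) (rule conv_commute)
  then show ?thesis using hbound_conv [OF \<sigma> \<beta> b a] by (simp add: ac_simps)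
qed

definition tame_const :: "'d::finite itself \<Rightarrow> real \<Rightarrow> real \<Rightarrow> real" where
  "tame_const d s \<sigma> = 2 powr s * sob_const d \<sigma>"

lemma tame_const_nonneg [simp]: "tame_const TYPE('d::finite) s \<sigma> \<ge> 0"
  by (simp add: tame_const_def)

text \<open>Each term carries the high norm of one factor only, multiplied by the low norm of the
  other. Powers of a function therefore grow linearly in the high norm, at a rate set by the low
  norm.\<close>

lemma hbound_conv_tame:
  fixes a b :: "int ^ 'd::finite \<Rightarrow> complex"
  assumes \<sigma>: "\<sigma> > real CARD('d) / 2" and s: "s \<ge> \<sigma>"
    and a: "hbound s a A" "hbound \<sigma> a A'" and b: "hbound s b B" "hbound \<sigma> b B'"
  shows "hbound s (conv a b) (tame_const TYPE('d) s \<sigma> * (A' * B + B' * A))"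
proof -
  define S where "S = sob_const TYPE('d) \<sigma>"
  have s0: "s \<ge> 0" using \<sigma> s by (smt (verit) divide_nonneg_nonneg of_nat_0_le_iff)
  have "hbound s (conv a b) (2 powr s * ((S * A') * B + (S * B') * A))"
  proof (rule hbound_conv_split)
    show "hbound 0 a A" "hbound 0 b B" using hbound_weaken [OF a(1)] hbound_weaken [OF b(1)] s0 by auto
    show "(\<Sum>k\<in>F. norm (a k)) \<le> S * A'" if "finite F" for F
      using hbound_l1 [OF \<sigma> a(2)] that by (auto simp: l1_bound_def S_def)
    show "(\<Sum>k\<in>F. norm (b k)) \<le> S * B'" if "finite F" for F
      using hbound_l1 [OF \<sigma> b(2)] that by (auto simp: l1_bound_def S_def)
    show "L2_set (\<lambda>k. weight s k * norm (a k)) F \<le> A" if "finite F" for F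
      using a that by (auto simp: hbound_def)
    show "L2_set (\<lambda>k. weight s k * norm (b k)) F \<le> B" if "finite F" for F
      using b that by (auto simp: hbound_def)
    fix k l :: "int ^ 'd"
    have "weight s k * (norm (a l) * norm (b (k - l))) \<le>
          2 powr s * max (weight s l) (weight s (k - l)) * (norm (a l) * norm (b (k - l)))"
      by (intro mult_right_mono weight_split s0) auto
    also have "\<dots> \<le> 2 powr s * (weight s l + weight s (k - l)) * (norm (a l) * norm (b (k - l)))"
      by (intro mult_right_mono mult_left_mono) (auto simp: max_def)
    finally show "weight s k * (norm (a l) * norm (b (k - l))) \<le>
        2 powr s * (norm (a l) * (weight s (k - l) * norm (b (k - l))) + weight s l * norm (a l) * norm (b (k - l)))"
      by (simp add: algebra_simps)
  qed auto
  then show ?thesis by (simp add: tame_const_def S_def algebra_simps)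
qed

section \<open>Trilinear and cubic terms\<close>

lemma hbound_flat: "hbound s a A \<Longrightarrow> hbound s (flat a) A"
  unfolding hbound_def
proof (intro allI impI)
  fix F :: "(int ^ 'a) set"
  assume *: "\<forall>F. finite F \<longrightarrow> L2_set (\<lambda>k. weight s k * norm (a k)) F \<le> A" and F: "finite F"
  have "L2_set (\<lambda>k. weight s k * norm (flat a k)) F = L2_set (\<lambda>k. weight s k * norm (a k)) (uminus ` F)"
    unfolding L2_set_def by (subst sum.reindex) (auto simp: inj_on_def flat_def)
  then show "L2_set (\<lambda>k. weight s k * norm (flat a k)) F \<le> A" using * F by simp
qed

text \<open>Coefficients of the product u * cnj v * w of functions with coefficients
  \<open>a\<close>, \<open>b\<close>, \<open>c\<close>; three equal arguments give |u|^2 u.\<close>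

definition tri :: "(int ^ 'd \<Rightarrow> complex) \<Rightarrow> (int ^ 'd \<Rightarrow> complex) \<Rightarrow> (int ^ 'd \<Rightarrow> complex) \<Rightarrow> int ^ 'd::finite \<Rightarrow> complex" where
  "tri a b c = conv (conv a (flat b)) c"

definition cubic :: "real \<Rightarrow> (int ^ 'd \<Rightarrow> complex) \<Rightarrow> int ^ 'd::finite \<Rightarrow> complex" where
  "cubic lam a k = - \<i> * of_real lam * tri a a a k"

lemma infsum_minus:
  fixes f g :: "'a \<Rightarrow> complex"
  assumes "f summable_on A" "g summable_on A"
  shows "infsum (\<lambda>x. f x - g x) A = infsum f A - infsum g A"
  using infsum_add [OF assms(1), of "\<lambda>x. - g x"] assms(2) by (simp add: infsum_uminus summable_on_uminus)

lemma conv_diff_left: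
  assumes "hbound 0 a A" "hbound 0 a' A'" "hbound 0 b B"
  shows "conv (\<lambda>k. a k - a' k) b = (\<lambda>k. conv a b k - conv a' b k)"
  unfolding conv_def left_diff_distrib
  by (intro ext infsum_minus conv_summable [OF assms(1,3)] conv_summable [OF assms(2,3)])

lemma conv_diff_right:
  assumes "hbound 0 a A" "hbound 0 b B" "hbound 0 b' B'"
  shows "conv a (\<lambda>k. b k - b' k) = (\<lambda>k. conv a b k - conv a b' k)"
  unfolding conv_def right_diff_distrib
  by (intro ext infsum_minus conv_summable [OF assms(1,2)] conv_summable [OF assms(1,3)])

lemma conv_cmult: "conv (\<lambda>k. c * a k) b = (\<lambda>k. c * conv a b k)" "conv a (\<lambda>k. c * b k) = (\<lambda>k. c * conv a b k)"
  by (simp_all add: conv_def fun_eq_iff infsum_cmult_right' [symmetric] mult_ac)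

lemma flat_diff: "flat (\<lambda>k. a k - b k) = (\<lambda>k. flat a k - flat b k)"
  by (simp add: flat_def fun_eq_iff)

lemma flat_of_real: "flat (\<lambda>k. of_real r * a k) = (\<lambda>k. of_real r * flat a k)"
  by (simp add: flat_def fun_eq_iff)

text \<open>Only real scalars, because the second argument enters through its conjugate. The scalars
  pulled out later are real, such as \<open>\<tau>\<close> and \<open>h * g r\<close>.\<close>

lemma tri_of_real:
  "tri (\<lambda>k. of_real r * a k) b c = (\<lambda>k. of_real r * tri a b c k)"
  "tri a (\<lambda>k. of_real r * b k) c = (\<lambda>k. of_real r * tri a b c k)"
  "tri a b (\<lambda>k. of_real r * c k) = (\<lambda>k. of_real r * tri a b c k)"
  by (simp_all add: tri_def flat_of_real conv_cmult)

text \<open>Above d/2 the space is an algebra. The index is a locale parameter because the results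
  are used both for \<alpha> - 2 and for \<alpha>.\<close>

locale algebra_index =
  fixes D :: "'d::finite itself" and \<sigma> :: real
  assumes \<sigma>: "\<sigma> > real CARD('d) / 2"
begin

lemma \<sigma>_nonneg: "\<sigma> \<ge> 0"
  using \<sigma> by (smt (verit) divide_nonneg_nonneg of_nat_0_le_iff)

definition K where "K = (prod_const TYPE('d) \<sigma>)\<^sup>2"

lemma K_nonneg: "K \<ge> 0" by (simp add: K_def)

text \<open>One lemma for each position of the factor that is only in H^\<beta>. The other two
  factors supply the regularity that a product needs when \<beta> is below d/2.\<close>

lemma hbound_tri3:
  fixes a b c :: "int ^ 'd \<Rightarrow> complex"
  assumes "0 \<le> \<beta>" "\<beta> \<le> \<sigma>" "hbound \<sigma> a A" "hbound \<sigma> b B" "hbound \<beta> c C"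
  shows "hbound \<beta> (tri a b c) (K * A * B * C)"
  using hbound_conv [OF \<sigma> assms(1,2) hbound_conv [OF \<sigma> \<sigma>_nonneg order_refl assms(3) hbound_flat [OF assms(4)]] assms(5)]
  by (simp add: tri_def K_def power2_eq_square mult_ac)

lemma hbound_tri2:
  fixes a b c :: "int ^ 'd \<Rightarrow> complex"
  assumes "0 \<le> \<beta>" "\<beta> \<le> \<sigma>" "hbound \<sigma> a A" "hbound \<beta> b B" "hbound \<sigma> c C"
  shows "hbound \<beta> (tri a b c) (K * A * B * C)"
  using hbound_conv' [OF \<sigma> assms(1,2) hbound_conv [OF \<sigma> assms(1,2,3) hbound_flat [OF assms(4)]] assms(5)]
  by (simp add: tri_def K_def power2_eq_square mult_ac)

lemma hbound_tri1:
  fixes a b c :: "int ^ 'd \<Rightarrow> complex"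
  assumes "0 \<le> \<beta>" "\<beta> \<le> \<sigma>" "hbound \<beta> a A" "hbound \<sigma> b B" "hbound \<sigma> c C"
  shows "hbound \<beta> (tri a b c) (K * A * B * C)"
  using hbound_conv' [OF \<sigma> assms(1,2) hbound_conv' [OF \<sigma> assms(1,2,3) hbound_flat [OF assms(4)]] assms(5)]
  by (simp add: tri_def K_def power2_eq_square mult_ac)

lemma tri_diff:
  fixes a b c :: "int ^ 'd \<Rightarrow> complex"
  assumes "hbound \<sigma> a A" "hbound \<sigma> b B" "hbound \<sigma> c C"
    and "hbound \<sigma> a' A'" "hbound \<sigma> b' B'" "hbound \<sigma> c' C'"
  shows "tri a b c k - tri a' b' c' k =
    tri (\<lambda>k. a k - a' k) b c k + tri a' (\<lambda>k. b k - b' k) c k + tri a' b' (\<lambda>k. c k - c' k) k"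
proof -
  note z = hbound_weaken [OF _ \<sigma>_nonneg]
  note f = hbound_flat
  have cv: "hbound 0 (conv x y) (prod_const TYPE('d) \<sigma> * X * Y)" if "hbound \<sigma> x X" "hbound \<sigma> y Y" for x y :: "int ^ 'd \<Rightarrow> complex" and X Y
    by (rule z [OF hbound_conv [OF \<sigma> \<sigma>_nonneg order_refl that]])
  have "tri (\<lambda>k. a k - a' k) b c = (\<lambda>k. tri a b c k - tri a' b c k)"
    unfolding tri_def
    by (simp add: conv_diff_left [OF z [OF assms(1)] z [OF assms(4)] z [OF f [OF assms(2)]]]
        conv_diff_left [OF cv [OF assms(1) f [OF assms(2)]] cv [OF assms(4) f [OF assms(2)]] z [OF assms(3)]])
  moreover have "tri a' (\<lambda>k. b k - b' k) c = (\<lambda>k. tri a' b c k - tri a' b' c k)"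
    unfolding tri_def flat_diff
    by (simp add: conv_diff_right [OF z [OF assms(4)] z [OF f [OF assms(2)]] z [OF f [OF assms(5)]]]
        conv_diff_left [OF cv [OF assms(4) f [OF assms(2)]] cv [OF assms(4) f [OF assms(5)]] z [OF assms(3)]])
  moreover have "tri a' b' (\<lambda>k. c k - c' k) = (\<lambda>k. tri a' b' c k - tri a' b' c' k)"
    unfolding tri_def
    by (simp add: conv_diff_right [OF cv [OF assms(4) f [OF assms(5)]] z [OF assms(3)] z [OF assms(6)]])
  ultimately show ?thesis by simp
qed

lemma hbound_cubic:
  fixes a :: "int ^ 'd \<Rightarrow> complex"
  assumes "hbound \<sigma> a A" shows "hbound \<sigma> (cubic lam a) (\<bar>lam\<bar> * K * A ^ 3)"
  using hbound_cmult [OF hbound_tri3 [OF \<sigma>_nonneg order_refl assms assms assms], of "- \<i> * of_real lam"]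
  by (simp add: cubic_def [abs_def] power3_eq_cube norm_mult mult_ac)

lemma hbound_tri_diff:
  fixes a b c :: "int ^ 'd \<Rightarrow> complex"
  assumes \<beta>: "0 \<le> \<beta>" "\<beta> \<le> \<sigma>"
    and h: "hbound \<sigma> a r" "hbound \<sigma> b r" "hbound \<sigma> c r"
     "hbound \<sigma> a' r" "hbound \<sigma> b' r" "hbound \<sigma> c' r"
    and d: "hbound \<beta> (\<lambda>k. a k - a' k) X" "hbound \<beta> (\<lambda>k. b k - b' k) Y" "hbound \<beta> (\<lambda>k. c k - c' k) Z"
  shows "hbound \<beta> (\<lambda>k. tri a b c k - tri a' b' c' k) (K * r\<^sup>2 * (X + Y + Z))"
proof -
  have "hbound \<beta> (\<lambda>k. tri (\<lambda>k. a k - a' k) b c k + tri a' (\<lambda>k. b k - b' k) c k + tri a' b' (\<lambda>k. c k - c' k) k)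
     (K * X * r * r + K * r * Y * r + K * r * r * Z)"
    by (intro hbound_add hbound_tri1 hbound_tri2 hbound_tri3 \<beta> h d)
  then show ?thesis
    unfolding tri_diff [OF h] by (simp add: power2_eq_square algebra_simps)
qed

lemma hbound_cubic_diff:
  fixes a b :: "int ^ 'd \<Rightarrow> complex"
  assumes \<beta>: "0 \<le> \<beta>" "\<beta> \<le> \<sigma>"
    and h: "hbound \<sigma> a r" "hbound \<sigma> b r" and d: "hbound \<beta> (\<lambda>k. a k - b k) X"
  shows "hbound \<beta> (\<lambda>k. cubic lam a k - cubic lam b k) (3 * \<bar>lam\<bar> * K * r\<^sup>2 * X)"
  using hbound_cmult [OF hbound_tri_diff [OF \<beta> h(1) h(1) h(1) h(2) h(2) h(2) d d d], of "- \<i> * of_real lam"]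
  by (simp add: cubic_def right_diff_distrib norm_mult mult_ac)

text \<open>The tame estimate is used for both convolutions; the low norm of the inner one comes
  from the algebra property. The result is linear in the high norm \<open>A\<close>.\<close>

lemma hbound_cubic_tame:
  fixes a :: "int ^ 'd \<Rightarrow> complex"
  assumes s: "s \<ge> \<sigma>" and a: "hbound s a A" "hbound \<sigma> a M"
  shows "hbound s (cubic lam a)
    (\<bar>lam\<bar> * tame_const TYPE('d) s \<sigma> * (prod_const TYPE('d) \<sigma> + 2 * tame_const TYPE('d) s \<sigma>) * M\<^sup>2 * A)"
proof -
  have "hbound s (tri a a a) (tame_const TYPE('d) s \<sigma> *
      (prod_const TYPE('d) \<sigma> * M * M * A + M * (tame_const TYPE('d) s \<sigma> * (M * A + M * A))))"
    unfolding tri_def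
    by (intro hbound_conv_tame \<sigma> s a hbound_flat hbound_conv \<sigma>_nonneg order_refl)
  from hbound_cmult [OF this, of "- \<i> * of_real lam"] show ?thesis
    by (simp add: cubic_def [abs_def] norm_mult power2_eq_square algebra_simps)
qed

end

section \<open>Products of functions and convolutions of coefficients\<close>

lemma fourier_series_cnj: "cnj (fourier_series a x) = fourier_series (flat a) x"
proof -
  have "cnj (fourier_series a x) = (\<Sum>\<^sub>\<infinity>k. cnj (a k * wave k x))"
    unfolding fourier_series_def by (rule infsum_cnj [symmetric])
  also have "\<dots> = (\<Sum>\<^sub>\<infinity>k. flat a (0 - k) * wave (0 - k) x)"
    by (rule infsum_cong) (simp add: flat_def cnj_wave)
  also have "\<dots> = fourier_series (flat a) x"
    unfolding fourier_series_def by (rule infsum_reflect)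
  finally show ?thesis .
qed

text \<open>Cauchy product: absolute summability over pairs of frequencies allows the double sum to
  be rearranged by the total frequency.\<close>

lemma fourier_series_mult:
  fixes a b :: "int ^ 'd::finite \<Rightarrow> complex"
  assumes a: "l1_bound a A" and b: "l1_bound b B"
  shows "fourier_series a x * fourier_series b x = fourier_series (conv a b) x"
proof -
  have B: "B \<ge> 0" using b unfolding l1_bound_def by (metis finite.emptyI sum.empty)
  have sm: "(\<lambda>(l, k). a l * (b (k - l) * wave k x)) summable_on (UNIV \<times> UNIV)"
  proof (rule abs_summable_summable, rule nonneg_bdd_above_summable_on)
    have "(\<Sum>z\<in>F. norm (case z of (l, k) \<Rightarrow> a l * (b (k - l) * wave k x))) \<le> A * B" if F: "finite F" for F
    proof -
      have "(\<Sum>z\<in>F. norm (case z of (l, k) \<Rightarrow> a l * (b (k - l) * wave k x))) \<le>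
            (\<Sum>z\<in>fst ` F \<times> snd ` F. norm (case z of (l, k) \<Rightarrow> a l * (b (k - l) * wave k x)))"
        by (rule sum_mono2) (use F in \<open>force+\<close>)
      also have "\<dots> = (\<Sum>l\<in>fst ` F. norm (a l) * (\<Sum>k\<in>snd ` F. norm (b (k - l))))"
        unfolding sum_distrib_left sum.cartesian_product
        by (rule sum.cong) (auto simp: norm_mult)
      also have "\<dots> \<le> (\<Sum>l\<in>fst ` F. norm (a l) * B)"
      proof (intro sum_mono mult_left_mono)
        fix l
        have "(\<Sum>k\<in>snd ` F. norm (b (k - l))) = (\<Sum>k\<in>(\<lambda>k. k - l) ` snd ` F. norm (b k))"
          by (subst (2) sum.reindex) (auto simp: inj_on_def)
        then show "(\<Sum>k\<in>snd ` F. norm (b (k - l))) \<le> B" using b F by (simp add: l1_bound_def)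
      qed simp
      also have "\<dots> \<le> A * B"
        unfolding sum_distrib_right [symmetric]
        using a F B by (intro mult_right_mono) (auto simp: l1_bound_def)
      finally show ?thesis .
    qed
    then show "bdd_above (sum (\<lambda>z. norm (case z of (l, k) \<Rightarrow> a l * (b (k - l) * wave k x))) ` {F. F \<subseteq> UNIV \<times> UNIV \<and> finite F})"
      by (auto simp: bdd_above_def)
  qed simp
  have "fourier_series a x * fourier_series b x = (\<Sum>\<^sub>\<infinity>l. a l * wave l x * fourier_series b x)"
    unfolding fourier_series_def by (rule infsum_cmult_left' [symmetric])
  also have "\<dots> = (\<Sum>\<^sub>\<infinity>l. \<Sum>\<^sub>\<infinity>k. a l * (b (k - l) * wave k x))"
  proof (rule infsum_cong)
    fix l
    have "fourier_series b x = (\<Sum>\<^sub>\<infinity>k. b (k - l) * wave (k - l) x)"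
      unfolding fourier_series_def
      by (rule infsum_reindex_bij_betw [symmetric])
        (rule bij_betw_byWitness [where f' = "\<lambda>k. k + l"], auto)
    then have "a l * wave l x * fourier_series b x = (\<Sum>\<^sub>\<infinity>k. a l * wave l x * (b (k - l) * wave (k - l) x))"
      by (simp add: infsum_cmult_right')
    also have "\<dots> = (\<Sum>\<^sub>\<infinity>k. a l * (b (k - l) * wave k x))"
    proof (rule infsum_cong)
      fix k
      have "wave l x * wave (k - l) x = wave k x" by (simp add: wave_mult)
      then show "a l * wave l x * (b (k - l) * wave (k - l) x) = a l * (b (k - l) * wave k x)"
        by (metis (no_types, lifting) mult.assoc mult.left_commute)
    qed
    finally show "a l * wave l x * fourier_series b x = (\<Sum>\<^sub>\<infinity>k. a l * (b (k - l) * wave k x))" .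
  qed
  also have "\<dots> = (\<Sum>\<^sub>\<infinity>k. \<Sum>\<^sub>\<infinity>l. a l * (b (k - l) * wave k x))"
    by (rule infsum_swap_banach [OF sm])
  also have "\<dots> = (\<Sum>\<^sub>\<infinity>k. conv a b k * wave k x)"
    by (rule infsum_cong) (simp add: conv_def infsum_cmult_left' [symmetric] mult.assoc)
  finally show ?thesis by (simp add: fourier_series_def)
qed

context algebra_index begin

lemma hbound_l1': "hbound \<sigma> a B \<Longrightarrow> l1_bound a (sob_const TYPE('d) \<sigma> * B)"
  for a :: "int ^ 'd \<Rightarrow> complex"
  by (rule hbound_l1 [OF \<sigma>])

lemma nls_nonlinearity_series:
  fixes a :: "int ^ 'd \<Rightarrow> complex"
  assumes a: "hbound \<sigma> a B"
  shows "nls_nonlinearity lam (fourier_series a) x = fourier_series (cubic lam a) x"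
proof -
  let ?u = "fourier_series a x"
  note f = hbound_flat [OF a]
  have "fourier_series (tri a a a) x = ?u * cnj ?u * ?u"
    unfolding tri_def fourier_series_cnj
    by (simp add: fourier_series_mult [OF hbound_l1' [OF a] hbound_l1' [OF f]]
        fourier_series_mult [OF hbound_l1' [OF hbound_conv [OF \<sigma> \<sigma>_nonneg order_refl a f]] hbound_l1' [OF a]])
  also have "?u * cnj ?u = of_real ((cmod ?u)\<^sup>2)" by (simp only: complex_norm_square)
  finally have "of_real ((cmod ?u)\<^sup>2) * ?u = fourier_series (tri a a a) x" by simp
  moreover have "fourier_series (cubic lam a) x = - \<i> * of_real lam * fourier_series (tri a a a) x"
    unfolding fourier_series_def cubic_def mult.assoc by (simp add: infsum_cmult_right' infsum_uminus)
  ultimately show ?thesis by (simp add: nls_nonlinearity_def mult.assoc)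
qed

lemma sobolev_series_AE:
  fixes u :: "'d torus_fun"
  assumes "u \<in> L2_torus" "hbound \<sigma> (fourier_coeff u) B"
  shows "AE x in lebesgue. u x = fourier_series (fourier_coeff u) x"
  by (rule fourier_series_AE [OF assms(1) hbound_l1' [OF assms(2)]])

lemma nls_nonlinearity_AE:
  fixes u :: "'d torus_fun"
  assumes "u \<in> L2_torus" "hbound \<sigma> (fourier_coeff u) B"
  shows "AE x in lebesgue. nls_nonlinearity lam u x = fourier_series (cubic lam (fourier_coeff u)) x"
  using sobolev_series_AE [OF assms]
proof eventually_elim
  case (elim x)
  have "nls_nonlinearity lam u x = nls_nonlinearity lam (fourier_series (fourier_coeff u)) x"
    by (simp add: nls_nonlinearity_def elim)
  then show ?case by (simp only: nls_nonlinearity_series [OF assms(2)])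
qed

text \<open>The nonlinearity of a representative is known to be measurable; it agrees almost
  everywhere with a continuous series, from which its coefficients are read off.\<close>

lemma fourier_coeff_nls_nonlinearity:
  fixes u :: "'d torus_fun"
  assumes u: "u \<in> L2_torus" and h: "hbound \<sigma> (fourier_coeff u) B"
  shows "fourier_coeff (nls_nonlinearity lam u) k = cubic lam (fourier_coeff u) k"
proof -
  note l = hbound_l1' [OF hbound_cubic [OF h, of lam]]
  have "u \<in> borel_measurable cell" using L2_torus_integrable [OF u] by auto
  then have m: "nls_nonlinearity lam u \<in> borel_measurable cell"
    unfolding nls_nonlinearity_def by measurable
  have "fourier_coeff (nls_nonlinearity lam u) k = fourier_coeff (fourier_series (cubic lam (fourier_coeff u))) k"
    by (rule fourier_coeff_cong_AE [OF m _ nls_nonlinearity_AE [OF u h]])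
      (rule continuous_measurable_cell [OF continuous_on_fourier_series [OF l]])
  then show ?thesis by (simp add: fourier_coeff_fourier_series [OF l])
qed

end

section \<open>The equation in Fourier coefficients\<close>

text \<open>Continuity in H^s, phrased for coefficient sequences so that no function representing
  them has to be carried along.\<close>

definition hcont :: "real \<Rightarrow> real set \<Rightarrow> (real \<Rightarrow> int ^ 'd::finite \<Rightarrow> complex) \<Rightarrow> bool" where
  "hcont s J a \<longleftrightarrow> (\<forall>t\<in>J. \<forall>e>0. \<forall>\<^sub>F r in at t within J. hbound s (\<lambda>k. a r k - a t k) e)"

text \<open>The eigenvalue on the k-th wave of i \<kappa> times the Laplacian: for \<kappa> = h /
  eps this is V, for \<kappa> = 1 / eps the generator of the linear flow. It is imaginary, so its
  real multiples have exponentials of modulus 1.\<close>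

definition symbol :: "real \<Rightarrow> int ^ 'd::finite \<Rightarrow> complex" where
  "symbol \<kappa> k = \<i> * of_real \<kappa> * (- of_real (freq_norm_sq k))"

lemma Re_symbol [simp]: "Re (symbol \<kappa> k) = 0"
  by (simp add: symbol_def)

lemma norm_symbol: "\<kappa> \<ge> 0 \<Longrightarrow> norm (symbol \<kappa> k) = \<kappa> * freq_norm_sq k"
  by (simp add: symbol_def norm_mult)

lemma hcont_coord:
  assumes "hcont s J a" "s \<ge> 0" shows "continuous_on J (\<lambda>t. a t k)"
  unfolding continuous_on_def
proof (intro ballI tendstoI)
  fix t e :: real assume t: "t \<in> J" and e: "e > 0"
  have "\<forall>\<^sub>F r in at t within J. hbound s (\<lambda>k. a r k - a t k) (e / 2)"
    using assms(1) t e by (simp add: hcont_def)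
  then show "\<forall>\<^sub>F r in at t within J. dist (a r k) (a t k) < e"
  proof eventually_elim
    case (elim r)
    then show ?case using hbound_coord [OF elim assms(2), of k] e by (simp add: dist_norm)
  qed
qed

lemma hcontI_lipschitz:
  assumes "\<And>t r. t \<in> J \<Longrightarrow> r \<in> J \<Longrightarrow> hbound s (\<lambda>k. a r k - a t k) (L * \<bar>r - t\<bar>)"
  shows "hcont s J a"
  unfolding hcont_def
proof (intro ballI allI impI)
  fix t e :: real assume t: "t \<in> J" and e: "e > 0"
  have "((\<lambda>r. L * \<bar>r - t\<bar>) \<longlongrightarrow> L * \<bar>t - t\<bar>) (at t within J)" by (intro tendsto_intros)
  then have "\<forall>\<^sub>F r in at t within J. L * \<bar>r - t\<bar> < e" using e by (intro order_tendstoD(2)) auto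
  moreover have "\<forall>\<^sub>F r in at t within J. r \<in> J" by (simp add: eventually_at_filter)
  ultimately show "\<forall>\<^sub>F r in at t within J. hbound s (\<lambda>k. a r k - a t k) e"
    by eventually_elim (use assms [OF t] hbound_le less_imp_le in blast)
qed

text \<open>A divergent infinite sum has the value 0 by convention, so \<open>sobolev_norm\<close>
  controls the coefficients only once some finite bound is known.\<close>

lemma hbound_sobolev_norm:
  "hbound s (fourier_coeff v) B \<Longrightarrow> hbound s (fourier_coeff v) (sobolev_norm s v)"
  unfolding sobolev_norm_def by (rule hboundI_summable [OF hbound_summable(1)])

lemma sobolev_L2: "u \<in> sobolev s \<Longrightarrow> u \<in> L2_torus"
  by (simp add: sobolev_def)

lemma sobolev_integrable: "u \<in> sobolev s \<Longrightarrow> integrable cell u"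
  by (intro L2_torus_integrable sobolev_L2)

lemma fourier_coeff_minus:
  assumes "u \<in> sobolev s" "v \<in> sobolev s"
  shows "fourier_coeff (u - v) = (\<lambda>k. fourier_coeff u k - fourier_coeff v k)"
  using fourier_coeff_diff [OF sobolev_integrable [OF assms(1)] sobolev_integrable [OF assms(2)]]
  by (simp add: fun_eq_iff fun_diff_def)

lemma sobolev_minus:
  assumes "u \<in> sobolev s" "v \<in> sobolev s" shows "u - v \<in> sobolev s"
proof (rule sobolevI_hbound)
  have "u \<in> L2_torus" "v \<in> L2_torus" using assms by (auto intro: sobolev_L2)
  then have m: "u \<in> borel_measurable lebesgue" "v \<in> borel_measurable lebesgue"
    and i: "integrable cell (\<lambda>x. (cmod (u x))\<^sup>2)" "integrable cell (\<lambda>x. (cmod (v x))\<^sup>2)"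
    and p: "periodic_fun u" "periodic_fun v"
    by (auto simp: L2_torus_def)
  have m': "u \<in> borel_measurable cell" "v \<in> borel_measurable cell"
    using m by (auto intro: measurable_restrict_space1)
  have "integrable cell (\<lambda>x. (cmod (u x - v x))\<^sup>2)"
  proof (rule Bochner_Integration.integrable_bound)
    show "integrable cell (\<lambda>x. 2 * (cmod (u x))\<^sup>2 + 2 * (cmod (v x))\<^sup>2)" using i by simp
    show "(\<lambda>x. (cmod (u x - v x))\<^sup>2) \<in> borel_measurable cell" using m' by measurable
    have "(cmod (a - b))\<^sup>2 \<le> 2 * (cmod a)\<^sup>2 + 2 * (cmod b)\<^sup>2" for a b
    proof -
      have "(cmod (a - b))\<^sup>2 \<le> (cmod a + cmod b)\<^sup>2" by (intro power_mono norm_triangle_ineq4) auto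
      also have "\<dots> \<le> 2 * (cmod a)\<^sup>2 + 2 * (cmod b)\<^sup>2"
        using zero_le_power2 [of "cmod a - cmod b"] by (simp add: power2_eq_square algebra_simps)
      finally show ?thesis .
    qed
    then show "AE x in cell. norm ((cmod (u x - v x))\<^sup>2) \<le> norm (2 * (cmod (u x))\<^sup>2 + 2 * (cmod (v x))\<^sup>2)"
      by auto
  qed
  then show "u - v \<in> L2_torus"
    using m p by (simp add: L2_torus_def periodic_fun_def fun_diff_def)
  show "hbound s (fourier_coeff (u - v)) (sobolev_norm s u + sobolev_norm s v)"
    unfolding fourier_coeff_minus [OF assms] by (intro hbound_diff sobolev_hbound assms)
qed

lemma sobolev_weaken: "u \<in> sobolev s \<Longrightarrow> t \<le> s \<Longrightarrow> u \<in> sobolev t"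
  by (rule sobolevI_hbound [OF sobolev_L2 hbound_weaken [OF sobolev_hbound]])

lemma sobolev_continuous_hcont:
  assumes "sobolev_continuous_on s J F"
  shows "hcont s J (\<lambda>t. fourier_coeff (F t))"
  unfolding hcont_def
proof (intro ballI allI impI)
  fix t e :: real assume t: "t \<in> J" and e: "e > 0"
  have F: "F r \<in> sobolev s" if "r \<in> J" for r using assms that by (simp add: sobolev_continuous_on_def)
  have "((\<lambda>r. sobolev_norm s (F r - F t)) \<longlongrightarrow> 0) (at t within J)"
    using assms t by (simp add: sobolev_continuous_on_def)
  then have "\<forall>\<^sub>F r in at t within J. sobolev_norm s (F r - F t) < e"
    using e by (rule order_tendstoD(2))
  moreover have "\<forall>\<^sub>F r in at t within J. r \<in> J" by (simp add: eventually_at_filter)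
  ultimately show "\<forall>\<^sub>F r in at t within J. hbound s (\<lambda>k. fourier_coeff (F r) k - fourier_coeff (F t) k) e"
  proof eventually_elim
    case (elim r)
    have "hbound s (fourier_coeff (F r - F t)) (sobolev_norm s (F r - F t))"
      by (intro sobolev_hbound sobolev_minus F t elim)
    then show ?case unfolding fourier_coeff_minus [OF F [OF elim(2)] F [OF t]]
      using elim(1) by (auto intro: hbound_le)
  qed
qed

lemma hcont_sobolev_continuous:
  assumes F: "\<And>t. t \<in> J \<Longrightarrow> F t \<in> sobolev s" and "hcont s J (\<lambda>t. fourier_coeff (F t))"
  shows "sobolev_continuous_on s J F"
  unfolding sobolev_continuous_on_def
proof (intro conjI ballI F tendstoI)
  fix t e :: real assume t: "t \<in> J" and e: "e > 0"
  have "\<forall>\<^sub>F r in at t within J. hbound s (\<lambda>k. fourier_coeff (F r) k - fourier_coeff (F t) k) (e / 2)"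
    using assms(2) t e by (simp add: hcont_def)
  moreover have "\<forall>\<^sub>F r in at t within J. r \<in> J" by (simp add: eventually_at_filter)
  ultimately show "\<forall>\<^sub>F r in at t within J. dist (sobolev_norm s (F r - F t)) 0 < e"
  proof eventually_elim
    case (elim r)
    have "sobolev_norm s (F r - F t) \<le> e / 2"
      by (rule sobolev_norm_le) (simp only: fourier_coeff_minus [OF F [OF elim(2)] F [OF t]] elim(1))
    moreover have "sobolev_norm s (F r - F t) \<ge> 0"
      by (simp add: sobolev_norm_def infsum_nonneg)
    ultimately show ?case using e by simp
  qed
qed

text \<open>For s \<ge> 0 a single coefficient is bounded by the norm, so difference quotients that
  converge in H^s converge in each coefficient.\<close>

lemma sobolev_derivative_coord:
  assumes F: "\<And>t. t \<in> J \<Longrightarrow> F t \<in> sobolev s" and F': "\<And>t. t \<in> J \<Longrightarrow> F' t \<in> sobolev s"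
    and D: "sobolev_derivative_on s J F F'" and s: "s \<ge> 0" and t: "t \<in> J"
  shows "((\<lambda>t. fourier_coeff (F t) k) has_vector_derivative fourier_coeff (F' t) k) (at t within J)"
  unfolding has_vector_derivative_def has_derivative_iff_norm
proof (intro conjI bounded_linear_scaleR_left)
  let ?y = "\<lambda>t. fourier_coeff (F t)"
  let ?N = "\<lambda>r. sobolev_norm s (\<lambda>x. (F r x - F t x) / of_real (r - t) - F' t x)"
  have lim: "(?N \<longlongrightarrow> 0) (at t within J)"
    using D t by (simp add: sobolev_derivative_on_def)
  have le: "\<forall>\<^sub>F r in at t within J. norm (?y r k - ?y t k - (r - t) *\<^sub>R fourier_coeff (F' t) k) / norm (r - t) \<le> ?N r"
    unfolding eventually_at_filter
  proof (intro always_eventually allI impI)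
    fix r assume r: "r \<noteq> t" "r \<in> J"
    note i = sobolev_integrable [OF F [OF r(2)]] sobolev_integrable [OF F [OF t]] sobolev_integrable [OF F' [OF t]]
    have c: "fourier_coeff (\<lambda>x. (F r x - F t x) / of_real (r - t) - F' t x) =
      (\<lambda>k. inverse (of_real (r - t)) * (?y r k - ?y t k) - fourier_coeff (F' t) k)"
    proof
      fix k
      have "fourier_coeff (\<lambda>x. inverse (of_real (r - t)) * (F r x - F t x) - F' t x) k =
         inverse (of_real (r - t)) * (?y r k - ?y t k) - fourier_coeff (F' t) k"
        using i by (subst fourier_coeff_diff) (auto simp: fourier_coeff_cmult fourier_coeff_diff)
      then show "fourier_coeff (\<lambda>x. (F r x - F t x) / of_real (r - t) - F' t x) k =
         inverse (of_real (r - t)) * (?y r k - ?y t k) - fourier_coeff (F' t) k"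
        by (simp add: divide_inverse mult.commute)
    qed
    have "hbound s (fourier_coeff (\<lambda>x. (F r x - F t x) / of_real (r - t) - F' t x)) 
      (norm (inverse (of_real (r - t)) :: complex) * (sobolev_norm s (F r) + sobolev_norm s (F t)) + sobolev_norm s (F' t))"
      unfolding c by (intro hbound_diff hbound_cmult sobolev_hbound F F' r t)
    from hbound_coord [OF hbound_sobolev_norm [OF this] s, of k]
    have "norm (inverse (of_real (r - t)) * (?y r k - ?y t k) - fourier_coeff (F' t) k) \<le> ?N r"
      unfolding c .
    moreover have "inverse (of_real (r - t)) * (?y r k - ?y t k) - fourier_coeff (F' t) k =
      inverse (of_real (r - t)) * (?y r k - ?y t k - (r - t) *\<^sub>R fourier_coeff (F' t) k)"
      using r by (simp add: right_diff_distrib scaleR_conv_of_real mult.assoc [symmetric] del: of_real_diff)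
    ultimately show "norm (?y r k - ?y t k - (r - t) *\<^sub>R fourier_coeff (F' t) k) / norm (r - t) \<le> ?N r"
      by (simp add: norm_mult norm_inverse divide_inverse mult.commute flip: of_real_diff)
  qed
  show "((\<lambda>r. norm (?y r k - ?y t k - (r - t) *\<^sub>R fourier_coeff (F' t) k) / norm (r - t)) \<longlongrightarrow> 0) (at t within J)"
    by (rule real_tendsto_sandwich [OF _ le tendsto_const lim]) auto
qed

lemma fourier_series_add:
  assumes "l1_bound a A" "l1_bound b B"
  shows "fourier_series (\<lambda>k. a k + b k) x = fourier_series a x + fourier_series b x"
  unfolding fourier_series_def distrib_right
  by (intro infsum_add fourier_series_summable [OF assms(1)] fourier_series_summable [OF assms(2)])

lemma fourier_series_cmult: "fourier_series (\<lambda>k. c * a k) x = c * fourier_series a x"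
  unfolding fourier_series_def mult.assoc by (rule infsum_cmult_right')

lemma fourier_coeff_eq_series:
  assumes u: "u \<in> borel_measurable cell" and eq: "AE x in lebesgue. u x = fourier_series a x"
    and l: "l1_bound a A"
  shows "fourier_coeff u k = a k"
  using fourier_coeff_cong_AE [OF u _ eq, of k] fourier_coeff_fourier_series [OF l, of k]
    continuous_measurable_cell [OF continuous_on_fourier_series [OF l]] by simp

section \<open>The evolution equation of the coefficients\<close>

context algebra_index begin

lemma hcont_cubic:
  fixes a :: "real \<Rightarrow> int ^ 'd \<Rightarrow> complex"
  assumes c: "hcont \<sigma> J a" and b: "\<And>t. t \<in> J \<Longrightarrow> hbound \<sigma> (a t) r"
  shows "hcont \<sigma> J (\<lambda>t. cubic lam (a t))"
  unfolding hcont_def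
proof (intro ballI allI impI)
  fix t e :: real assume t: "t \<in> J" and e: "e > 0"
  define Q where "Q = 3 * \<bar>lam\<bar> * K * r\<^sup>2"
  have Q: "Q \<ge> 0" using K_nonneg by (simp add: Q_def)
  have "\<forall>\<^sub>F s in at t within J. hbound \<sigma> (\<lambda>k. a s k - a t k) (e / (Q + 1))"
    using c t e Q by (simp add: hcont_def)
  moreover have "\<forall>\<^sub>F r in at t within J. r \<in> J" by (simp add: eventually_at_filter)
  ultimately show "\<forall>\<^sub>F s in at t within J. hbound \<sigma> (\<lambda>k. cubic lam (a s) k - cubic lam (a t) k) e"
  proof eventually_elim
    case (elim s)
    have "hbound \<sigma> (\<lambda>k. cubic lam (a s) k - cubic lam (a t) k) (Q * (e / (Q + 1)))"
      unfolding Q_def using hbound_cubic_diff [OF \<sigma>_nonneg order_refl b [OF elim(2)] b [OF t] elim(1)]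
      by (simp add: Q_def)
    moreover have "Q * (e / (Q + 1)) \<le> e" using Q e by (simp add: field_simps)
    ultimately show ?case by (rule hbound_le)
  qed
qed

text \<open>Cauchy-Schwarz bounds the tail by that of one fixed summable sequence. The rate is the
  same for all sequences with bound \<open>B\<close>, which makes convergence uniform in a
  parameter.\<close>

lemma fourier_series_tail:
  fixes a :: "int ^ 'd \<Rightarrow> complex"
  assumes a: "hbound \<sigma> a B" and F: "finite F"
  shows "norm (fourier_series a x - (\<Sum>k\<in>F. a k * wave k x)) \<le>
    B * sqrt ((\<Sum>\<^sub>\<infinity>k :: int ^ 'd. (weight (- \<sigma>) k)\<^sup>2) - (\<Sum>k\<in>F. (weight (- \<sigma>) k)\<^sup>2))"
proof -
  define S where "S = (\<Sum>\<^sub>\<infinity>k :: int ^ 'd. (weight (- \<sigma>) k)\<^sup>2)"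
  have B: "B \<ge> 0" by (rule hbound_nonneg [OF a])
  have "((\<lambda>G. \<Sum>k\<in>G. a k * wave k x) \<longlongrightarrow> fourier_series a x) (finite_subsets_at_top UNIV)"
    unfolding fourier_series_def
    by (rule infsum_tendsto [OF fourier_series_summable [OF hbound_l1' [OF a]]])
  then have "((\<lambda>G. norm ((\<Sum>k\<in>G. a k * wave k x) - (\<Sum>k\<in>F. a k * wave k x))) \<longlongrightarrow>
      norm (fourier_series a x - (\<Sum>k\<in>F. a k * wave k x))) (finite_subsets_at_top UNIV)"
    by (intro tendsto_intros)
  moreover have "\<forall>\<^sub>F G in finite_subsets_at_top UNIV.
      norm ((\<Sum>k\<in>G. a k * wave k x) - (\<Sum>k\<in>F. a k * wave k x)) \<le> B * sqrt (S - (\<Sum>k\<in>F. (weight (- \<sigma>) k)\<^sup>2))"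
    unfolding eventually_finite_subsets_at_top
  proof (intro exI [of _ F] conjI allI impI F)
    fix G :: "(int ^ 'd) set" assume G: "finite G \<and> F \<subseteq> G \<and> G \<subseteq> UNIV"
    have "(\<Sum>k\<in>G. a k * wave k x) - (\<Sum>k\<in>F. a k * wave k x) = (\<Sum>k\<in>G - F. a k * wave k x)"
      using G by (simp add: sum_diff)
    also have "norm \<dots> \<le> (\<Sum>k\<in>G - F. \<bar>weight (- \<sigma>) k\<bar> * \<bar>weight \<sigma> k * norm (a k)\<bar>)"
      by (rule order_trans [OF norm_sum])
        (auto intro!: sum_mono simp: norm_mult mult.assoc [symmetric] weight_add [symmetric])
    also have "\<dots> \<le> L2_set (weight (- \<sigma>)) (G - F) * L2_set (\<lambda>k. weight \<sigma> k * norm (a k)) (G - F)"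
      by (rule L2_set_mult_ineq)
    also have "\<dots> \<le> sqrt (S - (\<Sum>k\<in>F. (weight (- \<sigma>) k)\<^sup>2)) * B"
    proof (rule mult_mono)
      have "(\<Sum>k\<in>G - F. (weight (- \<sigma>) k)\<^sup>2) = (\<Sum>k\<in>G. (weight (- \<sigma>) k)\<^sup>2) - (\<Sum>k\<in>F. (weight (- \<sigma>) k)\<^sup>2)"
        using G by (simp add: sum_diff)
      also have "(\<Sum>k\<in>G. (weight (- \<sigma>) k)\<^sup>2) \<le> S"
        unfolding S_def using G by (intro finite_sum_le_infsum weight_summable \<sigma>) auto
      finally show "L2_set (weight (- \<sigma>)) (G - F) \<le> sqrt (S - (\<Sum>k\<in>F. (weight (- \<sigma>) k)\<^sup>2))"
        by (simp add: L2_set_def)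
      show "L2_set (\<lambda>k. weight \<sigma> k * norm (a k)) (G - F) \<le> B" using a G by (simp add: hbound_def)
      have "(\<Sum>k\<in>F. (weight (- \<sigma>) k)\<^sup>2) \<le> S"
        unfolding S_def by (intro finite_sum_le_infsum weight_summable \<sigma> F) auto
      then show "0 \<le> sqrt (S - (\<Sum>k\<in>F. (weight (- \<sigma>) k)\<^sup>2))" by simp
    qed auto
    finally show "norm ((\<Sum>k\<in>G. a k * wave k x) - (\<Sum>k\<in>F. a k * wave k x)) \<le> B * sqrt (S - (\<Sum>k\<in>F. (weight (- \<sigma>) k)\<^sup>2))"
      by (simp only: mult.commute)
  qed auto
  ultimately show ?thesis unfolding S_def by (rule tendsto_upperbound) simp
qed

text \<open>By \<open>fourier_series_tail\<close> the partial sums converge uniformly in r, so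
  integration commutes with the series at every point x.\<close>

lemma integral_fourier_series:
  fixes G :: "real \<Rightarrow> int ^ 'd \<Rightarrow> complex"
  assumes G: "\<And>r. r \<in> {0..1} \<Longrightarrow> hbound \<sigma> (G r) B"
    and c: "\<And>k. continuous_on {0..1} (\<lambda>r. G r k)"
  shows "integral {0..1} (\<lambda>r. fourier_series (G r) x) = fourier_series (\<lambda>k. integral {0..1} (\<lambda>r. G r k)) x"
proof -
  define S where "S = (\<Sum>\<^sub>\<infinity>k :: int ^ 'd. (weight (- \<sigma>) k)\<^sup>2)"
  have "((\<lambda>F. \<Sum>k\<in>F. (weight (- \<sigma>) k)\<^sup>2) \<longlongrightarrow> S) (finite_subsets_at_top (UNIV :: (int ^ 'd) set))"
    unfolding S_def by (rule infsum_tendsto [OF weight_summable [OF \<sigma>]])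
  then have "((\<lambda>F. B * sqrt (S - (\<Sum>k\<in>F. (weight (- \<sigma>) k)\<^sup>2))) \<longlongrightarrow> B * sqrt (S - S)) (finite_subsets_at_top (UNIV :: (int ^ 'd) set))"
    by (intro tendsto_intros)
  then have lim0: "((\<lambda>F. B * sqrt (S - (\<Sum>k\<in>F. (weight (- \<sigma>) k)\<^sup>2))) \<longlongrightarrow> 0) (finite_subsets_at_top (UNIV :: (int ^ 'd) set))"
    by simp
  have "uniform_limit {0..1} (\<lambda>F r. \<Sum>k\<in>F. G r k * wave k x) (\<lambda>r. fourier_series (G r) x) (finite_subsets_at_top UNIV)"
  proof (rule uniform_limitI)
    fix e :: real assume "e > 0"
    with lim0 have "\<forall>\<^sub>F F in finite_subsets_at_top (UNIV :: (int ^ 'd) set). B * sqrt (S - (\<Sum>k\<in>F. (weight (- \<sigma>) k)\<^sup>2)) < e"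
      by (rule order_tendstoD(2))
    moreover have "\<forall>\<^sub>F F in finite_subsets_at_top (UNIV :: (int ^ 'd) set). finite F"
      by (rule eventually_finite_subsets_at_top_weakI)
    ultimately show "\<forall>\<^sub>F F in finite_subsets_at_top UNIV. \<forall>r\<in>{0..1}. dist (\<Sum>k\<in>F. G r k * wave k x) (fourier_series (G r) x) < e"
    proof eventually_elim
      case (elim F)
      show ?case
      proof
        fix r :: real assume r: "r \<in> {0..1}"
        have "norm (fourier_series (G r) x - (\<Sum>k\<in>F. G r k * wave k x)) \<le> B * sqrt (S - (\<Sum>k\<in>F. (weight (- \<sigma>) k)\<^sup>2))"
          unfolding S_def by (rule fourier_series_tail [OF G [OF r] elim(2)])
        then show "dist (\<Sum>k\<in>F. G r k * wave k x) (fourier_series (G r) x) < e"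
          using elim(1) by (simp add: dist_norm norm_minus_commute)
      qed
    qed
  qed
  then have ul: "uniform_limit (cbox 0 1) (\<lambda>F r. \<Sum>k\<in>F. G r k * wave k x) (\<lambda>r. fourier_series (G r) x) (finite_subsets_at_top UNIV)"
    by simp
  obtain I J where I: "\<And>F. ((\<lambda>r. \<Sum>k\<in>F. G r k * wave k x) has_integral I F) (cbox 0 1)"
    and J: "((\<lambda>r. fourier_series (G r) x) has_integral J) (cbox 0 1)"
    and IJ: "(I \<longlongrightarrow> J) (finite_subsets_at_top UNIV)"
    by (rule uniform_limit_integral_cbox [OF ul]) (auto intro!: continuous_intros c)
  have Gi: "(\<lambda>r. G r k) integrable_on {0..1}" for k
    by (rule integrable_continuous_real [OF c])
  have "I F = (\<Sum>k\<in>F. integral {0..1} (\<lambda>r. G r k) * wave k x)" if "finite F" for F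
  proof (rule has_integral_unique [OF I])
    show "((\<lambda>r. \<Sum>k\<in>F. G r k * wave k x) has_integral (\<Sum>k\<in>F. integral {0..1} (\<lambda>r. G r k) * wave k x)) (cbox 0 1)"
      unfolding cbox_interval by (intro has_integral_sum that has_integral_mult_left integrable_integral Gi)
  qed
  then have "\<forall>\<^sub>F F in finite_subsets_at_top UNIV. I F = (\<Sum>k\<in>F. integral {0..1} (\<lambda>r. G r k) * wave k x)"
    by (intro eventually_finite_subsets_at_top_weakI) auto
  with IJ have 1: "((\<lambda>F. \<Sum>k\<in>F. integral {0..1} (\<lambda>r. G r k) * wave k x) \<longlongrightarrow> J) (finite_subsets_at_top UNIV)"
    by (rule Lim_transform_eventually)
  have "hbound \<sigma> (\<lambda>k. integral {0..1} (\<lambda>r. G r k)) ((1 - 0) * B)"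
    by (rule hbound_integral [OF G _ Gi]) auto
  then have "((\<lambda>F. \<Sum>k\<in>F. integral {0..1} (\<lambda>r. G r k) * wave k x) \<longlongrightarrow>
      fourier_series (\<lambda>k. integral {0..1} (\<lambda>r. G r k)) x) (finite_subsets_at_top UNIV)"
    unfolding fourier_series_def
    by (intro infsum_tendsto fourier_series_summable [OF hbound_l1'])
  with 1 have "J = fourier_series (\<lambda>k. integral {0..1} (\<lambda>r. G r k)) x"
    by (intro tendsto_unique [OF finite_subsets_at_top_neq_bot])
  with J show ?thesis by (simp add: integral_unique)
qed

text \<open>In order \<sigma> = \<alpha> - 2 > d/2 the Laplacian and the cubic term have absolutely
  summable coefficients. The equation, which holds almost everywhere, can therefore be compared
  coefficient by coefficient.\<close>

lemma nls_solution_fourier: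
  fixes u :: "real \<Rightarrow> 'd torus_fun"
  assumes sol: "nls_solution lam eps T (\<sigma> + 2) u0 u" and t: "t \<in> {0..T}"
  shows "((\<lambda>t. fourier_coeff (u t) k) has_vector_derivative
    (symbol (1 / eps) k * fourier_coeff (u t) k + cubic lam (fourier_coeff (u t)) k)) (at t within {0..T})"
proof -
  obtain u' where u': "sobolev_continuous_on \<sigma> {0..T} u'" "sobolev_derivative_on \<sigma> {0..T} u u'"
    and eq: "\<And>t. t \<in> {0..T} \<Longrightarrow> AE x in lebesgue.
              \<i> * u' t x = - of_real (1 / eps) * laplacian (u t) x
                           + of_real lam * of_real ((cmod (u t x))\<^sup>2) * u t x"
    using sol unfolding nls_solution_def by auto
  have uc: "sobolev_continuous_on (\<sigma> + 2) {0..T} u" using sol by (simp add: nls_solution_def)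
  have us: "u t \<in> sobolev (\<sigma> + 2)" if "t \<in> {0..T}" for t using uc that by (simp add: sobolev_continuous_on_def)
  have us': "u' t \<in> sobolev \<sigma>" if "t \<in> {0..T}" for t using u'(1) that by (simp add: sobolev_continuous_on_def)
  have "((\<lambda>t. fourier_coeff (u t) k) has_vector_derivative fourier_coeff (u' t) k) (at t within {0..T})"
    by (rule sobolev_derivative_coord [OF _ us' u'(2) \<sigma>_nonneg t]) (rule sobolev_weaken [OF us], auto)
  moreover have "fourier_coeff (u' t) k = symbol (1 / eps) k * fourier_coeff (u t) k + cubic lam (fourier_coeff (u t)) k"
  proof -
    let ?a = "fourier_coeff (u t)"
    let ?m = "\<lambda>k :: int ^ 'd. - of_real (freq_norm_sq k) :: complex"
    have h2: "hbound (\<sigma> + 2) ?a (sobolev_norm (\<sigma> + 2) (u t))" by (rule sobolev_hbound [OF us [OF t]])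
    have h: "hbound \<sigma> ?a (sobolev_norm (\<sigma> + 2) (u t))" by (rule hbound_weaken [OF h2]) simp
    have hl: "hbound \<sigma> (\<lambda>k. ?m k * ?a k) (1 * sobolev_norm (\<sigma> + 2) (u t))"
      using hbound_multiplier [OF h2, of 1 ?m 1] by simp
    have lap: "laplacian (u t) = fourier_series (\<lambda>k. ?m k * ?a k)"
      by (simp add: laplacian_def fourier_multiplier_series)
    have l: "l1_bound (\<lambda>k. \<i> * of_real (1 / eps) * (?m k * ?a k)) (sob_const TYPE('d) \<sigma> * (norm (\<i> * of_real (1 / eps) :: complex) * (1 * sobolev_norm (\<sigma> + 2) (u t))))"
      by (rule hbound_l1' [OF hbound_cmult [OF hl]])
    note lc = hbound_l1' [OF hbound_cubic [OF h, of lam]]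
    have ls: "l1_bound (\<lambda>k. \<i> * of_real (1 / eps) * (?m k * ?a k) + cubic lam ?a k)
       (sob_const TYPE('d) \<sigma> * (norm (\<i> * of_real (1 / eps) :: complex) * (1 * sobolev_norm (\<sigma> + 2) (u t)) + \<bar>lam\<bar> * K * sobolev_norm (\<sigma> + 2) (u t) ^ 3))"
      by (rule hbound_l1' [OF hbound_add [OF hbound_cmult [OF hl] hbound_cubic [OF h]]])
    have "AE x in lebesgue. u' t x = fourier_series (\<lambda>k. \<i> * of_real (1 / eps) * (?m k * ?a k) + cubic lam ?a k) x"
      using eq [OF t] nls_nonlinearity_AE [OF sobolev_L2 [OF us [OF t]] h, of lam]
    proof eventually_elim
      case (elim x)
      have "u' t x = - \<i> * (\<i> * u' t x)" by simp
      also have "\<dots> = \<i> * of_real (1 / eps) * laplacian (u t) x + nls_nonlinearity lam (u t) x"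
        unfolding elim(1) nls_nonlinearity_def by (simp add: algebra_simps)
      also have "\<dots> = fourier_series (\<lambda>k. \<i> * of_real (1 / eps) * (?m k * ?a k) + cubic lam ?a k) x"
        unfolding fourier_series_add [OF l lc] elim(2) lap fourier_series_cmult ..
      finally show ?case .
    qed
    from fourier_coeff_eq_series [OF _ this ls, of k] sobolev_integrable [OF us' [OF t]]
    show ?thesis by (auto simp: symbol_def mult.assoc)
  qed
  ultimately show ?thesis by simp
qed

end

section \<open>Stages of an exponential integrator\<close>

text \<open>Requirements on a method, uniform on the imaginary axis, where the spectrum of V lies;
  one constant \<open>L\<close> serves all of them. By \<open>C_one\<close> the final value uses the
  exact linear flow, an isometry, and this is why a step expands distances by 1 + O(h) and not by
  \<open>L\<close>.\<close>

locale ep_method =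
  fixes C :: "real \<Rightarrow> complex \<Rightarrow> complex" and A :: "real \<Rightarrow> real \<Rightarrow> complex \<Rightarrow> complex" and L :: real
  assumes L: "L \<ge> 1"
    and C_bound: "\<tau> \<in> {0..1} \<Longrightarrow> Re z = 0 \<Longrightarrow> norm (C \<tau> z) \<le> L"
    and A_bound: "\<tau> \<in> {0..1} \<Longrightarrow> r \<in> {0..1} \<Longrightarrow> Re z = 0 \<Longrightarrow> norm (A \<tau> r z) \<le> L"
    and C_lip: "\<tau> \<in> {0..1} \<Longrightarrow> \<tau>' \<in> {0..1} \<Longrightarrow> Re z = 0 \<Longrightarrow> norm (C \<tau> z - C \<tau>' z) \<le> L * \<bar>\<tau> - \<tau>'\<bar>"
    and A_lip: "\<tau> \<in> {0..1} \<Longrightarrow> \<tau>' \<in> {0..1} \<Longrightarrow> r \<in> {0..1} \<Longrightarrow> Re z = 0 \<Longrightarrow>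
      norm (A \<tau> r z - A \<tau>' r z) \<le> L * \<bar>\<tau> - \<tau>'\<bar>"
    and A_cont: "continuous_on {0..1} (\<lambda>r. A \<tau> r z)"
    and C_one: "C 1 z = exp z"
    and C_consistent: "\<tau> \<in> {0..1} \<Longrightarrow> Re z = 0 \<Longrightarrow> norm (exp (of_real \<tau> * z) - C \<tau> z) \<le> L * norm z"
    and A_consistent: "r \<in> {0..1} \<Longrightarrow> Re z = 0 \<Longrightarrow> norm (exp (of_real (1 - r) * z) - A 1 r z) \<le> L * norm z"
begin

lemma L_nonneg: "L \<ge> 0" using L by simp

definition stage_map ::
  "real \<Rightarrow> real \<Rightarrow> real \<Rightarrow> (int ^ 'd \<Rightarrow> complex) \<Rightarrow> (real \<Rightarrow> int ^ 'd \<Rightarrow> complex) \<Rightarrow> real \<Rightarrow> int ^ 'd::finite \<Rightarrow> complex" where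
  "stage_map lam \<kappa> h v U \<tau> k = C \<tau> (symbol \<kappa> k) * v k +
     of_real h * integral {0..1} (\<lambda>r. A \<tau> r (symbol \<kappa> k) * cubic lam (U r) k)"

definition seq_stages ::
  "real \<Rightarrow> real \<Rightarrow> real \<Rightarrow> real \<Rightarrow> real \<Rightarrow> (int ^ 'd \<Rightarrow> complex) \<Rightarrow> (real \<Rightarrow> int ^ 'd::finite \<Rightarrow> complex) \<Rightarrow> bool" where
  "seq_stages s \<rho> lam \<kappa> h v U \<longleftrightarrow> hcont s {0..1} U \<and> (\<forall>\<tau>\<in>{0..1}. hbound s (U \<tau>) \<rho>) \<and>
     (\<forall>\<tau>\<in>{0..1}. \<forall>k. U \<tau> k = stage_map lam \<kappa> h v U \<tau> k)"

lemma seq_stagesD: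
  assumes "seq_stages s \<rho> lam \<kappa> h v U"
  shows "hcont s {0..1} U" and "\<tau> \<in> {0..1} \<Longrightarrow> hbound s (U \<tau>) \<rho>"
    and "\<tau> \<in> {0..1} \<Longrightarrow> U \<tau> k = stage_map lam \<kappa> h v U \<tau> k"
  using assms unfolding seq_stages_def by blast+

end

lemma hbound_weighted_integral:
  fixes G g :: "real \<Rightarrow> int ^ 'd::finite \<Rightarrow> complex"
  assumes G: "\<And>r. r \<in> {0..1} \<Longrightarrow> hbound s (G r) B"
    and Gc: "\<And>k. continuous_on {0..1} (\<lambda>r. G r k)"
    and g: "\<And>r k. r \<in> {0..1} \<Longrightarrow> norm (g r k) \<le> c" and gc: "\<And>k. continuous_on {0..1} (\<lambda>r. g r k)"
  shows "hbound s (\<lambda>k. integral {0..1} (\<lambda>r. g r k * G r k)) (c * B)"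
proof -
  have "norm (g 0 undefined) \<le> c" by (rule g) simp
  then have c: "c \<ge> 0" using norm_ge_zero order_trans by blast
  have "hbound s (\<lambda>k. integral {0..1} (\<lambda>r. g r k * G r k)) ((1 - 0) * (c * B))"
  proof (rule hbound_integral)
    show "hbound s (\<lambda>k. g r k * G r k) (c * B)" if "r \<in> {0..1}" for r
      by (rule hbound_mult [OF G [OF that] c g [OF that]])
    show "(\<lambda>r. g r k * G r k) integrable_on {0..1}" for k
      by (intro integrable_continuous_real continuous_intros Gc gc)
  qed simp
  then show ?thesis by simp
qed

lemma integral_mult_diff:
  fixes f g G :: "real \<Rightarrow> complex"
  assumes "continuous_on {0..1} f" "continuous_on {0..1} g" "continuous_on {0..1} G"
  shows "integral {0..1} (\<lambda>r. f r * G r) - integral {0..1} (\<lambda>r. g r * G r) = integral {0..1} (\<lambda>r. (f r - g r) * G r)"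
  unfolding left_diff_distrib
  by (rule integral_diff [symmetric]) (intro integrable_continuous_real continuous_intros assms)+

lemma integral_mult_diff2:
  fixes f g G :: "real \<Rightarrow> complex"
  assumes "continuous_on {0..1} f" "continuous_on {0..1} g" "continuous_on {0..1} G"
  shows "integral {0..1} (\<lambda>r. G r * f r) - integral {0..1} (\<lambda>r. G r * g r) = integral {0..1} (\<lambda>r. G r * (f r - g r))"
  using integral_mult_diff [OF assms] by (simp add: mult.commute)

section \<open>Stability, existence and uniqueness of the stages\<close>

locale ep_setting = algebra_index D \<sigma> + ep_method C A L
  for D :: "'d::finite itself" and \<sigma> C A L
begin

text \<open>\<open>h * Q lam \<rho>\<close> is a Lipschitz constant of the integral term of the
  stages on the ball of radius \<open>\<rho>\<close>: that of the cubic map times the bound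
  \<open>L\<close> of the weights.\<close>

definition Q where "Q lam \<rho> = 3 * \<bar>lam\<bar> * K * \<rho>\<^sup>2 * L"

lemma Q_nonneg: "Q lam \<rho> \<ge> 0"
  using K_nonneg L_nonneg by (simp add: Q_def)

text \<open>The difference to the stages without residual is \<open>p\<close> plus a term with
  Lipschitz constant \<open>h * Q lam \<rho> \<le> 1 / 2\<close>, which is absorbed. The second
  bound says that the difference is \<open>p\<close> up to a factor h. The third keeps the residual
  of the final stage apart, since it is much smaller than \<open>P\<close> in the error
  analysis.\<close>

lemma stage_perturb:
  fixes U V p :: "real \<Rightarrow> int ^ 'd \<Rightarrow> complex"
  assumes \<beta>: "0 \<le> \<beta>" "\<beta> \<le> \<sigma>"
    and U: "\<And>r. r \<in> {0..1} \<Longrightarrow> hbound \<sigma> (U r) \<rho>" and V: "\<And>r. r \<in> {0..1} \<Longrightarrow> hbound \<sigma> (V r) \<rho>"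
    and Uc: "\<And>k. continuous_on {0..1} (\<lambda>r. cubic lam (U r) k)"
    and Vc: "\<And>k. continuous_on {0..1} (\<lambda>r. cubic lam (V r) k)"
    and Ueq: "\<And>\<tau> k. \<tau> \<in> {0..1} \<Longrightarrow> U \<tau> k = stage_map lam \<kappa> h a U \<tau> k"
    and Veq: "\<And>\<tau> k. \<tau> \<in> {0..1} \<Longrightarrow> V \<tau> k = p \<tau> k + stage_map lam \<kappa> h a V \<tau> k"
    and h: "h \<ge> 0" "h * Q lam \<rho> \<le> 1 / 2"
    and p: "\<And>\<tau>. \<tau> \<in> {0..1} \<Longrightarrow> hbound \<beta> (p \<tau>) P"
  shows "\<tau> \<in> {0..1} \<Longrightarrow> hbound \<beta> (\<lambda>k. V \<tau> k - U \<tau> k) (2 * P)"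
    and "\<tau> \<in> {0..1} \<Longrightarrow> hbound \<beta> (\<lambda>k. V \<tau> k - U \<tau> k - p \<tau> k) (h * Q lam \<rho> * (2 * P))"
    and "hbound \<beta> (p 1) P1 \<Longrightarrow> hbound \<beta> (\<lambda>k. V 1 k - U 1 k) (P1 + h * Q lam \<rho> * (2 * P))"
proof -
  have diff: "hbound \<beta> (\<lambda>k. V \<tau> k - U \<tau> k - p \<tau> k) (h * Q lam \<rho> * X)"
    if X: "\<And>r. r \<in> {0..1} \<Longrightarrow> hbound \<beta> (\<lambda>k. V r k - U r k) X" and \<tau>: "\<tau> \<in> {0..1}"
    for X \<tau>
  proof -
    have "hbound \<beta> (\<lambda>k. integral {0..1} (\<lambda>r. A \<tau> r (symbol \<kappa> k) * (cubic lam (V r) k - cubic lam (U r) k)))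
        (L * (3 * \<bar>lam\<bar> * K * \<rho>\<^sup>2 * X))"
      by (rule hbound_weighted_integral)
        (auto intro!: hbound_cubic_diff \<beta> U V X A_bound \<tau> continuous_intros Uc Vc A_cont)
    from hbound_cmult [OF this, of "of_real h"]
    have "hbound \<beta> (\<lambda>k. of_real h * integral {0..1} (\<lambda>r. A \<tau> r (symbol \<kappa> k) * (cubic lam (V r) k - cubic lam (U r) k)))
       (h * Q lam \<rho> * X)"
      using h by (simp add: Q_def mult_ac)
    then show ?thesis
      unfolding Ueq [OF \<tau>] Veq [OF \<tau>] stage_map_def integral_mult_diff2 [OF Vc Uc A_cont, symmetric]
      by (simp add: algebra_simps)
  qed
  have step: "hbound \<beta> (\<lambda>k. V \<tau> k - U \<tau> k) (P' + h * Q lam \<rho> * X)"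
    if X: "\<And>r. r \<in> {0..1} \<Longrightarrow> hbound \<beta> (\<lambda>k. V r k - U r k) X" and \<tau>: "\<tau> \<in> {0..1}" and P': "hbound \<beta> (p \<tau>) P'"
    for X \<tau> P'
    using hbound_add [OF P' diff [OF X \<tau>]] by simp
  have main: "hbound \<beta> (\<lambda>k. V \<tau> k - U \<tau> k) (2 * P)" if \<tau>: "\<tau> \<in> {0..1}" for \<tau>
  proof (rule hbound_self_improve [where J = "{0..1}" and U = "\<lambda>\<tau> k. V \<tau> k - U \<tau> k" and A = P])
    show "P \<ge> 0" using hbound_nonneg [OF p [OF \<tau>]] .
    \<comment> \<open>This crude bound only starts the absorption.\<close>
    show "hbound \<beta> (\<lambda>k. V t k - U t k) (\<rho> + \<rho>)" if "t \<in> {0..1}" for t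
      by (intro hbound_weaken [OF hbound_diff [OF V U]] that \<beta>)
    show "hbound \<beta> (\<lambda>k. V t k - U t k) (P + X / 2)"
      if "\<And>t. t \<in> {0..1} \<Longrightarrow> hbound \<beta> (\<lambda>k. V t k - U t k) X" "X \<ge> 0" "t \<in> {0..1}" for X t
      by (rule hbound_le [OF step [OF that(1,3) p [OF that(3)]]])
        (use mult_right_mono [OF h(2) that(2)] in simp_all)
  qed fact
  then show "\<tau> \<in> {0..1} \<Longrightarrow> hbound \<beta> (\<lambda>k. V \<tau> k - U \<tau> k) (2 * P)" .
  show "\<tau> \<in> {0..1} \<Longrightarrow> hbound \<beta> (\<lambda>k. V \<tau> k - U \<tau> k - p \<tau> k) (h * Q lam \<rho> * (2 * P))"
    by (rule diff [OF main])
  show "hbound \<beta> (\<lambda>k. V 1 k - U 1 k) (P1 + h * Q lam \<rho> * (2 * P))" if "hbound \<beta> (p 1) P1"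
    by (rule step [OF main _ that]) auto
qed

lemma seq_stages_cont:
  fixes U :: "real \<Rightarrow> int ^ 'd \<Rightarrow> complex"
  assumes "seq_stages \<sigma> \<rho> lam \<kappa> h v U"
  shows "continuous_on {0..1} (\<lambda>r. cubic lam (U r) k)"
  using assms unfolding seq_stages_def
  by (intro hcont_coord [OF hcont_cubic \<sigma>_nonneg]) auto

text \<open>A change of the initial value acts as the residual \<open>p\<close> with factor
  \<open>C \<tau>\<close>. At the final stage this factor has modulus 1, which gives the constant 1
  + O(h).\<close>

lemma stage_stable:
  fixes U V :: "real \<Rightarrow> int ^ 'd \<Rightarrow> complex"
  assumes \<beta>: "0 \<le> \<beta>" "\<beta> \<le> \<sigma>"
    and U: "\<And>r. r \<in> {0..1} \<Longrightarrow> hbound \<sigma> (U r) \<rho>" and V: "\<And>r. r \<in> {0..1} \<Longrightarrow> hbound \<sigma> (V r) \<rho>"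
    and Uc: "\<And>k. continuous_on {0..1} (\<lambda>r. cubic lam (U r) k)"
    and Vc: "\<And>k. continuous_on {0..1} (\<lambda>r. cubic lam (V r) k)"
    and Ueq: "\<And>\<tau> k. \<tau> \<in> {0..1} \<Longrightarrow> U \<tau> k = stage_map lam \<kappa> h a U \<tau> k"
    and Veq: "\<And>\<tau> k. \<tau> \<in> {0..1} \<Longrightarrow> V \<tau> k = stage_map lam \<kappa> h b V \<tau> k"
    and h: "h \<ge> 0" "h * Q lam \<rho> \<le> 1 / 2"
    and X: "hbound \<beta> (\<lambda>k. b k - a k) X"
  shows "\<tau> \<in> {0..1} \<Longrightarrow> hbound \<beta> (\<lambda>k. V \<tau> k - U \<tau> k) (2 * (L * X))"
    and "hbound \<beta> (\<lambda>k. V 1 k - U 1 k) ((1 + h * (2 * L * Q lam \<rho>)) * X)"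
proof -
  define p where "p = (\<lambda>\<tau> k. C \<tau> (symbol \<kappa> k) * (b k - a k))"
  have p: "hbound \<beta> (p \<tau>) (L * X)" if "\<tau> \<in> {0..1}" for \<tau>
    unfolding p_def by (rule hbound_mult [OF X L_nonneg C_bound [OF that]]) simp
  have p1: "hbound \<beta> (p 1) (1 * X)"
    unfolding p_def C_one by (rule hbound_mult [OF X]) (auto simp: norm_exp_eq_Re)
  have Veq': "V \<tau> k = p \<tau> k + stage_map lam \<kappa> h a V \<tau> k" if "\<tau> \<in> {0..1}" for \<tau> k
    unfolding Veq [OF that] stage_map_def p_def by (simp add: algebra_simps)
  show "\<tau> \<in> {0..1} \<Longrightarrow> hbound \<beta> (\<lambda>k. V \<tau> k - U \<tau> k) (2 * (L * X))"
    by (rule stage_perturb(1) [OF \<beta> U V Uc Vc Ueq Veq' h p])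
  have "hbound \<beta> (\<lambda>k. V 1 k - U 1 k) (1 * X + h * Q lam \<rho> * (2 * (L * X)))"
    by (rule stage_perturb(3) [OF \<beta> U V Uc Vc Ueq Veq' h p p1])
  then show "hbound \<beta> (\<lambda>k. V 1 k - U 1 k) ((1 + h * (2 * L * Q lam \<rho>)) * X)"
    by (simp add: algebra_simps)
qed

lemma seq_stages_unique:
  fixes U V :: "real \<Rightarrow> int ^ 'd \<Rightarrow> complex"
  assumes U: "seq_stages \<sigma> \<rho> lam \<kappa> h v U" and V: "seq_stages \<sigma> \<rho> lam \<kappa> h v V"
    and h: "h \<ge> 0" "h * Q lam \<rho> \<le> 1 / 2" and \<tau>: "\<tau> \<in> {0..1}"
  shows "V \<tau> = U \<tau>"
proof
  fix k
  have "hbound \<sigma> (\<lambda>k. V \<tau> k - U \<tau> k) (2 * (L * 0))"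
  proof (rule stage_stable(1) [OF \<sigma>_nonneg order_refl, where a = v and b = v])
    show "hbound \<sigma> (\<lambda>k. v k - v k) 0" by simp
  qed (fact seq_stagesD(2) [OF U] seq_stagesD(2) [OF V] seq_stages_cont [OF U] seq_stages_cont [OF V]
      seq_stagesD(3) [OF U] seq_stagesD(3) [OF V] h \<tau>)+
  from hbound_coord [OF this \<sigma>_nonneg, of k] show "V \<tau> k = U \<tau> k" by simp
qed

text \<open>The Lipschitz bound in \<tau> is what makes the iterates of the existence proof
  continuous curves in H^\<sigma>.\<close>

lemma hbound_stage_map:
  fixes U :: "real \<Rightarrow> int ^ 'd \<Rightarrow> complex"
  assumes v: "hbound \<sigma> v R" and U: "\<And>r. r \<in> {0..1} \<Longrightarrow> hbound \<sigma> (U r) \<rho>"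
    and Uc: "\<And>k. continuous_on {0..1} (\<lambda>r. cubic lam (U r) k)" and h: "h \<ge> 0"
  shows "\<tau> \<in> {0..1} \<Longrightarrow> hbound \<sigma> (stage_map lam \<kappa> h v U \<tau>) (L * R + h * (L * (\<bar>lam\<bar> * K * \<rho> ^ 3)))"
    and "\<lbrakk>\<tau> \<in> {0..1}; \<tau>' \<in> {0..1}\<rbrakk> \<Longrightarrow> hbound \<sigma> (\<lambda>k. stage_map lam \<kappa> h v U \<tau> k - stage_map lam \<kappa> h v U \<tau>' k)
      ((L * R + h * (L * (\<bar>lam\<bar> * K * \<rho> ^ 3))) * \<bar>\<tau> - \<tau>'\<bar>)"
proof -
  assume \<tau>: "\<tau> \<in> {0..1}"
  have "hbound \<sigma> (\<lambda>k. integral {0..1} (\<lambda>r. A \<tau> r (symbol \<kappa> k) * cubic lam (U r) k)) (L * (\<bar>lam\<bar> * K * \<rho> ^ 3))"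
    by (rule hbound_weighted_integral) (auto intro!: hbound_cubic U A_bound \<tau> Uc A_cont)
  from hbound_add [OF hbound_mult [OF v L_nonneg C_bound [OF \<tau> Re_symbol]] hbound_cmult [OF this, of "of_real h"]]
  show "hbound \<sigma> (stage_map lam \<kappa> h v U \<tau>) (L * R + h * (L * (\<bar>lam\<bar> * K * \<rho> ^ 3)))"
    using h by (simp add: stage_map_def [abs_def])
next
  assume \<tau>: "\<tau> \<in> {0..1}" "\<tau>' \<in> {0..1}"
  have "hbound \<sigma> (\<lambda>k. integral {0..1} (\<lambda>r. (A \<tau> r (symbol \<kappa> k) - A \<tau>' r (symbol \<kappa> k)) * cubic lam (U r) k))
     (L * \<bar>\<tau> - \<tau>'\<bar> * (\<bar>lam\<bar> * K * \<rho> ^ 3))"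
    by (rule hbound_weighted_integral)
      (auto intro!: hbound_cubic U A_lip \<tau> Uc A_cont continuous_intros)
  from hbound_add [OF hbound_mult [OF v _ C_lip [OF \<tau> Re_symbol, of \<kappa>]] hbound_cmult [OF this, of "of_real h"]]
  have "hbound \<sigma> (\<lambda>k. (C \<tau> (symbol \<kappa> k) - C \<tau>' (symbol \<kappa> k)) * v k + of_real h *
     integral {0..1} (\<lambda>r. (A \<tau> r (symbol \<kappa> k) - A \<tau>' r (symbol \<kappa> k)) * cubic lam (U r) k))
     ((L * R + h * (L * (\<bar>lam\<bar> * K * \<rho> ^ 3))) * \<bar>\<tau> - \<tau>'\<bar>)"
    using h L by (simp add: algebra_simps)
  then show "hbound \<sigma> (\<lambda>k. stage_map lam \<kappa> h v U \<tau> k - stage_map lam \<kappa> h v U \<tau>' k)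
      ((L * R + h * (L * (\<bar>lam\<bar> * K * \<rho> ^ 3))) * \<bar>\<tau> - \<tau>'\<bar>)"
    unfolding stage_map_def integral_mult_diff [OF A_cont A_cont Uc, symmetric] by (simp add: algebra_simps)
qed

text \<open>Picard iteration from 0 in the ball of radius \<open>2 * L * R\<close>: the linear part
  takes half of the radius, the integral term at most a sixth, and the map contracts by 1/2. The
  limit is taken coefficientwise, and \<open>hbound_limit\<close> carries the bounds over.\<close>

lemma seq_stages_exist:
  fixes v :: "int ^ 'd \<Rightarrow> complex"
  assumes v: "hbound \<sigma> v R" and h: "h \<ge> 0" "h * Q lam (2 * L * R) \<le> 1 / 2"
  shows "\<exists>U. seq_stages \<sigma> (2 * L * R) lam \<kappa> h v U"
proof -
  define \<rho> where "\<rho> = 2 * L * R"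
  have R: "R \<ge> 0" by (rule hbound_nonneg [OF v])
  have \<rho>: "\<rho> \<ge> 0" using R L by (simp add: \<rho>_def)
  define M where "M = L * R + h * (L * (\<bar>lam\<bar> * K * \<rho> ^ 3))"
  have M: "M \<le> \<rho>"
  proof -
    have "h * (L * (\<bar>lam\<bar> * K * \<rho> ^ 3)) = h * Q lam \<rho> * \<rho> / 3"
      by (simp add: Q_def power3_eq_cube power2_eq_square)
    also have "\<dots> \<le> (1 / 2) * \<rho> / 3"
      using h \<rho> unfolding \<rho>_def [symmetric] by (intro divide_right_mono mult_right_mono) auto
    finally show ?thesis using \<rho> by (simp add: M_def \<rho>_def)
  qed
  define W where "W = rec_nat (\<lambda>_ _. 0) (\<lambda>_ U \<tau>. stage_map lam \<kappa> h v U \<tau>)"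
  have W0: "W 0 = (\<lambda>_ _. 0)" and WS: "W (Suc n) = (\<lambda>\<tau>. stage_map lam \<kappa> h v (W n) \<tau>)" for n
    by (simp_all add: W_def)
  have inv: "(\<forall>\<tau>\<in>{0..1}. hbound \<sigma> (W n \<tau>) \<rho>) \<and> (\<forall>k. continuous_on {0..1} (\<lambda>r. cubic lam (W n r) k)) \<and>
     (\<forall>\<tau>\<in>{0..1}. \<forall>\<tau>'\<in>{0..1}. hbound \<sigma> (\<lambda>k. W n \<tau> k - W n \<tau>' k) (M * \<bar>\<tau> - \<tau>'\<bar>))" for n
  proof (induction n)
    case 0
    have "M \<ge> 0" using R L h K_nonneg \<rho> by (simp add: M_def)
    then show ?case using \<rho> by (auto simp: W0 intro: hbound_le [OF hbound_zero])
  next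
    case (Suc n)
    have b: "hbound \<sigma> (W (Suc n) \<tau>) \<rho>" if "\<tau> \<in> {0..1}" for \<tau>
      unfolding WS by (rule hbound_le [OF hbound_stage_map(1) [OF v _ _ h(1) that] M [unfolded M_def]]) (use Suc in auto)
    moreover have l: "hbound \<sigma> (\<lambda>k. W (Suc n) \<tau> k - W (Suc n) \<tau>' k) (M * \<bar>\<tau> - \<tau>'\<bar>)"
      if "\<tau> \<in> {0..1}" "\<tau>' \<in> {0..1}" for \<tau> \<tau>'
      unfolding WS M_def by (rule hbound_stage_map(2) [OF v _ _ h(1) that]) (use Suc in auto)
    ultimately show ?case
      by (auto intro!: hcont_coord [OF hcont_cubic [OF hcontI_lipschitz [OF l] b] \<sigma>_nonneg])
  qed
  have contr: "hbound \<sigma> (\<lambda>k. W (Suc n) \<tau> k - W n \<tau> k) (\<rho> / 2 ^ n)" if "\<tau> \<in> {0..1}" for n \<tau>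
    using that
  proof (induction n arbitrary: \<tau>)
    case 0
    then show ?case using inv [of 1] by (simp add: W0)
  next
    case (Suc n)
    have "hbound \<sigma> (\<lambda>k. integral {0..1} (\<lambda>r. A \<tau> r (symbol \<kappa> k) * (cubic lam (W (Suc n) r) k - cubic lam (W n r) k)))
        (L * (3 * \<bar>lam\<bar> * K * \<rho>\<^sup>2 * (\<rho> / 2 ^ n)))"
    proof (rule hbound_weighted_integral)
      show "hbound \<sigma> (\<lambda>k. cubic lam (W (Suc n) r) k - cubic lam (W n r) k) (3 * \<bar>lam\<bar> * K * \<rho>\<^sup>2 * (\<rho> / 2 ^ n))"
        if "r \<in> {0..1}" for r
        by (rule hbound_cubic_diff [OF \<sigma>_nonneg order_refl _ _ Suc.IH [OF that]]) (use inv that in auto)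
    qed (use inv Suc.prems in \<open>auto intro!: A_bound continuous_intros A_cont\<close>)
    from hbound_cmult [OF this, of "of_real h"]
    have "hbound \<sigma> (\<lambda>k. W (Suc (Suc n)) \<tau> k - W (Suc n) \<tau> k) (h * Q lam \<rho> * (\<rho> / 2 ^ n))"
      using inv h unfolding WS [of "Suc n"] unfolding WS [of n] stage_map_def [of _ _ _ _ _ \<tau>]
      unfolding WS [of n, symmetric]
      by (subst (asm) integral_mult_diff2 [symmetric])
        (auto intro!: A_cont simp: Q_def algebra_simps)
    then show ?case
      by (rule hbound_le) (use mult_right_mono [OF h(2) [folded \<rho>_def], of "\<rho> / 2 ^ n"] \<rho> in simp)
  qed
  define U where "U = (\<lambda>\<tau> k. lim (\<lambda>n. W n \<tau> k))"
  have tail: "hbound \<sigma> (\<lambda>k. W (n + m) \<tau> k - W n \<tau> k) (2 * \<rho> / 2 ^ n)" if \<tau>: "\<tau> \<in> {0..1}" for n m \<tau>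
  proof -
    \<comment> \<open>The partial geometric sum is kept in closed form so that the induction on
      \<open>m\<close> closes.\<close>
    have "hbound \<sigma> (\<lambda>k. W (n + m) \<tau> k - W n \<tau> k) (2 * \<rho> / 2 ^ n - 2 * \<rho> / 2 ^ (n + m))"
    proof (induction m)
      case 0
      then show ?case by simp
    next
      case (Suc m)
      from hbound_add [OF contr [OF \<tau>, of "n + m"] Suc] show ?case
        by (simp add: mult.commute)
    qed
    then show ?thesis by (rule hbound_le) (use \<rho> in simp)
  qed
  have zero: "(\<lambda>n. 2 * \<rho> / 2 ^ n) \<longlonglongrightarrow> 0" by (rule LIMSEQ_divide_realpow_zero) simp
  have lim: "(\<lambda>n. W n \<tau> k) \<longlonglongrightarrow> U \<tau> k" if \<tau>: "\<tau> \<in> {0..1}" for \<tau> k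
  proof -
    have "Cauchy (\<lambda>n. W n \<tau> k)"
    proof (rule CauchyI')
      fix e :: real assume "e > 0"
      then have "\<forall>\<^sub>F n in sequentially. 2 * \<rho> / 2 ^ n < e" using zero by (intro order_tendstoD(2))
      then obtain N where N: "\<And>n. n \<ge> N \<Longrightarrow> 2 * \<rho> / 2 ^ n < e" by (auto simp: eventually_sequentially)
      have "dist (W m \<tau> k) (W n \<tau> k) < e" if "m \<ge> N" "n > m" for m n
        using hbound_coord [OF tail [OF \<tau>, of m "n - m"] \<sigma>_nonneg, of k] N [OF that(1)] that
        by (simp add: dist_norm norm_minus_commute)
      then show "\<exists>N. \<forall>m\<ge>N. \<forall>n>m. dist (W m \<tau> k) (W n \<tau> k) < e" by blast
    qed
    then show ?thesis unfolding U_def using Cauchy_convergent convergent_LIMSEQ_iff by blast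
  qed
  have UW: "hbound \<sigma> (\<lambda>k. U \<tau> k - W n \<tau> k) (2 * \<rho> / 2 ^ n)" if \<tau>: "\<tau> \<in> {0..1}" for n \<tau>
  proof (rule hbound_limit)
    show "\<forall>\<^sub>F m in sequentially. hbound \<sigma> (\<lambda>k. W (m + n) \<tau> k - W n \<tau> k) (2 * \<rho> / 2 ^ n)"
      using tail [OF \<tau>] by (simp add: add.commute [of _ n])
    show "(\<lambda>m. W (m + n) \<tau> k - W n \<tau> k) \<longlonglongrightarrow> U \<tau> k - W n \<tau> k" for k
      by (intro tendsto_intros LIMSEQ_ignore_initial_segment lim \<tau>)
  qed auto
  have Ub: "hbound \<sigma> (U \<tau>) \<rho>" if \<tau>: "\<tau> \<in> {0..1}" for \<tau>
    by (rule hbound_limit [OF _ lim [OF \<tau>] tendsto_const]) (use inv \<tau> in auto)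
  have Ul: "hbound \<sigma> (\<lambda>k. U \<tau> k - U \<tau>' k) (M * \<bar>\<tau> - \<tau>'\<bar>)" if \<tau>: "\<tau> \<in> {0..1}" "\<tau>' \<in> {0..1}" for \<tau> \<tau>'
    by (rule hbound_limit [OF _ tendsto_diff [OF lim [OF \<tau>(1)] lim [OF \<tau>(2)]] tendsto_const]) (use inv \<tau> in auto)
  have Uh: "hcont \<sigma> {0..1} U" by (rule hcontI_lipschitz [OF Ul])
  have Uc: "continuous_on {0..1} (\<lambda>r. cubic lam (U r) k)" for k
    by (rule hcont_coord [OF hcont_cubic [OF Uh Ub] \<sigma>_nonneg])
  have "U \<tau> k = stage_map lam \<kappa> h v U \<tau> k" if \<tau>: "\<tau> \<in> {0..1}" for \<tau> k
  proof -
    have "norm (stage_map lam \<kappa> h v U \<tau> k - W (Suc n) \<tau> k) \<le> h * Q lam \<rho> * (2 * \<rho> / 2 ^ n)" for n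
    proof -
      have "hbound \<sigma> (\<lambda>k. integral {0..1} (\<lambda>r. A \<tau> r (symbol \<kappa> k) * (cubic lam (U r) k - cubic lam (W n r) k)))
          (L * (3 * \<bar>lam\<bar> * K * \<rho>\<^sup>2 * (2 * \<rho> / 2 ^ n)))"
      proof (rule hbound_weighted_integral)
        show "hbound \<sigma> (\<lambda>k. cubic lam (U r) k - cubic lam (W n r) k) (3 * \<bar>lam\<bar> * K * \<rho>\<^sup>2 * (2 * \<rho> / 2 ^ n))"
          if "r \<in> {0..1}" for r
          by (rule hbound_cubic_diff [OF \<sigma>_nonneg order_refl Ub [OF that] _ UW [OF that]]) (use inv that in auto)
      qed (use inv \<tau> in \<open>auto intro!: A_bound continuous_intros A_cont Uc\<close>)
      from hbound_cmult [OF this, of "of_real h"]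
      have "hbound \<sigma> (\<lambda>k. stage_map lam \<kappa> h v U \<tau> k - W (Suc n) \<tau> k) (h * Q lam \<rho> * (2 * \<rho> / 2 ^ n))"
        using inv h unfolding WS stage_map_def
        by (subst (asm) integral_mult_diff2 [symmetric])
          (auto intro!: A_cont Uc simp: Q_def algebra_simps)
      then show ?thesis by (rule hbound_coord [OF _ \<sigma>_nonneg])
    qed
    then have bd: "\<forall>\<^sub>F n in sequentially. norm (stage_map lam \<kappa> h v U \<tau> k - W (Suc n) \<tau> k) \<le> h * Q lam \<rho> * (2 * \<rho> / 2 ^ n)"
      by (intro always_eventually allI)
    have "(\<lambda>n. h * Q lam \<rho> * (2 * \<rho> / 2 ^ n)) \<longlonglongrightarrow> h * Q lam \<rho> * 0"
      by (intro tendsto_intros zero)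
    then have "(\<lambda>n. h * Q lam \<rho> * (2 * \<rho> / 2 ^ n)) \<longlonglongrightarrow> 0" by (simp only: mult_zero_right)
    with bd have "(\<lambda>n. stage_map lam \<kappa> h v U \<tau> k - W (Suc n) \<tau> k) \<longlonglongrightarrow> 0"
      by (rule Lim_null_comparison)
    moreover have "(\<lambda>n. stage_map lam \<kappa> h v U \<tau> k - W (Suc n) \<tau> k) \<longlonglongrightarrow> stage_map lam \<kappa> h v U \<tau> k - U \<tau> k"
      by (intro tendsto_intros LIMSEQ_Suc lim \<tau>)
    ultimately have "stage_map lam \<kappa> h v U \<tau> k - U \<tau> k = 0" by (rule LIMSEQ_unique [rotated])
    then show ?thesis by simp
  qed
  then have "seq_stages \<sigma> \<rho> lam \<kappa> h v U" unfolding seq_stages_def using Uh Ub by blast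
  then show ?thesis unfolding \<rho>_def by blast
qed

text \<open>The integral in the scheme is taken at fixed x. Exchanging it with the Fourier series
  turns the right-hand side into the series of \<open>stage_map\<close> at every point, not just
  almost everywhere.\<close>

lemma stage_series:
  fixes v :: "'d torus_fun" and V :: "real \<Rightarrow> 'd torus_fun"
  assumes v: "v \<in> sobolev \<sigma>" and V: "\<And>r. r \<in> {0..1} \<Longrightarrow> V r \<in> L2_torus"
    and b: "\<And>r. r \<in> {0..1} \<Longrightarrow> hbound \<sigma> (fourier_coeff (V r)) \<rho>"
    and c: "hcont \<sigma> {0..1} (\<lambda>r. fourier_coeff (V r))" and \<tau>: "\<tau> \<in> {0..1}"
  shows "fun_of_V eps h (C \<tau>) v x + of_real h * integral {0..1}
      (\<lambda>r. fun_of_V eps h (A \<tau> r) (nls_nonlinearity lam (V r)) x) =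
    fourier_series (stage_map lam (h / eps) h (fourier_coeff v) (\<lambda>r. fourier_coeff (V r)) \<tau>) x"
proof -
  let ?\<kappa> = "h / eps"
  let ?a = "\<lambda>r. fourier_coeff (V r)"
  define G where "G = (\<lambda>r k. A \<tau> r (symbol ?\<kappa> k) * cubic lam (?a r) k)"
  have cc: "continuous_on {0..1} (\<lambda>r. cubic lam (?a r) k)" for k
    by (rule hcont_coord [OF hcont_cubic [OF c b] \<sigma>_nonneg])
  have Gb: "hbound \<sigma> (G r) (L * (\<bar>lam\<bar> * K * \<rho> ^ 3))" if "r \<in> {0..1}" for r
    unfolding G_def by (rule hbound_mult [OF hbound_cubic [OF b [OF that]] L_nonneg A_bound [OF \<tau> that]]) simp
  have Gc: "continuous_on {0..1} (\<lambda>r. G r k)" for k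
    unfolding G_def by (intro continuous_intros A_cont cc)
  have "integral {0..1} (\<lambda>r. fun_of_V eps h (A \<tau> r) (nls_nonlinearity lam (V r)) x) =
        integral {0..1} (\<lambda>r. fourier_series (G r) x)"
  proof (rule integral_cong)
    fix r :: real assume r: "r \<in> {0..1}"
    have "fourier_coeff (nls_nonlinearity lam (V r)) = cubic lam (?a r)"
      by (rule ext) (rule fourier_coeff_nls_nonlinearity [OF V [OF r] b [OF r]])
    then show "fun_of_V eps h (A \<tau> r) (nls_nonlinearity lam (V r)) x = fourier_series (G r) x"
      by (simp add: fun_of_V_def fourier_multiplier_series G_def symbol_def)
  qed
  also have "\<dots> = fourier_series (\<lambda>k. integral {0..1} (\<lambda>r. G r k)) x"
    by (rule integral_fourier_series [OF Gb Gc])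
  finally have I: "integral {0..1} (\<lambda>r. fun_of_V eps h (A \<tau> r) (nls_nonlinearity lam (V r)) x) =
     fourier_series (\<lambda>k. integral {0..1} (\<lambda>r. G r k)) x" .
  have Cs: "fun_of_V eps h (C \<tau>) v x = fourier_series (\<lambda>k. C \<tau> (symbol ?\<kappa> k) * fourier_coeff v k) x"
    by (simp add: fun_of_V_def fourier_multiplier_series symbol_def)
  note l1 = hbound_l1' [OF hbound_mult [OF sobolev_hbound [OF v] L_nonneg C_bound [OF \<tau> Re_symbol]]]
  have "hbound \<sigma> (\<lambda>k. integral {0..1} (\<lambda>r. G r k)) ((1 - 0) * (L * (\<bar>lam\<bar> * K * \<rho> ^ 3)))"
    by (rule hbound_integral) (auto intro: Gb integrable_continuous_real Gc)
  note l2 = hbound_l1' [OF hbound_cmult [OF this, of "of_real h"]]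
  have eq: "stage_map lam ?\<kappa> h (fourier_coeff v) ?a \<tau> =
     (\<lambda>k. C \<tau> (symbol ?\<kappa> k) * fourier_coeff v k + of_real h * integral {0..1} (\<lambda>r. G r k))"
    by (simp add: fun_eq_iff stage_map_def G_def)
  show ?thesis
    unfolding Cs I eq fourier_series_add [OF l1 l2] fourier_series_cmult ..
qed

lemma ep_stages_seq:
  fixes v :: "'d torus_fun" and U :: "real \<Rightarrow> 'd torus_fun"
  assumes v: "v \<in> sobolev \<sigma>" and U: "ep_stages C A lam \<sigma> \<rho> eps h v U" and h: "h \<ge> 0"
  shows "seq_stages \<sigma> \<rho> lam (h / eps) h (fourier_coeff v) (\<lambda>\<tau>. fourier_coeff (U \<tau>))"
  unfolding seq_stages_def
proof (intro conjI ballI allI)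
  have Uc: "sobolev_continuous_on \<sigma> {0..1} U" using U by (simp add: ep_stages_def)
  have Us: "U r \<in> sobolev \<sigma>" if "r \<in> {0..1}" for r
    using Uc that by (simp add: sobolev_continuous_on_def)
  show hc: "hcont \<sigma> {0..1} (\<lambda>\<tau>. fourier_coeff (U \<tau>))" by (rule sobolev_continuous_hcont [OF Uc])
  show hb: "hbound \<sigma> (fourier_coeff (U \<tau>)) \<rho>" if "\<tau> \<in> {0..1}" for \<tau>
    using hbound_le [OF sobolev_hbound [OF Us [OF that]]] U that by (simp add: ep_stages_def)
  fix \<tau> :: real and k assume \<tau>: "\<tau> \<in> {0..1}"
  have eq: "fun_of_V eps h (C \<tau>) v x + of_real h * integral {0..1}
      (\<lambda>r. fun_of_V eps h (A \<tau> r) (nls_nonlinearity lam (U r)) x) =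
    fourier_series (stage_map lam (h / eps) h (fourier_coeff v) (\<lambda>r. fourier_coeff (U r)) \<tau>) x" for x
    by (rule stage_series [OF v _ hb hc \<tau>]) (rule sobolev_L2 [OF Us])
  have "AE x in lebesgue. U \<tau> x = fourier_series (stage_map lam (h / eps) h (fourier_coeff v) (\<lambda>r. fourier_coeff (U r)) \<tau>) x"
    unfolding eq [symmetric] using U \<tau> unfolding ep_stages_def by blast
  moreover have "hbound \<sigma> (stage_map lam (h / eps) h (fourier_coeff v) (\<lambda>r. fourier_coeff (U r)) \<tau>)
     (L * sobolev_norm \<sigma> v + h * (L * (\<bar>lam\<bar> * K * \<rho> ^ 3)))"
    by (rule hbound_stage_map(1) [OF sobolev_hbound [OF v] hb _ h \<tau>])
      (auto intro: hcont_coord [OF hcont_cubic [OF hc hb] \<sigma>_nonneg])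
  ultimately show "fourier_coeff (U \<tau>) k = stage_map lam (h / eps) h (fourier_coeff v) (\<lambda>r. fourier_coeff (U r)) \<tau> k"
    using sobolev_integrable [OF Us [OF \<tau>]] by (auto intro!: fourier_coeff_eq_series hbound_l1')
qed

text \<open>The stages are realised by their continuous Fourier series, for which the scheme holds
  at every x.\<close>

lemma seq_ep_stages:
  fixes v :: "'d torus_fun"
  assumes v: "v \<in> sobolev \<sigma>" and U: "seq_stages \<sigma> \<rho> lam (h / eps) h (fourier_coeff v) U"
  shows "ep_stages C A lam \<sigma> \<rho> eps h v (\<lambda>\<tau>. fourier_series (U \<tau>))"
proof -
  have Ub: "hbound \<sigma> (U \<tau>) \<rho>" if "\<tau> \<in> {0..1}" for \<tau> using U that by (simp add: seq_stages_def)
  have co: "fourier_coeff (fourier_series (U \<tau>)) = U \<tau>" if "\<tau> \<in> {0..1}" for \<tau>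
    by (rule ext) (rule fourier_coeff_fourier_series [OF hbound_l1' [OF Ub [OF that]]])
  have L2: "fourier_series (U \<tau>) \<in> L2_torus" if "\<tau> \<in> {0..1}" for \<tau>
    by (rule fourier_series_L2 [OF hbound_l1' [OF Ub [OF that]]])
  have hb: "hbound \<sigma> (fourier_coeff (fourier_series (U \<tau>))) \<rho>" if "\<tau> \<in> {0..1}" for \<tau>
    by (simp only: co [OF that] Ub [OF that])
  have Us: "fourier_series (U \<tau>) \<in> sobolev \<sigma>" if "\<tau> \<in> {0..1}" for \<tau>
    by (rule sobolevI_hbound [OF L2 [OF that] hb [OF that]])
  have hc: "hcont \<sigma> {0..1} (\<lambda>\<tau>. fourier_coeff (fourier_series (U \<tau>)))"
    unfolding hcont_def
  proof (intro ballI allI impI)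
    fix t e :: real assume t: "t \<in> {0..1}" and e: "e > 0"
    have "\<forall>\<^sub>F r in at t within {0..1}. hbound \<sigma> (\<lambda>k. U r k - U t k) e"
      using seq_stagesD(1) [OF U] t e by (simp add: hcont_def)
    moreover have "\<forall>\<^sub>F r in at t within {0..1}. r \<in> {0..1}" by (simp add: eventually_at_filter)
    ultimately show "\<forall>\<^sub>F r in at t within {0..1}. hbound \<sigma> (\<lambda>k. fourier_coeff (fourier_series (U r)) k - fourier_coeff (fourier_series (U t)) k) e"
      by eventually_elim (simp only: co t)
  qed
  show ?thesis
    unfolding ep_stages_def
  proof (intro conjI ballI hcont_sobolev_continuous Us hc sobolev_norm_le hb AE_I2)
    fix \<tau> :: real and x :: "real ^ 'd" assume \<tau>: "\<tau> \<in> {0..1}"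
    have eq: "fun_of_V eps h (C \<tau>) v x + of_real h * integral {0..1}
        (\<lambda>r. fun_of_V eps h (A \<tau> r) (nls_nonlinearity lam (fourier_series (U r))) x) =
      fourier_series (stage_map lam (h / eps) h (fourier_coeff v) (\<lambda>r. fourier_coeff (fourier_series (U r))) \<tau>) x"
      by (rule stage_series [OF v L2 hb hc \<tau>])
    have "stage_map lam (h / eps) h (fourier_coeff v) (\<lambda>r. fourier_coeff (fourier_series (U r))) \<tau> =
          stage_map lam (h / eps) h (fourier_coeff v) U \<tau>"
      unfolding stage_map_def by (intro ext arg_cong2 [of _ _ _ _ plus] arg_cong2 [of _ _ _ _ times] refl integral_cong) (simp add: co)
    also have "\<dots> = U \<tau>" using U \<tau> by (auto simp: seq_stages_def)
    finally show "fourier_series (U \<tau>) x = fun_of_V eps h (C \<tau>) v x + of_real h * integral {0..1}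
      (\<lambda>r. fun_of_V eps h (A \<tau> r) (nls_nonlinearity lam (fourier_series (U r))) x)"
      by (simp only: eq)
  qed auto
qed

text \<open>The choice in \<open>ep_step\<close> fixes a function only up to null sets, but
  uniqueness fixes its coefficients, and the error analysis sees nothing else.\<close>

lemma ep_step_seq:
  fixes v :: "'d torus_fun"
  assumes v: "v \<in> sobolev \<sigma>" "hbound \<sigma> (fourier_coeff v) R" and h: "h \<ge> 0" "h * Q lam (2 * L * R) \<le> 1 / 2"
  shows "ep_uniquely_solvable C A lam \<sigma> (2 * L * R) eps h v"
    and "ep_step C A lam \<sigma> (2 * L * R) eps h v \<in> sobolev \<sigma>"
    and "\<exists>U. seq_stages \<sigma> (2 * L * R) lam (h / eps) h (fourier_coeff v) U \<and>
      fourier_coeff (ep_step C A lam \<sigma> (2 * L * R) eps h v) = U 1"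
proof -
  let ?\<rho> = "2 * L * R"
  obtain U where U: "seq_stages \<sigma> ?\<rho> lam (h / eps) h (fourier_coeff v) U"
    using seq_stages_exist [OF v(2) h] by blast
  have Ue: "ep_stages C A lam \<sigma> ?\<rho> eps h v (\<lambda>\<tau>. fourier_series (U \<tau>))"
    by (rule seq_ep_stages [OF v(1) U])
  have AE: "AE x in lebesgue. W \<tau> x = fourier_series (U \<tau>) x" if W: "ep_stages C A lam \<sigma> ?\<rho> eps h v W" and \<tau>: "\<tau> \<in> {0..1}" for W \<tau>
  proof -
    have "fourier_coeff (W \<tau>) = U \<tau>"
      by (rule seq_stages_unique [OF U ep_stages_seq [OF v(1) W h(1)] h \<tau>])
    moreover have "W \<tau> \<in> sobolev \<sigma>"
      using W \<tau> by (simp add: ep_stages_def sobolev_continuous_on_def)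
    ultimately show ?thesis using sobolev_series_AE [OF sobolev_L2 sobolev_hbound] by metis
  qed
  show "ep_uniquely_solvable C A lam \<sigma> ?\<rho> eps h v"
    unfolding ep_uniquely_solvable_def using Ue AE by blast
  define W where "W = (SOME U. ep_stages C A lam \<sigma> ?\<rho> eps h v U)"
  have W: "ep_stages C A lam \<sigma> ?\<rho> eps h v W"
    unfolding W_def by (rule someI [where P = "ep_stages C A lam \<sigma> ?\<rho> eps h v", OF Ue])
  have st: "ep_step C A lam \<sigma> ?\<rho> eps h v = W 1" by (simp add: ep_step_def W_def)
  show "ep_step C A lam \<sigma> ?\<rho> eps h v \<in> sobolev \<sigma>"
    using W unfolding st by (simp add: ep_stages_def sobolev_continuous_on_def)
  show "\<exists>U. seq_stages \<sigma> ?\<rho> lam (h / eps) h (fourier_coeff v) U \<and>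
      fourier_coeff (ep_step C A lam \<sigma> ?\<rho> eps h v) = U 1"
    unfolding st using ep_stages_seq [OF v(1) W h(1)] by blast
qed

end

section \<open>Global error from local errors\<close>

text \<open>The solution over one step, time rescaled to [0, 1], in Duhamel form. This form involves
  no time derivative, which exists only in a weaker space, and has the same shape as the stage
  equations.\<close>

definition exact_flow :: "real \<Rightarrow> real \<Rightarrow> real \<Rightarrow> real \<Rightarrow> real \<Rightarrow> (real \<Rightarrow> int ^ 'd::finite \<Rightarrow> complex) \<Rightarrow> bool" where
  "exact_flow lam \<kappa> h s M v \<longleftrightarrow> (\<forall>\<tau>\<in>{0..1}. hbound s (v \<tau>) M) \<and>
     (\<forall>k. continuous_on {0..1} (\<lambda>r. cubic lam (v r) k)) \<and>
     (\<forall>\<tau>\<in>{0..1}. \<forall>k. ((\<lambda>r. exp (of_real (\<tau> - r) * symbol \<kappa> k) * (of_real h * cubic lam (v r) k))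
        has_integral (v \<tau> k - exp (of_real \<tau> * symbol \<kappa> k) * v 0 k)) {0..\<tau>})"

lemma exact_flowD:
  assumes "exact_flow lam \<kappa> h s M v"
  shows "\<tau> \<in> {0..1} \<Longrightarrow> hbound s (v \<tau>) M"
    and "continuous_on {0..1} (\<lambda>r. cubic lam (v r) k)"
    and "\<tau> \<in> {0..1} \<Longrightarrow> ((\<lambda>r. exp (of_real (\<tau> - r) * symbol \<kappa> k) * (of_real h * cubic lam (v r) k))
        has_integral (v \<tau> k - exp (of_real \<tau> * symbol \<kappa> k) * v 0 k)) {0..\<tau>}"
  using assms unfolding exact_flow_def by blast+

text \<open>Variation of constants: the derivative of exp((\<tau> - r) z) y(r) in r is the
  integrand.\<close>

lemma duhamel:
  fixes y F :: "real \<Rightarrow> complex"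
  assumes y: "\<And>r. r \<in> {0..1} \<Longrightarrow> (y has_vector_derivative (z * y r + F r)) (at r within {0..1})"
    and \<tau>: "\<tau> \<in> {0..1}"
  shows "((\<lambda>r. exp (of_real (\<tau> - r) * z) * F r) has_integral (y \<tau> - exp (of_real \<tau> * z) * y 0)) {0..\<tau>}"
proof -
  let ?e = "\<lambda>r. exp (of_real (\<tau> - r) * z) * y r"
  have "((\<lambda>r. exp (of_real (\<tau> - r) * z) * F r) has_integral (?e \<tau> - ?e 0)) {0..\<tau>}"
  proof (rule fundamental_theorem_of_calculus)
    fix r assume r: "r \<in> {0..\<tau>}"
    have "(y has_vector_derivative (z * y r + F r)) (at r within {0..\<tau>})"
      by (rule has_vector_derivative_within_subset [OF y]) (use r \<tau> in auto)
    moreover have "((\<lambda>r. exp (of_real (\<tau> - r) * z)) has_vector_derivative (- z * exp (of_real (\<tau> - r) * z))) (at r within {0..\<tau>})"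
    proof -
      have "((\<lambda>w. exp ((of_real \<tau> - w) * z)) has_field_derivative (- z * exp ((of_real \<tau> - of_real r) * z))) (at (of_real r))"
        by (auto intro!: derivative_eq_intros)
      from has_vector_derivative_real_field [OF this] show ?thesis by simp
    qed
    ultimately have "(?e has_vector_derivative exp (of_real (\<tau> - r) * z) * (z * y r + F r) + (- z * exp (of_real (\<tau> - r) * z)) * y r) (at r within {0..\<tau>})"
      by (intro has_vector_derivative_mult)
    then show "(?e has_vector_derivative exp (of_real (\<tau> - r) * z) * F r) (at r within {0..\<tau>})"
      by (simp add: algebra_simps)
  qed (use \<tau> in auto)
  then show ?thesis by simp
qed

context algebra_index begin

lemma hbound_cubic_low:
  fixes a :: "int ^ 'd \<Rightarrow> complex"
  assumes "0 \<le> \<beta>" "\<beta> \<le> \<sigma>" "hbound \<sigma> a r" "hbound \<beta> a X"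
  shows "hbound \<beta> (cubic lam a) (\<bar>lam\<bar> * K * r\<^sup>2 * X)"
  using hbound_cmult [OF hbound_tri3 [OF assms(1,2,3,3,4)], of "- \<i> * of_real lam"]
  by (simp add: cubic_def [abs_def] power2_eq_square norm_mult mult_ac)

text \<open>Rescaling time by h multiplies the generator and the nonlinearity by h, so 1 / eps
  becomes h / eps in the symbol.\<close>

lemma nls_exact_flow:
  fixes u :: "real \<Rightarrow> 'd torus_fun"
  assumes sol: "nls_solution lam eps T (\<sigma> + 2) u0 u"
    and M: "\<And>t. t \<in> {0..T} \<Longrightarrow> sobolev_norm (\<sigma> + 2) (u t) \<le> M"
    and h: "h > 0" and t0: "t0 \<ge> 0" "t0 + h \<le> T"
  shows "exact_flow lam (h / eps) h (\<sigma> + 2) M (\<lambda>\<tau>. fourier_coeff (u (t0 + \<tau> * h)))"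
proof -
  have uc: "sobolev_continuous_on (\<sigma> + 2) {0..T} u" using sol by (simp add: nls_solution_def)
  have us: "u t \<in> sobolev (\<sigma> + 2)" if "t \<in> {0..T}" for t using uc that by (simp add: sobolev_continuous_on_def)
  have hb: "hbound (\<sigma> + 2) (fourier_coeff (u t)) M" if "t \<in> {0..T}" for t
    by (rule hbound_le [OF sobolev_hbound [OF us [OF that]] M [OF that]])
  have hs: "hbound \<sigma> (fourier_coeff (u t)) M" if "t \<in> {0..T}" for t
    by (rule hbound_weaken [OF hb [OF that]]) simp
  have hc: "hcont \<sigma> {0..T} (\<lambda>t. fourier_coeff (u t))"
    using sobolev_continuous_hcont [OF uc] unfolding hcont_def
    by (auto elim!: eventually_mono ballE allE intro: hbound_weaken)
  have cc: "continuous_on {0..T} (\<lambda>t. cubic lam (fourier_coeff (u t)) k)" for k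
    by (rule hcont_coord [OF hcont_cubic [OF hc hs] \<sigma>_nonneg])
  have mem: "t0 + \<tau> * h \<in> {0..T}" if "\<tau> \<in> {0..1}" for \<tau>
  proof -
    have "0 \<le> \<tau> * h" "\<tau> * h \<le> 1 * h" using that h by (auto intro: mult_right_mono)
    then show ?thesis using t0 by auto
  qed
  show ?thesis
    unfolding exact_flow_def
  proof (intro conjI ballI allI hb mem)
    show "continuous_on {0..1} (\<lambda>r. cubic lam (fourier_coeff (u (t0 + r * h))) k)" for k
      by (rule continuous_on_compose2 [OF cc]) (use mem in \<open>auto intro!: continuous_intros\<close>)
    fix \<tau> :: real and k assume \<tau>: "\<tau> \<in> {0..1}"
    show "((\<lambda>r. exp (of_real (\<tau> - r) * symbol (h / eps) k) * (of_real h * cubic lam (fourier_coeff (u (t0 + r * h))) k))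
        has_integral (fourier_coeff (u (t0 + \<tau> * h)) k - exp (of_real \<tau> * symbol (h / eps) k) * fourier_coeff (u (t0 + 0 * h)) k)) {0..\<tau>}"
    proof (rule duhamel [OF _ \<tau>, where y = "\<lambda>r. fourier_coeff (u (t0 + r * h)) k"])
      fix r :: real assume r: "r \<in> {0..1}"
      let ?f = "\<lambda>r. t0 + r * h"
      have "(?f has_vector_derivative h) (at r within {0..1})"
        by (auto intro!: derivative_eq_intros simp: has_real_derivative_iff_has_vector_derivative [symmetric])
      moreover have "((\<lambda>t. fourier_coeff (u t) k) has_vector_derivative
          (symbol (1 / eps) k * fourier_coeff (u (?f r)) k + cubic lam (fourier_coeff (u (?f r))) k)) (at (?f r) within ?f ` {0..1})"
        by (rule has_vector_derivative_within_subset [OF nls_solution_fourier [OF sol mem [OF r]]]) (use mem in auto)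
      ultimately have "((\<lambda>t. fourier_coeff (u t) k) \<circ> ?f has_vector_derivative
          h *\<^sub>R (symbol (1 / eps) k * fourier_coeff (u (?f r)) k + cubic lam (fourier_coeff (u (?f r))) k)) (at r within {0..1})"
        by (rule vector_diff_chain_within)
      moreover have "h *\<^sub>R (symbol (1 / eps) k * fourier_coeff (u (?f r)) k + cubic lam (fourier_coeff (u (?f r))) k) =
          symbol (h / eps) k * fourier_coeff (u (?f r)) k + of_real h * cubic lam (fourier_coeff (u (?f r))) k"
        by (simp add: symbol_def scaleR_conv_of_real algebra_simps)
      ultimately show "((\<lambda>r. fourier_coeff (u (?f r)) k) has_vector_derivative
          symbol (h / eps) k * fourier_coeff (u (?f r)) k + of_real h * cubic lam (fourier_coeff (u (?f r))) k) (at r within {0..1})"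
        by (simp add: o_def)
    qed
  qed
qed

end

section \<open>The defect of the exact solution\<close>

context ep_method begin

text \<open>The residual of the exact solution in the stage equations that start from its own value
  \<open>v 0\<close>.\<close>

definition defect :: "real \<Rightarrow> real \<Rightarrow> real \<Rightarrow> (real \<Rightarrow> int ^ 'd \<Rightarrow> complex) \<Rightarrow> real \<Rightarrow> int ^ 'd::finite \<Rightarrow> complex" where
  "defect lam \<kappa> h v \<tau> k = v \<tau> k - stage_map lam \<kappa> h (v 0) v \<tau> k"

lemma defect_eq:
  assumes v: "exact_flow lam \<kappa> h s M v" and \<tau>: "\<tau> \<in> {0..1}"
  shows "defect lam \<kappa> h v \<tau> k = (exp (of_real \<tau> * symbol \<kappa> k) - C \<tau> (symbol \<kappa> k)) * v 0 k +
     of_real h * (integral {0..\<tau>} (\<lambda>r. exp (of_real (\<tau> - r) * symbol \<kappa> k) * cubic lam (v r) k) -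
       integral {0..1} (\<lambda>r. A \<tau> r (symbol \<kappa> k) * cubic lam (v r) k))"
proof -
  have "v \<tau> k - exp (of_real \<tau> * symbol \<kappa> k) * v 0 k =
     integral {0..\<tau>} (\<lambda>r. of_real h * (exp (of_real (\<tau> - r) * symbol \<kappa> k) * cubic lam (v r) k))"
    using integral_unique [OF exact_flowD(3) [OF v \<tau>]] by (simp add: mult.left_commute)
  then show ?thesis by (simp add: defect_def stage_map_def algebra_simps)
qed

text \<open>Since \<open>C 1 z = exp z\<close>, the linear part cancels and the residual of the
  final stage carries a factor h.\<close>

lemma defect_one:
  assumes v: "exact_flow lam \<kappa> h s M v"
  shows "defect lam \<kappa> h v 1 k = of_real h *
    integral {0..1} (\<lambda>r. (exp (of_real (1 - r) * symbol \<kappa> k) - A 1 r (symbol \<kappa> k)) * cubic lam (v r) k)"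
proof -
  have "integral {0..1} (\<lambda>r. exp (of_real (1 - r) * symbol \<kappa> k) * cubic lam (v r) k) -
       integral {0..1} (\<lambda>r. A 1 r (symbol \<kappa> k) * cubic lam (v r) k) =
     integral {0..1} (\<lambda>r. (exp (of_real (1 - r) * symbol \<kappa> k) - A 1 r (symbol \<kappa> k)) * cubic lam (v r) k)"
    by (rule integral_mult_diff [OF _ A_cont exact_flowD(2) [OF v]]) (intro continuous_intros)
  then show ?thesis using defect_eq [OF v, of 1 k] by (simp add: C_one)
qed

end

lemma hbound_flow_integral:
  fixes G :: "real \<Rightarrow> int ^ 'd::finite \<Rightarrow> complex"
  assumes G: "\<And>r. r \<in> {0..1} \<Longrightarrow> hbound s (G r) B"
    and c: "\<And>k. continuous_on {0..1} (\<lambda>r. G r k)" and \<tau>: "\<tau> \<in> {0..1}"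
  shows "hbound s (\<lambda>k. integral {0..\<tau>} (\<lambda>r. exp (of_real (\<tau> - r) * symbol \<kappa> k) * G r k)) B"
proof (rule hbound_le [OF hbound_integral])
  have B: "B \<ge> 0" using hbound_nonneg [OF G [of 0]] by simp
  show "hbound s (\<lambda>k. exp (of_real (\<tau> - r) * symbol \<kappa> k) * G r k) (1 * B)" if "r \<in> {0..\<tau>}" for r
    by (rule hbound_mult [OF G]) (use that \<tau> in \<open>auto simp del: of_real_diff\<close>)
  show "(\<tau> - 0) * (1 * B) \<le> B" using B \<tau> by (simp add: mult_left_le_one_le)
  show "(\<lambda>r. exp (of_real (\<tau> - r) * symbol \<kappa> k) * G r k) integrable_on {0..\<tau>}" for k
    by (intro integrable_continuous_real continuous_intros continuous_on_subset [OF c]) (use \<tau> in auto)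
qed (use \<tau> in auto)

lemma one_plus_power_le_exp: "x \<ge> 0 \<Longrightarrow> (1 + x) ^ n \<le> exp (real n * x)" for x :: real
  using power_mono [OF exp_ge_add_one_self [of x], of n] by (simp add: exp_of_nat_mult)

section \<open>Error and growth over one step, and the global error\<close>

context ep_setting begin

text \<open>The exact solution satisfies the stage equations with residual \<open>defect\<close>, so
  \<open>stage_perturb\<close> applies. The radius \<open>max \<rho> M\<close> covers the numerical
  stages and the exact solution together.\<close>

lemma defect_error:
  fixes U v :: "real \<Rightarrow> int ^ 'd \<Rightarrow> complex"
  assumes \<beta>: "0 \<le> \<beta>" "\<beta> \<le> \<sigma>" and s: "s \<ge> \<sigma>"
    and v: "exact_flow lam \<kappa> h s M v" and U: "seq_stages s \<rho> lam \<kappa> h (v 0) U"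
    and h: "h \<ge> 0" "h * Q lam (max \<rho> M) \<le> 1 / 2"
    and p: "\<And>\<tau>. \<tau> \<in> {0..1} \<Longrightarrow> hbound \<beta> (defect lam \<kappa> h v \<tau>) P"
  shows "\<tau> \<in> {0..1} \<Longrightarrow> hbound \<beta> (\<lambda>k. v \<tau> k - U \<tau> k) (2 * P)"
    and "\<tau> \<in> {0..1} \<Longrightarrow> hbound \<beta> (\<lambda>k. v \<tau> k - U \<tau> k - defect lam \<kappa> h v \<tau> k) (h * Q lam (max \<rho> M) * (2 * P))"
    and "hbound \<beta> (defect lam \<kappa> h v 1) P1 \<Longrightarrow>
      hbound \<beta> (\<lambda>k. v 1 k - U 1 k) (P1 + h * Q lam (max \<rho> M) * (2 * P))"
proof -
  have Ub: "hbound \<sigma> (U r) (max \<rho> M)" if "r \<in> {0..1}" for r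
    by (rule hbound_le [OF hbound_weaken [OF seq_stagesD(2) [OF U that] s]]) simp
  have Vb: "hbound \<sigma> (v r) (max \<rho> M)" if "r \<in> {0..1}" for r
    by (rule hbound_le [OF hbound_weaken [OF exact_flowD(1) [OF v that] s]]) simp
  have hU: "hcont \<sigma> {0..1} U"
    using seq_stagesD(1) [OF U] s unfolding hcont_def
    by (auto elim!: eventually_mono ballE allE intro: hbound_weaken)
  have Uc: "continuous_on {0..1} (\<lambda>r. cubic lam (U r) k)" for k
    by (rule hcont_coord [OF hcont_cubic [OF hU Ub] \<sigma>_nonneg])
  have Veq: "v \<tau> k = defect lam \<kappa> h v \<tau> k + stage_map lam \<kappa> h (v 0) v \<tau> k" for \<tau> k
    by (simp add: defect_def)
  note st = stage_perturb [OF \<beta> Ub Vb Uc exact_flowD(2) [OF v] seq_stagesD(3) [OF U] Veq h p]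
  show "\<tau> \<in> {0..1} \<Longrightarrow> hbound \<beta> (\<lambda>k. v \<tau> k - U \<tau> k) (2 * P)" by (rule st(1))
  show "hbound \<beta> (defect lam \<kappa> h v 1) P1 \<Longrightarrow>
      hbound \<beta> (\<lambda>k. v 1 k - U 1 k) (P1 + h * Q lam (max \<rho> M) * (2 * P))" by (rule st(3))
  show "\<tau> \<in> {0..1} \<Longrightarrow> hbound \<beta> (\<lambda>k. v \<tau> k - U \<tau> k - defect lam \<kappa> h v \<tau> k) (h * Q lam (max \<rho> M) * (2 * P))"
    by (rule st(2))
qed

lemma algebra_index_up: "algebra_index TYPE('d) (\<sigma> + 2)"
  using \<sigma> by unfold_locales simp

lemma ep_setting_up: "ep_setting TYPE('d) (\<sigma> + 2) C A L"
  by (intro ep_setting.intro algebra_index_up ep_method_axioms)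

text \<open>The stage residuals are O(\<kappa>) and reach the final value with a further factor h;
  the final residual is O(h \<kappa>). Two derivatives are spent, from \<sigma> + 2 to \<sigma>.
  Summed over the steps this yields an error O(\<kappa>), enough to keep the iterates
  bounded.\<close>

lemma base_local_error:
  fixes U v :: "real \<Rightarrow> int ^ 'd \<Rightarrow> complex"
  assumes v: "exact_flow lam \<kappa> h (\<sigma> + 2) M v" and U: "seq_stages (\<sigma> + 2) \<rho> lam \<kappa> h (v 0) U"
    and h: "0 < h" "h \<le> \<kappa>" "h * Q lam (max \<rho> M) \<le> 1 / 2"
  shows "hbound \<sigma> (\<lambda>k. v 1 k - U 1 k) (h * ((L * (\<bar>lam\<bar> * algebra_index.K TYPE('d) (\<sigma> + 2) * M ^ 3) +
     2 * Q lam (max \<rho> M) * (L * M + (1 + L) * (\<bar>lam\<bar> * K * M ^ 3))) * \<kappa>))"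
proof -
  interpret hi: algebra_index "TYPE('d)" "\<sigma> + 2" by (rule algebra_index_up)
  have vs: "hbound \<sigma> (v r) M" if "r \<in> {0..1}" for r
    by (rule hbound_weaken [OF exact_flowD(1) [OF v that]]) simp
  define F where "F = \<bar>lam\<bar> * K * M ^ 3"
  define F2 where "F2 = \<bar>lam\<bar> * hi.K * M ^ 3"
  define q where "q = Q lam (max \<rho> M)"
  have M: "M \<ge> 0" using hbound_nonneg [OF vs [of 0]] by simp
  have F: "F \<ge> 0" using M K_nonneg by (simp add: F_def)
  have q: "q \<ge> 0" unfolding q_def by (rule Q_nonneg)
  have \<kappa>: "\<kappa> \<ge> 0" using h by simp
  have cF: "hbound \<sigma> (cubic lam (v r)) F" if "r \<in> {0..1}" for r
    unfolding F_def by (rule hbound_cubic [OF vs [OF that]])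
  have cF2: "hbound (\<sigma> + 2) (cubic lam (v r)) F2" if "r \<in> {0..1}" for r
    unfolding F2_def by (rule hi.hbound_cubic [OF exact_flowD(1) [OF v that]])
  have p: "hbound \<sigma> (defect lam \<kappa> h v \<tau>) (\<kappa> * (L * M + (1 + L) * F))" if \<tau>: "\<tau> \<in> {0..1}" for \<tau>
  proof -
    \<comment> \<open>The order equals \<sigma>, written in the form that
      \<open>hbound_multiplier\<close> produces.\<close>
    have "hbound (\<sigma> + 2 - 2 * real 1) (\<lambda>k. (exp (of_real \<tau> * symbol \<kappa> k) - C \<tau> (symbol \<kappa> k)) * v 0 k) (L * \<kappa> * M)"
      using C_consistent [OF \<tau>, of "symbol \<kappa> _"] L_nonneg \<kappa>
      by (intro hbound_multiplier exact_flowD(1) [OF v]) (auto simp: norm_symbol mult.assoc)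
    then have 1: "hbound \<sigma> (\<lambda>k. (exp (of_real \<tau> * symbol \<kappa> k) - C \<tau> (symbol \<kappa> k)) * v 0 k) (L * \<kappa> * M)" by simp
    have 2: "hbound \<sigma> (\<lambda>k. integral {0..\<tau>} (\<lambda>r. exp (of_real (\<tau> - r) * symbol \<kappa> k) * cubic lam (v r) k)) F"
      by (rule hbound_flow_integral [OF cF exact_flowD(2) [OF v] \<tau>])
    have 3: "hbound \<sigma> (\<lambda>k. integral {0..1} (\<lambda>r. A \<tau> r (symbol \<kappa> k) * cubic lam (v r) k)) (L * F)"
      by (rule hbound_weighted_integral [OF cF exact_flowD(2) [OF v]]) (auto intro: A_bound \<tau> A_cont)
    have "hbound \<sigma> (defect lam \<kappa> h v \<tau>) (L * \<kappa> * M + norm (of_real h :: complex) * (F + L * F))"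
      unfolding defect_eq [OF v \<tau>, abs_def] by (intro hbound_add hbound_cmult hbound_diff 1 2 3)
    moreover have "L * \<kappa> * M + norm (of_real h :: complex) * (F + L * F) \<le> \<kappa> * (L * M + (1 + L) * F)"
      using mult_right_mono [OF h(2), of "F + L * F"] F L_nonneg h by (simp add: algebra_simps)
    ultimately show ?thesis by (rule hbound_le)
  qed
  have p1: "hbound \<sigma> (defect lam \<kappa> h v 1) (h * (L * \<kappa> * F2))"
  proof -
    have "hbound (\<sigma> + 2 - 2 * real 1) (\<lambda>k. (exp (of_real (1 - r) * symbol \<kappa> k) - A 1 r (symbol \<kappa> k)) * cubic lam (v r) k) (L * \<kappa> * F2)"
      if r: "r \<in> {0..1}" for r
      using A_consistent [OF r, of "symbol \<kappa> _"] L_nonneg \<kappa>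
      by (intro hbound_multiplier cF2 r) (auto simp: norm_symbol mult.assoc)
    then have "hbound \<sigma> (\<lambda>k. integral {0..1} (\<lambda>r. (exp (of_real (1 - r) * symbol \<kappa> k) - A 1 r (symbol \<kappa> k)) * cubic lam (v r) k)) ((1 - 0) * (L * \<kappa> * F2))"
      by (intro hbound_integral integrable_continuous_real continuous_intros A_cont exact_flowD(2) [OF v]) auto
    from hbound_cmult [OF this, of "of_real h"] show ?thesis
      unfolding defect_one [OF v, abs_def] using h by simp
  qed
  have "hbound \<sigma> (\<lambda>k. v 1 k - U 1 k) (h * (L * \<kappa> * F2) + h * q * (2 * (\<kappa> * (L * M + (1 + L) * F))))"
    unfolding q_def
    by (rule defect_error(3) [OF \<sigma>_nonneg order_refl _ v U _ h(3) p p1]) (use h in auto)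
  then show ?thesis
    unfolding q_def [symmetric] F_def [symmetric] F2_def [symmetric] by (simp add: algebra_simps)
qed

text \<open>The constant of \<open>hbound_cubic_tame\<close> for the orders \<sigma> and \<sigma> +
  2.\<close>

definition growth_const where
  "growth_const lam = \<bar>lam\<bar> * tame_const TYPE('d) (\<sigma> + 2) \<sigma> * (prod_const TYPE('d) \<sigma> + 2 * tame_const TYPE('d) (\<sigma> + 2) \<sigma>)"

text \<open>The rate contains the H^\<sigma> bound \<open>M\<close> of the initial value, but
  neither \<open>\<rho>\<close> nor the H^(\<sigma> + 2) bound \<open>a\<close>. Absorption is used
  twice: in H^\<sigma> it brings the stages from \<open>\<rho>\<close> down to
  \<open>2 * (L * M)\<close>, and the tame estimate based on this bound makes it work in H^(\<sigma>
  + 2).\<close>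

lemma stage_growth:
  fixes U :: "real \<Rightarrow> int ^ 'd \<Rightarrow> complex"
  assumes U: "seq_stages (\<sigma> + 2) \<rho> lam \<kappa> h v U"
    and v: "hbound (\<sigma> + 2) v a" "hbound \<sigma> v M"
    and h: "h \<ge> 0" "h * Q lam \<rho> \<le> 1 / 2" "h * (L * growth_const lam * (2 * (L * M))\<^sup>2) \<le> 1 / 2"
  shows "hbound (\<sigma> + 2) (U 1) ((1 + h * (2 * L * (L * growth_const lam * (2 * (L * M))\<^sup>2))) * a)"
proof -
  define T0 where "T0 = growth_const lam"
  have T0: "T0 \<ge> 0" by (simp add: T0_def growth_const_def)
  note h = h [folded T0_def]
  have M: "M \<ge> 0" and a: "a \<ge> 0" using v by (auto intro: hbound_nonneg)
  note Ub = seq_stagesD(2) [OF U] and Ueq = seq_stagesD(3) [OF U]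
  have Us: "hbound \<sigma> (U r) \<rho>" if "r \<in> {0..1}" for r
    by (rule hbound_weaken [OF Ub [OF that]]) simp
  have hU: "hcont \<sigma> {0..1} U"
    using seq_stagesD(1) [OF U] unfolding hcont_def
    by (auto elim!: eventually_mono ballE allE intro: hbound_weaken)
  have Uc: "continuous_on {0..1} (\<lambda>r. cubic lam (U r) k)" for k
    by (rule hcont_coord [OF hcont_cubic [OF hU Us] \<sigma>_nonneg])
  have step: "hbound s (U \<tau>) (c * b + h * (L * Y))"
    if "hbound s v b" "\<And>r. r \<in> {0..1} \<Longrightarrow> hbound s (cubic lam (U r)) Y" and \<tau>: "\<tau> \<in> {0..1}"
      and c: "c \<ge> 0" "\<And>k :: int ^ 'd. norm (C \<tau> (symbol \<kappa> k)) \<le> c" for s b Y \<tau> c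
  proof -
    have "hbound s (\<lambda>k. integral {0..1} (\<lambda>r. A \<tau> r (symbol \<kappa> k) * cubic lam (U r) k)) (L * Y)"
      by (rule hbound_weighted_integral [OF that(2) Uc]) (auto intro: A_bound \<tau> A_cont)
    note I = this
    have "hbound s (\<lambda>k. C \<tau> (symbol \<kappa> k) * v k) (c * b)"
      by (rule hbound_mult [OF that(1) c(1)]) (rule c(2))
    from hbound_add [OF this hbound_cmult [OF I, of "of_real h"]]
    have "hbound s (stage_map lam \<kappa> h v U \<tau>) (c * b + h * (L * Y))"
      using h by (simp add: stage_map_def [abs_def])
    moreover have "stage_map lam \<kappa> h v U \<tau> = U \<tau>" by (rule ext) (rule Ueq [OF \<tau>, symmetric])
    ultimately show ?thesis by simp
  qed
  have low: "hbound \<sigma> (U \<tau>) (2 * (L * M))" if \<tau>: "\<tau> \<in> {0..1}" for \<tau>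
  proof (rule hbound_self_improve [where J = "{0..1}"])
    show "L * M \<ge> 0" using L_nonneg M by simp
    fix X t :: real assume X: "\<And>t. t \<in> {0..1} \<Longrightarrow> hbound \<sigma> (U t) X" "X \<ge> 0" and t: "t \<in> {0..1}"
    have "hbound \<sigma> (U t) (L * M + h * (L * (\<bar>lam\<bar> * K * \<rho>\<^sup>2 * X)))"
      by (rule step [OF v(2) hbound_cubic_low [OF \<sigma>_nonneg order_refl Us X(1)] t L_nonneg C_bound [OF t]]) auto
    \<comment> \<open>The 3 is the factor in \<open>Q\<close> that comes from the Lipschitz
      estimate; the plain cubic bound is without it.\<close>
    moreover have "h * (L * (\<bar>lam\<bar> * K * \<rho>\<^sup>2 * X)) = (h * Q lam \<rho>) * X / 3"
      by (simp add: Q_def)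
    moreover have "(h * Q lam \<rho>) * X / 3 \<le> X / 2" using mult_right_mono [OF h(2) X(2)] X(2) by simp
    ultimately show "hbound \<sigma> (U t) (L * M + X / 2)" by (auto intro: hbound_le)
  qed (use Us \<tau> in auto)
  let ?g = "L * T0 * (2 * (L * M))\<^sup>2"
  have tame: "hbound (\<sigma> + 2) (cubic lam (U r)) (T0 * (2 * (L * M))\<^sup>2 * X)"
    if "hbound (\<sigma> + 2) (U r) X" "r \<in> {0..1}" for r X
    unfolding T0_def growth_const_def by (rule hbound_cubic_tame [OF _ that(1) low [OF that(2)]]) simp
  have high: "hbound (\<sigma> + 2) (U \<tau>) (2 * (L * a))" if \<tau>: "\<tau> \<in> {0..1}" for \<tau>
  proof (rule hbound_self_improve [where J = "{0..1}"])
    show "L * a \<ge> 0" using L_nonneg a by simp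
    fix X t :: real assume X: "\<And>t. t \<in> {0..1} \<Longrightarrow> hbound (\<sigma> + 2) (U t) X" "X \<ge> 0" and t: "t \<in> {0..1}"
    have "hbound (\<sigma> + 2) (U t) (L * a + h * (L * (T0 * (2 * (L * M))\<^sup>2 * X)))"
      by (rule step [OF v(1) tame [OF X(1)] t L_nonneg C_bound [OF t]]) auto
    moreover have "h * (L * (T0 * (2 * (L * M))\<^sup>2 * X)) = (h * ?g) * X" by simp
    moreover have "(h * ?g) * X \<le> X / 2" using mult_right_mono [OF h(3) X(2)] by simp
    ultimately show "hbound (\<sigma> + 2) (U t) (L * a + X / 2)" by (auto intro: hbound_le)
  qed (use Ub \<tau> in auto)
  have "hbound (\<sigma> + 2) (U 1) (1 * a + h * (L * (T0 * (2 * (L * M))\<^sup>2 * (2 * (L * a)))))"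
    by (rule step [OF v(1) tame [OF high]]) (auto simp: C_one norm_exp_eq_Re)
  then show ?thesis unfolding T0_def [symmetric] by (simp add: algebra_simps)
qed

text \<open>Lady Windermere's fan: the step from the iterate is compared with the step from the
  exact value, and this one with the exact solution. Three statements support each other in the
  induction: an H^(\<sigma> + 2) bound that guarantees solvability, an H^\<sigma> error below 1 that
  keeps the growth rate valid, and the error in H^\<beta> that is the result.\<close>

theorem global_error:
  fixes E :: "real set"
  assumes T: "T > 0" and Kp: "Kp > 1" and \<beta>: "0 \<le> \<beta>" "\<beta> \<le> \<sigma>" and E: "E \<subseteq> {0<..1}"
    and bnd: "\<And>h eps. h > 0 \<Longrightarrow> eps \<in> E \<Longrightarrow> bnd h eps \<ge> 0"
    and LE: "\<And>M \<rho>. \<exists>c>0. \<exists>D\<ge>0. \<forall>eps\<in>E. \<forall>h v U. 0 < h \<and> h / eps \<le> c \<and>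
       exact_flow lam (h / eps) h (\<sigma> + 2) M v \<and>
       seq_stages (\<sigma> + 2) \<rho> lam (h / eps) h (v 0 :: int ^ 'd \<Rightarrow> complex) U \<longrightarrow>
       hbound \<beta> (\<lambda>k. v 1 k - U 1 k) (h * (D * bnd h eps))"
  shows "ep_error_bound TYPE('d) C A lam T Kp R (\<sigma> + 2) \<beta> E bnd"
proof -
  interpret hi: ep_setting "TYPE('d)" "\<sigma> + 2" C A L by (rule ep_setting_up)
  define T0 where "T0 = growth_const lam"
  \<comment> \<open>At least 1, so that all radii are positive whatever \<open>R\<close> is.\<close>
  define R1 where "R1 = max R 1"
  define M where "M = Kp * R1"
  have R1: "R1 \<ge> 1" "R1 \<ge> R" by (auto simp: R1_def)
  have M: "M \<ge> R1" using Kp R1 by (simp add: M_def)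
  \<comment> \<open>The rate uses \<open>M + 1\<close>, the bound of the iterates in H^\<sigma>, and
    is thus fixed before \<open>\<rho>\<close>.\<close>
  define g where "g = L * T0 * (2 * (L * (M + 1)))\<^sup>2"
  define G where "G = 2 * L * g"
  have T0: "T0 \<ge> 0" by (simp add: T0_def growth_const_def)
  have g: "g \<ge> 0" and G: "G \<ge> 0" using T0 L_nonneg by (auto simp: g_def G_def)
  \<comment> \<open>Bounds the iterates in H^(\<sigma> + 2) up to time \<open>T\<close>;
    \<open>\<rho>\<close> is then the radius that \<open>seq_stages_exist\<close> assigns to initial
    values of this size.\<close>
  define r0 where "r0 = M * exp (G * T)"
  have r0: "r0 \<ge> M" unfolding r0_def using M R1 G T by (simp add: mult_le_cancel_left1)
  define \<rho> where "\<rho> = 2 * L * r0"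
  define q where "q = Q lam (max \<rho> M)"
  have \<rho>: "\<rho> \<ge> M"
  proof -
    have "1 * r0 \<le> (2 * L) * r0" using L r0 M R1 by (intro mult_right_mono) auto
    then show ?thesis using r0 by (simp add: \<rho>_def)
  qed
  then have q\<rho>: "Q lam \<rho> = q" by (simp add: q_def max_def)
  have q: "q \<ge> 0" and hq: "hi.Q lam \<rho> \<ge> 0" unfolding q_def by (rule Q_nonneg hi.Q_nonneg)+
  define S where "S = 2 * L * q"
  have S: "S \<ge> 0" using L_nonneg q by (simp add: S_def)
  define D1 where "D1 = L * (\<bar>lam\<bar> * hi.K * M ^ 3) + 2 * q * (L * M + (1 + L) * (\<bar>lam\<bar> * K * M ^ 3))"
  have D1: "D1 \<ge> 0"
    using L_nonneg q M R1 K_nonneg hi.K_nonneg by (simp add: D1_def)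
  from LE [of M \<rho>] obtain c2 D2 where c2: "c2 > 0" and D2: "D2 \<ge> 0"
    and LE0: "\<forall>eps\<in>E. \<forall>h v U. 0 < h \<and> h / eps \<le> c2 \<and>
       exact_flow lam (h / eps) h (\<sigma> + 2) M v \<and>
       seq_stages (\<sigma> + 2) \<rho> lam (h / eps) h (v 0 :: int ^ 'd \<Rightarrow> complex) U \<longrightarrow>
       hbound \<beta> (\<lambda>k. v 1 k - U 1 k) (h * (D2 * bnd h eps))"
    by (elim exE conjE)
  have LE: "hbound \<beta> (\<lambda>k. v 1 k - U 1 k) (h * (D2 * bnd h eps))"
    if "eps \<in> E" "0 < h" "h / eps \<le> c2" "exact_flow lam (h / eps) h (\<sigma> + 2) M v"
      "seq_stages (\<sigma> + 2) \<rho> lam (h / eps) h (v 0 :: int ^ 'd \<Rightarrow> complex) U" for eps h v U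
    using LE0 that by blast
  \<comment> \<open>In this order: range of the local error estimate, solvability in H^(\<sigma> +
    2), stability in H^\<sigma>, growth bound, and an H^\<sigma> error of at most 1.\<close>
  define c where "c = Min {c2, 1 / (2 * (hi.Q lam \<rho> + 1)), 1 / (2 * (q + 1)), 1 / (2 * (g + 1)), 1 / (T * D1 * exp (S * T) + 1)}"
  have TD: "T * D1 * exp (S * T) \<ge> 0" using T D1 by simp
  have c: "c > 0"
    unfolding c_def using c2 hq q g TD by (simp add: add_nonneg_pos)
  have cl: "c \<le> c2" "c \<le> 1 / (2 * (hi.Q lam \<rho> + 1))" "c \<le> 1 / (2 * (q + 1))" "c \<le> 1 / (2 * (g + 1))"
    "c \<le> 1 / (T * D1 * exp (S * T) + 1)"
    unfolding c_def by (intro Min_le; simp)+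
  have half: "x * y \<le> 1 / 2" if "y \<ge> 0" "0 \<le> x" "x \<le> 1 / (2 * (y + 1))" for x y :: real
  proof -
    have "x * y \<le> 1 / (2 * (y + 1)) * y" using that by (intro mult_right_mono) auto
    also have "\<dots> \<le> 1 / 2" using that by (simp add: field_simps)
    finally show ?thesis .
  qed
  \<comment> \<open>The added 1 makes the constant positive even when \<open>D2\<close> is
    0.\<close>
  define B where "B = T * D2 * exp (S * T) + 1"
  have B: "B > 0" using T D2 by (simp add: B_def add_nonneg_pos)
  have \<rho>0: "\<rho> > 0" using \<rho> M R1 by simp
  have main: "(\<forall>n. real (Suc n) * h \<le> T \<longrightarrow>
           ep_uniquely_solvable C A lam (\<sigma> + 2) \<rho> eps h ((ep_step C A lam (\<sigma> + 2) \<rho> eps h ^^ n) u0)) \<and>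
        (\<forall>n. real n * h \<le> T \<longrightarrow>
           (ep_step C A lam (\<sigma> + 2) \<rho> eps h ^^ n) u0 - u (real n * h) \<in> sobolev \<beta> \<and>
           sobolev_norm \<beta> ((ep_step C A lam (\<sigma> + 2) \<rho> eps h ^^ n) u0 - u (real n * h)) \<le> B * bnd h eps)"
    if eps: "eps \<in> E" and u0: "u0 \<in> sobolev (\<sigma> + 2)" "sobolev_norm (\<sigma> + 2) u0 \<le> R"
      and sol: "unique_nls_solution lam eps T (\<sigma> + 2) u0 u"
      and ub: "\<forall>t\<in>{0..T}. sobolev_norm (\<sigma> + 2) (u t) \<le> Kp * sobolev_norm (\<sigma> + 2) u0"
      and h: "0 < h" "h \<le> c * eps"
    for eps h :: real and u0 :: "'d torus_fun" and u
  proof -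
    define \<kappa> where "\<kappa> = h / eps"
    have eps0: "0 < eps" "eps \<le> 1" using E eps by auto
    \<comment> \<open>Because eps \<le> 1, every bound on \<kappa> is also one on h.\<close>
    have \<kappa>: "\<kappa> \<le> c" "h \<le> \<kappa>" "\<kappa> > 0"
      using h eps0 by (auto simp: \<kappa>_def field_simps mult_left_le)
    have hc: "h \<le> c" using \<kappa> by simp
    have h1: "h * hi.Q lam \<rho> \<le> 1 / 2" by (rule half) (use h hq hc cl in auto)
    have h2: "h * q \<le> 1 / 2" by (rule half) (use h q hc cl in auto)
    have h3: "h * g \<le> 1 / 2" by (rule half) (use h g hc cl in auto)
    have nls: "nls_solution lam eps T (\<sigma> + 2) u0 u" using sol by (simp add: unique_nls_solution_def)
    have us: "u t \<in> sobolev (\<sigma> + 2)" if "t \<in> {0..T}" for t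
      using nls that by (simp add: nls_solution_def sobolev_continuous_on_def)
    have uM: "sobolev_norm (\<sigma> + 2) (u t) \<le> M" if "t \<in> {0..T}" for t
    proof -
      have "sobolev_norm (\<sigma> + 2) (u t) \<le> Kp * sobolev_norm (\<sigma> + 2) u0" using ub that by blast
      also have "\<dots> \<le> Kp * R1" using u0(2) R1 Kp by (intro mult_left_mono) auto
      finally show ?thesis by (simp add: M_def)
    qed
    define y where "y = (\<lambda>t. fourier_coeff (u t))"
    have yM: "hbound (\<sigma> + 2) (y t) M" if "t \<in> {0..T}" for t
      unfolding y_def by (rule hbound_le [OF sobolev_hbound [OF us [OF that]] uM [OF that]])
    define w where "w = (\<lambda>n. (ep_step C A lam (\<sigma> + 2) \<rho> eps h ^^ n) u0)"
    have w0: "w 0 = u0" and wS: "w (Suc n) = ep_step C A lam (\<sigma> + 2) \<rho> eps h (w n)" for n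
      by (simp_all add: w_def)
    \<comment> \<open>Accumulated errors: n local errors, each amplified by at most (1 + h
      S)^n.\<close>
    define X1 where "X1 = (\<lambda>n. real n * h * (D1 * \<kappa>) * (1 + h * S) ^ n)"
    define X2 where "X2 = (\<lambda>n. real n * h * (D2 * bnd h eps) * (1 + h * S) ^ n)"
    have b0: "bnd h eps \<ge> 0" by (rule bnd [OF h(1) eps])
    have pw: "(1 + h * x) ^ n \<le> exp (x * T)" if "x \<ge> 0" "real n * h \<le> T" for x n
    proof -
      have "(1 + h * x) ^ n \<le> exp (real n * (h * x))"
        by (rule one_plus_power_le_exp) (use h that in simp)
      also have "\<dots> \<le> exp (x * T)" using mult_right_mono [OF that(2,1)] by (simp add: mult_ac)
      finally show ?thesis .
    qed
    have X1le: "X1 n \<le> 1" if n: "real n * h \<le> T" for n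
    proof -
      have "X1 n \<le> T * (D1 * \<kappa>) * exp (S * T)"
        unfolding X1_def using h S D1 \<kappa> T by (intro mult_mono n pw) auto
      also have "\<dots> = (T * D1 * exp (S * T)) * \<kappa>" by simp
      also have "\<dots> \<le> (T * D1 * exp (S * T)) * (1 / (T * D1 * exp (S * T) + 1))"
        using \<kappa>(1) cl(5) TD by (intro mult_left_mono) auto
      also have "\<dots> \<le> 1" using TD by (simp add: field_simps)
      finally show ?thesis .
    qed
    have rec: "(1 + h * S) * (real n * h * d * (1 + h * S) ^ n) + h * d \<le> real (Suc n) * h * d * (1 + h * S) ^ Suc n"
      if "d \<ge> 0" for d n
    proof -
      have "1 \<le> (1 + h * S) ^ Suc n" using h S by (intro one_le_power) simp
      then have "h * d * 1 \<le> h * d * (1 + h * S) ^ Suc n" using h that by (intro mult_left_mono) auto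
      then show ?thesis by (simp add: algebra_simps)
    qed
    have claim: "w n \<in> sobolev (\<sigma> + 2) \<and> hbound (\<sigma> + 2) (fourier_coeff (w n)) (R1 * (1 + h * G) ^ n) \<and>
       hbound \<sigma> (\<lambda>k. fourier_coeff (w n) k - y (real n * h) k) (X1 n) \<and>
       hbound \<beta> (\<lambda>k. fourier_coeff (w n) k - y (real n * h) k) (X2 n)" if "real n * h \<le> T" for n
      using that
    proof (induction n)
      case 0
      have "u 0 \<in> sobolev (\<sigma> + 2)" using us T by simp
      then have m: "u0 \<in> borel_measurable cell" "u 0 \<in> borel_measurable cell"
        using sobolev_integrable [OF u0(1)] sobolev_integrable [OF \<open>u 0 \<in> sobolev (\<sigma> + 2)\<close>] by auto
      have "AE x in lebesgue. u 0 x = u0 x" using nls by (simp add: nls_solution_def)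
      then have "AE x in lebesgue. u0 x = u 0 x" by eventually_elim simp
      then have "fourier_coeff u0 k = fourier_coeff (u 0) k" for k by (rule fourier_coeff_cong_AE [OF m])
      then have "(\<lambda>k. fourier_coeff (w 0) k - y (real 0 * h) k) = (\<lambda>k. 0)" by (simp add: w0 y_def)
      moreover have "hbound (\<sigma> + 2) (fourier_coeff u0) R1"
        by (rule hbound_le [OF sobolev_hbound [OF u0(1)]]) (use u0(2) R1 in auto)
      ultimately show ?case using u0 by (simp add: w0 X1_def X2_def)
    next
      case (Suc n)
      have n: "real n * h \<le> T" using Suc.prems h by (simp add: algebra_simps)
      note IH = Suc.IH [OF n]
      have tn: "real n * h \<in> {0..T}" using n h by simp
      have wr0: "hbound (\<sigma> + 2) (fourier_coeff (w n)) r0"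
      proof (rule hbound_le)
        show "hbound (\<sigma> + 2) (fourier_coeff (w n)) (R1 * (1 + h * G) ^ n)" using IH by blast
        show "R1 * (1 + h * G) ^ n \<le> r0"
          unfolding r0_def using M R1 h G by (intro mult_mono pw n) auto
      qed
      obtain U where U: "seq_stages (\<sigma> + 2) \<rho> lam \<kappa> h (fourier_coeff (w n)) U"
        and wU: "fourier_coeff (w (Suc n)) = U 1"
        using hi.ep_step_seq(3) [OF _ wr0, of h lam eps] IH h h1 unfolding wS \<kappa>_def \<rho>_def by auto
      have ws: "w (Suc n) \<in> sobolev (\<sigma> + 2)"
        using hi.ep_step_seq(2) [OF _ wr0, of h lam eps] IH h h1 unfolding wS \<rho>_def by auto
      \<comment> \<open>Exact solution plus an error of at most 1: here the H^\<sigma> error bound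
        feeds back into the growth estimate.\<close>
      have low: "hbound \<sigma> (fourier_coeff (w n)) (M + 1)"
      proof -
        have "hbound \<sigma> (\<lambda>k. y (real n * h) k + (fourier_coeff (w n) k - y (real n * h) k)) (M + X1 n)"
          using IH by (intro hbound_add hbound_weaken [OF yM [OF tn]]) auto
        then show ?thesis using X1le [OF n] by (auto intro: hbound_le)
      qed
      have "hbound (\<sigma> + 2) (U 1) ((1 + h * (2 * L * (L * T0 * (2 * (L * (M + 1)))\<^sup>2))) * (R1 * (1 + h * G) ^ n))"
        unfolding T0_def
        by (rule stage_growth [OF U _ low])
          (use IH h h2 h3 q\<rho> in \<open>auto simp: g_def T0_def\<close>)
      then have grow: "hbound (\<sigma> + 2) (fourier_coeff (w (Suc n))) (R1 * (1 + h * G) ^ Suc n)"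
        unfolding wU G_def g_def by (simp add: mult_ac)
      define v where "v = (\<lambda>\<tau>. y (real n * h + \<tau> * h))"
      have ve: "exact_flow lam \<kappa> h (\<sigma> + 2) M v"
        unfolding v_def y_def \<kappa>_def
        by (rule nls_exact_flow [OF nls uM h(1)]) (use Suc.prems h in \<open>auto simp: algebra_simps\<close>)
      have v0: "v 0 = y (real n * h)" and v1: "v 1 = y (real (Suc n) * h)"
        by (simp_all add: v_def algebra_simps)
      \<comment> \<open>The numerical stages \<open>V\<close> started at the exact value are the
        intermediate point of the comparison.\<close>
      have "hbound (\<sigma> + 2) (v 0) r0" unfolding v0 by (rule hbound_le [OF yM [OF tn] r0])
      from hi.seq_stages_exist [OF this, of h lam \<kappa>]
      obtain V where V: "seq_stages (\<sigma> + 2) \<rho> lam \<kappa> h (v 0) V"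
        using h h1 unfolding \<rho>_def by auto
      have e1: "hbound \<sigma> (\<lambda>k. v 1 k - V 1 k) (h * (D1 * \<kappa>))"
        unfolding D1_def q_def
        by (rule base_local_error [OF ve V h(1) \<kappa>(2)]) (use h2 in \<open>simp add: q_def\<close>)
      have e2: "hbound \<beta> (\<lambda>k. v 1 k - V 1 k) (h * (D2 * bnd h eps))"
        by (rule LE [OF eps h(1)]) (use \<kappa> cl ve V in \<open>auto simp: \<kappa>_def\<close>)
      have sl: "hbound \<sigma> (W r) \<rho>" "continuous_on {0..1} (\<lambda>r. cubic lam (W r) k)"
        if W: "seq_stages (\<sigma> + 2) \<rho> lam \<kappa> h a W" and r: "r \<in> {0..1}"
        for W and a :: "int ^ 'd \<Rightarrow> complex" and r k
        using hbound_weaken [OF seq_stagesD(2) [OF W r], of \<sigma>] hi.seq_stages_cont [OF W] by auto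
      have st: "hbound b (\<lambda>k. U 1 k - V 1 k) ((1 + h * S) * X)"
        if b: "0 \<le> b" "b \<le> \<sigma>" and X: "hbound b (\<lambda>k. fourier_coeff (w n) k - y (real n * h) k) X" for b X
        unfolding S_def q\<rho> [symmetric]
        by (rule stage_stable(2) [OF b sl(1) [OF V] sl(1) [OF U] sl(2) [OF V, of 0] sl(2) [OF U, of 0]
              seq_stagesD(3) [OF V] seq_stagesD(3) [OF U]]) (use X h h2 q\<rho> v0 in auto)
      have comb: "hbound b (\<lambda>k. fourier_coeff (w (Suc n)) k - y (real (Suc n) * h) k) (real (Suc n) * h * d * (1 + h * S) ^ Suc n)"
        if b: "0 \<le> b" "b \<le> \<sigma>" and d: "d \<ge> 0"
          and X: "hbound b (\<lambda>k. fourier_coeff (w n) k - y (real n * h) k) (real n * h * d * (1 + h * S) ^ n)"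
          and e: "hbound b (\<lambda>k. v 1 k - V 1 k) (h * d)" for b d
      proof -
        have "hbound b (\<lambda>k. (U 1 k - V 1 k) - (v 1 k - V 1 k)) ((1 + h * S) * (real n * h * d * (1 + h * S) ^ n) + h * d)"
          by (intro hbound_diff st b X e)
        then have "hbound b (\<lambda>k. U 1 k - v 1 k) ((1 + h * S) * (real n * h * d * (1 + h * S) ^ n) + h * d)"
          by simp
        from hbound_le [OF this rec [OF d]] show ?thesis unfolding wU v1 [symmetric] .
      qed
      have "hbound \<sigma> (\<lambda>k. fourier_coeff (w (Suc n)) k - y (real (Suc n) * h) k) (X1 (Suc n))"
        unfolding X1_def by (rule comb [OF \<sigma>_nonneg order_refl _ _ e1]) (use D1 \<kappa> IH in \<open>auto simp: X1_def\<close>)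
      moreover have "hbound \<beta> (\<lambda>k. fourier_coeff (w (Suc n)) k - y (real (Suc n) * h) k) (X2 (Suc n))"
        unfolding X2_def by (rule comb [OF \<beta> _ _ e2]) (use D2 b0 IH in \<open>auto simp: X2_def\<close>)
      ultimately show ?case using ws grow by blast
    qed
    show ?thesis
      unfolding w_def [symmetric, THEN fun_cong]
    proof (intro conjI allI impI)
      fix n
      assume n: "real (Suc n) * h \<le> T"
      then have n': "real n * h \<le> T" using h by (simp add: algebra_simps)
      have "hbound (\<sigma> + 2) (fourier_coeff (w n)) r0"
      proof (rule hbound_le)
        show "hbound (\<sigma> + 2) (fourier_coeff (w n)) (R1 * (1 + h * G) ^ n)" using claim [OF n'] by blast
        show "R1 * (1 + h * G) ^ n \<le> r0"
          unfolding r0_def using M R1 h G by (intro mult_mono pw n') auto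
      qed
      then show "ep_uniquely_solvable C A lam (\<sigma> + 2) \<rho> eps h (w n)"
        unfolding \<rho>_def by (rule hi.ep_step_seq(1) [rotated]) (use claim [OF n'] h h1 in \<open>auto simp: \<rho>_def\<close>)
    next
      fix n
      assume n: "real n * h \<le> T"
      note cl = claim [OF n]
      have ut: "u (real n * h) \<in> sobolev (\<sigma> + 2)" using us n h by simp
      show "w n - u (real n * h) \<in> sobolev \<beta>"
        by (rule sobolev_weaken [OF sobolev_minus [OF _ ut]]) (use cl \<beta> in auto)
      have "sobolev_norm \<beta> (w n - u (real n * h)) \<le> X2 n"
        using cl fourier_coeff_minus [OF _ ut, of "w n"] by (intro sobolev_norm_le) (simp add: y_def)
      also have "\<dots> \<le> T * (D2 * bnd h eps) * exp (S * T)"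
        unfolding X2_def using h S D2 b0 T by (intro mult_mono n pw) auto
      also have "\<dots> \<le> B * bnd h eps" using b0 by (simp add: B_def algebra_simps)
      finally show "sobolev_norm \<beta> (w n - u (real n * h)) \<le> B * bnd h eps" .
    qed
  qed
  show ?thesis
    unfolding ep_error_bound_def
    by (rule exI [of _ c], rule conjI [OF c], rule exI [of _ \<rho>], rule conjI [OF \<rho>0], rule exI [of _ B], rule conjI [OF B])
      (use main in blast)
qed

end

section \<open>Local errors\<close>

text \<open>Consistency as a quadrature: at z = 0 the weight of stage \<tau> has the same mass as
  the interval [0, \<tau>], and the weight of the final stage reproduces the integral of the
  exponential for every z.\<close>

locale ep_method0 = ep_method +
  assumes A_at0: "\<tau> \<in> {0..1} \<Longrightarrow> r \<in> {0..1} \<Longrightarrow> Re z = 0 \<Longrightarrow> norm (A \<tau> r z - A \<tau> r 0) \<le> L * norm z"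
    and A0_mean: "\<tau> \<in> {0..1} \<Longrightarrow> integral {0..1} (\<lambda>r. A \<tau> r 0) = of_real \<tau>"
    and A_mean: "Re z = 0 \<Longrightarrow> integral {0..1} (\<lambda>r. exp (of_real (1 - r) * z) - A 1 r z) = 0"

lemma norm_exp_minus_one:
  assumes "Re z = 0" shows "norm (exp z - 1) \<le> norm z"
  using Taylor_exp [of z 0] assms by simp

lemma norm_exp_minus_linear:
  assumes "Re z = 0" shows "norm (exp z - 1 - z) \<le> (norm z)\<^sup>2"
  using Taylor_exp [of z 1] assms by (simp add: power2_eq_square diff_diff_eq)

text \<open>Separates moments: the affine part of \<open>F\<close> contributes the zeroth and first
  moments of the kernel, and the kernel otherwise acts on the deviation of \<open>F\<close> from
  it.\<close>

lemma integral_split_linear: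
  fixes e F :: "real \<Rightarrow> complex"
  assumes e: "continuous_on {a..b} e" and F: "continuous_on {a..b} F"
  shows "integral {a..b} (\<lambda>r. e r * F r) =
    integral {a..b} (\<lambda>r. e r * (F r - c - of_real r * q)) + integral {a..b} e * c + integral {a..b} (\<lambda>r. e r * of_real r) * q"
proof (rule integral_unique)
  have "((\<lambda>r. e r * (F r - c - of_real r * q) + e r * c + (e r * of_real r) * q) has_integral
     integral {a..b} (\<lambda>r. e r * (F r - c - of_real r * q)) + integral {a..b} e * c + integral {a..b} (\<lambda>r. e r * of_real r) * q) {a..b}"
    by (intro has_integral_add has_integral_mult_left integrable_integral integrable_continuous_real continuous_intros e F)
  then show "((\<lambda>r. e r * F r) has_integral
     integral {a..b} (\<lambda>r. e r * (F r - c - of_real r * q)) + integral {a..b} e * c + integral {a..b} (\<lambda>r. e r * of_real r) * q) {a..b}"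
    by (simp add: algebra_simps)
qed

lemma norm_integral_exp_minus:
  assumes z: "Re z = 0" and \<tau>: "\<tau> \<in> {0..1}" and g: "continuous_on {0..1} g" "\<And>r. r \<in> {0..1} \<Longrightarrow> norm (g r) \<le> 1"
  shows "norm (integral {0..\<tau>} (\<lambda>r. exp (of_real (\<tau> - r) * z) * g r) - integral {0..\<tau>} g) \<le> norm z"
proof -
  have c: "continuous_on {0..\<tau>} g" by (rule continuous_on_subset [OF g(1)]) (use \<tau> in auto)
  have "integral {0..\<tau>} (\<lambda>r. exp (of_real (\<tau> - r) * z) * g r) - integral {0..\<tau>} g =
     integral {0..\<tau>} (\<lambda>r. (exp (of_real (\<tau> - r) * z) - 1) * g r)"
    unfolding left_diff_distrib mult_1
    by (rule integral_diff [symmetric]) (intro integrable_continuous_real continuous_intros c)+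
  also have "norm \<dots> \<le> norm z * (\<tau> - 0)"
  proof (rule integral_bound)
    fix r assume r: "r \<in> {0..\<tau>}"
    have "norm (exp (of_real (\<tau> - r) * z) - 1) \<le> norm (of_real (\<tau> - r) * z)"
      by (rule norm_exp_minus_one) (simp add: z)
    also have "\<dots> \<le> norm z" using r \<tau> by (simp add: norm_mult mult_left_le_one_le del: of_real_diff)
    finally have "norm (exp (of_real (\<tau> - r) * z) - 1) * norm (g r) \<le> norm z * 1"
      using r \<tau> by (intro mult_mono g) auto
    then show "norm ((exp (of_real (\<tau> - r) * z) - 1) * g r) \<le> norm z" by (simp add: norm_mult)
  qed (use \<tau> in \<open>auto intro!: continuous_intros c\<close>)
  also have "\<dots> \<le> norm z" using \<tau> by (simp add: mult_left_le)
  finally show ?thesis .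
qed

context ep_method0 begin

lemma A_weight_at0:
  assumes z: "Re z = 0" and \<tau>: "\<tau> \<in> {0..1}" and g: "continuous_on {0..1} g" "\<And>r. r \<in> {0..1} \<Longrightarrow> norm (g r) \<le> 1"
  shows "norm (integral {0..1} (\<lambda>r. A \<tau> r z * g r) - integral {0..1} (\<lambda>r. A \<tau> r 0 * g r)) \<le> L * norm z"
proof -
  have "integral {0..1} (\<lambda>r. A \<tau> r z * g r) - integral {0..1} (\<lambda>r. A \<tau> r 0 * g r) =
     integral {0..1} (\<lambda>r. (A \<tau> r z - A \<tau> r 0) * g r)"
    by (rule integral_mult_diff [OF A_cont A_cont g(1)])
  also have "norm \<dots> \<le> (L * norm z) * (1 - 0)"
  proof (rule integral_bound)
    fix r :: real assume r: "r \<in> {0..1}"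
    have "norm (A \<tau> r z - A \<tau> r 0) * norm (g r) \<le> (L * norm z) * 1"
      using L_nonneg by (intro mult_mono A_at0 g \<tau> r z) auto
    then show "norm ((A \<tau> r z - A \<tau> r 0) * g r) \<le> L * norm z" by (simp add: norm_mult)
  qed (auto intro!: continuous_intros A_cont g)
  finally show ?thesis by simp
qed

text \<open>Both integrals are within O(z) of \<tau>, by comparison with z = 0.\<close>

lemma A_zeroth_moment:
  assumes z: "Re z = 0" and \<tau>: "\<tau> \<in> {0..1}"
  shows "norm (integral {0..\<tau>} (\<lambda>r. exp (of_real (\<tau> - r) * z)) - integral {0..1} (\<lambda>r. A \<tau> r z)) \<le> (1 + L) * norm z"
proof -
  have 1: "norm (integral {0..\<tau>} (\<lambda>r. exp (of_real (\<tau> - r) * z)) - of_real \<tau>) \<le> norm z"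
    using norm_integral_exp_minus [OF z \<tau>, of "\<lambda>_. 1"] \<tau> by (simp add: scaleR_conv_of_real)
  have 2: "norm (integral {0..1} (\<lambda>r. A \<tau> r z) - of_real \<tau>) \<le> L * norm z"
    using A_weight_at0 [OF z \<tau>, of "\<lambda>_. 1"] by (simp add: A0_mean [OF \<tau>])
  show ?thesis using norm_triangle_ineq4
      [of "integral {0..\<tau>} (\<lambda>r. exp (of_real (\<tau> - r) * z)) - of_real \<tau>" "integral {0..1} (\<lambda>r. A \<tau> r z) - of_real \<tau>"] 1 2
    by (simp add: ring_distribs)
qed

end

section \<open>Expansions along one step of the exact solution\<close>

locale ep_setting0 = algebra_index D \<sigma> + ep_method0 C A L
  for D :: "'d::finite itself" and \<sigma> C A L

sublocale ep_setting0 \<subseteq> ep_setting D \<sigma> C A L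
  by unfold_locales

text \<open>A fixed solution over one step. The condition \<open>h \<le> \<kappa>\<close> encodes
  eps \<le> 1 and lets a factor h be absorbed into \<kappa>.\<close>

locale exact_step = ep_setting0 D \<sigma> C A L
  for D :: "'d::finite itself" and \<sigma> C A L +
  fixes lam \<kappa> h M :: real and v :: "real \<Rightarrow> int ^ 'd \<Rightarrow> complex"
  assumes v: "exact_flow lam \<kappa> h (\<sigma> + 2) M v" and h: "0 < h" "h \<le> \<kappa>"
begin

definition F where "F r = cubic lam (v r)"
text \<open>\<open>F1\<close> and \<open>F2\<close> bound \<open>F\<close> in the orders \<sigma>
  and \<sigma> + 2; \<open>V1\<close> and \<open>W1\<close> bound the increments of \<open>v\<close>
  and \<open>F\<close> in order \<sigma>, divided by \<kappa>.\<close>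

definition F1 where "F1 = \<bar>lam\<bar> * K * M ^ 3"
definition F2 where "F2 = \<bar>lam\<bar> * algebra_index.K TYPE('d) (\<sigma> + 2) * M ^ 3"
definition V1 where "V1 = M + F1"
definition W1 where "W1 = 3 * \<bar>lam\<bar> * K * M\<^sup>2 * V1"

lemma v_bound: "r \<in> {0..1} \<Longrightarrow> hbound \<sigma> (v r) M"
  by (rule hbound_weaken [OF exact_flowD(1) [OF v]]) auto

lemma M_nonneg: "M \<ge> 0" using hbound_nonneg [OF v_bound [of 0]] by simp

lemma F1_nonneg: "F1 \<ge> 0" using M_nonneg K_nonneg by (simp add: F1_def)

lemma F2_nonneg: "F2 \<ge> 0"
  using M_nonneg algebra_index.K_nonneg [OF algebra_index_up] by (simp add: F2_def)

lemma V1_nonneg: "V1 \<ge> 0" using M_nonneg F1_nonneg by (simp add: V1_def)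

lemma W1_nonneg: "W1 \<ge> 0" using V1_nonneg K_nonneg by (simp add: W1_def)

lemma kappa_nonneg: "\<kappa> \<ge> 0" using h by simp

lemma F_bound: "r \<in> {0..1} \<Longrightarrow> hbound \<sigma> (F r) F1"
  unfolding F_def F1_def by (rule hbound_cubic [OF v_bound])

lemma F_bound2: "r \<in> {0..1} \<Longrightarrow> hbound (\<sigma> + 2) (F r) F2"
  unfolding F_def F2_def by (rule algebra_index.hbound_cubic [OF algebra_index_up exact_flowD(1) [OF v]])

lemma F_cont: "continuous_on {0..1} (\<lambda>r. F r k)"
  unfolding F_def by (rule exact_flowD(2) [OF v])

lemma hbound_symbol:
  assumes "hbound s a B" "c \<ge> 0" "\<And>k. norm (g k) \<le> c * norm (symbol \<kappa> k) ^ j"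
  shows "hbound (s - 2 * real j) (\<lambda>k. g k * a k) (c * \<kappa> ^ j * B)"
  by (rule hbound_multiplier [OF assms(1)])
    (use assms(2,3) kappa_nonneg in \<open>auto simp: norm_symbol power_mult_distrib mult.assoc\<close>)

lemma v_duhamel:
  assumes \<tau>: "\<tau> \<in> {0..1}"
  shows "v \<tau> k = exp (of_real \<tau> * symbol \<kappa> k) * v 0 k +
     of_real h * integral {0..\<tau>} (\<lambda>r. exp (of_real (\<tau> - r) * symbol \<kappa> k) * F r k)"
proof -
  have "v \<tau> k - exp (of_real \<tau> * symbol \<kappa> k) * v 0 k =
     integral {0..\<tau>} (\<lambda>r. of_real h * (exp (of_real (\<tau> - r) * symbol \<kappa> k) * F r k))"
    using integral_unique [OF exact_flowD(3) [OF v \<tau>]] by (simp add: F_def mult.left_commute)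
  then show ?thesis by (simp add: algebra_simps)
qed

text \<open>Two derivatives buy one power of \<kappa> in the linear part; the integral term is O(h),
  and h \<le> \<kappa>.\<close>

lemma v_diff: 
  assumes \<tau>: "\<tau> \<in> {0..1}" shows "hbound \<sigma> (\<lambda>k. v \<tau> k - v 0 k) (\<kappa> * V1)"
proof -
  have "hbound (\<sigma> + 2 - 2 * real 1) (\<lambda>k. (exp (of_real \<tau> * symbol \<kappa> k) - 1) * v 0 k) (1 * \<kappa> ^ 1 * M)"
  proof (rule hbound_symbol)
    show "norm (exp (of_real \<tau> * symbol \<kappa> k) - 1) \<le> 1 * norm (symbol \<kappa> k) ^ 1" for k :: "int ^ 'd"
      using norm_exp_minus_one [of "of_real \<tau> * symbol \<kappa> k"] \<tau>
      by (simp add: norm_mult) (meson mult_left_le_one_le norm_ge_zero order_trans)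
  qed (use exact_flowD(1) [OF v] in auto)
  then have 1: "hbound \<sigma> (\<lambda>k. (exp (of_real \<tau> * symbol \<kappa> k) - 1) * v 0 k) (\<kappa> * M)" by simp
  have "hbound \<sigma> (\<lambda>k. of_real h * integral {0..\<tau>} (\<lambda>r. exp (of_real (\<tau> - r) * symbol \<kappa> k) * F r k)) (norm (of_real h :: complex) * F1)"
    by (intro hbound_cmult hbound_flow_integral F_bound F_cont \<tau>)
  from hbound_add [OF 1 this]
  have "hbound \<sigma> (\<lambda>k. v \<tau> k - v 0 k) (\<kappa> * M + norm (of_real h :: complex) * F1)"
    unfolding v_duhamel [OF \<tau>] by (simp add: algebra_simps)
  moreover have "\<kappa> * M + norm (of_real h :: complex) * F1 \<le> \<kappa> * V1"
    using mult_right_mono [OF h(2) F1_nonneg] h by (simp add: V1_def algebra_simps)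
  ultimately show ?thesis by (rule hbound_le)
qed

lemma F_diff:
  assumes \<tau>: "\<tau> \<in> {0..1}" shows "hbound \<sigma> (\<lambda>k. F \<tau> k - F 0 k) (\<kappa> * W1)"
  using hbound_cubic_diff [OF \<sigma>_nonneg order_refl v_bound [OF \<tau>] v_bound [of 0] v_diff [OF \<tau>], where lam = lam]
  by (simp add: F_def W1_def mult_ac)

text \<open>By \<open>A_mean\<close> a constant integrates to zero, so \<open>F\<close> may be
  replaced by its increment. This gains a factor \<kappa> in order \<sigma>, before any derivatives
  are spent on the order of the weight.\<close>

lemma defect_one_diff:
  "defect lam \<kappa> h v 1 k = of_real h *
    integral {0..1} (\<lambda>r. (exp (of_real (1 - r) * symbol \<kappa> k) - A 1 r (symbol \<kappa> k)) * (F r k - F 0 k))"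
proof -
  have c: "continuous_on {0..1} (\<lambda>r. exp (of_real (1 - r) * symbol \<kappa> k) - A 1 r (symbol \<kappa> k))"
    by (intro continuous_intros A_cont)
  show ?thesis
    unfolding defect_one [OF v] F_def [symmetric]
    using integral_split_linear [OF c F_cont, of k "F 0 k" 0] A_mean [of "symbol \<kappa> k"] by simp
qed

lemma defect_one_bound:
  assumes A_ord: "\<And>r z. r \<in> {0..1} \<Longrightarrow> Re z = 0 \<Longrightarrow> norm (exp (of_real (1 - r) * z) - A 1 r z) \<le> L * norm z ^ p"
  shows "hbound (\<sigma> - 2 * real p) (defect lam \<kappa> h v 1) (h * (L * W1 * \<kappa> ^ (p + 1)))"
proof -
  have "hbound (\<sigma> - 2 * real p) (\<lambda>k. (exp (of_real (1 - r) * symbol \<kappa> k) - A 1 r (symbol \<kappa> k)) * (F r k - F 0 k)) (L * \<kappa> ^ p * (\<kappa> * W1))"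
    if r: "r \<in> {0..1}" for r
    by (rule hbound_symbol [OF F_diff [OF r] L_nonneg A_ord [OF r]]) simp
  then have "hbound (\<sigma> - 2 * real p) (\<lambda>k. integral {0..1} (\<lambda>r. (exp (of_real (1 - r) * symbol \<kappa> k) - A 1 r (symbol \<kappa> k)) * (F r k - F 0 k))) ((1 - 0) * (L * \<kappa> ^ p * (\<kappa> * W1)))"
    by (intro hbound_integral integrable_continuous_real continuous_intros A_cont F_cont) auto
  from hbound_cmult [OF this, of "of_real h"] show ?thesis
    unfolding defect_one_diff [abs_def] using h by (simp add: mult_ac)
qed

text \<open>Order p + 1 costs 2p + 2 derivatives, two of which are covered by the regularity
  \<sigma> + 2 of \<open>v 0\<close>.\<close>

lemma C_part_bound:
  assumes C_ord: "\<And>z. Re z = 0 \<Longrightarrow> norm (exp (of_real \<tau> * z) - C \<tau> z) \<le> L * norm z ^ (p + 1)"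
  shows "hbound (\<sigma> - 2 * real p) (\<lambda>k. (exp (of_real \<tau> * symbol \<kappa> k) - C \<tau> (symbol \<kappa> k)) * v 0 k) (L * \<kappa> ^ (p + 1) * M)"
proof -
  have "hbound (\<sigma> + 2 - 2 * real (p + 1)) (\<lambda>k. (exp (of_real \<tau> * symbol \<kappa> k) - C \<tau> (symbol \<kappa> k)) * v 0 k) (L * \<kappa> ^ (p + 1) * M)"
    by (rule hbound_symbol [OF exact_flowD(1) [OF v] L_nonneg C_ord]) auto
  then show ?thesis by simp
qed

text \<open>The slope \<open>q\<close> is free: 0 for the basic local error, the derivative of
  \<open>F\<close> at 0 for the sharper one.\<close>

lemma defect_split:
  assumes \<tau>: "\<tau> \<in> {0..1}"
  shows "defect lam \<kappa> h v \<tau> k = (exp (of_real \<tau> * symbol \<kappa> k) - C \<tau> (symbol \<kappa> k)) * v 0 k +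
     of_real h * ((integral {0..\<tau>} (\<lambda>r. exp (of_real (\<tau> - r) * symbol \<kappa> k) * (F r k - F 0 k - of_real r * q)) -
        integral {0..1} (\<lambda>r. A \<tau> r (symbol \<kappa> k) * (F r k - F 0 k - of_real r * q))) +
      (integral {0..\<tau>} (\<lambda>r. exp (of_real (\<tau> - r) * symbol \<kappa> k)) - integral {0..1} (\<lambda>r. A \<tau> r (symbol \<kappa> k))) * F 0 k +
      (integral {0..\<tau>} (\<lambda>r. exp (of_real (\<tau> - r) * symbol \<kappa> k) * of_real r) - integral {0..1} (\<lambda>r. A \<tau> r (symbol \<kappa> k) * of_real r)) * q)"
proof -
  have c: "continuous_on {0..\<tau>} (\<lambda>r. exp (of_real (\<tau> - r) * symbol \<kappa> k))" by (intro continuous_intros)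
  have d: "continuous_on {0..\<tau>} (\<lambda>r. F r k)" by (rule continuous_on_subset [OF F_cont]) (use \<tau> in auto)
  show ?thesis
    unfolding defect_eq [OF v \<tau>] F_def [symmetric]
    unfolding integral_split_linear [OF c d, of "F 0 k" q] integral_split_linear [OF A_cont F_cont, of \<tau> "symbol \<kappa> k" k "F 0 k" q]
    by (simp add: algebra_simps)
qed

lemma defect_bound:
  assumes \<tau>: "\<tau> \<in> {0..1}"
    and C_ord: "\<And>z. Re z = 0 \<Longrightarrow> norm (exp (of_real \<tau> * z) - C \<tau> z) \<le> L * norm z ^ (p + 1)"
  shows "hbound (\<sigma> - 2 * real p) (defect lam \<kappa> h v \<tau>) (L * \<kappa> ^ (p + 1) * M + h * ((1 + L) * \<kappa> * (W1 + F2)))"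
proof -
  have c: "continuous_on {0..1} (\<lambda>r. F r k - F 0 k)" for k by (intro continuous_intros F_cont)
  have 2: "hbound \<sigma> (\<lambda>k. integral {0..\<tau>} (\<lambda>r. exp (of_real (\<tau> - r) * symbol \<kappa> k) * (F r k - F 0 k))) (\<kappa> * W1)"
    by (rule hbound_flow_integral [OF F_diff c \<tau>])
  have 3: "hbound \<sigma> (\<lambda>k. integral {0..1} (\<lambda>r. A \<tau> r (symbol \<kappa> k) * (F r k - F 0 k))) (L * (\<kappa> * W1))"
    by (rule hbound_weighted_integral [OF F_diff c]) (auto intro: A_bound \<tau> A_cont)
  have "hbound (\<sigma> + 2 - 2 * real 1) (\<lambda>k. (integral {0..\<tau>} (\<lambda>r. exp (of_real (\<tau> - r) * symbol \<kappa> k)) - integral {0..1} (\<lambda>r. A \<tau> r (symbol \<kappa> k))) * F 0 k) ((1 + L) * \<kappa> ^ 1 * F2)"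
    by (rule hbound_symbol [OF F_bound2]) (use A_zeroth_moment [OF _ \<tau>] L_nonneg in auto)
  then have 4: "hbound \<sigma> (\<lambda>k. (integral {0..\<tau>} (\<lambda>r. exp (of_real (\<tau> - r) * symbol \<kappa> k)) - integral {0..1} (\<lambda>r. A \<tau> r (symbol \<kappa> k))) * F 0 k) ((1 + L) * \<kappa> * F2)"
    by simp
  have "hbound (\<sigma> - 2 * real p) (defect lam \<kappa> h v \<tau>) (L * \<kappa> ^ (p + 1) * M + norm (of_real h :: complex) * ((\<kappa> * W1 + L * (\<kappa> * W1)) + (1 + L) * \<kappa> * F2))"
    using hbound_add [OF C_part_bound [OF C_ord] hbound_weaken [OF hbound_cmult [OF hbound_add [OF hbound_diff [OF 2 3] 4], where c = "of_real h"], of "\<sigma> - 2 * real p"]]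
    unfolding defect_split [OF \<tau>, where q = 0, abs_def] by simp
  then show ?thesis using h by (simp add: algebra_simps)
qed

end

section \<open>The local error without averaging\<close>

context ep_setting0 begin

text \<open>The final residual contributes h \<kappa>^(p + 1). The stage residuals, of size
  \<kappa>^(p + 1) + h \<kappa>, enter the final value with a further factor h.\<close>

theorem local_error:
  assumes p: "\<sigma> - 2 * real p \<ge> 0"
    and C_ord: "\<And>\<tau> z. \<tau> \<in> {0..1} \<Longrightarrow> Re z = 0 \<Longrightarrow> norm (exp (of_real \<tau> * z) - C \<tau> z) \<le> L * norm z ^ (p + 1)"
    and A_ord: "\<And>r z. r \<in> {0..1} \<Longrightarrow> Re z = 0 \<Longrightarrow> norm (exp (of_real (1 - r) * z) - A 1 r z) \<le> L * norm z ^ p"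
  shows "\<exists>c>0. \<exists>D\<ge>0. \<forall>\<kappa> h v U. 0 < h \<and> h \<le> \<kappa> \<and> \<kappa> \<le> c \<and>
       exact_flow lam \<kappa> h (\<sigma> + 2) M v \<and> seq_stages (\<sigma> + 2) \<rho> lam \<kappa> h (v 0 :: int ^ 'd \<Rightarrow> complex) U \<longrightarrow>
       hbound (\<sigma> - 2 * real p) (\<lambda>k. v 1 k - U 1 k) (h * (D * (\<kappa> ^ (p + 1) + h * \<kappa>)))"
proof (cases "M \<ge> 0")
  case False
  have "\<not> exact_flow lam \<kappa> h (\<sigma> + 2) M v" for \<kappa> h and v :: "real \<Rightarrow> int ^ 'd \<Rightarrow> complex"
    using exact_flowD(1) [of lam \<kappa> h "\<sigma> + 2" M v 0] hbound_nonneg False by force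
  \<comment> \<open>No exact flow has a negative bound, so any constants do.\<close>
  then show ?thesis by (intro exI [of _ 1]) auto
next
  case M: True
  define q where "q = Q lam (max \<rho> M)"
  have q: "q \<ge> 0" unfolding q_def by (rule Q_nonneg)
  \<comment> \<open>The constants of \<open>exact_step\<close>, restated outside that locale because
    they must be fixed before \<kappa>, h and v.\<close>
  define f1 where "f1 = \<bar>lam\<bar> * K * M ^ 3"
  define f2 where "f2 = \<bar>lam\<bar> * algebra_index.K TYPE('d) (\<sigma> + 2) * M ^ 3"
  define w1 where "w1 = 3 * \<bar>lam\<bar> * K * M\<^sup>2 * (M + f1)"
  have f: "f1 \<ge> 0" "f2 \<ge> 0" "w1 \<ge> 0"
    using M K_nonneg algebra_index.K_nonneg [OF algebra_index_up] by (auto simp: f1_def f2_def w1_def)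
  define B where "B = L * w1 + 2 * q * (L * M) + 2 * q * ((1 + L) * (w1 + f2))"
  have B: "B \<ge> 0" using q f M L_nonneg by (simp add: B_def)
  have "hbound (\<sigma> - 2 * real p) (\<lambda>k. v 1 k - U 1 k) (h * (B * (\<kappa> ^ (p + 1) + h * \<kappa>)))"
    if hs: "0 < h" "h \<le> \<kappa>" "\<kappa> \<le> 1 / (2 * (q + 1))" and v: "exact_flow lam \<kappa> h (\<sigma> + 2) M v"
      and U: "seq_stages (\<sigma> + 2) \<rho> lam \<kappa> h (v 0) U" for \<kappa> h v and U :: "real \<Rightarrow> int ^ 'd \<Rightarrow> complex"
  proof -
    interpret exact_step D \<sigma> C A L lam \<kappa> h M v
      by unfold_locales (use v hs in auto)
    have w: "W1 = w1" "F2 = f2" by (simp_all add: W1_def w1_def V1_def F1_def f1_def F2_def f2_def)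
    have hq: "h * q \<le> 1 / 2"
    proof -
      have "h * q \<le> 1 / (2 * (q + 1)) * q" using hs q by (intro mult_right_mono) auto
      also have "\<dots> \<le> 1 / 2" using q by (simp add: field_simps)
      finally show ?thesis .
    qed
    have "hbound (\<sigma> - 2 * real p) (\<lambda>k. v 1 k - U 1 k)
        (h * (L * W1 * \<kappa> ^ (p + 1)) + h * q * (2 * (L * \<kappa> ^ (p + 1) * M + h * ((1 + L) * \<kappa> * (W1 + F2)))))"
      unfolding q_def
      by (rule defect_error(3) [OF p _ _ v U _ _ defect_bound defect_one_bound])
        (use h hq q_def C_ord A_ord in auto)
    moreover have "h * (L * W1 * \<kappa> ^ (p + 1)) + h * q * (2 * (L * \<kappa> ^ (p + 1) * M + h * ((1 + L) * \<kappa> * (W1 + F2))))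
      \<le> h * (B * (\<kappa> ^ (p + 1) + h * \<kappa>))"
    proof -
      define N where "N = \<kappa> ^ (p + 1)"
      have N: "N \<ge> 0" "h * \<kappa> \<ge> 0" using h by (auto simp: N_def)
      have "L * w1 * N + q * (2 * (L * N * M + h * ((1 + L) * \<kappa> * (w1 + f2)))) \<le> B * (N + h * \<kappa>)"
      proof -
        have "B * (N + h * \<kappa>) - (L * w1 * N + q * (2 * (L * N * M + h * ((1 + L) * \<kappa> * (w1 + f2))))) =
          2 * q * ((1 + L) * (w1 + f2)) * N + (L * w1 + 2 * q * (L * M)) * (h * \<kappa>)"
          by (simp add: B_def algebra_simps)
        also have "\<dots> \<ge> 0" using N q f M L_nonneg by simp
        finally show ?thesis by simp
      qed
      from mult_left_mono [OF this, of h] show ?thesis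
        using h unfolding N_def w by (simp add: algebra_simps)
    qed
    ultimately show ?thesis by (rule hbound_le)
  qed
  then show ?thesis
    using B q by (intro exI [of _ "1 / (2 * (q + 1))"] conjI exI [of _ B]) auto
qed

end

text \<open>The Frechet derivative of \<open>cubic lam\<close> at \<open>a\<close> in direction
  \<eta>. It is only real linear in \<eta>, because of the conjugate.\<close>

definition dcubic :: "real \<Rightarrow> (int ^ 'd \<Rightarrow> complex) \<Rightarrow> (int ^ 'd \<Rightarrow> complex) \<Rightarrow> int ^ 'd::finite \<Rightarrow> complex" where
  "dcubic lam a \<eta> k = - \<i> * of_real lam * (tri \<eta> a a k + tri a \<eta> a k + tri a a \<eta> k)"

lemma hbound_cong: "hbound s a A \<Longrightarrow> (\<And>k. b k = a k) \<Longrightarrow> A = B \<Longrightarrow> hbound s b B"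
  by (simp add: hbound_def)

lemma tri_zero [simp]:
  "tri (\<lambda>k. 0) b c = (\<lambda>k. 0)" "tri a (\<lambda>k. 0) c = (\<lambda>k. 0)" "tri a b (\<lambda>k. 0) = (\<lambda>k. 0)"
  by (simp_all add: tri_def conv_def flat_def fun_eq_iff)

section \<open>Second-order estimates for the cubic term\<close>

context algebra_index begin

lemma hbound_tri_diff_sep:
  fixes a b c :: "int ^ 'd \<Rightarrow> complex"
  assumes h: "hbound \<sigma> a A" "hbound \<sigma> b B" "hbound \<sigma> c C" "hbound \<sigma> a' A'" "hbound \<sigma> b' B'" "hbound \<sigma> c' C'"
    and d: "hbound \<sigma> (\<lambda>k. a k - a' k) X" "hbound \<sigma> (\<lambda>k. b k - b' k) Y" "hbound \<sigma> (\<lambda>k. c k - c' k) Z"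
  shows "hbound \<sigma> (\<lambda>k. tri a b c k - tri a' b' c' k) (K * X * B * C + K * A' * Y * C + K * A' * B' * Z)"
  unfolding tri_diff [OF h]
  by (intro hbound_add hbound_tri1 hbound_tri2 hbound_tri3 \<sigma>_nonneg order_refl h d)

lemma hbound_dcubic:
  fixes a \<eta> :: "int ^ 'd \<Rightarrow> complex"
  assumes \<beta>: "0 \<le> \<beta>" "\<beta> \<le> \<sigma>" and a: "hbound \<sigma> a M" and \<eta>: "hbound \<beta> \<eta> X"
  shows "hbound \<beta> (dcubic lam a \<eta>) (3 * \<bar>lam\<bar> * K * M\<^sup>2 * X)"
proof -
  have "hbound \<beta> (\<lambda>k. tri \<eta> a a k + tri a \<eta> a k + tri a a \<eta> k) (K * X * M * M + K * M * X * M + K * M * M * X)"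
    by (intro hbound_add hbound_tri1 hbound_tri2 hbound_tri3 \<beta> a \<eta>)
  from hbound_cmult [OF this, of "- \<i> * of_real lam"] show ?thesis
    by (rule hbound_cong) (simp_all add: dcubic_def norm_mult power2_eq_square algebra_simps)
qed

lemma dcubic_linear:
  fixes a \<eta> \<zeta> :: "int ^ 'd \<Rightarrow> complex"
  assumes a: "hbound \<sigma> a M" and \<eta>: "hbound \<sigma> \<eta> X" and \<zeta>: "hbound \<sigma> \<zeta> Y"
  shows "dcubic lam a (\<lambda>k. \<eta> k - of_real r * \<zeta> k) k = dcubic lam a \<eta> k - of_real r * dcubic lam a \<zeta> k"
proof -
  note z = hbound_cmult [OF \<zeta>, of "of_real r"]
  show ?thesis
    using tri_diff [OF \<eta> a a z a a, of k] tri_diff [OF a \<eta> a a z a, of k] tri_diff [OF a a \<eta> a a z, of k]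
    by (simp add: dcubic_def tri_of_real algebra_simps)
qed

lemma dcubic_of_real: "dcubic lam a (\<lambda>k. of_real r * \<eta> k) k = of_real r * dcubic lam a \<eta> k"
  by (simp add: dcubic_def tri_of_real algebra_simps)

text \<open>Taylor remainder of second order. The telescoped difference has \<eta> = b - a in each
  slot once; its terms differ from those of the derivative by exchanging \<open>b\<close> and
  \<open>a\<close> in other slots, which costs a second factor \<eta>. The terms with \<eta> in the
  last slot cancel.\<close>

lemma hbound_cubic_linearize:
  fixes a b :: "int ^ 'd \<Rightarrow> complex"
  assumes a: "hbound \<sigma> a r" and b: "hbound \<sigma> b r" and Y: "hbound \<sigma> (\<lambda>k. b k - a k) Y"
  shows "hbound \<sigma> (\<lambda>k. cubic lam b k - cubic lam a k - dcubic lam a (\<lambda>k. b k - a k) k) (3 * \<bar>lam\<bar> * K * r * Y\<^sup>2)"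
proof -
  let ?\<eta> = "\<lambda>k. b k - a k"
  have z: "hbound \<sigma> (\<lambda>k. c k - c k) 0" for c :: "int ^ 'd \<Rightarrow> complex" by simp
  have 1: "hbound \<sigma> (\<lambda>k. tri ?\<eta> b b k - tri ?\<eta> a a k) (K * 0 * r * r + K * Y * Y * r + K * Y * r * Y)"
    by (rule hbound_tri_diff_sep [OF Y b b Y a a z Y Y])
  have 2: "hbound \<sigma> (\<lambda>k. tri a ?\<eta> b k - tri a ?\<eta> a k) (K * 0 * Y * r + K * r * 0 * r + K * r * Y * Y)"
    by (rule hbound_tri_diff_sep [OF a Y b a Y a z z Y])
  have eq: "cubic lam b k - cubic lam a k - dcubic lam a ?\<eta> k =
     - \<i> * of_real lam * ((tri ?\<eta> b b k - tri ?\<eta> a a k) + (tri a ?\<eta> b k - tri a ?\<eta> a k))" for k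
  proof -
    have "cubic lam b k - cubic lam a k = - \<i> * of_real lam * (tri b b b k - tri a a a k)"
      by (simp add: cubic_def algebra_simps)
    then show ?thesis
      unfolding tri_diff [OF b b b a a a] dcubic_def by (simp add: algebra_simps)
  qed
  show ?thesis
    by (rule hbound_cong [OF hbound_cmult [OF hbound_add [OF 1 2]] eq])
      (simp add: norm_mult power2_eq_square algebra_simps)
qed

text \<open>Serves to move the derivative from a varying base point to the fixed one
  \<open>v 0\<close>.\<close>

lemma hbound_dcubic_base:
  fixes a b \<eta> :: "int ^ 'd \<Rightarrow> complex"
  assumes a: "hbound \<sigma> a r" and b: "hbound \<sigma> b r" and Y: "hbound \<sigma> (\<lambda>k. a k - b k) Y" and X: "hbound \<sigma> \<eta> X"
  shows "hbound \<sigma> (\<lambda>k. dcubic lam a \<eta> k - dcubic lam b \<eta> k) (6 * \<bar>lam\<bar> * K * r * X * Y)"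
proof -
  have z: "hbound \<sigma> (\<lambda>k. \<eta> k - \<eta> k) 0" by simp
  have 1: "hbound \<sigma> (\<lambda>k. tri \<eta> a a k - tri \<eta> b b k) (K * 0 * r * r + K * X * Y * r + K * X * r * Y)"
    by (rule hbound_tri_diff_sep [OF X a a X b b z Y Y])
  have 2: "hbound \<sigma> (\<lambda>k. tri a \<eta> a k - tri b \<eta> b k) (K * Y * X * r + K * r * 0 * r + K * r * X * Y)"
    by (rule hbound_tri_diff_sep [OF a X a b X b Y z Y])
  have 3: "hbound \<sigma> (\<lambda>k. tri a a \<eta> k - tri b b \<eta> k) (K * Y * r * X + K * r * Y * X + K * r * r * 0)"
    by (rule hbound_tri_diff_sep [OF a a X b b X Y Y z])
  have eq: "dcubic lam a \<eta> k - dcubic lam b \<eta> k = - \<i> * of_real lam * ((tri \<eta> a a k - tri \<eta> b b k) +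
     (tri a \<eta> a k - tri b \<eta> b k) + (tri a a \<eta> k - tri b b \<eta> k))" for k
    by (simp add: dcubic_def algebra_simps)
  show ?thesis
    by (rule hbound_cong [OF hbound_cmult [OF hbound_add [OF hbound_add [OF 1 2] 3]] eq])
      (simp add: norm_mult algebra_simps)
qed

end

lemma exact_flow_mono: "exact_flow lam \<kappa> h s M v \<Longrightarrow> M \<le> M' \<Longrightarrow> exact_flow lam \<kappa> h s M' v"
  unfolding exact_flow_def using hbound_le by blast

section \<open>Second-order expansion of the solution and of the defect\<close>

context exact_step begin

text \<open>\<open>pv\<close> and \<open>qv\<close> are the derivatives of \<open>v\<close> and
  \<open>F\<close> at \<tau> = 0 along the rescaled flow; \<open>V2\<close> and \<open>W2\<close>
  bound the remainders of first-order Taylor expansion, divided by \<kappa>^2.\<close>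

definition pv where "pv k = symbol \<kappa> k * v 0 k + of_real h * F 0 k"
definition qv where "qv = dcubic lam (v 0) pv"
definition V2 where "V2 = M + W1 + F2"
definition W2 where "W2 = 3 * \<bar>lam\<bar> * K * (M * V1\<^sup>2 + M\<^sup>2 * V2)"

lemma pv_bound: "hbound \<sigma> pv (\<kappa> * V1)"
proof -
  have "hbound (\<sigma> + 2 - 2 * real 1) (\<lambda>k. symbol \<kappa> k * v 0 k) (1 * \<kappa> ^ 1 * M)"
    by (rule hbound_symbol [OF exact_flowD(1) [OF v]]) auto
  then have "hbound \<sigma> (\<lambda>k. symbol \<kappa> k * v 0 k) (\<kappa> * M)" by simp
  from hbound_add [OF this hbound_cmult [OF F_bound [of 0], of "of_real h"]]
  have "hbound \<sigma> pv (\<kappa> * M + norm (of_real h :: complex) * F1)" by (simp add: pv_def [abs_def])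
  then show ?thesis
    by (rule hbound_le) (use mult_right_mono [OF h(2) F1_nonneg] h in \<open>simp add: V1_def algebra_simps\<close>)
qed

lemma qv_bound: "hbound \<sigma> qv (\<kappa> * W1)"
  using hbound_dcubic [OF \<sigma>_nonneg order_refl v_bound [of 0] pv_bound, of lam]
  by (simp add: qv_def W1_def mult_ac)

text \<open>Four derivatives are lost from order \<sigma> + 2, two for each power of \<kappa>. In
  the integral term one power comes from h, the other from the increment of \<open>F\<close> or from
  the deviation of the exponential from 1.\<close>

lemma v_taylor:
  assumes \<tau>: "\<tau> \<in> {0..1}"
  shows "hbound (\<sigma> - 2) (\<lambda>k. v \<tau> k - v 0 k - of_real \<tau> * pv k) (\<kappa>\<^sup>2 * V2)"
proof -
  have c: "continuous_on {0..1} (\<lambda>r. F r k - F 0 k)" for k by (intro continuous_intros F_cont)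
  have "hbound (\<sigma> + 2 - 2 * real 2) (\<lambda>k. (exp (of_real \<tau> * symbol \<kappa> k) - 1 - of_real \<tau> * symbol \<kappa> k) * v 0 k) (1 * \<kappa> ^ 2 * M)"
  proof (rule hbound_symbol)
    show "norm (exp (of_real \<tau> * symbol \<kappa> k) - 1 - of_real \<tau> * symbol \<kappa> k) \<le> 1 * norm (symbol \<kappa> k) ^ 2" for k :: "int ^ 'd"
    proof -
      have "norm (exp (of_real \<tau> * symbol \<kappa> k) - 1 - of_real \<tau> * symbol \<kappa> k) \<le> (norm (of_real \<tau> * symbol \<kappa> k))\<^sup>2"
        by (rule norm_exp_minus_linear) simp
      also have "\<dots> \<le> (norm (symbol \<kappa> k))\<^sup>2"
        using \<tau> by (intro power_mono) (auto simp: norm_mult mult_left_le_one_le)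
      finally show ?thesis by simp
    qed
  qed (use exact_flowD(1) [OF v] in auto)
  then have 1: "hbound (\<sigma> - 2) (\<lambda>k. (exp (of_real \<tau> * symbol \<kappa> k) - 1 - of_real \<tau> * symbol \<kappa> k) * v 0 k) (\<kappa>\<^sup>2 * M)" by simp
  have 2: "hbound \<sigma> (\<lambda>k. integral {0..\<tau>} (\<lambda>r. exp (of_real (\<tau> - r) * symbol \<kappa> k) * (F r k - F 0 k))) (\<kappa> * W1)"
    by (rule hbound_flow_integral [OF F_diff c \<tau>])
  have "hbound (\<sigma> + 2 - 2 * real 1) (\<lambda>k. (integral {0..\<tau>} (\<lambda>r. exp (of_real (\<tau> - r) * symbol \<kappa> k)) - of_real \<tau>) * F 0 k) (1 * \<kappa> ^ 1 * F2)"
    by (rule hbound_symbol [OF F_bound2])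
      (use norm_integral_exp_minus [OF _ \<tau>, of _ "\<lambda>_. 1"] \<tau> in \<open>auto simp: scaleR_conv_of_real\<close>)
  then have 3: "hbound \<sigma> (\<lambda>k. (integral {0..\<tau>} (\<lambda>r. exp (of_real (\<tau> - r) * symbol \<kappa> k)) - of_real \<tau>) * F 0 k) (\<kappa> * F2)" by simp
  have eq: "v \<tau> k - v 0 k - of_real \<tau> * pv k = (exp (of_real \<tau> * symbol \<kappa> k) - 1 - of_real \<tau> * symbol \<kappa> k) * v 0 k +
     of_real h * (integral {0..\<tau>} (\<lambda>r. exp (of_real (\<tau> - r) * symbol \<kappa> k) * (F r k - F 0 k)) +
      (integral {0..\<tau>} (\<lambda>r. exp (of_real (\<tau> - r) * symbol \<kappa> k)) - of_real \<tau>) * F 0 k)" for k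
  proof -
    have d: "continuous_on {0..\<tau>} (\<lambda>r. F r k)" by (rule continuous_on_subset [OF F_cont]) (use \<tau> in auto)
    have "continuous_on {0..\<tau>} (\<lambda>r. exp (of_real (\<tau> - r) * symbol \<kappa> k))" by (intro continuous_intros)
    from integral_split_linear [OF this d, of "F 0 k" 0] show ?thesis
      unfolding v_duhamel [OF \<tau>] pv_def by (simp add: algebra_simps)
  qed
  have "hbound (\<sigma> - 2) (\<lambda>k. v \<tau> k - v 0 k - of_real \<tau> * pv k) (\<kappa>\<^sup>2 * M + norm (of_real h :: complex) * (\<kappa> * W1 + \<kappa> * F2))"
    unfolding eq by (intro hbound_add 1 hbound_weaken [OF hbound_cmult [OF hbound_add [OF 2 3]]]) simp
  moreover have "\<kappa>\<^sup>2 * M + norm (of_real h :: complex) * (\<kappa> * W1 + \<kappa> * F2) \<le> \<kappa>\<^sup>2 * V2"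
    using mult_right_mono [OF h(2), of "\<kappa> * W1 + \<kappa> * F2"] h W1_nonneg F2_nonneg
    by (simp add: V2_def algebra_simps power2_eq_square)
  ultimately show ?thesis by (rule hbound_le)
qed

text \<open>Chain rule: the cubic term is linearised at \<open>v 0\<close>, and the increment of
  \<open>v\<close> is expanded inside the derivative.\<close>

lemma F_taylor:
  assumes \<tau>: "\<tau> \<in> {0..1}" and \<sigma>2: "\<sigma> \<ge> 2"
  shows "hbound (\<sigma> - 2) (\<lambda>k. F \<tau> k - F 0 k - of_real \<tau> * qv k) (\<kappa>\<^sup>2 * W2)"
proof -
  have 1: "hbound (\<sigma> - 2) (\<lambda>k. cubic lam (v \<tau>) k - cubic lam (v 0) k - dcubic lam (v 0) (\<lambda>k. v \<tau> k - v 0 k) k) (3 * \<bar>lam\<bar> * K * M * (\<kappa> * V1)\<^sup>2)"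
    by (rule hbound_weaken [OF hbound_cubic_linearize [OF v_bound v_bound [OF \<tau>] v_diff [OF \<tau>]]]) auto
  have 2: "hbound (\<sigma> - 2) (dcubic lam (v 0) (\<lambda>k. (v \<tau> k - v 0 k) - of_real \<tau> * pv k)) (3 * \<bar>lam\<bar> * K * M\<^sup>2 * (\<kappa>\<^sup>2 * V2))"
    using \<sigma>2 by (intro hbound_dcubic v_bound v_taylor \<tau>) auto
  have "dcubic lam (v 0) (\<lambda>k. (v \<tau> k - v 0 k) - of_real \<tau> * pv k) k = dcubic lam (v 0) (\<lambda>k. v \<tau> k - v 0 k) k - of_real \<tau> * qv k" for k
    unfolding qv_def by (rule dcubic_linear [OF v_bound [of 0] v_diff [OF \<tau>] pv_bound]) simp
  then have "(\<lambda>k. F \<tau> k - F 0 k - of_real \<tau> * qv k) = (\<lambda>k. (cubic lam (v \<tau>) k - cubic lam (v 0) k - dcubic lam (v 0) (\<lambda>k. v \<tau> k - v 0 k) k) +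
      dcubic lam (v 0) (\<lambda>k. (v \<tau> k - v 0 k) - of_real \<tau> * pv k) k)"
    by (simp add: F_def fun_eq_iff)
  then show ?thesis using hbound_add [OF 1 2] by (simp add: W2_def algebra_simps power2_eq_square)
qed

text \<open>With slope \<open>qv\<close> the remainder of \<open>F\<close> is O(\<kappa>^2). Besides
  the error of \<open>C\<close>, the one term of size h \<kappa> left is the mismatch
  \<open>g\<close> of the first moments at z = 0, times h \<open>qv\<close>; at other z the mismatch
  changes by O(z), which costs two derivatives.\<close>

lemma defect_principal:
  assumes \<tau>: "\<tau> \<in> {0..1}" and p: "p \<ge> 1" "\<sigma> - 2 * real p \<ge> 0"
    and C_ord: "\<And>z. Re z = 0 \<Longrightarrow> norm (exp (of_real \<tau> * z) - C \<tau> z) \<le> L * norm z ^ (p + 1)"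
    and m0: "\<And>z. Re z = 0 \<Longrightarrow> norm (integral {0..\<tau>} (\<lambda>r. exp (of_real (\<tau> - r) * z)) - integral {0..1} (\<lambda>r. A \<tau> r z)) \<le> L * norm z ^ 2"
    and m1: "integral {0..1} (\<lambda>r. A \<tau> r 0 * of_real r) = of_real (\<tau>\<^sup>2 / 2 - g)"
  shows "hbound (\<sigma> - 2 * real p) (\<lambda>k. defect lam \<kappa> h v \<tau> k - of_real (h * g) * qv k)
    (L * \<kappa> ^ (p + 1) * M + h * \<kappa>\<^sup>2 * ((1 + L) * (W1 + W2) + L * F2))"
proof -
  have \<sigma>2: "\<sigma> \<ge> 2" "\<sigma> - 2 * real p \<le> \<sigma> - 2" using p by (auto simp: Suc_le_eq)
  have c: "continuous_on {0..1} (\<lambda>r. F r k - F 0 k - of_real r * qv k)" for k by (intro continuous_intros F_cont)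
  have 2: "hbound (\<sigma> - 2) (\<lambda>k. integral {0..\<tau>} (\<lambda>r. exp (of_real (\<tau> - r) * symbol \<kappa> k) * (F r k - F 0 k - of_real r * qv k))) (\<kappa>\<^sup>2 * W2)"
    by (rule hbound_flow_integral [OF F_taylor [OF _ \<sigma>2(1)] c \<tau>])
  have 3: "hbound (\<sigma> - 2) (\<lambda>k. integral {0..1} (\<lambda>r. A \<tau> r (symbol \<kappa> k) * (F r k - F 0 k - of_real r * qv k))) (L * (\<kappa>\<^sup>2 * W2))"
    by (rule hbound_weighted_integral [OF F_taylor [OF _ \<sigma>2(1)] c]) (auto intro: A_bound \<tau> A_cont)
  have "hbound (\<sigma> + 2 - 2 * real 2) (\<lambda>k. (integral {0..\<tau>} (\<lambda>r. exp (of_real (\<tau> - r) * symbol \<kappa> k)) - integral {0..1} (\<lambda>r. A \<tau> r (symbol \<kappa> k))) * F 0 k) (L * \<kappa> ^ 2 * F2)"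
    by (rule hbound_symbol [OF F_bound2]) (use m0 L_nonneg in auto)
  then have 4: "hbound (\<sigma> - 2) (\<lambda>k. (integral {0..\<tau>} (\<lambda>r. exp (of_real (\<tau> - r) * symbol \<kappa> k)) - integral {0..1} (\<lambda>r. A \<tau> r (symbol \<kappa> k))) * F 0 k) (L * \<kappa>\<^sup>2 * F2)"
    by simp
  let ?m1 = "\<lambda>z. integral {0..\<tau>} (\<lambda>r. exp (of_real (\<tau> - r) * z) * of_real r) - integral {0..1} (\<lambda>r. A \<tau> r z * of_real r)"
  have m1z: "norm (?m1 z - of_real g) \<le> (1 + L) * norm z" if z: "Re z = 0" for z
  proof -
    have i: "integral {0..\<tau>} (\<lambda>r. of_real r :: complex) = of_real (\<tau>\<^sup>2 / 2)"
    proof -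
      have "((\<lambda>r. of_real r :: complex) has_integral (of_real (\<tau>\<^sup>2 / 2) - of_real (0\<^sup>2 / 2))) {0..\<tau>}"
      proof (rule fundamental_theorem_of_calculus)
        fix r
        have "((\<lambda>w. w\<^sup>2 / 2) has_field_derivative (of_real r)) (at (of_real r :: complex))"
          by (auto intro!: derivative_eq_intros)
        from has_vector_derivative_real_field [OF this]
        show "((\<lambda>r. of_real (r\<^sup>2 / 2) :: complex) has_vector_derivative of_real r) (at r within {0..\<tau>})" by simp
      qed (use \<tau> in auto)
      then show ?thesis by (simp add: integral_unique)
    qed
    have 1: "norm (integral {0..\<tau>} (\<lambda>r. exp (of_real (\<tau> - r) * z) * of_real r) - of_real (\<tau>\<^sup>2 / 2)) \<le> norm z"
      using norm_integral_exp_minus [OF z \<tau>, of of_real] unfolding i by (auto intro!: continuous_intros)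
    have 2: "norm (integral {0..1} (\<lambda>r. A \<tau> r z * of_real r) - of_real (\<tau>\<^sup>2 / 2 - g)) \<le> L * norm z"
      using A_weight_at0 [OF z \<tau>, of of_real] unfolding m1 by (auto intro!: continuous_intros)
    have "?m1 z - of_real g = (integral {0..\<tau>} (\<lambda>r. exp (of_real (\<tau> - r) * z) * of_real r) - of_real (\<tau>\<^sup>2 / 2)) -
        (integral {0..1} (\<lambda>r. A \<tau> r z * of_real r) - of_real (\<tau>\<^sup>2 / 2 - g))"
      unfolding of_real_diff [of "\<tau>\<^sup>2 / 2" g] by (simp only: algebra_simps)
    also have "norm \<dots> \<le> norm z + L * norm z"
      by (rule order_trans [OF norm_triangle_ineq4 add_mono [OF 1 2]])
    finally show ?thesis by (simp only: ring_distribs mult_1)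
  qed
  have "hbound (\<sigma> - 2 * real 1) (\<lambda>k. (?m1 (symbol \<kappa> k) - of_real g) * qv k) ((1 + L) * \<kappa> ^ 1 * (\<kappa> * W1))"
    by (rule hbound_symbol [OF qv_bound]) (use m1z L_nonneg in auto)
  then have 5: "hbound (\<sigma> - 2) (\<lambda>k. (?m1 (symbol \<kappa> k) - of_real g) * qv k) ((1 + L) * \<kappa>\<^sup>2 * W1)"
    by (simp add: power2_eq_square mult_ac)
  have eq: "defect lam \<kappa> h v \<tau> k - of_real (h * g) * qv k = (exp (of_real \<tau> * symbol \<kappa> k) - C \<tau> (symbol \<kappa> k)) * v 0 k +
     of_real h * ((integral {0..\<tau>} (\<lambda>r. exp (of_real (\<tau> - r) * symbol \<kappa> k) * (F r k - F 0 k - of_real r * qv k)) -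
        integral {0..1} (\<lambda>r. A \<tau> r (symbol \<kappa> k) * (F r k - F 0 k - of_real r * qv k))) +
      (integral {0..\<tau>} (\<lambda>r. exp (of_real (\<tau> - r) * symbol \<kappa> k)) - integral {0..1} (\<lambda>r. A \<tau> r (symbol \<kappa> k))) * F 0 k +
      (?m1 (symbol \<kappa> k) - of_real g) * qv k)" for k
    unfolding defect_split [OF \<tau>, of k "qv k"] by (simp add: algebra_simps)
  have "hbound (\<sigma> - 2 * real p) (\<lambda>k. defect lam \<kappa> h v \<tau> k - of_real (h * g) * qv k)
    (L * \<kappa> ^ (p + 1) * M + norm (of_real h :: complex) * ((\<kappa>\<^sup>2 * W2 + L * (\<kappa>\<^sup>2 * W2)) + L * \<kappa>\<^sup>2 * F2 + (1 + L) * \<kappa>\<^sup>2 * W1))"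
    unfolding eq
    by (intro hbound_add C_part_bound C_ord hbound_weaken [OF hbound_cmult [OF hbound_add [OF hbound_add [OF hbound_diff [OF 2 3] 4] 5]] \<sigma>2(2)])
  then show ?thesis using h by (simp add: algebra_simps)
qed

end

section \<open>The local error with averaging of the drift\<close>

context ep_setting0 begin

text \<open>The stages deviate from the solution by h g(\<tau>) \<open>qv\<close> up to smaller
  terms. In the final value this enters through the integral of A(1, r) g(r), applied to the
  derivative of the nonlinearity. Since A(1, r) is 1 at z = 0 and g has mean zero, the integral is
  O(z), which gains the missing power of \<kappa>.\<close>

theorem local_error_balanced:
  assumes p: "p \<ge> 1" "\<sigma> - 2 * real p \<ge> 0"
    and C_ord: "\<And>\<tau> z. \<tau> \<in> {0..1} \<Longrightarrow> Re z = 0 \<Longrightarrow> norm (exp (of_real \<tau> * z) - C \<tau> z) \<le> L * norm z ^ (p + 1)"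
    and A_ord: "\<And>r z. r \<in> {0..1} \<Longrightarrow> Re z = 0 \<Longrightarrow> norm (exp (of_real (1 - r) * z) - A 1 r z) \<le> L * norm z ^ p"
    and m0: "\<And>\<tau> z. \<tau> \<in> {0..1} \<Longrightarrow> Re z = 0 \<Longrightarrow> norm (integral {0..\<tau>} (\<lambda>r. exp (of_real (\<tau> - r) * z)) - integral {0..1} (\<lambda>r. A \<tau> r z)) \<le> L * norm z ^ 2"
    and m1: "\<And>\<tau>. \<tau> \<in> {0..1} \<Longrightarrow> integral {0..1} (\<lambda>r. A \<tau> r 0 * of_real r) = of_real (\<tau>\<^sup>2 / 2 - g \<tau>)"
    and g: "continuous_on {0..1} g" "\<And>\<tau>. \<tau> \<in> {0..1} \<Longrightarrow> \<bar>g \<tau>\<bar> \<le> L" "integral {0..1} g = 0"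
  shows "\<exists>c>0. \<exists>D\<ge>0. \<forall>\<kappa> h v U. 0 < h \<and> h \<le> \<kappa> \<and> \<kappa> \<le> c \<and>
       exact_flow lam \<kappa> h (\<sigma> + 2) M v \<and> seq_stages (\<sigma> + 2) \<rho> lam \<kappa> h (v 0 :: int ^ 'd \<Rightarrow> complex) U \<longrightarrow>
       hbound (\<sigma> - 2 * real p) (\<lambda>k. v 1 k - U 1 k) (h * (D * (\<kappa> ^ (p + 1) + h * \<kappa>\<^sup>2)))"
proof (cases "M \<ge> 0")
  case False
  have "\<not> exact_flow lam \<kappa> h (\<sigma> + 2) M v" for \<kappa> h and v :: "real \<Rightarrow> int ^ 'd \<Rightarrow> complex"
    using exact_flowD(1) [of lam \<kappa> h "\<sigma> + 2" M v 0] hbound_nonneg False by force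
  then show ?thesis by (intro exI [of _ 1]) auto
next
  case M: True
  define f1 where "f1 = \<bar>lam\<bar> * K * M ^ 3"
  define f2 where "f2 = \<bar>lam\<bar> * algebra_index.K TYPE('d) (\<sigma> + 2) * M ^ 3"
  define v1 where "v1 = M + f1"
  define w1 where "w1 = 3 * \<bar>lam\<bar> * K * M\<^sup>2 * v1"
  define v2 where "v2 = M + w1 + f2"
  define w2 where "w2 = 3 * \<bar>lam\<bar> * K * (M * v1\<^sup>2 + M\<^sup>2 * v2)"
  have f: "f1 \<ge> 0" "f2 \<ge> 0" "v1 \<ge> 0" "w1 \<ge> 0" "v2 \<ge> 0" "w2 \<ge> 0"
    using M K_nonneg algebra_index.K_nonneg [OF algebra_index_up]
    by (auto simp: f1_def f2_def v1_def w1_def v2_def w2_def)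
  \<comment> \<open>Bounds the solution minus its drift, the intermediate point between exact and
    numerical stages.\<close>
  define M' where "M' = M + L * w1"
  define \<rho>' where "\<rho>' = max \<rho> M'"
  have M': "M' \<ge> M" using f L_nonneg by (simp add: M'_def)
  have \<rho>': "\<rho>' \<ge> M'" "\<rho>' \<ge> 0" "\<rho>' \<ge> \<rho>" using M M' by (auto simp: \<rho>'_def)
  define q where "q = Q lam \<rho>'"
  have q: "q \<ge> 0" unfolding q_def by (rule Q_nonneg)
  define lk where "lk = \<bar>lam\<bar> * K"
  have lk: "lk \<ge> 0" using K_nonneg by (simp add: lk_def)
  define e2 where "e2 = L * M + ((1 + L) * (w1 + w2) + L * f2)"
  define e3 where "e3 = 2 * e2 + 2 * q * L * w1"
  define e4 where "e4 = 3 * lk * \<rho>' * (L * w1)\<^sup>2 + 6 * lk * \<rho>' * (L * w1) * (v1 + L * w1) + 3 * lk * \<rho>'\<^sup>2 * e3"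
  define x1 where "x1 = 3 * lk * M\<^sup>2 * w1"
  define B where "B = L * w1 + (L * e4 + L * L * x1)"
  have e: "e2 \<ge> 0" "e3 \<ge> 0" "e4 \<ge> 0" "x1 \<ge> 0"
    using f M L_nonneg q lk \<rho>' by (auto simp: e2_def e3_def e4_def x1_def)
  have B: "B \<ge> 0" using e f L_nonneg by (simp add: B_def)
  have "hbound (\<sigma> - 2 * real p) (\<lambda>k. v 1 k - U 1 k) (h * (B * (\<kappa> ^ (p + 1) + h * \<kappa>\<^sup>2)))"
    if hs: "0 < h" "h \<le> \<kappa>" "\<kappa> \<le> 1 / (2 * (q + 1))" and v: "exact_flow lam \<kappa> h (\<sigma> + 2) M v"
      and U: "seq_stages (\<sigma> + 2) \<rho> lam \<kappa> h (v 0) U" for \<kappa> h v and U :: "real \<Rightarrow> int ^ 'd \<Rightarrow> complex"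
  proof -
    interpret exact_step D \<sigma> C A L lam \<kappa> h M v
      by unfold_locales (use v hs in auto)
    have w: "F2 = f2" "V1 = v1" "W1 = w1" "W2 = w2"
      by (simp_all add: W2_def w2_def V2_def v2_def W1_def w1_def V1_def v1_def F1_def f1_def F2_def f2_def)
    define N where "N = \<kappa> ^ (p + 1) + h * \<kappa>\<^sup>2"
    have N1: "\<kappa> ^ (p + 1) \<le> N" "h * \<kappa>\<^sup>2 \<le> N" "0 \<le> h * \<kappa>\<^sup>2" "0 \<le> \<kappa> ^ (p + 1)" "N \<ge> 0" using hs by (auto simp: N_def)
    have hq: "h * q \<le> 1 / 2"
    proof -
      have "h * q \<le> 1 / (2 * (q + 1)) * q" using hs q by (intro mult_right_mono) auto
      also have "\<dots> \<le> 1 / 2" using q by (simp add: field_simps)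
      finally show ?thesis .
    qed
    have \<kappa>1: "\<kappa> \<le> 1"
    proof -
      have "1 / (2 * (q + 1)) \<le> 1" using q by (simp add: field_simps)
      then show ?thesis using hs by simp
    qed
    have h1: "h \<le> 1" using hs \<kappa>1 by simp
    let ?b = "\<sigma> - 2 * real p"
    have b\<sigma>: "?b \<le> \<sigma>" "?b \<le> \<sigma> - 2" using p by auto
    define d2 where "d2 = L * \<kappa> ^ (p + 1) * M + h * \<kappa>\<^sup>2 * ((1 + L) * (W1 + W2) + L * F2)"
    have d2: "d2 \<le> e2 * N" "d2 \<ge> 0"
    proof -
      have "L * M * \<kappa> ^ (p + 1) \<le> L * M * N" using N1 L_nonneg M by (intro mult_left_mono) auto
      moreover have "((1 + L) * (W1 + W2) + L * F2) * (h * \<kappa>\<^sup>2) \<le> ((1 + L) * (W1 + W2) + L * F2) * N"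
        using N1 L_nonneg f by (intro mult_left_mono) (auto simp: w)
      ultimately show "d2 \<le> e2 * N" unfolding d2_def e2_def w by (simp add: algebra_simps)
      show "d2 \<ge> 0" unfolding d2_def w using N1 L_nonneg f M by simp
    qed
    have def2: "hbound ?b (\<lambda>k. defect lam \<kappa> h v \<tau> k - of_real (h * g \<tau>) * qv k) d2" if \<tau>: "\<tau> \<in> {0..1}" for \<tau>
      unfolding d2_def by (rule defect_principal [OF \<tau> p C_ord [OF \<tau>] m0 [OF \<tau>] m1 [OF \<tau>]])
    have gq: "hbound \<sigma> (\<lambda>k. of_real (h * g \<tau>) * qv k) (h * (L * W1) * \<kappa>)" if \<tau>: "\<tau> \<in> {0..1}" for \<tau>
    proof -
      have "hbound \<sigma> (\<lambda>k. of_real (h * g \<tau>) * qv k) ((h * L) * (\<kappa> * W1))"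
        by (rule hbound_mult [OF qv_bound]) (use g(2) [OF \<tau>] hs L_nonneg in \<open>auto simp: abs_mult norm_mult\<close>)
      then show ?thesis by (simp add: mult_ac)
    qed
    define P where "P = d2 + h * (L * W1) * \<kappa>"
    have defP: "hbound ?b (defect lam \<kappa> h v \<tau>) P" if \<tau>: "\<tau> \<in> {0..1}" for \<tau>
      using hbound_add [OF def2 [OF \<tau>] hbound_weaken [OF gq [OF \<tau>] b\<sigma>(1)]] unfolding P_def by simp
    \<comment> \<open>Enlarging the bound to \<open>M'\<close> makes the Lipschitz constant in
      \<open>defect_error\<close> equal to \<open>q\<close>.\<close>
    have vM': "exact_flow lam \<kappa> h (\<sigma> + 2) M' v" by (rule exact_flow_mono [OF v M'])
    define P3 where "P3 = h * q * (2 * P) + d2"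
    have P3: "P3 \<le> e3 * N"
    proof -
      have "(h * q) * (2 * d2) \<le> 1 / 2 * (2 * d2)" using hq d2 by (intro mult_right_mono) auto
      moreover have "(2 * q * L * w1 * h) * (h * \<kappa>) \<le> (2 * q * L * w1 * 1) * N"
      proof -
        have "h * (h * \<kappa>) \<le> h * (\<kappa> * \<kappa>)" using hs by (intro mult_left_mono mult_right_mono) auto
        then have "h * (h * \<kappa>) \<le> N" using N1 by (simp add: power2_eq_square)
        then have "(2 * q * L * w1) * (h * (h * \<kappa>)) \<le> (2 * q * L * w1) * N"
          using q L_nonneg f by (intro mult_left_mono) auto
        then show ?thesis by (simp add: mult_ac)
      qed
      ultimately show ?thesis using d2(1) unfolding P3_def P_def e3_def w by (simp add: algebra_simps)
    qed
    have dlt2: "hbound ?b (\<lambda>k. v \<tau> k - U \<tau> k - of_real (h * g \<tau>) * qv k) P3" if \<tau>: "\<tau> \<in> {0..1}" for \<tau>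
    proof -
      have "hbound ?b (\<lambda>k. v \<tau> k - U \<tau> k - defect lam \<kappa> h v \<tau> k) (h * Q lam (max \<rho> M') * (2 * P))"
        by (rule defect_error(2) [OF p(2) b\<sigma>(1) _ vM' U _ _ defP \<tau>])
          (use hs hq in \<open>auto simp: q_def \<rho>'_def\<close>)
      from hbound_add [OF this def2 [OF \<tau>]] show ?thesis
        by (rule hbound_cong) (simp_all add: P3_def q_def \<rho>'_def)
    qed
    define \<psi> where "\<psi> = dcubic lam (v 0) qv"
    have \<psi>: "hbound \<sigma> \<psi> (\<kappa> * x1)"
      using hbound_dcubic [OF \<sigma>_nonneg order_refl v_bound [of 0] qv_bound, of lam]
      by (simp add: \<psi>_def x1_def lk_def w mult_ac)
    have vr: "hbound \<sigma> (v r) \<rho>'" if "r \<in> {0..1}" for r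
      by (rule hbound_le [OF v_bound [OF that]]) (use M' \<rho>' in simp)
    have Ur: "hbound \<sigma> (U r) \<rho>'" if "r \<in> {0..1}" for r
      by (rule hbound_le [OF hbound_weaken [OF seq_stagesD(2) [OF U that]] \<rho>'(3)]) simp
    \<comment> \<open>What remains of the difference of the nonlinearities once its leading part h
      g(r) \<psi> is removed.\<close>
    define \<theta> where "\<theta> = (\<lambda>r k. F r k - cubic lam (U r) k - of_real (h * g r) * \<psi> k)"
    have \<theta>: "hbound ?b (\<theta> r) (e4 * N)" if r: "r \<in> {0..1}" for r
    proof -
      define \<eta> where "\<eta> = (\<lambda>k. of_real (h * g r) * qv k)"
      \<comment> \<open>A bound for the drift \<eta> in H^\<sigma>; its square and its product with
        \<kappa> are O(h \<kappa>^2).\<close>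
      define y where "y = h * (L * w1) * \<kappa>"
      have \<eta>: "hbound \<sigma> \<eta> y" unfolding \<eta>_def y_def using gq [OF r] by (simp add: w)
      have y: "0 \<le> y" "y \<le> L * w1" "y * y \<le> (L * w1)\<^sup>2 * (h * \<kappa>\<^sup>2)" "y * (\<kappa> * v1 + y) \<le> (L * w1) * (v1 + L * w1) * (h * \<kappa>\<^sup>2)"
      proof -
        have Lw: "L * w1 \<ge> 0" using L_nonneg f by simp
        show y0: "0 \<le> y" unfolding y_def using Lw hs by simp
        have "h * \<kappa> \<le> 1 * 1" using h1 \<kappa>1 hs by (intro mult_mono) auto
        then have "(L * w1) * (h * \<kappa>) \<le> (L * w1) * 1" using Lw by (intro mult_left_mono) auto
        then show "y \<le> L * w1" by (simp add: y_def mult_ac)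
        have y\<kappa>: "y \<le> (L * w1) * \<kappa>"
        proof -
          have "h * \<kappa> \<le> 1 * \<kappa>" using h1 hs by (intro mult_right_mono) auto
          then have "(L * w1) * (h * \<kappa>) \<le> (L * w1) * \<kappa>" using Lw by (intro mult_left_mono) auto
          then show ?thesis by (simp add: y_def mult_ac)
        qed
        have "y * y \<le> y * ((L * w1) * \<kappa>)" using y0 y\<kappa> by (intro mult_left_mono) auto
        then show "y * y \<le> (L * w1)\<^sup>2 * (h * \<kappa>\<^sup>2)" by (simp add: y_def power2_eq_square mult_ac)
        have "y * (\<kappa> * v1 + y) \<le> y * (\<kappa> * v1 + (L * w1) * \<kappa>)" using y0 y\<kappa> by (intro mult_left_mono) auto
        then show "y * (\<kappa> * v1 + y) \<le> (L * w1) * (v1 + L * w1) * (h * \<kappa>\<^sup>2)"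
          by (simp add: y_def power2_eq_square algebra_simps)
      qed
      \<comment> \<open>Solution minus drift. \<open>T1\<close> linearises at this point,
        \<open>T2\<close> moves the derivative to \<open>v 0\<close>, and \<open>T3\<close> compares
        with the numerical stage, for which the weak norm suffices.\<close>
      define a where "a = (\<lambda>k. v r k - \<eta> k)"
      have a: "hbound \<sigma> a \<rho>'"
      proof -
        have "hbound \<sigma> a (M + y)" unfolding a_def by (intro hbound_diff v_bound r \<eta>)
        then show ?thesis by (rule hbound_le) (use y(2) \<rho>'(1) in \<open>simp add: M'_def\<close>)
      qed
      have va: "(\<lambda>k. v r k - a k) = \<eta>" by (simp add: a_def)
      have T1: "hbound \<sigma> (\<lambda>k. F r k - cubic lam a k - dcubic lam a \<eta> k) (3 * \<bar>lam\<bar> * K * \<rho>' * y\<^sup>2)"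
        using hbound_cubic_linearize [OF a vr [OF r], of y lam] \<eta> unfolding va F_def by simp
      have av0: "hbound \<sigma> (\<lambda>k. a k - v 0 k) (\<kappa> * v1 + y)"
        using hbound_diff [OF v_diff [OF r] \<eta>] by (simp add: a_def w algebra_simps)
      have T2: "hbound \<sigma> (\<lambda>k. dcubic lam a \<eta> k - dcubic lam (v 0) \<eta> k) (6 * \<bar>lam\<bar> * K * \<rho>' * y * (\<kappa> * v1 + y))"
        by (rule hbound_dcubic_base [OF a vr av0 \<eta>]) simp
      have "hbound ?b (\<lambda>k. a k - U r k) P3" using dlt2 [OF r] by (simp add: a_def \<eta>_def algebra_simps)
      then have T3: "hbound ?b (\<lambda>k. cubic lam a k - cubic lam (U r) k) (3 * \<bar>lam\<bar> * K * \<rho>'\<^sup>2 * P3)"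
        by (rule hbound_cubic_diff [OF p(2) b\<sigma>(1) a Ur [OF r]])
      have "\<theta> r k = (F r k - cubic lam a k - dcubic lam a \<eta> k) + (dcubic lam a \<eta> k - dcubic lam (v 0) \<eta> k) + (cubic lam a k - cubic lam (U r) k)" for k
        by (simp add: \<theta>_def \<psi>_def \<eta>_def dcubic_of_real del: of_real_mult)
      then have "\<theta> r = (\<lambda>k. (F r k - cubic lam a k - dcubic lam a \<eta> k) + (dcubic lam a \<eta> k - dcubic lam (v 0) \<eta> k) + (cubic lam a k - cubic lam (U r) k))"
        by (rule ext)
      then have "hbound ?b (\<theta> r) (3 * \<bar>lam\<bar> * K * \<rho>' * y\<^sup>2 + 6 * \<bar>lam\<bar> * K * \<rho>' * y * (\<kappa> * v1 + y) + 3 * \<bar>lam\<bar> * K * \<rho>'\<^sup>2 * P3)"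
        using hbound_add [OF hbound_weaken [OF hbound_add [OF T1 T2] b\<sigma>(1)] T3] by simp
      moreover have "3 * \<bar>lam\<bar> * K * \<rho>' * y\<^sup>2 + 6 * \<bar>lam\<bar> * K * \<rho>' * y * (\<kappa> * v1 + y) + 3 * \<bar>lam\<bar> * K * \<rho>'\<^sup>2 * P3 \<le> e4 * N"
      proof -
        have Lw: "L * w1 \<ge> 0" using L_nonneg f by simp
        have "(L * w1)\<^sup>2 * (h * \<kappa>\<^sup>2) \<le> (L * w1)\<^sup>2 * N" using N1 by (intro mult_left_mono) auto
        then have "y * y \<le> (L * w1)\<^sup>2 * N" using y(3) by linarith
        then have 1: "(3 * lk * \<rho>') * (y * y) \<le> (3 * lk * \<rho>') * ((L * w1)\<^sup>2 * N)" using lk \<rho>' by (intro mult_left_mono) auto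
        have "(L * w1) * (v1 + L * w1) * (h * \<kappa>\<^sup>2) \<le> (L * w1) * (v1 + L * w1) * N"
          using N1 Lw f by (intro mult_left_mono) auto
        then have "y * (\<kappa> * v1 + y) \<le> (L * w1) * (v1 + L * w1) * N" using y(4) by linarith
        then have 2: "(6 * lk * \<rho>') * (y * (\<kappa> * v1 + y)) \<le> (6 * lk * \<rho>') * ((L * w1) * (v1 + L * w1) * N)" using lk \<rho>' by (intro mult_left_mono) auto
        have 3: "(3 * lk * \<rho>'\<^sup>2) * P3 \<le> (3 * lk * \<rho>'\<^sup>2) * (e3 * N)" using lk P3 by (intro mult_left_mono) auto
        have "3 * \<bar>lam\<bar> * K * \<rho>' * y\<^sup>2 + 6 * \<bar>lam\<bar> * K * \<rho>' * y * (\<kappa> * v1 + y) + 3 * \<bar>lam\<bar> * K * \<rho>'\<^sup>2 * P3 =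
           (3 * lk * \<rho>') * (y * y) + (6 * lk * \<rho>') * (y * (\<kappa> * v1 + y)) + (3 * lk * \<rho>'\<^sup>2) * P3"
          by (simp add: lk_def power2_eq_square mult.assoc)
        also have "\<dots> \<le> (3 * lk * \<rho>') * ((L * w1)\<^sup>2 * N) + (6 * lk * \<rho>') * ((L * w1) * (v1 + L * w1) * N) + (3 * lk * \<rho>'\<^sup>2) * (e3 * N)"
          by (intro add_mono 1 2 3)
        also have "\<dots> = e4 * N" by (simp add: e4_def distrib_right mult.assoc)
        finally show ?thesis .
      qed
      ultimately show ?thesis by (rule hbound_le)
    qed
    have hU: "hcont \<sigma> {0..1} U"
      using seq_stagesD(1) [OF U] unfolding hcont_def
      by (auto elim!: eventually_mono ballE allE intro: hbound_weaken)
    have Uc: "continuous_on {0..1} (\<lambda>r. cubic lam (U r) k)" for k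
      by (rule hcont_coord [OF hcont_cubic [OF hU Ur] \<sigma>_nonneg])
    have \<theta>c: "continuous_on {0..1} (\<lambda>r. \<theta> r k)" for k
      unfolding \<theta>_def by (intro continuous_intros F_cont Uc g)
    have I1: "hbound ?b (\<lambda>k. integral {0..1} (\<lambda>r. A 1 r (symbol \<kappa> k) * \<theta> r k)) (L * (e4 * N))"
      by (rule hbound_weighted_integral [OF \<theta> \<theta>c]) (auto intro: A_bound A_cont)
    define J where "J = (\<lambda>z. integral {0..1} (\<lambda>r. A 1 r z * of_real (g r)))"
    have Jz: "norm (J z) \<le> L * L * norm z" if z: "Re z = 0" for z
    proof -
      have "((\<lambda>r. of_real (g r) :: complex) has_integral of_real (integral {0..1} g)) {0..1}"
        by (rule has_integral_of_real [OF integrable_integral [OF integrable_continuous_real [OF g(1)]]])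
      then have g0: "integral {0..1} (\<lambda>r. of_real (g r) :: complex) = 0"
        using g(3) by (simp add: integral_unique)
      \<comment> \<open>At z = 0 the consistency bound is 0 and forces equality.\<close>
      have A10: "A 1 r 0 = 1" if "r \<in> {0..1}" for r using A_consistent [OF that, of 0] by simp
      have "J z = integral {0..1} (\<lambda>r. A 1 r z * of_real (g r)) - integral {0..1} (\<lambda>r. 1 * of_real (g r))"
        by (simp add: J_def g0)
      also have "\<dots> = integral {0..1} (\<lambda>r. (A 1 r z - 1) * of_real (g r))"
        by (rule integral_mult_diff) (intro continuous_intros A_cont g)+
      also have "norm \<dots> \<le> (L * norm z * L) * (1 - 0)"
      proof (rule integral_bound)
        fix r :: real assume r: "r \<in> {0..1}"
        have "norm (A 1 r z - 1) \<le> L * norm z" using A_at0 [OF _ r z, of 1] A10 [OF r] by simp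
        then have "norm (A 1 r z - 1) * \<bar>g r\<bar> \<le> (L * norm z) * L"
          using L_nonneg g(2) [OF r] by (intro mult_mono) auto
        then show "norm ((A 1 r z - 1) * of_real (g r)) \<le> L * norm z * L" by (simp add: norm_mult)
      qed (auto intro!: continuous_intros A_cont g)
      finally show ?thesis by (simp add: mult_ac)
    qed
    have "hbound (\<sigma> - 2 * real 1) (\<lambda>k. J (symbol \<kappa> k) * \<psi> k) (L * L * \<kappa> ^ 1 * (\<kappa> * x1))"
      by (rule hbound_symbol [OF \<psi>]) (use Jz L_nonneg in auto)
    then have "hbound (\<sigma> - 2) (\<lambda>k. J (symbol \<kappa> k) * \<psi> k) (L * L * \<kappa>\<^sup>2 * x1)"
      by (simp add: power2_eq_square mult_ac)
    from hbound_weaken [OF hbound_cmult [OF this, of "of_real h"] b\<sigma>(2)]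
    have I2: "hbound ?b (\<lambda>k. of_real h * (J (symbol \<kappa> k) * \<psi> k)) (L * L * x1 * (h * \<kappa>\<^sup>2))"
      using h by (simp add: mult_ac)
    have eq: "v 1 k - U 1 k = defect lam \<kappa> h v 1 k + of_real h *
       (integral {0..1} (\<lambda>r. A 1 r (symbol \<kappa> k) * \<theta> r k) + of_real h * (J (symbol \<kappa> k) * \<psi> k))" for k
    proof -
      have "U 1 k = stage_map lam \<kappa> h (v 0) U 1 k" by (rule seq_stagesD(3) [OF U]) simp
      then have "v 1 k - U 1 k = defect lam \<kappa> h v 1 k + (stage_map lam \<kappa> h (v 0) v 1 k - stage_map lam \<kappa> h (v 0) U 1 k)"
        by (simp add: defect_def)
      also have "stage_map lam \<kappa> h (v 0) v 1 k - stage_map lam \<kappa> h (v 0) U 1 k = of_real h *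
         (integral {0..1} (\<lambda>r. A 1 r (symbol \<kappa> k) * F r k) - integral {0..1} (\<lambda>r. A 1 r (symbol \<kappa> k) * cubic lam (U r) k))"
        by (simp add: stage_map_def F_def right_diff_distrib)
      also have "integral {0..1} (\<lambda>r. A 1 r (symbol \<kappa> k) * F r k) - integral {0..1} (\<lambda>r. A 1 r (symbol \<kappa> k) * cubic lam (U r) k) =
          integral {0..1} (\<lambda>r. A 1 r (symbol \<kappa> k) * (F r k - cubic lam (U r) k))"
        by (rule integral_mult_diff2 [OF F_cont Uc A_cont])
      also have "\<dots> = integral {0..1} (\<lambda>r. A 1 r (symbol \<kappa> k) * \<theta> r k) + of_real h * (J (symbol \<kappa> k) * \<psi> k)"
      proof (rule integral_unique)
        have "((\<lambda>r. A 1 r (symbol \<kappa> k) * \<theta> r k + of_real h * (A 1 r (symbol \<kappa> k) * of_real (g r) * \<psi> k)) has_integral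
          (integral {0..1} (\<lambda>r. A 1 r (symbol \<kappa> k) * \<theta> r k) + of_real h * (J (symbol \<kappa> k) * \<psi> k))) {0..1}"
          unfolding J_def
          by (intro has_integral_add has_integral_mult_left has_integral_mult_right integrable_integral
              integrable_continuous_real continuous_intros A_cont \<theta>c g)
        then show "((\<lambda>r. A 1 r (symbol \<kappa> k) * (F r k - cubic lam (U r) k)) has_integral
          (integral {0..1} (\<lambda>r. A 1 r (symbol \<kappa> k) * \<theta> r k) + of_real h * (J (symbol \<kappa> k) * \<psi> k))) {0..1}"
          by (simp add: \<theta>_def algebra_simps)
      qed
      finally show ?thesis .
    qed
    have "hbound ?b (\<lambda>k. v 1 k - U 1 k) (h * (L * W1 * \<kappa> ^ (p + 1)) + norm (of_real h :: complex) * (L * (e4 * N) + L * L * x1 * (h * \<kappa>\<^sup>2)))"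
      unfolding eq by (intro hbound_add hbound_cmult defect_one_bound A_ord I1 I2)
    moreover have "h * (L * W1 * \<kappa> ^ (p + 1)) + norm (of_real h :: complex) * (L * (e4 * N) + L * L * x1 * (h * \<kappa>\<^sup>2)) \<le> h * (B * N)"
    proof -
      have "L * w1 * \<kappa> ^ (p + 1) \<le> L * w1 * N" using N1 L_nonneg f by (intro mult_left_mono) auto
      moreover have "L * L * x1 * (h * \<kappa>\<^sup>2) \<le> L * L * x1 * N" using N1 L_nonneg e by (intro mult_left_mono) auto
      ultimately have "L * w1 * \<kappa> ^ (p + 1) + (L * (e4 * N) + L * L * x1 * (h * \<kappa>\<^sup>2)) \<le> B * N"
        by (simp add: B_def algebra_simps)
      from mult_left_mono [OF this, of h] show ?thesis using h by (simp add: w algebra_simps)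
    qed
    ultimately show ?thesis unfolding N_def by (rule hbound_le)
  qed
  then show ?thesis
    using B q by (intro exI [of _ "1 / (2 * (q + 1))"] conjI exI [of _ B]) auto
qed

end

section \<open>Coefficients of the methods\<close>

text \<open>The formula (exp z - 1) / z for \<open>phi1\<close>, without the division.\<close>

lemma mult_phi1: "z * phi1 z = exp z - 1"
proof -
  have "((\<lambda>\<xi>. z * exp (of_real (1 - \<xi>) * z)) has_integral (- exp (of_real (1 - 1) * z) - - exp (of_real (1 - 0) * z))) {0..1}"
  proof (rule fundamental_theorem_of_calculus)
    fix r :: real
    have "((\<lambda>w. - exp ((1 - w) * z)) has_field_derivative (z * exp ((1 - of_real r) * z))) (at (of_real r))"
      by (auto intro!: derivative_eq_intros)
    from has_vector_derivative_real_field [OF this]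
    show "((\<lambda>\<xi>. - exp (of_real (1 - \<xi>) * z)) has_vector_derivative z * exp (of_real (1 - r) * z)) (at r within {0..1})"
      by simp
  qed simp
  from integral_unique [OF this] show ?thesis
    unfolding phi1_def integral_mult_right by simp
qed

lemma phi1_0 [simp]: "phi1 0 = 1"
  by (simp add: phi1_def)

lemma exp_taylor_bound:
  assumes "Re z = 0" shows "norm (exp z - (\<Sum>j\<le>n. z ^ j / fact j)) \<le> norm z ^ Suc n"
proof -
  have "norm (exp z - (\<Sum>j\<le>n. z ^ j / fact j)) \<le> exp \<bar>Re z\<bar> * norm z ^ Suc n / fact n" by (rule Taylor_exp)
  also have "\<dots> = norm z ^ Suc n / fact n" using assms by simp
  also have "\<dots> \<le> norm z ^ Suc n / 1" by (rule divide_left_mono) (auto simp: fact_ge_1)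
  also have "\<dots> = norm z ^ Suc n" by simp
  finally show ?thesis .
qed

text \<open>The remainder of exp of one order higher, divided by z.\<close>

lemma phi1_taylor_bound:
  assumes "Re z = 0" shows "norm (phi1 z - (\<Sum>j<n. z ^ j / fact (Suc j))) \<le> norm z ^ n"
proof (cases "z = 0")
  case True
  then show ?thesis by (cases n) (simp_all add: lessThan_Suc_eq_insert_0 sum.insert sum.reindex)
next
  case False
  have "exp z - (\<Sum>j\<le>n. z ^ j / fact j) = z * (phi1 z - (\<Sum>j<n. z ^ j / fact (Suc j)))"
  proof -
    have "(\<Sum>j\<le>n. z ^ j / fact j) = 1 + (\<Sum>j<n. z ^ Suc j / fact (Suc j))"
      by (simp add: sum.atMost_shift)
    then show ?thesis by (simp add: right_diff_distrib mult_phi1 sum_distrib_left del: fact_Suc)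
  qed
  then have "norm z * norm (phi1 z - (\<Sum>j<n. z ^ j / fact (Suc j))) \<le> norm z * norm z ^ n"
    using exp_taylor_bound [OF assms, of n] by (simp add: norm_mult [symmetric])
  then show ?thesis using False by simp
qed

lemma norm_exp_imag: "Re z = 0 \<Longrightarrow> norm (exp z) = 1"
  by (simp add: norm_exp_eq_Re)

lemma phi1_bounds:
  assumes "Re z = 0"
  shows "norm (phi1 z) \<le> 1" "norm (phi1 z - 1) \<le> norm z" "norm (phi1 z - (1 + z / 2)) \<le> norm z ^ 2"
  using phi1_taylor_bound [OF assms, of 0] phi1_taylor_bound [OF assms, of 1] phi1_taylor_bound [OF assms, of 2]
  by (simp_all add: numeral_2_eq_2)

lemma exp_bounds:
  assumes "Re z = 0"
  shows "norm (exp z - 1) \<le> norm z" "norm (exp z - (1 + z)) \<le> norm z ^ 2" "norm (exp z - (1 + z + z ^ 2 / 2)) \<le> norm z ^ 3"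
  using exp_taylor_bound [OF assms, of 0] exp_taylor_bound [OF assms, of 1] exp_taylor_bound [OF assms, of 2]
  by (simp_all add: numeral_2_eq_2 numeral_3_eq_3)

lemma le_scale_mono: "x \<le> a * y \<Longrightarrow> a \<le> b \<Longrightarrow> y \<ge> 0 \<Longrightarrow> x \<le> b * y" for x a b y :: real
  using mult_right_mono order_trans by blast

lemma norm_of_real_mult_le:
  fixes a :: complex
  assumes "norm a \<le> b" "\<bar>r\<bar> \<le> c" "c \<ge> 0" shows "norm (of_real r * a) \<le> c * b"
  unfolding norm_mult norm_of_real by (rule mult_mono) (use assms in auto)

text \<open>For y \<le> 1 the highest power is the smallest, for y > 1 boundedness suffices. An
  error of top order that is also bounded therefore has every lower order, which provides all
  admissible p at once.\<close>

lemma power_bound_interpolate: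
  fixes x L y :: real
  assumes "x \<le> L" "x \<le> L * y ^ n" "j \<le> n" "y \<ge> 0" "L \<ge> 0"
  shows "x \<le> L * y ^ j"
proof (cases "y \<le> 1")
  case True
  then have "L * y ^ n \<le> L * y ^ j" using assms by (intro mult_left_mono power_decreasing) auto
  then show ?thesis using assms by simp
next
  case False
  then have "L * 1 \<le> L * y ^ j" using assms by (intro mult_left_mono one_le_power) auto
  then show ?thesis using assms by simp
qed

lemma integral_of_real_affine: "integral {0..1} (\<lambda>r. a + b * of_real r) = a + b / 2" for a b :: complex
proof (rule integral_unique)
  have "((\<lambda>r. a + b * of_real r) has_integral ((a * of_real 1 + b * of_real 1 ^ 2 / 2) - (a * of_real 0 + b * of_real 0 ^ 2 / 2))) {0..1}"
  proof (rule fundamental_theorem_of_calculus)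
    fix r :: real
    have "((\<lambda>w. a * w + b * w ^ 2 / 2) has_field_derivative (a + b * of_real r)) (at (of_real r))"
      by (auto intro!: derivative_eq_intros)
    from has_vector_derivative_real_field [OF this]
    show "((\<lambda>r. a * of_real r + b * of_real r ^ 2 / 2) has_vector_derivative a + b * of_real r) (at r within {0..1})" by simp
  qed simp
  then show "((\<lambda>r. a + b * of_real r) has_integral a + b / 2) {0..1}" by simp
qed

lemma integral_exp_phi1: "integral {0..1} (\<lambda>r. exp (of_real (1 - r) * z)) = phi1 z"
  by (simp add: phi1_def)

lemma A_mean_phi1:
  assumes "continuous_on {0..1} f" "integral {0..1} f = phi1 z"
  shows "integral {0..1} (\<lambda>r. exp (of_real (1 - r) * z) - f r) = 0"
proof -
  have "integral {0..1} (\<lambda>r. exp (of_real (1 - r) * z) - f r) = integral {0..1} (\<lambda>r. exp (of_real (1 - r) * z)) - integral {0..1} f"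
    by (rule integral_diff) (intro integrable_continuous_real continuous_intros assms)+
  then show ?thesis by (simp only: integral_exp_phi1 assms(2)) simp
qed

subsection \<open>EP1\<close>

text \<open>Linear interpolation between \<tau> = 0 and 1 reproduces 1 + \<tau> z, so only
  second-order remainders are left.\<close>

lemma EP1_C_order:
  assumes \<tau>: "\<tau> \<in> {0..1}" and z: "Re z = 0"
  shows "norm (exp (of_real \<tau> * z) - EP1_C \<tau> z) \<le> 2 * norm z ^ 2"
proof -
  have t: "Re (of_real \<tau> * z) = 0" using z by simp
  have "exp (of_real \<tau> * z) - EP1_C \<tau> z = (exp (of_real \<tau> * z) - (1 + of_real \<tau> * z)) - of_real \<tau> * (exp z - (1 + z))"
    by (simp add: EP1_C_def algebra_simps)
  also have "norm \<dots> \<le> norm (of_real \<tau> * z) ^ 2 + 1 * norm z ^ 2"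
    by (intro order_trans [OF norm_triangle_ineq4] add_mono exp_bounds(2) t norm_of_real_mult_le z) (use \<tau> in auto)
  also have "norm (of_real \<tau> * z) ^ 2 \<le> norm z ^ 2"
    using \<tau> by (intro power_mono) (auto simp: norm_mult mult_left_le_one_le)
  finally show ?thesis by simp
qed

lemma EP1_C_bound:
  assumes \<tau>: "\<tau> \<in> {0..1}" and z: "Re z = 0" shows "norm (EP1_C \<tau> z) \<le> 1"
proof -
  have "norm (EP1_C \<tau> z) \<le> norm (of_real (1 - \<tau>) :: complex) + norm (of_real \<tau> * exp z)"
    unfolding EP1_C_def by (rule norm_triangle_ineq)
  also have "\<dots> = 1" using \<tau> norm_exp_imag [OF z] by (simp add: norm_mult del: of_real_diff)
  finally show ?thesis .
qed

lemma EP1_A_order: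
  assumes r: "r \<in> {0..1}" and z: "Re z = 0"
  shows "norm (exp (of_real (1 - r) * z) - EP1_A 1 r z) \<le> 2 * norm z"
proof -
  have "exp (of_real (1 - r) * z) - EP1_A 1 r z = (exp (of_real (1 - r) * z) - 1) - (phi1 z - 1)"
    by (simp add: EP1_A_def)
  also have "norm \<dots> \<le> norm (of_real (1 - r) * z) + norm z"
    by (intro order_trans [OF norm_triangle_ineq4] add_mono exp_bounds(1) phi1_bounds(2)) (use z in auto)
  also have "norm (of_real (1 - r) * z) \<le> norm z"
    using r by (simp add: norm_mult mult_left_le_one_le del: of_real_diff)
  finally show ?thesis by simp
qed

lemma ep_method0_EP1: "ep_method0 EP1_C EP1_A 4"
proof
  fix \<tau> \<tau>' r :: real and z :: complex
  show "(4 :: real) \<ge> 1" by simp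
  show "continuous_on {0..1} (\<lambda>r. EP1_A \<tau> r z)" by (simp add: EP1_A_def)
  show "EP1_C 1 z = exp z" by (simp add: EP1_C_def)
  assume z: "Re z = 0"
  note e = norm_exp_imag [OF z] and ph = phi1_bounds [OF z]
  show "integral {0..1} (\<lambda>r. exp (of_real (1 - r) * z) - EP1_A 1 r z) = 0"
    by (rule A_mean_phi1) (simp_all add: EP1_A_def)
  show "norm (exp (of_real (1 - r) * z) - EP1_A 1 r z) \<le> 4 * norm z" if "r \<in> {0..1}"
    using EP1_A_order [OF that z] norm_ge_zero [of z] by linarith
  assume \<tau>: "\<tau> \<in> {0..1}"
  show "norm (EP1_C \<tau> z) \<le> 4" using EP1_C_bound [OF \<tau> z] by simp
  show "norm (exp (of_real \<tau> * z) - EP1_C \<tau> z) \<le> 4 * norm z"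
  proof -
    have "norm (exp (of_real \<tau> * z) - EP1_C \<tau> z) \<le> 1 + 1"
      by (intro order_trans [OF norm_triangle_ineq4] add_mono EP1_C_bound \<tau> z) (simp add: norm_exp_eq_Re z)
    then have 1: "norm (exp (of_real \<tau> * z) - EP1_C \<tau> z) \<le> 4" by simp
    have 2: "norm (exp (of_real \<tau> * z) - EP1_C \<tau> z) \<le> 4 * norm z ^ 2"
      using EP1_C_order [OF \<tau> z] zero_le_power2 [of "norm z"] by linarith
    from power_bound_interpolate [OF 1 2, of 1] show ?thesis by simp
  qed
  show "norm (EP1_A \<tau> r z) \<le> 4"
    unfolding EP1_A_def by (rule order_trans [OF norm_of_real_mult_le [OF ph(1), where c = 1]]) (use \<tau> in auto)
  show "norm (EP1_A \<tau> r z - EP1_A \<tau> r 0) \<le> 4 * norm z"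
  proof -
    have "norm (of_real \<tau> * (phi1 z - 1)) \<le> 1 * norm z"
      by (rule norm_of_real_mult_le [OF ph(2)]) (use \<tau> in auto)
    then have "norm (of_real \<tau> * (phi1 z - 1)) \<le> 4 * norm z" using norm_ge_zero [of z] by linarith
    then show ?thesis by (simp add: EP1_A_def algebra_simps)
  qed
  assume \<tau>': "\<tau>' \<in> {0..1}"
  show "norm (EP1_C \<tau> z - EP1_C \<tau>' z) \<le> 4 * \<bar>\<tau> - \<tau>'\<bar>"
  proof -
    have "EP1_C \<tau> z - EP1_C \<tau>' z = of_real (\<tau> - \<tau>') * (exp z - 1)" by (simp add: EP1_C_def algebra_simps)
    moreover have "norm (exp z - 1) \<le> 1 + 1"
      using e by (intro order_trans [OF norm_triangle_ineq4] add_mono) auto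
    ultimately have "norm (EP1_C \<tau> z - EP1_C \<tau>' z) \<le> 2 * \<bar>\<tau> - \<tau>'\<bar>"
      using norm_of_real_mult_le [of "exp z - 1" 2 "\<tau> - \<tau>'" "\<bar>\<tau> - \<tau>'\<bar>"] by simp
    then show ?thesis by (rule le_scale_mono) auto
  qed
  show "norm (EP1_A \<tau> r z - EP1_A \<tau>' r z) \<le> 4 * \<bar>\<tau> - \<tau>'\<bar>"
  proof -
    have "EP1_A \<tau> r z - EP1_A \<tau>' r z = of_real (\<tau> - \<tau>') * phi1 z" by (simp add: EP1_A_def algebra_simps)
    then have "norm (EP1_A \<tau> r z - EP1_A \<tau>' r z) \<le> 1 * \<bar>\<tau> - \<tau>'\<bar>"
      using norm_of_real_mult_le [OF ph(1), of "\<tau> - \<tau>'" "\<bar>\<tau> - \<tau>'\<bar>"] by simp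
    then show ?thesis by (rule le_scale_mono) auto
  qed
next
  fix \<tau> :: real
  show "integral {0..1} (\<lambda>r. EP1_A \<tau> r 0) = of_real \<tau>" by (simp add: EP1_A_def)
qed

subsection \<open>EP2\<close>

lemma EP2_C_eq:
  "EP2_C \<tau> z = of_real ((\<tau> - 1) * (2 * \<tau> - 1)) + of_real (- 4 * \<tau> * (\<tau> - 1)) * exp (z / 2) + of_real (\<tau> * (2 * \<tau> - 1)) * exp z"
  by (simp add: EP2_C_def EP2_m_def algebra_simps)

text \<open>For m = 1/2 the arguments m z and (1 - m) z coincide, and the four coefficients collapse
  to combinations of \<open>phi1 z\<close> and \<open>phi1 (z / 2)\<close>.\<close>

lemma EP2_A_eq:
  "EP2_A \<tau> r z = of_real (- 3 * \<tau> + 4 * (\<tau> * r) + 6 * \<tau>\<^sup>2 - 8 * (\<tau>\<^sup>2 * r)) * phi1 z +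
     of_real (8 * \<tau> - 12 * (\<tau> * r) - 10 * \<tau>\<^sup>2 + 16 * (\<tau>\<^sup>2 * r)) * phi1 (z / 2)"
  by (simp add: EP2_A_def EP2_a11_def EP2_a12_def EP2_a21_def EP2_a22_def EP2_m_def Let_def algebra_simps)

text \<open>21 and 46 are the sums of the moduli of the coefficients of monomials with values in
  [0, 1].\<close>

lemma EP2_poly_bounds:
  fixes \<tau> r :: real
  assumes \<tau>: "\<tau> \<in> {0..1}" and r: "r \<in> {0..1}"
  shows "\<bar>(\<tau> - 1) * (2 * \<tau> - 1)\<bar> \<le> 1" "\<bar>- 4 * \<tau> * (\<tau> - 1)\<bar> \<le> 4" "\<bar>\<tau> * (2 * \<tau> - 1)\<bar> \<le> 1"
    "\<bar>- 3 * \<tau> + 4 * (\<tau> * r) + 6 * \<tau>\<^sup>2 - 8 * (\<tau>\<^sup>2 * r)\<bar> \<le> 21" "\<bar>8 * \<tau> - 12 * (\<tau> * r) - 10 * \<tau>\<^sup>2 + 16 * (\<tau>\<^sup>2 * r)\<bar> \<le> 46"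
proof -
  have b: "\<bar>x * y\<bar> \<le> c" if "\<bar>x\<bar> \<le> a" "\<bar>y\<bar> \<le> b" "a * b = c" for x y a b c :: real
    unfolding abs_mult that(3) [symmetric] using that(1,2) by (intro mult_mono) auto
  show "\<bar>(\<tau> - 1) * (2 * \<tau> - 1)\<bar> \<le> 1" by (rule b [where a = 1 and b = 1]) (use \<tau> in auto)
  show "\<bar>- 4 * \<tau> * (\<tau> - 1)\<bar> \<le> 4" by (rule b [where a = 4 and b = 1]) (use \<tau> in auto)
  show "\<bar>\<tau> * (2 * \<tau> - 1)\<bar> \<le> 1" by (rule b [where a = 1 and b = 1]) (use \<tau> in auto)
  have "0 \<le> \<tau>" "\<tau> \<le> 1" "0 \<le> \<tau> * r" "\<tau> * r \<le> 1" "0 \<le> \<tau>\<^sup>2" "\<tau>\<^sup>2 \<le> 1" "0 \<le> \<tau>\<^sup>2 * r" "\<tau>\<^sup>2 * r \<le> 1"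
    using \<tau> r by (auto simp: power_le_one mult_le_one)
  then show "\<bar>- 3 * \<tau> + 4 * (\<tau> * r) + 6 * \<tau>\<^sup>2 - 8 * (\<tau>\<^sup>2 * r)\<bar> \<le> 21" "\<bar>8 * \<tau> - 12 * (\<tau> * r) - 10 * \<tau>\<^sup>2 + 16 * (\<tau>\<^sup>2 * r)\<bar> \<le> 46"
    by linarith+
qed

lemma norm_combination2:
  fixes a b :: complex
  assumes "norm a \<le> A" "norm b \<le> B" "\<bar>p\<bar> \<le> P" "\<bar>q\<bar> \<le> Q"
  shows "norm (of_real p * a + of_real q * b) \<le> P * A + Q * B"
proof -
  have "P \<ge> 0" "Q \<ge> 0" using order_trans [OF abs_ge_zero assms(3)] order_trans [OF abs_ge_zero assms(4)] by auto
  then show ?thesis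
    by (intro order_trans [OF norm_triangle_ineq] add_mono norm_of_real_mult_le assms)
qed

lemma norm_half: "norm (z / 2) = norm z / 2" for z :: complex
  by (simp add: norm_divide)

lemma EP2_C_bound:
  assumes \<tau>: "\<tau> \<in> {0..1}" and z: "Re z = 0" shows "norm (EP2_C \<tau> z) \<le> 6"
proof -
  note b = EP2_poly_bounds [OF \<tau> \<tau>]
  have "norm (EP2_C \<tau> z) \<le> 1 + 4 * 1 + 1 * 1"
    unfolding EP2_C_eq
    by (intro order_trans [OF norm_triangle_ineq] add_mono norm_of_real_mult_le b)
      (use b(1) z in \<open>simp_all add: norm_exp_eq_Re del: of_real_mult of_real_diff\<close>)
  then show ?thesis by simp
qed

text \<open>Quadratic interpolation at 0, 1/2 and 1 is exact on the Taylor polynomial of degree 2,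
  so third-order remainders \<open>E\<close> are left; the one at node 0 vanishes.\<close>

lemma EP2_C_order:
  assumes \<tau>: "\<tau> \<in> {0..1}" and z: "Re z = 0" and j: "j \<le> 3"
  shows "norm (exp (of_real \<tau> * z) - EP2_C \<tau> z) \<le> 500 * norm z ^ j"
proof (rule power_bound_interpolate [OF _ _ j])
  have t: "Re (of_real \<tau> * z) = 0" "Re (z / 2) = 0" using z by simp_all
  note b = EP2_poly_bounds [OF \<tau> \<tau>]
  have "norm (exp (of_real \<tau> * z) - EP2_C \<tau> z) \<le> 1 + 6"
    by (intro order_trans [OF norm_triangle_ineq4] add_mono EP2_C_bound \<tau> z) (simp add: norm_exp_eq_Re z)
  then show "norm (exp (of_real \<tau> * z) - EP2_C \<tau> z) \<le> 500" by simp
  define E where "E = (\<lambda>w :: complex. exp w - (1 + w + w ^ 2 / 2))"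
  have "exp (of_real \<tau> * z) - EP2_C \<tau> z = E (of_real \<tau> * z) - (of_real (- 4 * \<tau> * (\<tau> - 1)) * E (z / 2) + of_real (\<tau> * (2 * \<tau> - 1)) * E z)"
    unfolding EP2_C_eq E_def by (simp add: field_simps power2_eq_square)
  also have "norm \<dots> \<le> norm (of_real \<tau> * z) ^ 3 + (4 * norm (z / 2) ^ 3 + 1 * norm z ^ 3)"
    unfolding E_def
    by (intro order_trans [OF norm_triangle_ineq4] add_mono norm_combination2 exp_bounds(3) t z b)
  also have "norm (of_real \<tau> * z) ^ 3 \<le> norm z ^ 3"
    using \<tau> by (intro power_mono) (auto simp: norm_mult mult_left_le_one_le)
  also have "norm (z / 2) ^ 3 \<le> norm z ^ 3" by (intro power_mono) (auto simp: norm_half)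
  finally show "norm (exp (of_real \<tau> * z) - EP2_C \<tau> z) \<le> 500 * norm z ^ 3"
    using zero_le_power [OF norm_ge_zero [of z], of 3] by linarith
qed auto

lemma EP2_A_bound:
  assumes \<tau>: "\<tau> \<in> {0..1}" and r: "r \<in> {0..1}" and z: "Re z = 0" shows "norm (EP2_A \<tau> r z) \<le> 67"
proof -
  have "norm (EP2_A \<tau> r z) \<le> 21 * 1 + 46 * 1"
    unfolding EP2_A_eq
    by (intro norm_combination2 phi1_bounds(1) EP2_poly_bounds \<tau> r) (use z in auto)
  then show ?thesis by simp
qed

lemma EP2_A_one: "EP2_A 1 r z = of_real (3 - 4 * r) * phi1 z + of_real (4 * r - 2) * phi1 (z / 2)"
  unfolding EP2_A_eq by simp

text \<open>The linear parts 1 + z / 2 and 1 + z / 4 of the two \<open>phi1\<close> combine to 1 +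
  (1 - r) z, so second-order remainders are left.\<close>

lemma EP2_A_order:
  assumes r: "r \<in> {0..1}" and z: "Re z = 0" and j: "j \<le> 2"
  shows "norm (exp (of_real (1 - r) * z) - EP2_A 1 r z) \<le> 500 * norm z ^ j"
proof (rule power_bound_interpolate [OF _ _ j])
  have t: "Re (of_real (1 - r) * z) = 0" "Re (z / 2) = 0" using z by simp_all
  have "norm (exp (of_real (1 - r) * z) - EP2_A 1 r z) \<le> 1 + 67"
    by (intro order_trans [OF norm_triangle_ineq4] add_mono EP2_A_bound r z) (simp_all add: norm_exp_eq_Re z)
  then show "norm (exp (of_real (1 - r) * z) - EP2_A 1 r z) \<le> 500" by simp
  have "exp (of_real (1 - r) * z) - EP2_A 1 r z = (exp (of_real (1 - r) * z) - (1 + of_real (1 - r) * z)) -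
     (of_real (3 - 4 * r) * (phi1 z - (1 + z / 2)) + of_real (4 * r - 2) * (phi1 (z / 2) - (1 + z / 2 / 2)))"
    unfolding EP2_A_one by (simp add: field_simps)
  also have "norm \<dots> \<le> norm (of_real (1 - r) * z) ^ 2 + (3 * norm z ^ 2 + 2 * norm (z / 2) ^ 2)"
    by (intro order_trans [OF norm_triangle_ineq4] add_mono norm_combination2 exp_bounds(2) phi1_bounds(3) t z)
      (use r in auto)
  also have "norm (of_real (1 - r) * z) ^ 2 \<le> norm z ^ 2"
    using r by (intro power_mono) (auto simp: norm_mult mult_left_le_one_le simp del: of_real_diff)
  also have "norm (z / 2) ^ 2 \<le> norm z ^ 2" by (intro power_mono) (auto simp: norm_half)
  finally show "norm (exp (of_real (1 - r) * z) - EP2_A 1 r z) \<le> 500 * norm z ^ 2"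
    using zero_le_power [OF norm_ge_zero [of z], of 2] by linarith
qed auto

lemma ep_method0_EP2: "ep_method0 EP2_C EP2_A 500"
proof
  fix \<tau> \<tau>' r :: real and z :: complex
  show "(500 :: real) \<ge> 1" by simp
  show "continuous_on {0..1} (\<lambda>r. EP2_A \<tau> r z)" unfolding EP2_A_eq by (intro continuous_intros)
  show "EP2_C 1 z = exp z" by (simp add: EP2_C_eq)
  assume z: "Re z = 0"
  then have z2: "Re (z / 2) = 0" by simp
  show "integral {0..1} (\<lambda>r. exp (of_real (1 - r) * z) - EP2_A 1 r z) = 0"
  proof (rule A_mean_phi1)
    show "continuous_on {0..1} (\<lambda>r. EP2_A 1 r z)" unfolding EP2_A_eq by (intro continuous_intros)
    \<comment> \<open>The weight is affine in r, so its mean is its value at r = 1/2.\<close>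
    have "(\<lambda>r. EP2_A 1 r z) = (\<lambda>r. (3 * phi1 z - 2 * phi1 (z / 2)) + (4 * phi1 (z / 2) - 4 * phi1 z) * of_real r)"
      by (simp add: fun_eq_iff EP2_A_one algebra_simps)
    then show "integral {0..1} (\<lambda>r. EP2_A 1 r z) = phi1 z"
      by (simp only: integral_of_real_affine) (simp add: field_simps)
  qed
  show "norm (exp (of_real (1 - r) * z) - EP2_A 1 r z) \<le> 500 * norm z" if "r \<in> {0..1}"
    using EP2_A_order [OF that z, of 1] by simp
  assume \<tau>: "\<tau> \<in> {0..1}"
  show "norm (EP2_C \<tau> z) \<le> 500" using EP2_C_bound [OF \<tau> z] by simp
  show "norm (exp (of_real \<tau> * z) - EP2_C \<tau> z) \<le> 500 * norm z" using EP2_C_order [OF \<tau> z, of 1] by simp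
  show "norm (EP2_A \<tau> r z) \<le> 500" if "r \<in> {0..1}" using EP2_A_bound [OF \<tau> that z] by simp
  show "norm (EP2_A \<tau> r z - EP2_A \<tau> r 0) \<le> 500 * norm z" if r: "r \<in> {0..1}"
  proof -
    let ?a = "- 3 * \<tau> + 4 * (\<tau> * r) + 6 * \<tau>\<^sup>2 - 8 * (\<tau>\<^sup>2 * r)"
    let ?b = "8 * \<tau> - 12 * (\<tau> * r) - 10 * \<tau>\<^sup>2 + 16 * (\<tau>\<^sup>2 * r)"
    have "EP2_A \<tau> r z - EP2_A \<tau> r 0 = of_real ?a * (phi1 z - 1) + of_real ?b * (phi1 (z / 2) - 1)"
      unfolding EP2_A_eq by (simp only: right_diff_distrib phi1_0 div_0 mult_1_right) simp
    also have "norm \<dots> \<le> 21 * norm z + 46 * norm (z / 2)"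
      by (intro norm_combination2 phi1_bounds(2) EP2_poly_bounds \<tau> r z z2)
    finally show ?thesis using norm_ge_zero [of z] unfolding norm_half by linarith
  qed
  assume \<tau>': "\<tau>' \<in> {0..1}"
  have sq: "\<bar>\<tau>\<^sup>2 - \<tau>'\<^sup>2\<bar> \<le> 2 * \<bar>\<tau> - \<tau>'\<bar>"
  proof -
    have "\<bar>\<tau>\<^sup>2 - \<tau>'\<^sup>2\<bar> = \<bar>\<tau> + \<tau>'\<bar> * \<bar>\<tau> - \<tau>'\<bar>" by (simp add: power2_eq_square abs_mult [symmetric] algebra_simps)
    also have "\<dots> \<le> 2 * \<bar>\<tau> - \<tau>'\<bar>" using \<tau> \<tau>' by (intro mult_right_mono) auto
    finally show ?thesis .
  qed
  show "norm (EP2_C \<tau> z - EP2_C \<tau>' z) \<le> 500 * \<bar>\<tau> - \<tau>'\<bar>"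
  proof -
    let ?d = "\<tau> - \<tau>'" and ?s = "\<tau>\<^sup>2 - \<tau>'\<^sup>2"
    have "EP2_C \<tau> z - EP2_C \<tau>' z = of_real ?d * (- 3 + 4 * exp (z / 2) - exp z) + of_real ?s * (2 - 4 * exp (z / 2) + 2 * exp z)"
      by (simp add: EP2_C_eq power2_eq_square algebra_simps)
    also have "norm \<dots> \<le> \<bar>?d\<bar> * 8 + (2 * \<bar>?d\<bar>) * 8"
    proof (rule norm_combination2)
      have "norm (- 3 + 4 * exp (z / 2) - exp z) \<le> (norm (- 3 :: complex) + norm (4 * exp (z / 2))) + norm (exp z)"
        by (intro order_trans [OF norm_triangle_ineq4] add_mono norm_triangle_ineq order_refl)
      then show "norm (- 3 + 4 * exp (z / 2) - exp z) \<le> 8" by (simp add: norm_mult z)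
      have "norm (2 - 4 * exp (z / 2) + 2 * exp z) \<le> (norm (2 :: complex) + norm (4 * exp (z / 2))) + norm (2 * exp z)"
        by (intro order_trans [OF norm_triangle_ineq] add_mono norm_triangle_ineq4 order_refl)
      then show "norm (2 - 4 * exp (z / 2) + 2 * exp z) \<le> 8" by (simp add: norm_mult z)
    qed (use sq in auto)
    finally have "norm (EP2_C \<tau> z - EP2_C \<tau>' z) \<le> 24 * \<bar>\<tau> - \<tau>'\<bar>" by simp
    then show ?thesis by (rule le_scale_mono) auto
  qed
  show "norm (EP2_A \<tau> r z - EP2_A \<tau>' r z) \<le> 500 * \<bar>\<tau> - \<tau>'\<bar>" if r: "r \<in> {0..1}"
  proof -
    let ?d = "\<tau> - \<tau>'" and ?s = "\<tau>\<^sup>2 - \<tau>'\<^sup>2"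
    have "EP2_A \<tau> r z - EP2_A \<tau>' r z = of_real (?d * (4 * r - 3) + ?s * (6 - 8 * r)) * phi1 z +
       of_real (?d * (8 - 12 * r) + ?s * (16 * r - 10)) * phi1 (z / 2)"
      by (simp add: EP2_A_eq algebra_simps)
    also have "norm \<dots> \<le> (\<bar>?d\<bar> * 3 + (2 * \<bar>?d\<bar>) * 6) * 1 + (\<bar>?d\<bar> * 8 + (2 * \<bar>?d\<bar>) * 10) * 1"
    proof (intro norm_combination2 phi1_bounds(1) z z2)
      have b: "\<bar>x * p + y * q\<bar> \<le> X * P + Y * Q" if "\<bar>x\<bar> \<le> X" "\<bar>p\<bar> \<le> P" "\<bar>y\<bar> \<le> Y" "\<bar>q\<bar> \<le> Q" for x y p q X Y P Q :: real
        by (rule order_trans [OF abs_triangle_ineq]) (use that in \<open>auto simp: abs_mult intro!: add_mono mult_mono order_trans [OF abs_ge_zero]\<close>)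
      show "\<bar>?d * (4 * r - 3) + ?s * (6 - 8 * r)\<bar> \<le> \<bar>?d\<bar> * 3 + (2 * \<bar>?d\<bar>) * 6"
        by (rule b) (use sq r in auto)
      show "\<bar>?d * (8 - 12 * r) + ?s * (16 * r - 10)\<bar> \<le> \<bar>?d\<bar> * 8 + (2 * \<bar>?d\<bar>) * 10"
        by (rule b) (use sq r in auto)
    qed
    finally have "norm (EP2_A \<tau> r z - EP2_A \<tau>' r z) \<le> 43 * \<bar>\<tau> - \<tau>'\<bar>" by simp
    then show ?thesis by (rule le_scale_mono) auto
  qed
next
  fix \<tau> :: real
  have "(\<lambda>r. EP2_A \<tau> r 0) = (\<lambda>r. of_real (5 * \<tau> - 4 * \<tau>\<^sup>2) + of_real (- 8 * \<tau> + 8 * \<tau>\<^sup>2) * of_real r)"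
    by (simp add: fun_eq_iff EP2_A_eq algebra_simps)
  then show "integral {0..1} (\<lambda>r. EP2_A \<tau> r 0) = of_real \<tau>"
    by (simp only: integral_of_real_affine) (simp add: field_simps)
qed

subsection \<open>EP3\<close>

abbreviation "node \<equiv> EP3_node"
abbreviation "lag \<equiv> EP3_lagrange"

lemma node_simps [simp]: "node 0 = 0" "node (Suc 0) = 1 / 3" "node 1 = 1 / 3" "node 3 = 1"
  by (simp_all add: EP3_node_def)

text \<open>Cardano's formula: \<open>18 c\<^sub>2 - 14\<close> is a root of \<open>y\<^sup>3 = 21 y + 142\<close>.\<close>

lemma node2_cubic: "36 * node 2 ^ 3 - 84 * node 2 ^ 2 + 63 * node 2 - 16 = 0"
proof -
  define p q where "p = root 3 (71 - 9 * sqrt 58)" and "q = root 3 (71 + 9 * sqrt 58)"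
  have p3: "p ^ 3 = 71 - 9 * sqrt 58" and q3: "q ^ 3 = 71 + 9 * sqrt 58"
    unfolding p_def q_def by (rule odd_real_root_pow, simp)+
  \<comment> \<open>The product of the radicands is 5041 - 4698 = 343 = 7^3, hence p q = 7 and 3 p q
    = 21.\<close>
  have "(71 - 9 * sqrt 58) * (71 + 9 * sqrt 58) = 71\<^sup>2 - 81 * (sqrt 58)\<^sup>2"
    by (simp add: algebra_simps power2_eq_square)
  then have "(71 - 9 * sqrt 58) * (71 + 9 * sqrt 58) = 7 ^ 3" by simp
  then have pq: "p * q = 7"
    unfolding p_def q_def real_root_mult [symmetric] by (simp only:) (simp add: real_root_power_cancel)
  have n: "node 2 = (14 + p + q) / 18" by (simp add: EP3_node_def p_def q_def)
  have "(p + q) ^ 3 = p ^ 3 + q ^ 3 + 3 * (p * q) * (p + q)"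
    by (simp add: power3_eq_cube algebra_simps)
  then have y: "(p + q) ^ 3 = 142 + 21 * (p + q)" by (simp add: p3 q3 pq)
  define y where "y = p + q"
  have x: "node 2 = (14 + y) / 18" by (simp add: n y_def)
  have "162 * (36 * node 2 ^ 3 - 84 * node 2 ^ 2 + 63 * node 2 - 16) = y ^ 3 - 21 * y - 142"
    unfolding x by (simp add: power3_eq_cube power2_eq_square field_simps)
  also have "\<dots> = 0" using y by (simp add: y_def)
  finally show ?thesis by simp
qed

text \<open>The cubic takes the values -16, -3 and -1 at 0, 1/3 and 1, so no cube root has to be
  estimated.\<close>

lemma node2_neq: "node 2 \<noteq> 0" "node 2 \<noteq> 1 / 3" "node 2 \<noteq> 1"
proof -
  show "node 2 \<noteq> 0" using node2_cubic by (auto simp: power3_eq_cube power2_eq_square)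
  show "node 2 \<noteq> 1 / 3"
  proof
    assume e: "node 2 = 1 / 3"
    show False using node2_cubic unfolding e by (simp add: power3_eq_cube power2_eq_square)
  qed
  show "node 2 \<noteq> 1" using node2_cubic by (auto simp: power3_eq_cube power2_eq_square)
qed

lemma le3_cases: "(k :: nat) \<le> 3 \<longleftrightarrow> k = 0 \<or> k = 1 \<or> k = 2 \<or> k = 3"
  by auto

lemma node_inj: "i \<le> 3 \<Longrightarrow> j \<le> 3 \<Longrightarrow> node i = node j \<longleftrightarrow> i = j"
  using node2_neq node2_neq [symmetric] by (auto simp: le3_cases)

lemma poly_lag: "poly (lag j) x = (\<Prod>k\<in>{0..3} - {j}. (x - node k) / (node j - node k))"
  by (simp add: EP3_lagrange_def poly_prod diff_divide_distrib)

lemma lag_node: "i \<le> 3 \<Longrightarrow> j \<le> 3 \<Longrightarrow> poly (lag j) (node i) = (if i = j then 1 else 0)"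
proof (cases "i = j")
  case True
  assume "i \<le> 3" "j \<le> 3"
  then show ?thesis unfolding poly_lag using True by (auto intro!: prod.neutral simp: node_inj)
next
  case False
  assume "i \<le> 3" "j \<le> 3"
  then show ?thesis unfolding poly_lag using False by (auto intro!: prod_zero)
qed

lemma degree_lag: "j \<le> 3 \<Longrightarrow> degree (lag j) \<le> 3"
proof -
  assume j: "j \<le> 3"
  have "degree (lag j) \<le> (\<Sum>k\<in>{0..3} - {j}. degree (smult (1 / (node j - node k)) [:- node k, 1:]))"
    unfolding EP3_lagrange_def by (rule order_trans [OF degree_prod_sum_le]) (simp_all add: o_def)
  also have "\<dots> \<le> (\<Sum>k\<in>{0..3} - {j}. 1)" by (rule sum_mono) simp
  also have "\<dots> = 3" using j by simp
  finally show ?thesis .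
qed

text \<open>Two polynomials of degree at most 3 that agree at four distinct nodes.\<close>

lemma lag_interpolation:
  assumes "degree q \<le> 3" shows "(\<Sum>k\<le>3. smult (poly q (node k)) (lag k)) = q"
proof (rule poly_eqI_degree [where A = "node ` {..3}"])
  have card: "card (node ` {..3}) = 4"
    by (subst card_image) (auto simp: inj_on_def node_inj)
  have "degree (\<Sum>k\<le>3. smult (poly q (node k)) (lag k)) \<le> 3"
    by (intro degree_sum_le) (auto intro: order_trans [OF degree_smult_le] degree_lag)
  then show "degree (\<Sum>k\<le>3. smult (poly q (node k)) (lag k)) < card (node ` {..3})" using card by simp
  show "degree q < card (node ` {..3})" using card assms by simp
  fix x assume "x \<in> node ` {..3}"
  then obtain i where i: "i \<le> 3" "x = node i" by auto
  have "poly (\<Sum>k\<le>3. smult (poly q (node k)) (lag k)) x = (\<Sum>k\<le>3. if i = k then poly q (node k) else 0)"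
    unfolding poly_sum i(2) by (rule sum.cong) (use i in \<open>auto simp: lag_node\<close>)
  then show "poly (\<Sum>k\<le>3. smult (poly q (node k)) (lag k)) x = poly q x" using i by simp
qed

lemma sum_le3: "(\<Sum>k\<le>3. f k) = f 0 + f 1 + f 2 + f 3" for f :: "nat \<Rightarrow> 'a::comm_monoid_add"
  by (simp add: eval_nat_numeral add.assoc)

lemma lag_interp_point:
  assumes "degree q \<le> 3"
  shows "(\<Sum>k\<le>3. poly q (node k) * poly (lag k) x) = poly q x"
    and "(\<Sum>k\<le>3. poly q (node k) * poly (pderiv (lag k)) x) = poly (pderiv q) x"
proof -
  show "(\<Sum>k\<le>3. poly q (node k) * poly (lag k) x) = poly q x"
    using arg_cong [OF lag_interpolation [OF assms], of "\<lambda>p. poly p x"] by (simp add: poly_sum)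
  show "(\<Sum>k\<le>3. poly q (node k) * poly (pderiv (lag k)) x) = poly (pderiv q) x"
    using arg_cong [OF lag_interpolation [OF assms], of "\<lambda>p. poly (pderiv p) x"]
    by (simp add: sum_le3 pderiv_add pderiv_smult)
qed

lemma lag_power: "j \<le> 3 \<Longrightarrow> (\<Sum>k\<le>3. node k ^ j * poly (lag k) x) = x ^ j"
  using lag_interp_point(1) [of "monom 1 j" x] by (simp add: degree_monom_eq poly_monom)

text \<open>Differentiated interpolation of (1 - x)^j. These sums produce the Taylor coefficients of
  exp((1 - r) z) in \<open>EP3_A_order3\<close>.\<close>

lemma lag_deriv_shift:
  assumes "j \<le> 3" shows "(\<Sum>k\<le>3. (1 - node k) ^ j * poly (pderiv (lag k)) x) = - real j * (1 - x) ^ (j - 1)"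
proof -
  have "degree ([:1, - 1:] ^ j :: real poly) \<le> 3"
    using assms by (intro order_trans [OF degree_power_le]) simp
  from lag_interp_point(2) [OF this, of x] show ?thesis
    by (simp add: pderiv_power poly_power pderiv_pCons)
qed

section \<open>Moments and quadrature\<close>

lemma integral_poly_pderiv: "((\<lambda>r. poly (pderiv p) r) has_integral (poly p 1 - poly p 0)) {0..1}" for p :: "real poly"
  by (rule fundamental_theorem_of_calculus)
    (auto simp: has_real_derivative_iff_has_vector_derivative [symmetric] intro: poly_DERIV DERIV_subset)

lemma continuous_on_poly' [continuous_intros]: "continuous_on A (poly p)" for p :: "real poly"
  by (intro continuous_intros)

text \<open>Integration by parts; the boundary term at 0 vanishes.\<close>

lemma integral_mult_poly_pderiv:
  "((\<lambda>r. poly (pderiv p) r * r) has_integral (poly p 1 - integral {0..1} (poly p))) {0..1}" for p :: "real poly"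
proof -
  have "((\<lambda>r. poly p r + r * poly (pderiv p) r) has_integral (1 * poly p 1 - 0 * poly p 0)) {0..1}"
  proof (rule fundamental_theorem_of_calculus)
    fix r :: real
    have "((\<lambda>r. r * poly p r) has_real_derivative (poly p r + r * poly (pderiv p) r)) (at r)"
      by (auto intro!: derivative_eq_intros poly_DERIV simp: algebra_simps)
    then show "((\<lambda>r. r * poly p r) has_vector_derivative poly p r + r * poly (pderiv p) r) (at r within {0..1})"
      by (auto simp: has_real_derivative_iff_has_vector_derivative [symmetric] intro: DERIV_subset)
  qed simp
  from has_integral_diff [OF this integrable_integral [OF integrable_continuous_real [OF continuous_on_poly']], of p]
  show ?thesis by (simp add: mult.commute)
qed

text \<open>The weights of the interpolatory quadrature on [0, 1] at the nodes of EP3, exact up to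
  degree 3.\<close>

definition quad_weight :: "nat \<Rightarrow> real" where
  "quad_weight k = integral {0..1} (poly (lag k))"

lemma quad_weight_moment:
  assumes "j \<le> 3" shows "(\<Sum>k\<le>3. node k ^ j * quad_weight k) = 1 / real (Suc j)"
proof -
  have "((\<lambda>x. \<Sum>k\<le>3. node k ^ j * poly (lag k) x) has_integral (\<Sum>k\<le>3. node k ^ j * quad_weight k)) {0..1}"
    unfolding quad_weight_def
    by (intro has_integral_sum has_integral_mult_right integrable_integral integrable_continuous_real continuous_intros) auto
  then have "((\<lambda>x. x ^ j) has_integral (\<Sum>k\<le>3. node k ^ j * quad_weight k)) {0..1}"
    by (simp only: lag_power [OF assms])
  moreover have "((\<lambda>x :: real. x ^ j) has_integral (1 ^ Suc j / real (Suc j) - 0 ^ Suc j / real (Suc j))) {0..1}"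
  proof (rule fundamental_theorem_of_calculus)
    fix x :: real
    have "((\<lambda>x. x ^ Suc j / real (Suc j)) has_real_derivative x ^ j) (at x)"
      using DERIV_cdivide [OF DERIV_pow [of "Suc j" x], of "real (Suc j)"] by (simp del: of_nat_Suc)
    then show "((\<lambda>x. x ^ Suc j / real (Suc j)) has_vector_derivative x ^ j) (at x within {0..1})"
      by (auto simp: has_real_derivative_iff_has_vector_derivative [symmetric] intro: DERIV_subset)
  qed simp
  ultimately show ?thesis by (auto dest: has_integral_unique)
qed

definition pairs :: "(nat \<times> nat) set" where
  "pairs = {(k, i). k < i \<and> i \<le> 3}"

lemma pairs_eq: "pairs = {(0, 1), (0, 2), (0, 3), (1, 2), (1, 3), (2, 3)}"
proof -
  have "k < i \<and> i \<le> 3 \<longleftrightarrow> (k, i) \<in> {(0, 1), (0, 2), (0, 3), (1, 2), (1, 3), (2, 3)}" for k i :: nat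
    unfolding le3_cases by auto
  then show ?thesis unfolding pairs_def by blast
qed

lemma finite_pairs [simp]: "finite pairs"
  by (simp add: pairs_eq)

lemma sum_pairs: "sum f pairs = f (0, 1) + f (0, 2) + f (0, 3) + f (1, 2) + f (1, 3) + f (2, 3)"
  for f :: "nat \<times> nat \<Rightarrow> 'a::comm_monoid_add"
  by (simp add: pairs_eq add.assoc)

text \<open>This order condition is what determines the node \<open>c\<^sub>2\<close>: eliminating the quadrature weights leaves
  the cubic of \<open>node2_cubic\<close>.\<close>

lemma quad_weight_pairs:
  "(\<Sum>(k, i)\<in>pairs. quad_weight i * ((node i - node k) * quad_weight k)) = 1 / 6"
proof -
  define x where "x = node 2"
  define b0 b1 b2 b3 where b: "b0 = quad_weight 0" "b1 = quad_weight 1" "b2 = quad_weight 2" "b3 = quad_weight 3"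
  have x: "x \<noteq> 0" "3 * x - 1 \<noteq> 0" "x - 1 \<noteq> 0" using node2_neq by (auto simp: x_def)
  have e: "b0 + b1 + b2 + b3 = 1" "b1 / 3 + x * b2 + b3 = 1 / 2" "b1 / 9 + x ^ 2 * b2 + b3 = 1 / 3" "b1 / 27 + x ^ 3 * b2 + b3 = 1 / 4"
    using quad_weight_moment [of 0] quad_weight_moment [of 1] quad_weight_moment [of 2] quad_weight_moment [of 3]
    unfolding sum_le3 by (simp_all add: b x_def power2_eq_square power3_eq_cube)
  \<comment> \<open>The moment equations determine the weights as rational functions of x = c_2. The
    factors divided by, x, 3 x - 1 and x - 1, vanish only at the other nodes.\<close>
  have "b2 * (12 * x * (3 * x - 1) * (x - 1)) = - 1"
    using e(2-4) by algebra
  moreover have "12 * x * (3 * x - 1) * (x - 1) \<noteq> 0" using x by simp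
  ultimately have b2: "b2 = - 1 / (12 * x * (3 * x - 1) * (x - 1))" by (rule iffD2 [OF nonzero_eq_divide_eq, rotated])
  have "8 * (3 * x - 1) * b1 = 9 * (2 * x - 1)" using e(2-4) by algebra
  then have b1: "b1 = 9 * (2 * x - 1) / (8 * (3 * x - 1))" using x by (simp add: field_simps)
  have "24 * (x - 1) * b3 = 6 * x - 5" using e(2-4) by algebra
  then have b3: "b3 = (6 * x - 5) / (24 * (x - 1))" using x by (simp add: field_simps)
  have "12 * x * b0 = 1" using e by algebra
  then have b0: "b0 = 1 / (12 * x)" using x by (simp add: field_simps)
  \<comment> \<open>The factor clears the denominators of all six products and of 1/6.\<close>
  have "288 * x * (3 * x - 1) * (x - 1) * (b1 * (b0 / 3) + b2 * (x * b0) + b3 * b0 + b2 * ((x - 1 / 3) * b1) + b3 * (2 / 3 * b1) + b3 * ((1 - x) * b2) - 1 / 6)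
     = - (36 * x ^ 3 - 84 * x ^ 2 + 63 * x - 16)"
  proof -
    \<comment> \<open>Names for the linear factors keep them from being expanded while denominators
      cancel.\<close>
    define a b u w where d: "a = 3 * x - 1" "b = x - 1" "u = 2 * x - 1" "w = 6 * x - 5"
    have nz: "x \<noteq> 0" "a \<noteq> 0" "b \<noteq> 0" using x by (auto simp: d)
    have b': "b0 = 1 / (12 * x)" "b1 = 9 * u / (8 * a)" "b2 = - 1 / (12 * x * a * b)" "b3 = w / (24 * b)"
      unfolding d by (fact b0 b1 b2 b3)+
    have g: "x - 1 / 3 = a / 3" "1 - x = - b" by (simp_all add: d)
    have t1: "288 * x * a * b * (b1 * (b0 / 3)) = 9 * u * b" unfolding b' using nz by (simp add: field_simps)
    have t2: "288 * x * a * b * (b2 * (x * b0)) = - 2" unfolding b' using nz by (simp add: field_simps)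
    have t3: "288 * x * a * b * (b3 * b0) = w * a" unfolding b' using nz by (simp add: field_simps)
    have t4: "288 * x * a * b * (b2 * ((x - 1 / 3) * b1)) = - 9 * u" unfolding b' g using nz by (simp add: field_simps)
    have t5: "288 * x * a * b * (b3 * (2 / 3 * b1)) = 9 * x * u * w" unfolding b' using nz by (simp add: field_simps)
    have t6: "288 * x * a * b * (b3 * ((1 - x) * b2)) = w" unfolding b' g using nz by (simp add: field_simps)
    have "288 * x * a * b * (b1 * (b0 / 3) + b2 * (x * b0) + b3 * b0 + b2 * ((x - 1 / 3) * b1) + b3 * (2 / 3 * b1) + b3 * ((1 - x) * b2) - 1 / 6)
       = 9 * u * b + - 2 + w * a + - 9 * u + 9 * x * u * w + w - 288 * x * a * b * (1 / 6)"
      unfolding distrib_left right_diff_distrib [of _ _ "1 / 6"] t1 t2 t3 t4 t5 t6 ..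
    also have "\<dots> = - (36 * x ^ 3 - 84 * x ^ 2 + 63 * x - 16)"
      by (simp add: d power2_eq_square power3_eq_cube algebra_simps)
    finally show ?thesis by (simp only: d)
  qed
  also have "\<dots> = 0" using node2_cubic by (simp add: x_def)
  finally have "b1 * (b0 / 3) + b2 * (x * b0) + b3 * b0 + b2 * ((x - 1 / 3) * b1) + b3 * (2 / 3 * b1) + b3 * ((1 - x) * b2) = 1 / 6"
    using x by simp
  then show ?thesis unfolding sum_pairs by (simp add: b x_def)
qed

text \<open>The integral of exp((c_i - s) z) over s from c_k to c_i.\<close>

definition gap_phi :: "nat \<Rightarrow> nat \<Rightarrow> complex \<Rightarrow> complex" where
  "gap_phi k i z = of_real (node i - node k) * phi1 (of_real (node i - node k) * z)"

lemma sum_1_3: "(\<Sum>l=1..3. f l) = f 1 + f 2 + f (3 :: nat)" for f :: "nat \<Rightarrow> 'a::comm_monoid_add"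
  by (simp add: eval_nat_numeral add.assoc)

lemma poly_degree_3:
  fixes p :: "real poly" assumes "degree p \<le> 3"
  shows "poly p x = coeff p 0 + coeff p 1 * x + coeff p 2 * x ^ 2 + coeff p 3 * x ^ 3"
proof -
  have "poly p x = (\<Sum>i\<le>3. coeff p i * x ^ i)"
    unfolding poly_altdef by (rule sum.mono_neutral_left) (use assms in \<open>auto simp: coeff_eq_0\<close>)
  then show ?thesis by (simp add: sum_le3)
qed

text \<open>Dividing the coefficients of a derivative by l and summing integrates from 0 to \<tau>.
  This returns the Lagrange polynomial itself when it vanishes at 0, that is for k \<noteq>
  0.\<close>

lemma EP3_Cjk_sums:
  assumes "k \<le> 3"
  shows "(\<Sum>n=1..3. EP3_Cjk (n - 1) k * r ^ (n - 1)) = poly (pderiv (lag k)) r"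
    and "k \<noteq> 0 \<Longrightarrow> (\<Sum>l=1..3. 1 / real l * EP3_Cjk (l - 1) k * \<tau> ^ l) = poly (lag k) \<tau>"
proof -
  have d: "degree (pderiv (lag k)) \<le> 3" using degree_lag [OF assms] by (simp add: degree_pderiv)
  have "coeff (pderiv (lag k)) 3 = 0"
    using degree_lag [OF assms] by (intro coeff_eq_0) (simp add: degree_pderiv)
  then show "(\<Sum>n=1..3. EP3_Cjk (n - 1) k * r ^ (n - 1)) = poly (pderiv (lag k)) r"
    unfolding poly_degree_3 [OF d] sum_1_3 EP3_Cjk_def by simp
  assume "k \<noteq> 0"
  then have "coeff (lag k) 0 = 0"
    using lag_node [of 0 k] assms by (simp add: poly_0_coeff_0)
  then show "(\<Sum>l=1..3. 1 / real l * EP3_Cjk (l - 1) k * \<tau> ^ l) = poly (lag k) \<tau>"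
    unfolding poly_degree_3 [OF degree_lag [OF assms]] sum_1_3 EP3_Cjk_def coeff_pderiv by (simp add: numeral_2_eq_2 numeral_3_eq_3)
qed

text \<open>The coefficient sums factor into a part in \<tau> and a part in r. Each pair has k < i,
  so i \<noteq> 0 as the second part of \<open>EP3_Cjk_sums\<close> requires.\<close>

lemma EP3_A_eq:
  "EP3_A \<tau> r z = - (\<Sum>(k, i)\<in>pairs. of_real (poly (lag i) \<tau>) * of_real (poly (pderiv (lag k)) r) * gap_phi k i z)"
proof -
  define g where "g = (\<lambda>l n (p :: nat \<times> nat). of_real ((1 / real l * EP3_Cjk (l - 1) (snd p) * \<tau> ^ l) * (EP3_Cjk (n - 1) (fst p) * r ^ (n - 1))) * gap_phi (fst p) (snd p) z)"
  have "EP3_A \<tau> r z = (\<Sum>l=1..3. \<Sum>n=1..3. - (\<Sum>p\<in>pairs. g l n p))"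
    unfolding EP3_A_def EP3_a_def pairs_def [symmetric]
    by (intro sum.cong refl)
      (simp add: sum_distrib_left sum_distrib_right sum_negf [symmetric] g_def gap_phi_def split_def mult_ac)
  also have "\<dots> = - (\<Sum>l=1..3. \<Sum>n=1..3. \<Sum>p\<in>pairs. g l n p)" by (simp add: sum_negf)
  also have "(\<Sum>l=1..3. \<Sum>n=1..3. \<Sum>p\<in>pairs. g l n p) = (\<Sum>l=1..3. \<Sum>p\<in>pairs. \<Sum>n=1..3. g l n p)"
    by (intro sum.cong refl) (rule sum.swap)
  also have "\<dots> = (\<Sum>p\<in>pairs. \<Sum>l=1..3. \<Sum>n=1..3. g l n p)" by (rule sum.swap)
  also have "\<dots> = (\<Sum>(k, i)\<in>pairs. of_real (poly (lag i) \<tau>) * of_real (poly (pderiv (lag k)) r) * gap_phi k i z)"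
  proof (rule sum.cong [OF refl], clarify)
    fix k i assume "(k, i) \<in> pairs"
    then have ki: "k < i" "i \<le> 3" by (auto simp: pairs_def)
    have "(\<Sum>l=1..3. \<Sum>n=1..3. g l n (k, i)) = of_real (\<Sum>l=1..3. \<Sum>n=1..3. (1 / real l * EP3_Cjk (l - 1) i * \<tau> ^ l) * (EP3_Cjk (n - 1) k * r ^ (n - 1))) * gap_phi k i z"
      by (simp add: g_def sum_distrib_right)
    also have "(\<Sum>l=1..3. \<Sum>n=1..3. (1 / real l * EP3_Cjk (l - 1) i * \<tau> ^ l) * (EP3_Cjk (n - 1) k * r ^ (n - 1))) =
       (\<Sum>l=1..3. 1 / real l * EP3_Cjk (l - 1) i * \<tau> ^ l) * (\<Sum>n=1..3. EP3_Cjk (n - 1) k * r ^ (n - 1))"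
      by (rule sum_product [symmetric])
    also have "\<dots> = poly (lag i) \<tau> * poly (pderiv (lag k)) r"
      using ki by (subst EP3_Cjk_sums(1), simp) (subst EP3_Cjk_sums(2), simp_all)
    finally show "(\<Sum>l=1..3. \<Sum>n=1..3. g l n (k, i)) = of_real (poly (lag i) \<tau>) * of_real (poly (pderiv (lag k)) r) * gap_phi k i z"
      by simp
  qed
  finally show ?thesis .
qed

lemma EP3_C_eq: "EP3_C \<tau> z = (\<Sum>k\<le>3. of_real (poly (lag k) \<tau>) * exp (of_real (node k) * z))"
  by (simp add: EP3_C_def atMost_atLeast0)

lemma continuous_on_EP3_A: "continuous_on S (\<lambda>r. EP3_A \<tau> r z)"
  unfolding EP3_A_eq split_def by (intro continuous_intros)

lemma gap_phi_0_node3: "gap_phi 0 3 z = phi1 z"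
  by (simp add: gap_phi_def)

lemma lag_at_1: "k \<le> 3 \<Longrightarrow> poly (lag k) 1 = (if k = 3 then 1 else 0)"
  using lag_node [of 3 k] by auto

lemma lag_at_0: "k \<le> 3 \<Longrightarrow> poly (lag k) 0 = (if k = 0 then 1 else 0)"
  using lag_node [of 0 k] by auto

lemma EP3_A_one: "EP3_A 1 r z = - (\<Sum>k\<le>3. of_real (poly (pderiv (lag k)) r) * gap_phi k 3 z)"
  unfolding EP3_A_eq sum_pairs sum_le3 by (simp add: lag_at_1 gap_phi_def)

text \<open>Stated for a general \<open>w\<close> because it is needed with 1 for the zeroth and
  with r for the first moment.\<close>

lemma EP3_A_has_integral:
  assumes w: "\<And>k. k < 3 \<Longrightarrow> ((\<lambda>r. poly (pderiv (lag k)) r * w r) has_integral I k) {0..1}"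
  shows "((\<lambda>r. EP3_A \<tau> r z * of_real (w r)) has_integral
    - (\<Sum>(k, i)\<in>pairs. of_real (poly (lag i) \<tau> * I k) * gap_phi k i z)) {0..1}"
proof -
  have "((\<lambda>r. \<Sum>p\<in>pairs. of_real (poly (lag (snd p)) \<tau>) * of_real (poly (pderiv (lag (fst p))) r * w r) * gap_phi (fst p) (snd p) z)
     has_integral (\<Sum>p\<in>pairs. of_real (poly (lag (snd p)) \<tau>) * of_real (I (fst p)) * gap_phi (fst p) (snd p) z)) {0..1}"
    by (intro has_integral_sum finite_pairs has_integral_mult_left has_integral_mult_right has_integral_of_real w)
      (auto simp: pairs_def)
  from has_integral_neg [OF this] show ?thesis
    unfolding EP3_A_eq by (simp add: split_def sum_distrib_left sum_distrib_right mult_ac)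
qed

text \<open>For k < 3 the derivative of \<open>lag k\<close> has integral -1 if k = 0 and 0
  otherwise, so only pairs starting at node 0 survive. The result interpolates the integral of
  exp((\<tau> - s) z) over [0, \<tau>] at the nodes.\<close>

lemma EP3_A_integral:
  "integral {0..1} (\<lambda>r. EP3_A \<tau> r z) = (\<Sum>i\<le>3. of_real (poly (lag i) \<tau>) * gap_phi 0 i z)"
proof -
  have "((\<lambda>r. EP3_A \<tau> r z * of_real 1) has_integral
    - (\<Sum>(k, i)\<in>pairs. of_real (poly (lag i) \<tau> * (poly (lag k) 1 - poly (lag k) 0)) * gap_phi k i z)) {0..1}"
    by (rule EP3_A_has_integral) (use integral_poly_pderiv in simp)
  from integral_unique [OF this] show ?thesis
    unfolding sum_pairs sum_le3 by (simp add: lag_at_1 lag_at_0 gap_phi_def)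
qed

text \<open>The function g of the averaging argument: \<tau>^2 / 2 minus the first moment of the
  weight at z = 0.\<close>

definition EP3_drift :: "real \<Rightarrow> real" where
  "EP3_drift \<tau> = \<tau>\<^sup>2 / 2 - (\<Sum>(k, i)\<in>pairs. poly (lag i) \<tau> * ((node i - node k) * quad_weight k))"

lemma EP3_A_first_moment: "integral {0..1} (\<lambda>r. EP3_A \<tau> r 0 * of_real r) = of_real (\<tau>\<^sup>2 / 2 - EP3_drift \<tau>)"
proof -
  have "((\<lambda>r. EP3_A \<tau> r 0 * of_real r) has_integral
    - (\<Sum>(k, i)\<in>pairs. of_real (poly (lag i) \<tau> * (poly (lag k) 1 - quad_weight k)) * gap_phi k i 0)) {0..1}"
    unfolding quad_weight_def by (rule EP3_A_has_integral) (rule integral_mult_poly_pderiv)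
  from integral_unique [OF this] show ?thesis
    unfolding EP3_drift_def sum_pairs by (simp add: lag_at_1 gap_phi_def mult_ac)
qed

lemma continuous_on_EP3_drift: "continuous_on S EP3_drift"
  unfolding EP3_drift_def [abs_def] split_def by (intro continuous_intros) auto

text \<open>Integrating the Lagrange polynomials in \<tau> turns the sum into that of
  \<open>quad_weight_pairs\<close>, whose value 1/6 is the mean of \<tau>^2 / 2.\<close>

lemma EP3_drift_integral: "integral {0..1} EP3_drift = 0"
proof (rule integral_unique)
  have sq: "((\<lambda>\<tau> :: real. \<tau>\<^sup>2 / 2) has_integral 1 / 6) {0..1}"
  proof -
    have "((\<lambda>\<tau> :: real. \<tau>\<^sup>2 / 2) has_integral (1 ^ 3 / 6 - 0 ^ 3 / 6)) {0..1}"
    proof (rule fundamental_theorem_of_calculus)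
      fix x :: real
      have "((\<lambda>x. x ^ 3 / 6) has_real_derivative x\<^sup>2 / 2) (at x)"
        by (auto intro!: derivative_eq_intros)
      then show "((\<lambda>x. x ^ 3 / 6) has_vector_derivative x\<^sup>2 / 2) (at x within {0..1})"
        by (auto simp: has_real_derivative_iff_has_vector_derivative [symmetric] intro: DERIV_subset)
    qed simp
    then show ?thesis by simp
  qed
  have "(EP3_drift has_integral (1 / 6 - (\<Sum>p\<in>pairs. quad_weight (snd p) * ((node (snd p) - node (fst p)) * quad_weight (fst p))))) {0..1}"
    unfolding EP3_drift_def [abs_def] split_def
    by (intro has_integral_diff sq has_integral_sum finite_pairs has_integral_mult_left)
      (unfold quad_weight_def, intro integrable_integral integrable_continuous_real continuous_intros)
  then show "(EP3_drift has_integral 0) {0..1}"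
    unfolding quad_weight_pairs [unfolded split_def] by simp
qed

section \<open>Uniform bounds for the coefficients of EP3\<close>

lemma poly_bounded_unit: "\<exists>B. \<forall>x\<in>{0..1}. \<bar>poly p x\<bar> \<le> B" for p :: "real poly"
proof -
  have "bounded (poly p ` {0..1})"
    by (intro compact_imp_bounded compact_continuous_image continuous_intros) auto
  then show ?thesis by (auto simp: bounded_iff)
qed

lemma poly_lipschitz_unit:
  fixes p :: "real poly"
  assumes B: "\<And>x. x \<in> {0..1} \<Longrightarrow> \<bar>poly (pderiv p) x\<bar> \<le> B" and x: "x \<in> {0..1}" "y \<in> {0..1}"
  shows "\<bar>poly p x - poly p y\<bar> \<le> B * \<bar>x - y\<bar>"
proof -
  have "norm (poly p x - poly p y) \<le> B * norm (x - y)"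
    by (rule field_differentiable_bound [where S = "{0..1}" and f' = "poly (pderiv p)"])
      (use B x in \<open>auto intro: DERIV_subset poly_DERIV\<close>)
  then show ?thesis by simp
qed

text \<open>The constant is obtained from compactness and not computed, because c_2 is given by
  radicals.\<close>

definition EP3_bound :: "real \<Rightarrow> bool" where
  "EP3_bound B \<longleftrightarrow> B \<ge> 1 \<and> (\<forall>k\<le>3. \<forall>x\<in>{0..1}. \<bar>poly (lag k) x\<bar> \<le> B \<and> \<bar>poly (pderiv (lag k)) x\<bar> \<le> B) \<and>
     (\<forall>k\<le>3. \<forall>i\<le>3. \<bar>node i - node k\<bar> \<le> B)"

lemma EP3_bound_exists: "\<exists>B. EP3_bound B"
proof -
  have "\<forall>k. \<exists>B. \<forall>x\<in>{0..1}. \<bar>poly (lag k) x\<bar> \<le> B" by (intro allI poly_bounded_unit)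
  from choice [OF this] obtain b where "\<forall>k. \<forall>x\<in>{0..1}. \<bar>poly (lag k) x\<bar> \<le> b k" by (elim exE)
  then have b: "\<bar>poly (lag k) x\<bar> \<le> b k" if "x \<in> {0..1}" for k x using that by blast
  have "\<forall>k. \<exists>B. \<forall>x\<in>{0..1}. \<bar>poly (pderiv (lag k)) x\<bar> \<le> B" by (intro allI poly_bounded_unit)
  from choice [OF this] obtain b' where "\<forall>k. \<forall>x\<in>{0..1}. \<bar>poly (pderiv (lag k)) x\<bar> \<le> b' k" by (elim exE)
  then have b': "\<bar>poly (pderiv (lag k)) x\<bar> \<le> b' k" if "x \<in> {0..1}" for k x using that by blast
  define B where "B = 1 + (\<Sum>k\<le>3. b k) + (\<Sum>k\<le>3. b' k) + 2 * (\<Sum>k\<le>3. \<bar>node k\<bar>)"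
  have n: "b k \<ge> 0" "b' k \<ge> 0" for k using order_trans [OF abs_ge_zero b [of 0 k]] order_trans [OF abs_ge_zero b' [of 0 k]] by auto
  have le: "b k \<le> (\<Sum>k\<le>3. b k)" "b' k \<le> (\<Sum>k\<le>3. b' k)" "\<bar>node k\<bar> \<le> (\<Sum>k\<le>3. \<bar>node k\<bar>)" if "k \<le> 3" for k
    using that n by (auto intro!: member_le_sum)
  have s: "0 \<le> (\<Sum>k\<le>3. b k)" "0 \<le> (\<Sum>k\<le>3. b' k)" "0 \<le> (\<Sum>k\<le>3. \<bar>node k\<bar>)" using n by (auto intro!: sum_nonneg)
  have "EP3_bound B"
    unfolding EP3_bound_def
  proof (intro conjI allI impI ballI)
    show "B \<ge> 1" using s by (simp add: B_def)
    fix k :: nat assume k: "k \<le> 3"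
    show "\<bar>poly (lag k) x\<bar> \<le> B" if "x \<in> {0..1}" for x using b [OF that, of k] le(1) [OF k] s unfolding B_def by linarith
    show "\<bar>poly (pderiv (lag k)) x\<bar> \<le> B" if "x \<in> {0..1}" for x using b' [OF that, of k] le(2) [OF k] s unfolding B_def by linarith
    show "\<bar>node i - node k\<bar> \<le> B" if "i \<le> 3" for i using le(3) [OF k] le(3) [OF that] s unfolding B_def by linarith
  qed
  then show ?thesis ..
qed

locale EP3_bounded =
  fixes B :: real
  assumes B: "EP3_bound B"
begin

lemma B1: "B \<ge> 1" "B \<ge> 0" using B by (auto simp: EP3_bound_def)

lemma lag_B: "k \<le> 3 \<Longrightarrow> x \<in> {0..1} \<Longrightarrow> \<bar>poly (lag k) x\<bar> \<le> B"
  and dlag_B: "k \<le> 3 \<Longrightarrow> x \<in> {0..1} \<Longrightarrow> \<bar>poly (pderiv (lag k)) x\<bar> \<le> B"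
  and node_B: "k \<le> 3 \<Longrightarrow> i \<le> 3 \<Longrightarrow> \<bar>node i - node k\<bar> \<le> B"
  using B by (auto simp: EP3_bound_def)

lemma node_B': "k \<le> 3 \<Longrightarrow> \<bar>node k\<bar> \<le> B"
  using node_B [of 0 k] by simp

lemma norm_sum_pairs:
  fixes f :: "nat \<Rightarrow> nat \<Rightarrow> complex"
  assumes "\<And>k i. k \<le> 3 \<Longrightarrow> i \<le> 3 \<Longrightarrow> norm (f k i) \<le> c"
  shows "norm (\<Sum>(k, i)\<in>pairs. f k i) \<le> 6 * c"
proof -
  have "norm (\<Sum>(k, i)\<in>pairs. f k i) \<le> of_nat (card pairs) * c"
    by (rule sum_norm_bound) (use assms in \<open>auto simp: pairs_def\<close>)
  also have "card pairs = 6" by (simp add: pairs_eq)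
  finally show ?thesis by simp
qed

lemma norm_sum_le3:
  fixes f :: "nat \<Rightarrow> complex"
  assumes "\<And>k. k \<le> 3 \<Longrightarrow> norm (f k) \<le> c"
  shows "norm (\<Sum>k\<le>3. f k) \<le> 4 * c"
  using sum_norm_bound [of "{..3 :: nat}" f c] assms by simp

lemma gap_phi_B:
  assumes "Re z = 0" "k \<le> 3" "i \<le> 3"
  shows "norm (gap_phi k i z) \<le> B" "norm (gap_phi k i z - gap_phi k i 0) \<le> B * (B * norm z)"
    "norm (gap_phi k i z - of_real (node i - node k) * (1 + of_real (node i - node k) * z / 2)) \<le> B * (B * norm z) ^ 2"
    "norm (gap_phi k i z - of_real (node i - node k) * (\<Sum>j<3. (of_real (node i - node k) * z) ^ j / fact (Suc j))) \<le> B * (B * norm z) ^ 3"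
proof -
  let ?d = "node i - node k"
  let ?w = "of_real ?d * z"
  have w: "Re ?w = 0" using assms by simp
  have nw: "norm ?w \<le> B * norm z"
    unfolding norm_mult norm_of_real by (intro mult_right_mono node_B assms) auto
  have nn: "norm ?w ^ n \<le> (B * norm z) ^ n" for n by (intro power_mono nw) auto
  note m = norm_of_real_mult_le [OF _ node_B [OF assms(2,3)] B1(2)]
  show "norm (gap_phi k i z) \<le> B"
    unfolding gap_phi_def using m [OF phi1_bounds(1) [OF w]] by simp
  have "gap_phi k i z - gap_phi k i 0 = of_real ?d * (phi1 ?w - 1)"
    by (simp add: gap_phi_def right_diff_distrib)
  then show "norm (gap_phi k i z - gap_phi k i 0) \<le> B * (B * norm z)"
    using m [OF order_trans [OF phi1_bounds(2) [OF w] nw]] by (simp only:)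
  have "gap_phi k i z - of_real ?d * (1 + ?w / 2) = of_real ?d * (phi1 ?w - (1 + ?w / 2))"
    by (simp only: gap_phi_def right_diff_distrib)
  then show "norm (gap_phi k i z - of_real ?d * (1 + ?w / 2)) \<le> B * (B * norm z) ^ 2"
    using m [OF order_trans [OF phi1_bounds(3) [OF w] nn [of 2]]] by (simp only:)
  have "gap_phi k i z - of_real ?d * (\<Sum>j<3. ?w ^ j / fact (Suc j)) = of_real ?d * (phi1 ?w - (\<Sum>j<3. ?w ^ j / fact (Suc j)))"
    by (simp only: gap_phi_def right_diff_distrib)
  then show "norm (gap_phi k i z - of_real ?d * (\<Sum>j<3. ?w ^ j / fact (Suc j))) \<le> B * (B * norm z) ^ 3"
    using m [OF order_trans [OF phi1_taylor_bound [OF w, of 3] nn [of 3]]] by (simp only:)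
qed

lemma norm_mult3: "norm a \<le> p \<Longrightarrow> norm b \<le> q \<Longrightarrow> norm c \<le> s \<Longrightarrow> norm (a * b * c) \<le> p * q * s"
  for a b c :: complex
  unfolding norm_mult by (intro mult_mono mult_nonneg_nonneg) (auto intro: order_trans [OF norm_ge_zero])

lemma EP3_A_bound:
  assumes "\<tau> \<in> {0..1}" "r \<in> {0..1}" "Re z = 0"
  shows "norm (EP3_A \<tau> r z) \<le> 6 * B ^ 3"
  unfolding EP3_A_eq norm_minus_cancel
  by (rule order_trans [OF norm_sum_pairs [where c = "B * B * B"]])
    (auto intro!: norm_mult3 lag_B dlag_B gap_phi_B assms simp: power3_eq_cube)

lemma EP3_A_lip:
  assumes "\<tau> \<in> {0..1}" "\<tau>' \<in> {0..1}" "r \<in> {0..1}" "Re z = 0"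
  shows "norm (EP3_A \<tau> r z - EP3_A \<tau>' r z) \<le> 6 * B ^ 3 * \<bar>\<tau> - \<tau>'\<bar>"
proof -
  have "EP3_A \<tau> r z - EP3_A \<tau>' r z = - (\<Sum>(k, i)\<in>pairs. of_real (poly (lag i) \<tau> - poly (lag i) \<tau>') * of_real (poly (pderiv (lag k)) r) * gap_phi k i z)"
    unfolding EP3_A_eq split_def by (simp add: left_diff_distrib sum_subtractf)
  also have "norm \<dots> \<le> 6 * ((B * \<bar>\<tau> - \<tau>'\<bar>) * B * B)"
    unfolding norm_minus_cancel
    by (rule norm_sum_pairs)
      (intro norm_mult3 gap_phi_B assms; simp only: norm_of_real; intro poly_lipschitz_unit dlag_B assms)
  finally show ?thesis by (simp add: power3_eq_cube mult_ac)
qed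

lemma EP3_A_at0:
  assumes "\<tau> \<in> {0..1}" "r \<in> {0..1}" "Re z = 0"
  shows "norm (EP3_A \<tau> r z - EP3_A \<tau> r 0) \<le> 6 * B ^ 4 * norm z"
proof -
  have "EP3_A \<tau> r z - EP3_A \<tau> r 0 = - (\<Sum>(k, i)\<in>pairs. of_real (poly (lag i) \<tau>) * of_real (poly (pderiv (lag k)) r) * (gap_phi k i z - gap_phi k i 0))"
    unfolding EP3_A_eq split_def by (simp add: right_diff_distrib sum_subtractf)
  also have "norm \<dots> \<le> 6 * (B * B * (B * (B * norm z)))"
    unfolding norm_minus_cancel
    by (rule norm_sum_pairs) (auto intro!: norm_mult3 lag_B dlag_B gap_phi_B assms)
  finally show ?thesis by (simp add: eval_nat_numeral mult_ac)
qed

lemma EP3_C_bound: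
  assumes "\<tau> \<in> {0..1}" "Re z = 0" shows "norm (EP3_C \<tau> z) \<le> 4 * B"
  unfolding EP3_C_eq
  by (rule norm_sum_le3) (use assms in \<open>auto simp: norm_mult norm_exp_eq_Re lag_B\<close>)

lemma EP3_C_lip:
  assumes "\<tau> \<in> {0..1}" "\<tau>' \<in> {0..1}" "Re z = 0"
  shows "norm (EP3_C \<tau> z - EP3_C \<tau>' z) \<le> 4 * B * \<bar>\<tau> - \<tau>'\<bar>"
proof -
  have "EP3_C \<tau> z - EP3_C \<tau>' z = (\<Sum>k\<le>3. of_real (poly (lag k) \<tau> - poly (lag k) \<tau>') * exp (of_real (node k) * z))"
    unfolding EP3_C_eq by (simp add: left_diff_distrib sum_subtractf)
  also have "norm \<dots> \<le> 4 * (B * \<bar>\<tau> - \<tau>'\<bar>)"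
  proof (rule norm_sum_le3)
    fix k :: nat assume k: "k \<le> 3"
    have "norm (of_real (poly (lag k) \<tau> - poly (lag k) \<tau>') * exp (of_real (node k) * z)) = \<bar>poly (lag k) \<tau> - poly (lag k) \<tau>'\<bar>"
      unfolding norm_mult norm_of_real by (simp add: norm_exp_eq_Re assms)
    then show "norm (of_real (poly (lag k) \<tau> - poly (lag k) \<tau>') * exp (of_real (node k) * z)) \<le> B * \<bar>\<tau> - \<tau>'\<bar>"
      using poly_lipschitz_unit [OF dlag_B [OF k] assms(1,2)] by simp
  qed
  finally show ?thesis by simp
qed

text \<open>Cubic interpolation reproduces the Taylor polynomial of degree 3, so only fourth-order
  remainders are left.\<close>

lemma EP3_C_order4:
  assumes \<tau>: "\<tau> \<in> {0..1}" and z: "Re z = 0"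
  shows "norm (exp (of_real \<tau> * z) - EP3_C \<tau> z) \<le> 5 * B ^ 5 * norm z ^ 4"
proof -
  define E where "E = (\<lambda>w :: complex. exp w - (\<Sum>j\<le>3. w ^ j / fact j))"
  have lp: "(\<Sum>k\<le>3. of_real (poly (lag k) \<tau>) * (of_real (node k) * z) ^ j / fact j) = (of_real \<tau> * z) ^ j / fact j" if "j \<le> 3" for j
  proof -
    have "(\<Sum>k\<le>3. of_real (poly (lag k) \<tau>) * (of_real (node k) * z) ^ j / fact j) = of_real (\<Sum>k\<le>3. node k ^ j * poly (lag k) \<tau>) * z ^ j / fact j"
      by (simp add: power_mult_distrib sum_distrib_left sum_distrib_right sum_divide_distrib mult_ac)
    then show ?thesis by (simp add: lag_power [OF that] power_mult_distrib)
  qed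
  have "(\<Sum>k\<le>3. of_real (poly (lag k) \<tau>) * (\<Sum>j\<le>3. (of_real (node k) * z) ^ j / fact j)) =
     (\<Sum>j\<le>3. \<Sum>k\<le>3. of_real (poly (lag k) \<tau>) * (of_real (node k) * z) ^ j / fact j)"
    unfolding sum_distrib_left by (subst sum.swap) simp
  also have "\<dots> = (\<Sum>j\<le>3. (of_real \<tau> * z) ^ j / fact j)" by (rule sum.cong) (simp_all add: lp)
  finally have "exp (of_real \<tau> * z) - EP3_C \<tau> z = E (of_real \<tau> * z) - (\<Sum>k\<le>3. of_real (poly (lag k) \<tau>) * E (of_real (node k) * z))"
    unfolding EP3_C_eq E_def right_diff_distrib sum_subtractf by simp
  also have "norm \<dots> \<le> norm z ^ 4 + 4 * (B * (B * norm z) ^ 4)"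
  proof (intro order_trans [OF norm_triangle_ineq4] add_mono norm_sum_le3 norm_of_real_mult_le lag_B \<tau> B1)
    have E: "norm (E w) \<le> norm w ^ 4" if "Re w = 0" for w
      unfolding E_def using exp_taylor_bound [OF that, of 3] by simp
    have "norm (of_real \<tau> * z) ^ 4 \<le> norm z ^ 4"
      using \<tau> by (intro power_mono) (auto simp: norm_mult mult_left_le_one_le)
    from order_trans [OF E this] z show "norm (E (of_real \<tau> * z)) \<le> norm z ^ 4" by simp
    fix k :: nat assume k: "k \<le> 3"
    have "norm (of_real (node k) * z) ^ 4 \<le> (B * norm z) ^ 4"
      unfolding norm_mult norm_of_real by (intro power_mono mult_right_mono node_B' k) auto
    from order_trans [OF E this] z show "norm (E (of_real (node k) * z)) \<le> (B * norm z) ^ 4" by simp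
  qed
  also have "\<dots> \<le> 5 * B ^ 5 * norm z ^ 4"
  proof -
    have "1 * norm z ^ 4 \<le> B ^ 5 * norm z ^ 4" using B1 by (intro mult_right_mono one_le_power) auto
    moreover have "B * (B * norm z) ^ 4 = B ^ 5 * norm z ^ 4" by (simp add: power_mult_distrib eval_nat_numeral)
    ultimately show ?thesis by simp
  qed
  finally show ?thesis .
qed

text \<open>With \<open>phi1\<close> replaced by its Taylor polynomial,
  \<open>lag_deriv_shift\<close> shows that the weight at \<tau> = 1 reproduces the Taylor
  polynomial of degree 2 of exp((1 - r) z).\<close>

lemma EP3_A_order3:
  assumes r: "r \<in> {0..1}" and z: "Re z = 0"
  shows "norm (exp (of_real (1 - r) * z) - EP3_A 1 r z) \<le> 5 * B ^ 5 * norm z ^ 3"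
proof -
  define T where "T = (\<lambda>k. of_real (node 3 - node k) * (\<Sum>j<3. (of_real (node 3 - node k) * z) ^ j / fact (Suc j)) :: complex)"
  have j: "(\<Sum>k\<le>3. of_real (poly (pderiv (lag k)) r) * (of_real (1 - node k) * ((of_real (1 - node k) * z) ^ j / fact (Suc j)))) = - ((of_real (1 - r) * z) ^ j / fact j)"
    if "j < 3" for j
  proof -
    have "(\<Sum>k\<le>3. of_real (poly (pderiv (lag k)) r) * (of_real (1 - node k) * ((of_real (1 - node k) * z) ^ j / fact (Suc j)))) =
      of_real (\<Sum>k\<le>3. (1 - node k) ^ Suc j * poly (pderiv (lag k)) r) * z ^ j / fact (Suc j)"
      by (simp add: power_mult_distrib sum_distrib_left sum_distrib_right sum_divide_distrib mult_ac del: of_real_diff fact_Suc)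
    also have "\<dots> = of_real (- real (Suc j) * (1 - r) ^ j) * z ^ j / fact (Suc j)"
      using lag_deriv_shift [of "Suc j" r] that by simp
    also have "\<dots> = - ((of_real (1 - r) * z) ^ j / fact j)"
    proof -
      have "(fact (Suc j) :: complex) = of_nat (Suc j) * fact j" by (rule fact_Suc)
      then show ?thesis by (simp add: power_mult_distrib field_simps del: of_nat_Suc fact_Suc of_real_diff)
    qed
    finally show ?thesis .
  qed
  have "(\<Sum>k\<le>3. of_real (poly (pderiv (lag k)) r) * T k) =
     (\<Sum>j<3. \<Sum>k\<le>3. of_real (poly (pderiv (lag k)) r) * (of_real (1 - node k) * ((of_real (1 - node k) * z) ^ j / fact (Suc j))))"
    unfolding T_def sum_distrib_left node_simps by (subst sum.swap) simp
  also have "\<dots> = - (\<Sum>j<3. (of_real (1 - r) * z) ^ j / fact j)"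
    unfolding sum_negf [symmetric] by (intro sum.cong refl j) simp
  finally have s: "(\<Sum>j<3. (of_real (1 - r) * z) ^ j / fact j) = - (\<Sum>k\<le>3. of_real (poly (pderiv (lag k)) r) * T k)"
    by simp
  have "exp (of_real (1 - r) * z) - EP3_A 1 r z = (exp (of_real (1 - r) * z) - (\<Sum>j<3. (of_real (1 - r) * z) ^ j / fact j)) +
     (\<Sum>k\<le>3. of_real (poly (pderiv (lag k)) r) * (gap_phi k 3 z - T k))"
    unfolding s EP3_A_one right_diff_distrib sum_subtractf by simp
  also have "norm \<dots> \<le> norm z ^ 3 + 4 * (B * (B * (B * norm z) ^ 3))"
  proof (intro order_trans [OF norm_triangle_ineq] add_mono norm_sum_le3 norm_of_real_mult_le dlag_B r B1)
    have w: "Re (of_real (1 - r) * z) = 0" using z by simp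
    have "norm (exp (of_real (1 - r) * z) - (\<Sum>j<3. (of_real (1 - r) * z) ^ j / fact j)) \<le> norm (of_real (1 - r) * z) ^ 3"
      using exp_taylor_bound [OF w, of 2] by (simp add: eval_nat_numeral lessThan_Suc_atMost del: of_real_diff)
    also have "\<dots> \<le> norm z ^ 3"
      using r by (intro power_mono) (auto simp: norm_mult mult_left_le_one_le simp del: of_real_diff)
    finally show "norm (exp (of_real (1 - r) * z) - (\<Sum>j<3. (of_real (1 - r) * z) ^ j / fact j)) \<le> norm z ^ 3" .
    fix k :: nat assume k: "k \<le> 3"
    show "norm (gap_phi k 3 z - T k) \<le> B * (B * norm z) ^ 3"
      unfolding T_def by (rule gap_phi_B(4) [OF z k order_refl])
  qed
  also have "\<dots> \<le> 5 * B ^ 5 * norm z ^ 3"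
  proof -
    have "1 * norm z ^ 3 \<le> B ^ 5 * norm z ^ 3" using B1 by (intro mult_right_mono one_le_power) auto
    moreover have "B * (B * (B * norm z) ^ 3) = B ^ 5 * norm z ^ 3" by (simp add: power_mult_distrib eval_nat_numeral)
    ultimately show ?thesis by simp
  qed
  finally show ?thesis .
qed

text \<open>Interpolation is exact for \<tau> and \<tau>^2, so both integrals equal \<tau> +
  \<tau>^2 z / 2 up to second order. This is the condition \<open>m0\<close> of the averaging
  argument.\<close>

lemma EP3_A_zeroth:
  assumes \<tau>: "\<tau> \<in> {0..1}" and z: "Re z = 0"
  shows "norm (integral {0..\<tau>} (\<lambda>r. exp (of_real (\<tau> - r) * z)) - integral {0..1} (\<lambda>r. EP3_A \<tau> r z)) \<le> 5 * B ^ 5 * norm z ^ 2"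
proof -
  define D where "D = integral {0..\<tau>} (\<lambda>r. exp (of_real (\<tau> - r) * z)) - (of_real \<tau> + of_real (\<tau>\<^sup>2) * z / 2)"
  have lin: "((\<lambda>r. 1 + of_real (\<tau> - r) * z) has_integral (of_real \<tau> + of_real (\<tau>\<^sup>2) * z / 2)) {0..\<tau>}"
  proof -
    have "((\<lambda>r. 1 + of_real (\<tau> - r) * z) has_integral
       ((of_real \<tau> - (of_real \<tau> - of_real \<tau>)\<^sup>2 / 2 * z) - (of_real 0 - (of_real \<tau> - of_real 0)\<^sup>2 / 2 * z))) {0..\<tau>}"
    proof (rule fundamental_theorem_of_calculus)
      fix r :: real
      have "((\<lambda>w. w - (of_real \<tau> - w)\<^sup>2 / 2 * z) has_field_derivative (1 + (of_real \<tau> - of_real r) * z)) (at (of_real r))"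
        by (auto intro!: derivative_eq_intros simp: field_simps)
      from has_vector_derivative_real_field [OF this]
      show "((\<lambda>r. of_real r - (of_real \<tau> - of_real r)\<^sup>2 / 2 * z) has_vector_derivative 1 + of_real (\<tau> - r) * z) (at r within {0..\<tau>})"
        by simp
    qed (use \<tau> in auto)
    then show ?thesis by (simp add: power2_eq_square algebra_simps)
  qed
  have ex: "((\<lambda>r. exp (of_real (\<tau> - r) * z)) has_integral integral {0..\<tau>} (\<lambda>r. exp (of_real (\<tau> - r) * z))) {0..\<tau>}"
    by (intro integrable_integral integrable_continuous_real continuous_intros)
  have "norm D \<le> norm z ^ 2 * (\<tau> - 0)"
  proof -
    have "((\<lambda>r. exp (of_real (\<tau> - r) * z) - (1 + of_real (\<tau> - r) * z)) has_integral D) (cbox 0 \<tau>)"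
      unfolding D_def cbox_interval by (rule has_integral_diff [OF ex lin])
    moreover have "norm (exp (of_real (\<tau> - r) * z) - (1 + of_real (\<tau> - r) * z)) \<le> norm z ^ 2" if "r \<in> cbox 0 \<tau>" for r
    proof -
      have "norm (exp (of_real (\<tau> - r) * z) - (1 + of_real (\<tau> - r) * z)) \<le> norm (of_real (\<tau> - r) * z) ^ 2"
        by (rule exp_bounds(2)) (simp add: z)
      also have "\<dots> \<le> norm z ^ 2"
        using that \<tau> by (intro power_mono) (auto simp: norm_mult mult_left_le_one_le simp del: of_real_diff)
      finally show ?thesis .
    qed
    ultimately show ?thesis using has_integral_bound [of "norm z ^ 2" _ D 0 \<tau>] \<tau> by auto
  qed
  then have D: "norm D \<le> norm z ^ 2" using \<tau> mult_left_le [of \<tau> "norm z ^ 2"] by simp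
  define T where "T = (\<lambda>i. of_real (node i) * (1 + of_real (node i) * z / 2))"
  have "(\<Sum>i\<le>3. of_real (poly (lag i) \<tau>) * T i) = of_real (\<Sum>i\<le>3. node i ^ 1 * poly (lag i) \<tau>) + of_real (\<Sum>i\<le>3. node i ^ 2 * poly (lag i) \<tau>) * z / 2"
    by (simp add: T_def sum_le3 power2_eq_square algebra_simps add_divide_distrib)
  then have T: "(\<Sum>i\<le>3. of_real (poly (lag i) \<tau>) * T i) = of_real \<tau> + of_real (\<tau>\<^sup>2) * z / 2"
    by (simp add: lag_power [of 1, simplified] lag_power [of 2, simplified])
  have "integral {0..\<tau>} (\<lambda>r. exp (of_real (\<tau> - r) * z)) - integral {0..1} (\<lambda>r. EP3_A \<tau> r z) =
     D - (\<Sum>i\<le>3. of_real (poly (lag i) \<tau>) * (gap_phi 0 i z - T i))"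
    unfolding EP3_A_integral D_def right_diff_distrib sum_subtractf T by simp
  also have "norm \<dots> \<le> norm z ^ 2 + 4 * (B * (B * (B * norm z) ^ 2))"
  proof (rule order_trans [OF norm_triangle_ineq4 add_mono [OF D norm_sum_le3]])
    fix i :: nat assume i: "i \<le> 3"
    have "norm (gap_phi 0 i z - T i) \<le> B * (B * norm z) ^ 2"
      using gap_phi_B(3) [OF z _ i, of 0] by (simp add: T_def)
    then show "norm (of_real (poly (lag i) \<tau>) * (gap_phi 0 i z - T i)) \<le> B * (B * (B * norm z) ^ 2)"
      by (rule norm_of_real_mult_le [OF _ lag_B [OF i \<tau>] B1(2)])
  qed
  also have "\<dots> \<le> 5 * B ^ 5 * norm z ^ 2"
  proof -
    have "1 * norm z ^ 2 \<le> B ^ 5 * norm z ^ 2" using B1 by (intro mult_right_mono one_le_power) auto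
    moreover have "B ^ 4 * norm z ^ 2 \<le> B ^ 5 * norm z ^ 2" using B1 by (intro mult_right_mono power_increasing) auto
    moreover have "B * (B * (B * norm z) ^ 2) = B ^ 4 * norm z ^ 2" by (simp add: power_mult_distrib eval_nat_numeral)
    ultimately show ?thesis by simp
  qed
  finally show ?thesis .
qed

end

lemma le_twice: "X = Y \<Longrightarrow> 0 \<le> Y \<Longrightarrow> X \<le> 2 * Y" for X Y :: real
  by simp

context EP3_bounded begin

lemma EP3_drift_bound_exists: "\<exists>G\<ge>0. \<forall>\<tau>\<in>{0..1}. \<bar>EP3_drift \<tau>\<bar> \<le> G"
proof -
  have "bounded (EP3_drift ` {0..1})"
    by (intro compact_imp_bounded compact_continuous_image continuous_on_EP3_drift) auto
  then obtain G where G: "\<forall>\<tau>\<in>{0..1}. \<bar>EP3_drift \<tau>\<bar> \<le> G" by (auto simp: bounded_iff)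
  then have "\<bar>EP3_drift 0\<bar> \<le> G" by simp
  then have "G \<ge> 0" by linarith
  with G show ?thesis by blast
qed

lemma B_powers: "B \<le> B ^ 5" "B ^ 3 \<le> B ^ 5" "B ^ 4 \<le> B ^ 5" "1 \<le> B ^ 5"
  using B1 power_increasing [of 1 5 B] power_increasing [of 3 5 B] power_increasing [of 4 5 B] one_le_power [of B 5] by simp_all

lemma EP3_C_order:
  assumes \<tau>: "\<tau> \<in> {0..1}" and z: "Re z = 0" and j: "j \<le> 4" and L: "10 * B ^ 5 \<le> L"
  shows "norm (exp (of_real \<tau> * z) - EP3_C \<tau> z) \<le> L * norm z ^ j"
proof (rule power_bound_interpolate [OF _ _ j])
  have "norm (exp (of_real \<tau> * z) - EP3_C \<tau> z) \<le> 1 + 4 * B"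
    by (intro order_trans [OF norm_triangle_ineq4] add_mono EP3_C_bound \<tau> z) (simp add: norm_exp_eq_Re z)
  then show "norm (exp (of_real \<tau> * z) - EP3_C \<tau> z) \<le> L" using B_powers L by linarith
  have "5 * B ^ 5 * norm z ^ 4 \<le> L * norm z ^ 4" using L B_powers by (intro mult_right_mono) auto
  then show "norm (exp (of_real \<tau> * z) - EP3_C \<tau> z) \<le> L * norm z ^ 4" using EP3_C_order4 [OF \<tau> z] by linarith
  show "L \<ge> 0" using L B_powers by linarith
qed simp

lemma EP3_A_order:
  assumes r: "r \<in> {0..1}" and z: "Re z = 0" and j: "j \<le> 3" and L: "10 * B ^ 5 \<le> L"
  shows "norm (exp (of_real (1 - r) * z) - EP3_A 1 r z) \<le> L * norm z ^ j"
proof (rule power_bound_interpolate [OF _ _ j])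
  have "norm (exp (of_real (1 - r) * z) - EP3_A 1 r z) \<le> 1 + 6 * B ^ 3"
    by (intro order_trans [OF norm_triangle_ineq4] add_mono EP3_A_bound r z) (simp_all add: norm_exp_eq_Re z)
  then show "norm (exp (of_real (1 - r) * z) - EP3_A 1 r z) \<le> L" using B_powers L by linarith
  have "5 * B ^ 5 * norm z ^ 3 \<le> L * norm z ^ 3" using L B_powers by (intro mult_right_mono) auto
  then show "norm (exp (of_real (1 - r) * z) - EP3_A 1 r z) \<le> L * norm z ^ 3" using EP3_A_order3 [OF r z] by linarith
  show "L \<ge> 0" using L B_powers by linarith
qed simp

lemma ep_method0_EP3:
  assumes L: "10 * B ^ 5 \<le> L" shows "ep_method0 EP3_C EP3_A L"
proof
  fix \<tau> \<tau>' r :: real and z :: complex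
  note Bp = B_powers
  show "L \<ge> 1" using L Bp by linarith
  show "continuous_on {0..1} (\<lambda>r. EP3_A \<tau> r z)" by (rule continuous_on_EP3_A)
  show "EP3_C 1 z = exp z" unfolding EP3_C_eq sum_le3 by (simp add: lag_at_1)
  assume z: "Re z = 0"
  show "integral {0..1} (\<lambda>r. exp (of_real (1 - r) * z) - EP3_A 1 r z) = 0"
    by (rule A_mean_phi1 [OF continuous_on_EP3_A])
      (simp add: EP3_A_integral sum_le3 lag_at_1 gap_phi_0_node3)
  show "norm (exp (of_real (1 - r) * z) - EP3_A 1 r z) \<le> L * norm z" if "r \<in> {0..1}"
    using EP3_A_order [OF that z, of 1] L by simp
  assume \<tau>: "\<tau> \<in> {0..1}"
  show "norm (EP3_C \<tau> z) \<le> L" using EP3_C_bound [OF \<tau> z] Bp L by linarith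
  show "norm (exp (of_real \<tau> * z) - EP3_C \<tau> z) \<le> L * norm z" using EP3_C_order [OF \<tau> z, of 1] L by simp
  show "norm (EP3_A \<tau> r z) \<le> L" if "r \<in> {0..1}" using EP3_A_bound [OF \<tau> that z] Bp L by linarith
  show "norm (EP3_A \<tau> r z - EP3_A \<tau> r 0) \<le> L * norm z" if "r \<in> {0..1}"
    by (rule le_scale_mono [OF EP3_A_at0 [OF \<tau> that z]]) (use Bp L in auto)
  assume \<tau>': "\<tau>' \<in> {0..1}"
  show "norm (EP3_C \<tau> z - EP3_C \<tau>' z) \<le> L * \<bar>\<tau> - \<tau>'\<bar>"
    by (rule le_scale_mono [OF EP3_C_lip [OF \<tau> \<tau>' z]]) (use Bp L in auto)
  show "norm (EP3_A \<tau> r z - EP3_A \<tau>' r z) \<le> L * \<bar>\<tau> - \<tau>'\<bar>" if "r \<in> {0..1}"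
    by (rule le_scale_mono [OF EP3_A_lip [OF \<tau> \<tau>' that z]]) (use Bp L in auto)
next
  fix \<tau> :: real
  have "(\<Sum>i\<le>3. of_real (poly (lag i) \<tau>) * gap_phi 0 i 0) = (of_real (\<Sum>i\<le>3. node i ^ 1 * poly (lag i) \<tau>) :: complex)"
    by (simp add: sum_le3 gap_phi_def mult.commute)
  also have "\<dots> = of_real \<tau>" by (subst lag_power) simp_all
  finally show "integral {0..1} (\<lambda>r. EP3_A \<tau> r 0) = of_real \<tau>" unfolding EP3_A_integral .
qed

end

section \<open>The convergence theorem\<close>

context ep_setting0 begin

text \<open>Passes from the parameters \<kappa>, h of the local errors to h, eps. The factor 2
  merges terms of comparable size in \<open>N\<close>, as for EP1, where h \<kappa> \<le>
  \<kappa>^2.\<close>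

lemma error_bound_from_local:
  fixes E :: "real set" and bnd :: "real \<Rightarrow> real \<Rightarrow> real"
  assumes T: "T > 0" "Kp > 1" and p: "\<sigma> - 2 * real p \<ge> 0" and E: "E \<subseteq> {0<..1}"
    and bnd: "\<And>h eps. h > 0 \<Longrightarrow> eps \<in> E \<Longrightarrow> bnd h eps \<ge> 0"
    and local: "\<And>M \<rho>. \<exists>c>0. \<exists>D\<ge>0. \<forall>\<kappa> h v U. 0 < h \<and> h \<le> \<kappa> \<and> \<kappa> \<le> c \<and>
       exact_flow lam \<kappa> h (\<sigma> + 2) M v \<and> seq_stages (\<sigma> + 2) \<rho> lam \<kappa> h (v 0 :: int ^ 'd \<Rightarrow> complex) U \<longrightarrow>
       hbound (\<sigma> - 2 * real p) (\<lambda>k. v 1 k - U 1 k) (h * (D * N \<kappa> h))"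
    and N: "\<And>h eps. h > 0 \<Longrightarrow> eps \<in> E \<Longrightarrow> N (h / eps) h \<le> 2 * bnd h eps"
  shows "ep_error_bound TYPE('d) C A lam T Kp R (\<sigma> + 2) (\<sigma> - 2 * real p) E bnd"
proof (rule global_error [OF T p _ E bnd])
  fix M \<rho>
  from local [of M \<rho>] obtain c B where c: "c > 0" and B: "B \<ge> 0"
    and le: "\<forall>\<kappa> h v U. 0 < h \<and> h \<le> \<kappa> \<and> \<kappa> \<le> c \<and>
       exact_flow lam \<kappa> h (\<sigma> + 2) M v \<and> seq_stages (\<sigma> + 2) \<rho> lam \<kappa> h (v 0 :: int ^ 'd \<Rightarrow> complex) U \<longrightarrow>
       hbound (\<sigma> - 2 * real p) (\<lambda>k. v 1 k - U 1 k) (h * (B * N \<kappa> h))"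
    by (elim exE conjE)
  have "hbound (\<sigma> - 2 * real p) (\<lambda>k. v 1 k - U 1 k) (h * ((2 * B) * bnd h eps))"
    if eps: "eps \<in> E" and h: "0 < h" "h / eps \<le> c" and v: "exact_flow lam (h / eps) h (\<sigma> + 2) M v"
      "seq_stages (\<sigma> + 2) \<rho> lam (h / eps) h (v 0) U" for eps h v and U :: "real \<Rightarrow> int ^ 'd \<Rightarrow> complex"
  proof -
    have "eps > 0" "eps \<le> 1" using E eps by auto
    then have "h \<le> h / eps" using h by (simp add: field_simps mult_left_le)
    then have "hbound (\<sigma> - 2 * real p) (\<lambda>k. v 1 k - U 1 k) (h * (B * N (h / eps) h))"
      using le h v by blast
    moreover have "h * (B * N (h / eps) h) \<le> h * ((2 * B) * bnd h eps)"
      using mult_left_mono [OF N [OF h(1) eps], of B] h B by (intro mult_left_mono) auto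
    ultimately show ?thesis by (rule hbound_le)
  qed
  then show "\<exists>c>0. \<exists>D\<ge>0. \<forall>eps\<in>E. \<forall>h v U. 0 < h \<and> h / eps \<le> c \<and>
       exact_flow lam (h / eps) h (\<sigma> + 2) M v \<and>
       seq_stages (\<sigma> + 2) \<rho> lam (h / eps) h (v 0 :: int ^ 'd \<Rightarrow> complex) U \<longrightarrow>
       hbound (\<sigma> - 2 * real p) (\<lambda>k. v 1 k - U 1 k) (h * (D * bnd h eps))"
    using c B by (intro exI [of _ c] conjI exI [of _ "2 * B"] ballI allI impI) auto
qed auto

end

lemma ep_setting0I:
  fixes \<alpha> :: real
  assumes "\<alpha> > real CARD('d::finite) / 2 + 2" "ep_method0 C A L"
  shows "ep_setting0 TYPE('d) (\<alpha> - 2) C A L"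
  by (intro ep_setting0.intro algebra_index.intro assms) (use assms in simp)

theorem corollary1:
  fixes lam T K R \<alpha> :: real
  assumes "T > 0" and "K > 1"
  shows
    "(\<alpha> > max (real CARD('d::finite) / 2 + 2) 4 \<longrightarrow>
        ep_error_bound TYPE('d) EP1_C EP1_A lam T K R \<alpha> (\<alpha> - 4) {0<..1}
          (\<lambda>h eps. h^2 / eps^2)) \<and>
     (\<alpha> > max (real CARD('d) / 2 + 2) 6 \<longrightarrow>
        ep_error_bound TYPE('d) EP2_C EP2_A lam T K R \<alpha> (\<alpha> - 6) {0<..1}
          (\<lambda>h eps. h^2 / eps + h^3 / eps^3) \<and>
        ep_error_bound TYPE('d) EP2_C EP2_A lam T K R \<alpha> (\<alpha> - 4) {1}
          (\<lambda>h eps. h^2 / eps + h^3 / eps^3)) \<and>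
     (\<alpha> > max (real CARD('d) / 2 + 2) 8 \<longrightarrow>
        ep_error_bound TYPE('d) EP3_C EP3_A lam T K R \<alpha> (\<alpha> - 8) {0<..1}
          (\<lambda>h eps. h^3 / eps^2 + h^4 / eps^4) \<and>
        ep_error_bound TYPE('d) EP3_C EP3_A lam T K R \<alpha> (\<alpha> - 6) {1}
          (\<lambda>h eps. h^3 / eps^2 + h^4 / eps^4))"
proof (intro conjI impI)
  assume \<alpha>: "\<alpha> > max (real CARD('d) / 2 + 2) 4"
  interpret ep_setting0 "TYPE('d)" "\<alpha> - 2" EP1_C EP1_A 4
    by (rule ep_setting0I [OF _ ep_method0_EP1]) (use \<alpha> in simp)
  \<comment> \<open>p = 1; the term h \<kappa> is dominated by \<kappa>^2 because eps \<le>
    1.\<close>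
  have "ep_error_bound TYPE('d) EP1_C EP1_A lam T K R (\<alpha> - 2 + 2) (\<alpha> - 2 - 2 * real 1) {0<..1} (\<lambda>h eps. h^2 / eps^2)"
  proof (rule error_bound_from_local [OF assms])
    show "\<exists>c>0. \<exists>D\<ge>0. \<forall>\<kappa> h v U. 0 < h \<and> h \<le> \<kappa> \<and> \<kappa> \<le> c \<and>
       exact_flow lam \<kappa> h (\<alpha> - 2 + 2) M v \<and> seq_stages (\<alpha> - 2 + 2) \<rho> lam \<kappa> h (v 0 :: int ^ 'd \<Rightarrow> complex) U \<longrightarrow>
       hbound (\<alpha> - 2 - 2 * real 1) (\<lambda>k. v 1 k - U 1 k) (h * (D * (\<kappa> ^ (1 + 1) + h * \<kappa>)))" for M \<rho>
    proof (rule local_error)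
      show "norm (exp (of_real \<tau> * z) - EP1_C \<tau> z) \<le> 4 * norm z ^ (1 + 1)" if "\<tau> \<in> {0..1}" "Re z = 0" for \<tau> z
        by (rule order_trans [OF EP1_C_order [OF that]]) (simp add: numeral_2_eq_2)
      show "norm (exp (of_real (1 - r) * z) - EP1_A 1 r z) \<le> 4 * norm z ^ 1" if "r \<in> {0..1}" "Re z = 0" for r z
        by (rule order_trans [OF EP1_A_order [OF that]]) simp
    qed (use \<alpha> in simp)
    show "(h / eps) ^ (1 + 1) + h * (h / eps) \<le> 2 * (h\<^sup>2 / eps\<^sup>2)" if "h > 0" "eps \<in> {0<..1}" for h eps :: real
    proof -
      have "h * (h / eps) \<le> (h / eps) * (h / eps)"
        using that by (intro mult_right_mono) (auto simp: field_simps mult_left_le)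
      then show ?thesis by (simp add: power2_eq_square)
    qed
  qed (use \<alpha> in auto)
  then show "ep_error_bound TYPE('d) EP1_C EP1_A lam T K R \<alpha> (\<alpha> - 4) {0<..1} (\<lambda>h eps. h^2 / eps^2)"
    by simp
next
  assume \<alpha>: "\<alpha> > max (real CARD('d) / 2 + 2) 6"
  interpret ep_setting0 "TYPE('d)" "\<alpha> - 2" EP2_C EP2_A 500
    by (rule ep_setting0I [OF _ ep_method0_EP2]) (use \<alpha> in simp)
  have le: "\<exists>c>0. \<exists>D\<ge>0. \<forall>\<kappa> h v U. 0 < h \<and> h \<le> \<kappa> \<and> \<kappa> \<le> c \<and>
       exact_flow lam \<kappa> h (\<alpha> - 2 + 2) M v \<and> seq_stages (\<alpha> - 2 + 2) \<rho> lam \<kappa> h (v 0 :: int ^ 'd \<Rightarrow> complex) U \<longrightarrow>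
       hbound (\<alpha> - 2 - 2 * real p) (\<lambda>k. v 1 k - U 1 k) (h * (D * (\<kappa> ^ (p + 1) + h * \<kappa>)))" if "p \<le> 2" for p M \<rho>
  proof (rule local_error)
    show "0 \<le> \<alpha> - 2 - 2 * real p" using \<alpha> that by auto
    show "norm (exp (of_real \<tau> * z) - EP2_C \<tau> z) \<le> 500 * norm z ^ (p + 1)" if "\<tau> \<in> {0..1}" "Re z = 0" for \<tau> z
      using \<open>p \<le> 2\<close> by (intro EP2_C_order that) simp
    show "norm (exp (of_real (1 - r) * z) - EP2_A 1 r z) \<le> 500 * norm z ^ p" if "r \<in> {0..1}" "Re z = 0" for r z
      using \<open>p \<le> 2\<close> by (intro EP2_A_order that)
  qed
  \<comment> \<open>p = 2; here \<kappa>^3 + h \<kappa> is the claimed bound itself.\<close>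
  have "ep_error_bound TYPE('d) EP2_C EP2_A lam T K R (\<alpha> - 2 + 2) (\<alpha> - 2 - 2 * real 2) {0<..1} (\<lambda>h eps. h^2 / eps + h^3 / eps^3)"
  proof (rule error_bound_from_local [OF assms _ _ _ le])
    show "(h / eps) ^ (2 + 1) + h * (h / eps) \<le> 2 * (h\<^sup>2 / eps + h ^ 3 / eps ^ 3)" if "h > 0" "eps \<in> {0<..1}" for h eps :: real
    proof -
      have "(h / eps) ^ (2 + 1) + h * (h / eps) = h\<^sup>2 / eps + h ^ 3 / eps ^ 3"
        by (simp add: power2_eq_square power_divide)
      moreover have "h\<^sup>2 / eps + h ^ 3 / eps ^ 3 \<ge> 0" using that by simp
      ultimately show ?thesis by (rule le_twice)
    qed
  qed (use \<alpha> in auto)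
  then show "ep_error_bound TYPE('d) EP2_C EP2_A lam T K R \<alpha> (\<alpha> - 6) {0<..1} (\<lambda>h eps. h^2 / eps + h^3 / eps^3)"
    by simp
  \<comment> \<open>For eps = 1 the term h \<kappa> is h^2 already, so p = 1 loses nothing in the
    order.\<close>
  have "ep_error_bound TYPE('d) EP2_C EP2_A lam T K R (\<alpha> - 2 + 2) (\<alpha> - 2 - 2 * real 1) {1} (\<lambda>h eps. h^2 / eps + h^3 / eps^3)"
    by (rule error_bound_from_local [OF assms _ _ _ le]) (use \<alpha> in \<open>auto simp: power2_eq_square\<close>)
  then show "ep_error_bound TYPE('d) EP2_C EP2_A lam T K R \<alpha> (\<alpha> - 4) {1} (\<lambda>h eps. h^2 / eps + h^3 / eps^3)"
    by simp
next
  assume \<alpha>: "\<alpha> > max (real CARD('d) / 2 + 2) 8"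
  obtain B where "EP3_bound B" using EP3_bound_exists by blast
  then interpret EP3_bounded B by unfold_locales
  obtain G where G: "G \<ge> 0" "\<forall>\<tau>\<in>{0..1}. \<bar>EP3_drift \<tau>\<bar> \<le> G" using EP3_drift_bound_exists by blast
  \<comment> \<open>Large enough for the coefficient bounds and for the drift.\<close>
  define L where "L = 10 * B ^ 5 + G"
  have L_ge: "10 * B ^ 5 \<le> L" "G \<le> L" using G B_powers B1 unfolding L_def by linarith+
  interpret ep_setting0 "TYPE('d)" "\<alpha> - 2" EP3_C EP3_A L
    by (rule ep_setting0I [OF _ ep_method0_EP3 [OF L_ge(1)]]) (use \<alpha> in simp)
  have le: "\<exists>c>0. \<exists>D\<ge>0. \<forall>\<kappa> h v U. 0 < h \<and> h \<le> \<kappa> \<and> \<kappa> \<le> c \<and>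
       exact_flow lam \<kappa> h (\<alpha> - 2 + 2) M v \<and> seq_stages (\<alpha> - 2 + 2) \<rho> lam \<kappa> h (v 0 :: int ^ 'd \<Rightarrow> complex) U \<longrightarrow>
       hbound (\<alpha> - 2 - 2 * real p) (\<lambda>k. v 1 k - U 1 k) (h * (D * (\<kappa> ^ (p + 1) + h * \<kappa>\<^sup>2)))" if "1 \<le> p" "p \<le> 3" for p M \<rho>
  proof (rule local_error_balanced [OF that(1)])
    show "0 \<le> \<alpha> - 2 - 2 * real p" using \<alpha> that by auto
    show "norm (exp (of_real \<tau> * z) - EP3_C \<tau> z) \<le> L * norm z ^ (p + 1)" if "\<tau> \<in> {0..1}" "Re z = 0" for \<tau> z
      by (rule EP3_C_order [OF that _ L_ge(1)]) (use \<open>p \<le> 3\<close> in simp)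
    show "norm (exp (of_real (1 - r) * z) - EP3_A 1 r z) \<le> L * norm z ^ p" if "r \<in> {0..1}" "Re z = 0" for r z
      by (rule EP3_A_order [OF that \<open>p \<le> 3\<close> L_ge(1)])
    show "norm (integral {0..\<tau>} (\<lambda>r. exp (of_real (\<tau> - r) * z)) - integral {0..1} (\<lambda>r. EP3_A \<tau> r z)) \<le> L * norm z ^ 2"
      if "\<tau> \<in> {0..1}" "Re z = 0" for \<tau> z
      by (rule le_scale_mono [OF EP3_A_zeroth [OF that]]) (use L_ge B_powers in auto)
    show "integral {0..1} (\<lambda>r. EP3_A \<tau> r 0 * of_real r) = of_real (\<tau>\<^sup>2 / 2 - EP3_drift \<tau>)" for \<tau>
      by (rule EP3_A_first_moment)
    show "\<bar>EP3_drift \<tau>\<bar> \<le> L" if "\<tau> \<in> {0..1}" for \<tau> using G(2) L_ge(2) that by force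
  qed (rule continuous_on_EP3_drift EP3_drift_integral)+
  have "ep_error_bound TYPE('d) EP3_C EP3_A lam T K R (\<alpha> - 2 + 2) (\<alpha> - 2 - 2 * real 3) {0<..1} (\<lambda>h eps. h^3 / eps^2 + h^4 / eps^4)"
  proof (rule error_bound_from_local [OF assms _ _ _ le])
    show "(h / eps) ^ (3 + 1) + h * (h / eps)\<^sup>2 \<le> 2 * (h ^ 3 / eps\<^sup>2 + h ^ 4 / eps ^ 4)" if "h > 0" "eps \<in> {0<..1}" for h eps :: real
    proof -
      have "(h / eps) ^ (3 + 1) + h * (h / eps)\<^sup>2 = h ^ 3 / eps\<^sup>2 + h ^ 4 / eps ^ 4"
        by (simp add: power2_eq_square power3_eq_cube power_divide)
      moreover have "h ^ 3 / eps\<^sup>2 + h ^ 4 / eps ^ 4 \<ge> 0" using that by simp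
      ultimately show ?thesis by (rule le_twice)
    qed
  qed (use \<alpha> in auto)
  then show "ep_error_bound TYPE('d) EP3_C EP3_A lam T K R \<alpha> (\<alpha> - 8) {0<..1} (\<lambda>h eps. h^3 / eps^2 + h^4 / eps^4)"
    by simp
  \<comment> \<open>For eps = 1 the term h \<kappa>^2 is h^3 already, so p = 2 suffices.\<close>
  have "ep_error_bound TYPE('d) EP3_C EP3_A lam T K R (\<alpha> - 2 + 2) (\<alpha> - 2 - 2 * real 2) {1} (\<lambda>h eps. h^3 / eps^2 + h^4 / eps^4)"
    by (rule error_bound_from_local [OF assms _ _ _ le]) (use \<alpha> in \<open>auto simp: power2_eq_square power3_eq_cube\<close>)
  then show "ep_error_bound TYPE('d) EP3_C EP3_A lam T K R \<alpha> (\<alpha> - 6) {1} (\<lambda>h eps. h^3 / eps^2 + h^4 / eps^4)"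
    by simp
qed

end
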